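(* For every integer $g\ge 2$, if $\Sigma_g$ denotes the compact surface of genus $g$, there exists a homeomorphism $f:\Sigma_g\to\Sigma_g$ that is $2$-expansive but not expansive.
   Context: Surfaces are closed (compact, without boundary), connected and orientable, with any metric $d$ inducing the topology. Let $X$ be a compact metric space with metric $d$ and $f:X\to X$ a homeomorphism. For $\alpha>0$ and $x\in X$, the dynamic ball is $\Gamma_\alpha(x)=\{y\in X : d(f^k(x),f^k(y))\le\alpha \text{ for all } k\in\mathbb{Z}\}$. For an integer $N\ge1$, $f$ is called $N$-expansive if there exists $\alpha>0$ such that $\Gamma_\alpha(x)$ has at most $N$ elements for all $x\in X$. $f$ is called expansive if it is $1$-expansive, i.e. if there exists $\alpha>0$ such that $\Gamma_\alpha(x)=\{x\}$ for all $x\in X$. *)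

theory Defs
  imports "HOL-Analysis.Analysis"
begin

section \<open>The closed orientable surface of genus g\<close>

text \<open>For g at least 1, the surface of genus g (the connected sum of g tori) is the quotient of
  the regular 4g-gon, with vertices the 4g-th roots of unity, by the edge labelling
  a1 b1 a1' b1' ... ag bg ag' bg', where a prime marks an edge traversed backwards.
  Every closed, connected, orientable surface of genus g is homeomorphic to it.\<close>

definition corner :: "nat \<Rightarrow> nat \<Rightarrow> complex" where
  "corner g k = cis (2 * pi * real k / real (4 * g))"

definition polygon_4g :: "nat \<Rightarrow> complex set" where
  "polygon_4g g = convex hull (corner g ` {..<4 * g})"

definition edge :: "nat \<Rightarrow> nat \<Rightarrow> real \<Rightarrow> complex" where
  "edge g k = linepath (corner g k) (corner g (Suc k))"

definition glued :: "nat \<Rightarrow> complex \<Rightarrow> complex \<Rightarrow> bool" where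
  "glued g x y \<longleftrightarrow> (\<exists>i<g. \<exists>s\<in>{0..1}.
      (x = edge g (4 * i) s \<and> y = edge g (4 * i + 2) (1 - s)) \<or>
      (x = edge g (4 * i + 1) s \<and> y = edge g (4 * i + 3) (1 - s)))"

text \<open>A space is homeomorphic to the quotient of the polygon by the equivalence relation
  generated by the gluing iff it is the target of a quotient map whose fibres are exactly
  the equivalence classes.\<close>

definition surface_of_genus :: "nat \<Rightarrow> 'a topology \<Rightarrow> bool" where
  "surface_of_genus g X \<longleftrightarrow> (\<exists>q. quotient_map (top_of_set (polygon_4g g)) X q \<and>
      (\<forall>x\<in>polygon_4g g. \<forall>y\<in>polygon_4g g. q x = q y \<longleftrightarrow> equivclp (glued g) x y))"


section \<open>N-expansive homeomorphisms\<close>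

text \<open>The integer iterates of a bijection f of the carrier M; points outside M are irrelevant.\<close>

definition int_iterate :: "'a set \<Rightarrow> ('a \<Rightarrow> 'a) \<Rightarrow> int \<Rightarrow> 'a \<Rightarrow> 'a" where
  "int_iterate M f k = (if 0 \<le> k then f ^^ nat k else inv_into M f ^^ nat (- k))"

context Metric_space
begin

definition dynamic_ball :: "('a \<Rightarrow> 'a) \<Rightarrow> real \<Rightarrow> 'a \<Rightarrow> 'a set" where
  "dynamic_ball f \<alpha> x =
     {y \<in> M. \<forall>k::int. d (int_iterate M f k x) (int_iterate M f k y) \<le> \<alpha>}"

definition N_expansive :: "nat \<Rightarrow> ('a \<Rightarrow> 'a) \<Rightarrow> bool" where
  "N_expansive N f \<longleftrightarrow>
     (\<exists>\<alpha>>0. \<forall>x\<in>M. finite (dynamic_ball f \<alpha> x) \<and> card (dynamic_ball f \<alpha> x) \<le> N)"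

definition expansive :: "('a \<Rightarrow> 'a) \<Rightarrow> bool" where
  "expansive f \<longleftrightarrow> N_expansive 1 f"

lemma int_iterate_in_carrier:
  assumes "bij_betw f M M" "x \<in> M"
  shows "int_iterate M f k x \<in> M"
proof -
  have "(f ^^ n) x \<in> M" for n
    using assms by (induction n) (auto dest: bij_betwE)
  moreover have "(inv_into M f ^^ n) x \<in> M" for n
    using assms bij_betw_inv_into[OF assms(1)] by (induction n) (auto dest: bij_betwE)
  ultimately show ?thesis
    by (simp add: int_iterate_def)
qed

lemma expansive_iff:
  assumes "bij_betw f M M"
  shows "expansive f \<longleftrightarrow> (\<exists>\<alpha>>0. \<forall>x\<in>M. dynamic_ball f \<alpha> x = {x})"
proof -
  have "finite (dynamic_ball f \<alpha> x) \<and> card (dynamic_ball f \<alpha> x) \<le> 1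
          \<longleftrightarrow> dynamic_ball f \<alpha> x = {x}"
    if "\<alpha> > 0" "x \<in> M" for \<alpha> x
  proof -
    have "x \<in> dynamic_ball f \<alpha> x"
      using that int_iterate_in_carrier[OF assms] by (simp add: dynamic_ball_def)
    then show ?thesis
      by (auto simp: card_le_Suc0_iff_eq)
  qed
  then show ?thesis
    unfolding expansive_def N_expansive_def by blast
qed

end

end

theory Submission
  imports Defs
begin

text \<open>The surface of genus \<open>g\<close> is a central torus with \<open>g - 1\<close> holes, joined by necks to \<open>g - 1\<close> outer tori
  with one hole each. On the central torus take a hyperbolic automorphism \<open>diag(l, 1/l)\<close> (in eigencoordinates)
  that fixes the centres of the holes, and change it to multiplication by \<open>l\<close> near each of them, as in Smale's
  derived-from-Anosov construction; on the outer tori take the inverse of such a map. The inversion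
  \<open>v \<mapsto> C / v\<close> conjugates multiplication by \<open>l\<close> to its inverse, so gluing the tori along \<open>v \<mapsto> C / v\<close> yields
  a homeomorphism \<open>f\<close> of the surface with an attractor in the central torus and repellers in the outer ones.

  If the forward orbits of two points stay close in the central torus, the points have the same real part there,
  and similarly for backward orbits in an outer torus. On the attractor and on the repellers the other coordinate
  is then equal as well. All other orbits pass through a neck, where the two points \<open>v\<close>, \<open>w\<close> satisfy
  \<open>Re v = Re w\<close> and \<open>Re (C / v) = Re (C / w)\<close>. This is a quadratic condition, so at most two points are not
  separated; and for \<open>Im C \<noteq> 0\<close> it has pairs of distinct solutions that are arbitrarily close to each other, so \<open>f\<close>
  is not expansive.\<close>

section \<open>A derived-from-Anosov map of the plane\<close>

text \<open>The perturbed maps are bi-Lipschitz with piecewise linear profiles: all that is needed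
  of them is exact expansion of the real part, monotonicity on vertical lines, and contraction there
  outside a box around each hole. Each hole carries radii \<open>r1 < r0 < r2\<close> in geometric
  progression with |C| = \<open>r1 * r2 = r0 * r0\<close>. The inversion exchanges the circles
  \<open>r1\<close> and \<open>r2\<close> and preserves \<open>r0\<close>, so the charts overlap on
  a whole ring while the pieces cut off at \<open>r0\<close> still cover the surface; the overlap
  lets nearby orbits be followed inside one chart. The obstacle is that the surface is given only as
  a polygon with glued edges: charts are needed in which every neck is exactly an inversion. The
  other handles occupy sectors at one corner of a square, each hole is centred inside its sector,
  and the outer torus gets a hole bounded by the inverted boundary of the sector. As the metric is
  arbitrary, closeness is moved between surface and charts by compactness alone. The linear map
  depends on \<open>g\<close>, since it has to fix all hole centres modulo the lattice;
  \<open>Im C\<close> is nonzero because no centre lies on a certain line.\<close>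

definition hyp :: "real \<Rightarrow> complex \<Rightarrow> complex" where
  "hyp l z = Complex (l * Re z) (Im z / l)"

lemma hyp_simps [simp]: "Re (hyp l z) = l * Re z" "Im (hyp l z) = Im z / l"
  by (simp_all add: hyp_def)

lemma hyp_diff: "hyp l (z - w) = hyp l z - hyp l w"
  by (simp add: complex_eq_iff algebra_simps diff_divide_distrib)

lemma hyp_inverse: "l \<noteq> 0 \<Longrightarrow> hyp l (hyp (1 / l) z) = z" "l \<noteq> 0 \<Longrightarrow> hyp (1 / l) (hyp l z) = z"
  by (simp_all add: complex_eq_iff)

section \<open>The profile of a single bump\<close>

locale bump =
  fixes l \<rho> :: real
  assumes l_gt1: "l > 1" and rho_pos: "\<rho> > 0"
begin

text \<open>\<open>bmp\<close> is a perturbation of the contracted coordinate that is supported in \<open>\<bar>Re z\<bar> \<le> \<rho>\<close>, \<open>\<bar>Im z\<bar> \<le> ext\<close> and turns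
  \<open>Im z / l\<close> into \<open>l * Im z\<close> near \<open>0\<close>. Its slope is below \<open>-dec\<close> nowhere; \<open>dec\<close> is small, so that the perturbed map
  stays increasing in \<open>Im z\<close>.\<close>
definition "slp = l - 1 / l"
definition "dec = slp / (8 * l\<^sup>2)"
definition "ext = \<rho> + 8 * l\<^sup>2 * \<rho>"
definition "ramp s = max 0 (min (slp * s) (dec * (ext - s)))"
definition "bet s = ramp s - ramp (- s)"
definition "chi u = max 0 (min 1 ((\<rho> - \<bar>u\<bar>) / (\<rho> - \<rho> / l)))"
definition "bmp z = chi (Re z) * bet (Im z)"
definition "rad = \<rho> + ext"
definition "lipb = 2 * slp + 2 * slp * \<rho> / (\<rho> - \<rho> / l)"

lemma slp_pos: "slp > 0"
  using l_gt1 unfolding slp_def by (smt (verit) divide_less_eq_1 less_divide_eq_1)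

lemma dec_pos: "dec > 0"
  using slp_pos l_gt1 by (simp add: dec_def)

text \<open>The factor \<open>8 * l\<^sup>2\<close> in \<open>dec\<close> is chosen for the second
  bound: \<open>bet\<close> combines two ramps and a pair of points can see two bumps, so slopes add
  up to at least \<open>- 4 * dec\<close>, which leaves half of the linear rate
  \<open>1 / l\<close>.\<close>

lemma dec_le: "dec \<le> slp" "4 * dec \<le> 1 / (2 * l)"
proof -
  have "1 \<le> 8 * l\<^sup>2" using l_gt1 one_le_power[of l 2] by linarith
  then show "dec \<le> slp" unfolding dec_def using slp_pos l_gt1 by (simp add: divide_le_eq)
  have "4 * dec = (l - 1 / l) / (2 * l\<^sup>2)" by (simp add: dec_def slp_def divide_simps)
  also have "\<dots> \<le> l / (2 * l\<^sup>2)" using l_gt1 by (intro divide_right_mono) auto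
  also have "\<dots> = 1 / (2 * l)" using l_gt1 by (simp add: power2_eq_square)
  finally show "4 * dec \<le> 1 / (2 * l)" .
qed

lemma ext_gt: "ext > \<rho>" "ext > 0" "rad > 0"
  using l_gt1 rho_pos by (auto simp: ext_def rad_def add_pos_pos)

text \<open>This equation is the origin of \<open>ext\<close>: the rising and the falling line of
  \<open>ramp\<close> cross at \<rho>.\<close>

lemma ramp_meet: "dec * (ext - \<rho>) = slp * \<rho>"
  using l_gt1 by (simp add: dec_def ext_def)

lemma chi_width: "\<rho> - \<rho> / l > 0"
  using l_gt1 rho_pos by (simp add: divide_less_eq)

lemma ramp_lip: "\<bar>ramp s - ramp t\<bar> \<le> slp * \<bar>s - t\<bar>"
proof -
  have "\<bar>slp * s - slp * t\<bar> = slp * \<bar>s - t\<bar>"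
    using slp_pos by (simp add: abs_mult flip: right_diff_distrib)
  moreover have "\<bar>dec * (ext - s) - dec * (ext - t)\<bar> \<le> slp * \<bar>s - t\<bar>"
  proof -
    have "\<bar>dec * (ext - s) - dec * (ext - t)\<bar> = dec * \<bar>s - t\<bar>"
      using dec_pos by (simp add: abs_mult abs_minus_commute flip: right_diff_distrib)
    also have "\<dots> \<le> slp * \<bar>s - t\<bar>" using dec_le by (intro mult_right_mono) auto
    finally show ?thesis .
  qed
  ultimately show ?thesis unfolding ramp_def by linarith
qed

lemma ramp_lower:
  assumes "s \<le> t" shows "ramp t - ramp s \<ge> - dec * (t - s)"
proof -
  have "slp * t \<ge> slp * s" using assms slp_pos by simp
  moreover have "dec * (t - s) \<ge> 0" using assms dec_pos by simp
  moreover have "dec * (ext - t) = dec * (ext - s) - dec * (t - s)" by (simp add: algebra_simps)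
  ultimately show ?thesis unfolding ramp_def by auto
qed

lemma ramp_nonpos: "s \<le> 0 \<Longrightarrow> ramp s = 0"
  unfolding ramp_def using slp_pos mult_nonneg_nonpos[of slp s] by simp

lemma ramp_inner: assumes "0 \<le> s" "s \<le> \<rho>" shows "ramp s = slp * s"
proof -
  have "slp * s \<le> slp * \<rho>" using assms slp_pos by simp
  also have "\<dots> = dec * (ext - \<rho>)" by (simp add: ramp_meet)
  also have "\<dots> \<le> dec * (ext - s)" using assms dec_pos by simp
  finally show ?thesis unfolding ramp_def using assms slp_pos by (simp add: max_def min_def)
qed

lemma ramp_outer: assumes "\<rho> \<le> s" shows "ramp s = max 0 (dec * (ext - s))"
proof -
  have "dec * (ext - s) \<le> dec * (ext - \<rho>)" using assms dec_pos by simp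
  also have "\<dots> = slp * \<rho>" by (simp add: ramp_meet)
  also have "\<dots> \<le> slp * s" using assms slp_pos by simp
  finally show ?thesis unfolding ramp_def by (simp add: min_def)
qed

lemma ramp_bound: "0 \<le> ramp s" "ramp s \<le> slp * \<rho>"
proof -
  show "0 \<le> ramp s" by (simp add: ramp_def)
  have "dec * (ext - s) \<le> slp * \<rho>" if "s \<ge> \<rho>"
    using that dec_pos ramp_meet by (metis diff_left_mono less_imp_le mult_left_mono)
  moreover have "slp * s \<le> slp * \<rho>" if "s \<le> \<rho>" using that slp_pos by simp
  moreover have "0 \<le> slp * \<rho>" using slp_pos rho_pos by simp
  ultimately show "ramp s \<le> slp * \<rho>" unfolding ramp_def by (smt (verit))
qed

lemma bet_lip: "\<bar>bet s - bet t\<bar> \<le> 2 * slp * \<bar>s - t\<bar>"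
proof -
  have "\<bar>- s - - t\<bar> = \<bar>s - t\<bar>" by simp
  then show ?thesis
    using ramp_lip[of s t] ramp_lip[of "-s" "-t"] unfolding bet_def by (simp add: mult.assoc)
qed

lemma bet_lower: "s \<le> t \<Longrightarrow> bet t - bet s \<ge> - 2 * dec * (t - s)"
  using ramp_lower[of s t] ramp_lower[of "-t" "-s"] unfolding bet_def by simp

lemma bet_bound: "\<bar>bet s\<bar> \<le> slp * \<rho>"
  using ramp_bound[of s] ramp_bound[of "-s"] unfolding bet_def by linarith

lemma bet_inner: "\<bar>s\<bar> \<le> \<rho> \<Longrightarrow> bet s = slp * s"
  unfolding bet_def using ramp_inner[of s] ramp_inner[of "-s"] ramp_nonpos[of s] ramp_nonpos[of "-s"]
  by (cases "s \<ge> 0") auto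

lemma bet_outer: "\<bar>s\<bar> \<ge> ext \<Longrightarrow> bet s = 0"
proof -
  have *: "ramp t = 0" if "t \<ge> ext" for t
    using ramp_outer[of t] that ext_gt dec_pos mult_nonneg_nonpos[of dec "ext - t"] by simp
  show "\<bar>s\<bar> \<ge> ext \<Longrightarrow> bet s = 0"
    unfolding bet_def using *[of s] *[of "-s"] ramp_nonpos[of s] ramp_nonpos[of "-s"] ext_gt
    by (cases "s \<ge> 0") auto
qed

text \<open>Beyond distance \<rho> from 0 only the falling part of \<open>ramp\<close> is active.
  This sign is what later makes vertical contraction outside the box at least as strong as
  \<open>1 / l\<close>.\<close>

lemma bet_antimono:
  assumes "s \<le> t" "\<rho> \<le> s \<or> t \<le> - \<rho>" shows "bet t \<le> bet s"
proof -
  have *: "ramp b \<le> ramp a" if "\<rho> \<le> a" "a \<le> b" for a b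
    using ramp_outer[of a] ramp_outer[of b] that dec_pos mult_left_mono[of "ext - b" "ext - a" dec]
      max.mono[of 0 0 "dec * (ext - b)" "dec * (ext - a)"] by simp
  show ?thesis
    using assms *[of s t] *[of "-t" "-s"] rho_pos ramp_nonpos[of s] ramp_nonpos[of t]
      ramp_nonpos[of "-s"] ramp_nonpos[of "-t"]
    unfolding bet_def by auto
qed

lemma chi_bound: "0 \<le> chi u" "chi u \<le> 1"
  by (auto simp: chi_def)

text \<open>The plateau has half-width \<open>\<rho> / l\<close> so that multiplication by
  \<open>l\<close> maps it onto the full width \<rho> of the box; the inverse map is then linear on
  the whole box.\<close>

lemma chi_inner: "\<bar>u\<bar> \<le> \<rho> / l \<Longrightarrow> chi u = 1"
  using chi_width by (auto simp: chi_def le_divide_eq min_def)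

lemma chi_outer: "\<bar>u\<bar> \<ge> \<rho> \<Longrightarrow> chi u = 0"
  using chi_width divide_nonpos_pos[of "\<rho> - \<bar>u\<bar>" "\<rho> - \<rho> / l"] by (simp add: chi_def)

lemma chi_lip: "\<bar>chi u - chi v\<bar> \<le> \<bar>u - v\<bar> / (\<rho> - \<rho> / l)"
proof -
  have "\<bar>(\<rho> - \<bar>u\<bar>) / (\<rho> - \<rho> / l) - (\<rho> - \<bar>v\<bar>) / (\<rho> - \<rho> / l)\<bar> = \<bar>\<bar>v\<bar> - \<bar>u\<bar>\<bar> / (\<rho> - \<rho> / l)"
    using chi_width by (simp add: abs_divide flip: diff_divide_distrib)
  also have "\<dots> \<le> \<bar>u - v\<bar> / (\<rho> - \<rho> / l)"
    using chi_width by (intro divide_right_mono) auto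
  finally show ?thesis unfolding chi_def by linarith
qed

lemma lipb_pos: "lipb > 0"
  using slp_pos rho_pos chi_width by (simp add: lipb_def add_pos_nonneg)

lemma bmp_lip: "\<bar>bmp z - bmp w\<bar> \<le> lipb * cmod (z - w)"
proof -
  have "bmp z - bmp w = (chi (Re z) - chi (Re w)) * bet (Im z) + chi (Re w) * (bet (Im z) - bet (Im w))"
    by (simp add: bmp_def algebra_simps)
  also have "\<bar>\<dots>\<bar> \<le> \<bar>chi (Re z) - chi (Re w)\<bar> * \<bar>bet (Im z)\<bar> + chi (Re w) * \<bar>bet (Im z) - bet (Im w)\<bar>"
    using chi_bound(1)[of "Re w"]
    by (rule_tac order.trans[OF abs_triangle_ineq]) (simp add: abs_mult)
  also have "\<dots> \<le> (\<bar>Re z - Re w\<bar> / (\<rho> - \<rho> / l)) * (slp * \<rho>) + 1 * (2 * slp * \<bar>Im z - Im w\<bar>)"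
    using chi_lip bet_bound chi_bound bet_lip chi_width slp_pos rho_pos
    by (intro add_mono mult_mono) auto
  also have "\<dots> \<le> (cmod (z - w) / (\<rho> - \<rho> / l)) * (slp * \<rho>) + 1 * (2 * slp * cmod (z - w))"
    using chi_width slp_pos rho_pos abs_Re_le_cmod[of "z - w"] abs_Im_le_cmod[of "z - w"]
    by (intro add_mono mult_mono divide_right_mono) auto
  also have "\<dots> \<le> lipb * cmod (z - w)"
  proof -
    have "0 \<le> slp * \<rho> * cmod (z - w) / (\<rho> - \<rho> / l)"
      using chi_width slp_pos rho_pos by simp
    moreover have "cmod (z - w) / (\<rho> - \<rho> / l) * (slp * \<rho>) = slp * \<rho> * cmod (z - w) / (\<rho> - \<rho> / l)" by simp
    ultimately have "cmod (z - w) / (\<rho> - \<rho> / l) * (slp * \<rho>) \<le> 2 * (cmod (z - w) / (\<rho> - \<rho> / l) * (slp * \<rho>))"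
      by linarith
    also have "\<dots> = 2 * slp * \<rho> / (\<rho> - \<rho> / l) * cmod (z - w)" by simp
    finally show ?thesis by (simp add: lipb_def distrib_right)
  qed
  finally show ?thesis .
qed

lemma bmp_lower:
  assumes "Re z = Re w" "Im z \<le> Im w" shows "bmp w - bmp z \<ge> - 2 * dec * (Im w - Im z)"
proof -
  have "bmp w - bmp z = chi (Re w) * (bet (Im w) - bet (Im z))"
    using assms by (simp add: bmp_def algebra_simps)
  moreover have "chi (Re w) * (- (2 * dec * (Im w - Im z))) \<le> chi (Re w) * (bet (Im w) - bet (Im z))"
    using bet_lower[OF assms(2)] chi_bound by (intro mult_left_mono) auto
  moreover have "chi (Re w) * (2 * dec * (Im w - Im z)) \<le> 1 * (2 * dec * (Im w - Im z))"
    using chi_bound assms dec_pos by (intro mult_right_mono) auto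
  ultimately show ?thesis by simp
qed

text \<open>Unless the bump vanishes on their vertical line, two points outside the box that are at
  most \<rho> apart lie on the same side of it, where \<open>bet\<close> decreases.\<close>

lemma bmp_antimono:
  assumes "Re z = Re w" "Im z \<le> Im w" "Im w - Im z \<le> \<rho>"
    "\<rho> < \<bar>Re z\<bar> \<or> \<rho> < \<bar>Im z\<bar>" "\<rho> < \<bar>Re w\<bar> \<or> \<rho> < \<bar>Im w\<bar>"
  shows "bmp w \<le> bmp z"
proof (cases "\<rho> \<le> \<bar>Re z\<bar>")
  case True then show ?thesis using assms chi_outer by (simp add: bmp_def)
next
  case False
  then have "\<rho> \<le> Im z \<or> Im w \<le> - \<rho>" using assms rho_pos by auto
  from bet_antimono[OF assms(2) this] show ?thesis
    using assms chi_bound by (simp add: bmp_def mult_left_mono)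
qed

lemma bmp_inner: "\<bar>Re z\<bar> \<le> \<rho> / l \<Longrightarrow> \<bar>Im z\<bar> \<le> \<rho> \<Longrightarrow> bmp z = slp * Im z"
  by (simp add: bmp_def bet_inner chi_inner)

lemma bmp_far: assumes "rad \<le> cmod z" shows "bmp z = 0"
proof -
  have "\<bar>Re z\<bar> \<ge> \<rho> \<or> \<bar>Im z\<bar> \<ge> ext"
    using cmod_le[of z] assms unfolding rad_def by linarith
  then show ?thesis using chi_outer bet_outer by (auto simp: bmp_def)
qed

end

text \<open>\<open>\<Gamma>\<close> is the period lattice and \<open>H\<close> the set of the centres of the holes.\<close>
locale da = bump +
  fixes \<Gamma> H :: "complex set"
  assumes Gam_add: "\<And>a b. a \<in> \<Gamma> \<Longrightarrow> b \<in> \<Gamma> \<Longrightarrow> a + b \<in> \<Gamma>"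
    and Gam_minus: "\<And>a. a \<in> \<Gamma> \<Longrightarrow> - a \<in> \<Gamma>"
    and Gam_hyp: "\<And>a. hyp l a \<in> \<Gamma> \<longleftrightarrow> a \<in> \<Gamma>"
    and H_Gam: "\<And>p a. p \<in> H \<Longrightarrow> a \<in> \<Gamma> \<Longrightarrow> p + a \<in> H"
    and H_hyp: "\<And>p. p \<in> H \<Longrightarrow> hyp l p - p \<in> \<Gamma>"
    and H_sep: "\<And>p q. p \<in> H \<Longrightarrow> q \<in> H \<Longrightarrow> p \<noteq> q \<Longrightarrow> cmod (p - q) \<ge> 2 * rad"
begin

lemma H_hyp_mem: assumes "p \<in> H" shows "hyp l p \<in> H" "hyp (1 / l) p \<in> H"
proof -
  show "hyp l p \<in> H" using H_Gam[OF assms H_hyp[OF assms]] by simp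
  have "hyp l (hyp (1/l) p - p) \<in> \<Gamma>"
    using Gam_minus[OF H_hyp[OF assms]] l_gt1 by (simp add: hyp_diff hyp_inverse)
  then have "hyp (1/l) p - p \<in> \<Gamma>" by (simp add: Gam_hyp)
  from H_Gam[OF assms this] show "hyp (1 / l) p \<in> H" by simp
qed

text \<open>A choice replaces the sum over all bumps: the discs of radius \<open>rad\<close> around
  distinct points of \<open>H\<close> are disjoint, so at most one bump contributes at
  \<open>z\<close>.\<close>

definition "pert z = (if \<exists>p\<in>H. cmod (z - p) < rad then bmp (z - (SOME p. p \<in> H \<and> cmod (z - p) < rad)) else 0)"

definition F :: "complex \<Rightarrow> complex" where
  "F z = Complex (l * Re z) (Im z / l + pert z)"

lemma F_simps [simp]: "Re (F z) = l * Re z" "Im (F z) = Im z / l + pert z"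
  by (simp_all add: F_def)

lemma H_unique:
  assumes "p \<in> H" "q \<in> H" "cmod (z - p) < rad" "cmod (z - q) < rad" shows "p = q"
proof (rule ccontr)
  assume "p \<noteq> q"
  from H_sep[OF assms(1,2) this] show False
    using assms(3,4) norm_triangle_ineq4[of "z - q" "z - p"] by simp
qed

lemma pert_near: assumes "p \<in> H" "cmod (z - p) < rad" shows "pert z = bmp (z - p)"
proof -
  have "(SOME p. p \<in> H \<and> cmod (z - p) < rad) = p"
    using assms H_unique by (intro some_equality) blast+
  then show ?thesis using assms by (auto simp: pert_def)
qed

lemma pert_far: assumes "\<And>p. p \<in> H \<Longrightarrow> rad \<le> cmod (z - p)" shows "pert z = 0"
  using assms by (force simp: pert_def)

text \<open>At most two bumps are seen by a pair of points; this turns bounds on one bump into global ones.\<close>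
lemma pert_diff:
  obtains "pert z = pert w"
  | p where "p \<in> H" "pert z - pert w = bmp (z - p) - bmp (w - p)"
  | p q where "p \<in> H" "q \<in> H" "pert z - pert w = (bmp (z - p) - bmp (w - p)) + (bmp (z - q) - bmp (w - q))"
proof -
  consider "\<And>p. p \<in> H \<Longrightarrow> rad \<le> cmod (z - p)" "\<And>p. p \<in> H \<Longrightarrow> rad \<le> cmod (w - p)"
    | p where "p \<in> H" "cmod (z - p) < rad" "\<And>p. p \<in> H \<Longrightarrow> rad \<le> cmod (w - p)"
    | p where "p \<in> H" "cmod (w - p) < rad" "\<And>p. p \<in> H \<Longrightarrow> rad \<le> cmod (z - p)"
    | p where "p \<in> H" "cmod (z - p) < rad" "cmod (w - p) < rad"
    | p q where "p \<in> H" "q \<in> H" "cmod (z - p) < rad" "cmod (w - q) < rad" "p \<noteq> q"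
    by (metis linorder_not_less)
  then show thesis
  proof cases
    case 1 then show thesis using pert_far that(1) by simp
  next
    case 2 then show thesis using pert_far[of w] pert_near[of p z] bmp_far[of "w - p"] that(2) by simp
  next
    case 3 then show thesis using pert_far[of z] pert_near[of p w] bmp_far[of "z - p"] that(2) by simp
  next
    case 4 then show thesis using pert_near[of p z] pert_near[of p w] that(2) by simp
  next
    case 5
    then have "rad \<le> cmod (w - p)" "rad \<le> cmod (z - q)" using H_unique by (metis linorder_not_less)+
    then show thesis using 5 pert_near[of p z] pert_near[of q w] bmp_far that(3)[of p q] by simp
  qed
qed

lemma pert_lip: "\<bar>pert z - pert w\<bar> \<le> 2 * lipb * cmod (z - w)"
proof -
  have *: "\<bar>bmp (z - p) - bmp (w - p)\<bar> \<le> lipb * cmod (z - w)" for p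
    using bmp_lip[of "z - p" "w - p"] by simp
  have "0 \<le> lipb * cmod (z - w)" using lipb_pos by simp
  then show ?thesis
  proof (rule_tac pert_diff[of z w])
    fix p q assume "pert z - pert w = (bmp (z - p) - bmp (w - p)) + (bmp (z - q) - bmp (w - q))"
    then show ?thesis using *[of p] *[of q] by linarith
  next
    fix p assume "pert z - pert w = bmp (z - p) - bmp (w - p)"
    then show ?thesis using *[of p] \<open>0 \<le> lipb * cmod (z - w)\<close> by linarith
  qed simp
qed

lemma pert_lower:
  assumes "Re z = Re w" "Im z \<le> Im w" shows "pert w - pert z \<ge> - (Im w - Im z) / (2 * l)"
proof -
  have *: "bmp (w - p) - bmp (z - p) \<ge> - 2 * dec * (Im w - Im z)" for p
    using bmp_lower[of "z - p" "w - p"] assms by simp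
  have "4 * dec * (Im w - Im z) \<le> 1 / (2 * l) * (Im w - Im z)"
    using dec_le assms by (intro mult_right_mono) auto
  moreover have "dec * (Im w - Im z) \<ge> 0" using dec_pos assms by simp
  moreover have "pert w - pert z \<ge> - 4 * dec * (Im w - Im z)"
  proof (rule pert_diff[of w z])
    fix p q assume "pert w - pert z = (bmp (w - p) - bmp (z - p)) + (bmp (w - q) - bmp (z - q))"
    then show ?thesis using *[of p] *[of q] by linarith
  next
    fix p assume "pert w - pert z = bmp (w - p) - bmp (z - p)"
    then show ?thesis using *[of p] \<open>dec * (Im w - Im z) \<ge> 0\<close> by linarith
  qed (use \<open>dec * (Im w - Im z) \<ge> 0\<close> in simp)
  moreover have "- (Im w - Im z) / (2 * l) = - (1 / (2 * l) * (Im w - Im z))"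
    by (metis minus_divide_left mult.left_neutral times_divide_eq_left)
  ultimately show ?thesis by linarith
qed

definition "lipF = l + 1 + 2 * lipb"

lemma lipF_ge1: "lipF \<ge> 1"
  using l_gt1 lipb_pos by (simp add: lipF_def)

lemma F_lip: "cmod (F z - F w) \<le> lipF * cmod (z - w)"
proof -
  have "cmod (F z - F w) \<le> \<bar>Re (F z - F w)\<bar> + \<bar>Im (F z - F w)\<bar>" by (rule cmod_le)
  also have "\<bar>Re (F z - F w)\<bar> = l * \<bar>Re (z - w)\<bar>"
    using l_gt1 by (simp add: abs_mult flip: right_diff_distrib)
  also have "\<bar>Im (F z - F w)\<bar> \<le> \<bar>Im (z - w) / l\<bar> + \<bar>pert z - pert w\<bar>"
    by (simp add: diff_divide_distrib)
  also have "\<bar>Im (z - w) / l\<bar> \<le> \<bar>Im (z - w)\<bar>"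
    using l_gt1 by (simp add: abs_divide divide_le_eq mult_le_cancel_left1)
  finally have "cmod (F z - F w) \<le> l * \<bar>Re (z - w)\<bar> + (\<bar>Im (z - w)\<bar> + \<bar>pert z - pert w\<bar>)" by simp
  also have "\<dots> \<le> l * cmod (z - w) + (cmod (z - w) + 2 * lipb * cmod (z - w))"
    using l_gt1 abs_Re_le_cmod[of "z - w"] abs_Im_le_cmod[of "z - w"] pert_lip
    by (intro add_mono mult_left_mono) auto
  finally show ?thesis by (simp add: lipF_def algebra_simps)
qed

lemma F_mono_Im:
  assumes "Re z = Re w" "Im z \<le> Im w" shows "Im (F w) - Im (F z) \<ge> (Im w - Im z) / (2 * l)"
proof -
  have "Im w / l - Im z / l = 2 * ((Im w - Im z) / (2 * l))" using l_gt1 by (simp add: field_simps)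
  moreover have "- (Im w - Im z) / (2 * l) = - ((Im w - Im z) / (2 * l))"
    by (rule minus_divide_left[symmetric])
  ultimately show ?thesis using pert_lower[OF assms] unfolding F_simps by linarith
qed

definition "lipG = 1 + 2 * l * (2 + 2 * lipb)"

lemma lipG_ge1: "lipG \<ge> 1"
  using l_gt1 lipb_pos by (simp add: lipG_def)

text \<open>The real part is expanded by \<open>l\<close>. The imaginary parts are compared through
  the point \<open>w'\<close> on the vertical line of \<open>z\<close>, where \<open>F\<close>
  increases at a definite rate; moving from \<open>w\<close> to \<open>w'\<close> costs at most the
  Lipschitz constant of \<open>pert\<close>.\<close>

lemma F_colip: "cmod (z - w) \<le> lipG * cmod (F z - F w)"
proof -
  define w' where "w' = Complex (Re z) (Im w)"
  have re: "l * \<bar>Re (z - w)\<bar> = \<bar>Re (F z - F w)\<bar>"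
    using l_gt1 by (simp add: abs_mult flip: right_diff_distrib)
  then have re': "\<bar>Re (z - w)\<bar> \<le> cmod (F z - F w)"
    using abs_Re_le_cmod[of "F z - F w"] l_gt1
    by (smt (verit) mult_le_cancel_right1 abs_ge_zero)
  have "\<bar>Im z - Im w'\<bar> / (2 * l) \<le> \<bar>Im (F z) - Im (F w')\<bar>"
    using F_mono_Im[of z w'] F_mono_Im[of w' z] l_gt1
    by (cases "Im z \<le> Im w'") (auto simp: w'_def divide_right_mono abs_if)
  also have "\<dots> \<le> \<bar>Im (F z - F w)\<bar> + \<bar>Im (F w - F w')\<bar>" by simp
  also have "\<bar>Im (F w - F w')\<bar> = \<bar>pert w - pert w'\<bar>" by (simp add: w'_def)
  also have "\<dots> \<le> 2 * lipb * cmod (w - w')" by (rule pert_lip)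
  also have "cmod (w - w') = \<bar>Re (z - w)\<bar>" by (simp add: w'_def cmod_def abs_minus_commute)
  finally have "\<bar>Im (z - w)\<bar> / (2 * l) \<le> \<bar>Im (F z - F w)\<bar> + 2 * lipb * \<bar>Re (z - w)\<bar>"
    by (simp add: w'_def)
  also have "\<dots> \<le> cmod (F z - F w) + 2 * lipb * cmod (F z - F w)"
    using re' abs_Im_le_cmod[of "F z - F w"] lipb_pos by (intro add_mono mult_left_mono) (auto simp del: F_simps)
  finally have "\<bar>Im (z - w)\<bar> \<le> 2 * l * (1 + 2 * lipb) * cmod (F z - F w)"
    using l_gt1 by (simp add: divide_le_eq algebra_simps)
  moreover have "cmod (z - w) \<le> \<bar>Re (z - w)\<bar> + \<bar>Im (z - w)\<bar>" by (rule cmod_le)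
  moreover have "0 \<le> l * cmod (F z - F w)" using l_gt1 by simp
  ultimately show ?thesis using re' by (simp add: lipG_def algebra_simps)
qed

lemma F_inj: "F z = F w \<longleftrightarrow> z = w"
  using F_colip[of z w] by auto

lemma continuous_pert: "continuous_on S pert"
proof (rule continuous_onI)
  fix x e assume "x \<in> S" "0 < (e::real)"
  then show "\<exists>d>0. \<forall>x'\<in>S. dist x' x < d \<longrightarrow> dist (pert x') (pert x) \<le> e"
    using pert_lip lipb_pos
    by (intro exI[of _ "e / (2 * lipb)"])
      (auto simp: dist_norm less_divide_eq mult.commute intro: order.trans[OF pert_lip] less_imp_le)
qed

lemma pert_bound: "\<bar>pert z\<bar> \<le> slp * \<rho>"
proof (cases "\<exists>p\<in>H. cmod (z - p) < rad")
  case True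
  then obtain p where "p \<in> H" "cmod (z - p) < rad" by blast
  then have "\<bar>pert z\<bar> = chi (Re (z - p)) * \<bar>bet (Im (z - p))\<bar>"
    using pert_near chi_bound by (simp add: bmp_def abs_mult)
  also have "\<dots> \<le> 1 * (slp * \<rho>)" using chi_bound bet_bound by (intro mult_mono) auto
  finally show ?thesis by simp
next
  case False then show ?thesis using slp_pos rho_pos by (simp add: pert_def)
qed

text \<open>On a vertical line \<open>F\<close> is an increasing affine map plus a bounded
  perturbation, so the intermediate value theorem applies.\<close>

lemma F_surj: "\<exists>z. F z = w"
proof -
  define u where "u = Re w / l"
  define K where "K = l * (\<bar>Im w\<bar> + slp * \<rho>)"
  define h where "h t = Im (F (Complex u t))" for t
  have K: "K \<ge> 0" using l_gt1 slp_pos rho_pos by (simp add: K_def)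
  have "continuous_on {-K..K} h" unfolding h_def F_simps
    by (intro continuous_intros continuous_on_compose2[OF continuous_pert[of UNIV]])
      (use l_gt1 in \<open>auto intro!: continuous_intros simp: Complex_eq\<close>)
  moreover have "h (-K) \<le> Im w"
    using pert_bound[of "Complex u (-K)"] l_gt1 by (simp add: h_def K_def abs_le_iff) linarith
  moreover have "Im w \<le> h K"
    using pert_bound[of "Complex u K"] l_gt1 by (simp add: h_def K_def abs_le_iff) linarith
  ultimately obtain t where "h t = Im w" using IVT'[of h "-K" "Im w" K] K by auto
  then have "F (Complex u t) = w" using l_gt1 by (simp add: complex_eq_iff h_def u_def)
  then show ?thesis by blast
qed

definition "G = inv F"

lemma FG [simp]: "F (G w) = w" and GF [simp]: "G (F z) = z"
  using F_surj F_inj by (auto simp: G_def f_inv_into_f inv_f_f inj_def surj_def image_iff) (metis f_inv_into_f rangeI)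

lemma G_lip: "cmod (G z - G w) \<le> lipG * cmod (z - w)"
  using F_colip[of "G z" "G w"] by simp

lemma pert_Gam: assumes "a \<in> \<Gamma>" shows "pert (z + a) = pert z"
proof (cases "\<exists>p\<in>H. cmod (z - p) < rad")
  case True
  then obtain p where p: "p \<in> H" "cmod (z - p) < rad" by blast
  then show ?thesis using pert_near[OF p] pert_near[OF H_Gam[OF p(1) assms], of "z + a"] by simp
next
  case False
  have "rad \<le> cmod (z + a - p)" if "p \<in> H" for p
    using False H_Gam[OF that Gam_minus[OF assms]] by (metis add_diff_eq diff_diff_eq2 diff_conv_add_uminus add.commute linorder_not_less)
  then have "pert (z + a) = 0" by (rule pert_far)
  then show ?thesis using False by (simp add: pert_def)
qed

lemma F_Gam: "a \<in> \<Gamma> \<Longrightarrow> F (z + a) = F z + hyp l a"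
  by (simp add: complex_eq_iff pert_Gam distrib_left add_divide_distrib)

text \<open>A lattice difference of images can be pulled back because \<open>hyp l\<close> preserves
  \<Gamma> in both directions; hence \<open>F\<close> descends to an injective map of the
  torus.\<close>

lemma F_Gam_iff: "F z - F w \<in> \<Gamma> \<longleftrightarrow> z - w \<in> \<Gamma>"
proof
  assume "z - w \<in> \<Gamma>"
  then show "F z - F w \<in> \<Gamma>" using F_Gam[of "z - w" w] Gam_hyp by simp
next
  assume *: "F z - F w \<in> \<Gamma>"
  define a where "a = hyp (1/l) (F z - F w)"
  have a: "a \<in> \<Gamma>" "hyp l a = F z - F w"
    using * Gam_hyp[of a] l_gt1 by (auto simp: a_def hyp_inverse)
  then have "F (w + a) = F z" using F_Gam[of a w] by simp
  then show "z - w \<in> \<Gamma>" using F_inj a by auto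
qed

lemma F_near:
  assumes "p \<in> H" "\<bar>Re w\<bar> \<le> \<rho> / l" "\<bar>Im w\<bar> \<le> \<rho>" shows "F (p + w) = hyp l p + of_real l * w"
proof -
  have "\<rho> / l \<le> \<rho>" using l_gt1 rho_pos by (simp add: divide_le_eq)
  then have "cmod w < rad"
    using cmod_le[of w] assms ext_gt rho_pos unfolding rad_def by linarith
  then have "pert (p + w) = slp * Im w" using pert_near[OF assms(1), of "p + w"] bmp_inner assms by simp
  then show ?thesis by (simp add: complex_eq_iff slp_def algebra_simps add_divide_distrib)
qed

lemma F_near_cmod:
  assumes "p \<in> H" "cmod w \<le> \<rho> / l" shows "F (p + w) = hyp l p + of_real l * w"
proof (rule F_near[OF assms(1)])
  show "\<bar>Re w\<bar> \<le> \<rho> / l" using abs_Re_le_cmod[of w] assms by linarith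
  have "\<rho> / l \<le> \<rho>" using l_gt1 rho_pos by (simp add: divide_le_eq)
  then show "\<bar>Im w\<bar> \<le> \<rho>" using abs_Im_le_cmod[of w] assms by linarith
qed

lemma G_near:
  assumes "p \<in> H" "\<bar>Re w\<bar> \<le> \<rho>" "\<bar>Im w\<bar> \<le> \<rho>" shows "G (p + w) = hyp (1 / l) p + w / of_real l"
proof -
  have "\<rho> / l \<le> \<rho>" using l_gt1 rho_pos by (simp add: divide_le_eq)
  then have "F (hyp (1/l) p + w / of_real l) = hyp l (hyp (1/l) p) + of_real l * (w / of_real l)"
    using assms l_gt1 H_hyp_mem
    by (intro F_near) (auto simp: abs_divide divide_right_mono divide_le_eq intro: order.trans[of _ "\<rho> / l"])
  also have "\<dots> = p + w" using l_gt1 by (simp add: hyp_inverse)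
  finally show ?thesis by (metis GF)
qed

lemma G_near_cmod: "p \<in> H \<Longrightarrow> cmod w \<le> \<rho> \<Longrightarrow> G (p + w) = hyp (1 / l) p + w / of_real l"
  using G_near abs_Re_le_cmod[of w] abs_Im_le_cmod[of w] by force

section \<open>Complements of discs around the holes, and the box where contraction fails\<close>

definition "E r = {z. \<forall>p\<in>H. r \<le> cmod (z - p)}"

lemma E_mono: "r \<le> s \<Longrightarrow> E s \<subseteq> E r"
  by (force simp: E_def)

lemma E_Gam: "a \<in> \<Gamma> \<Longrightarrow> z + a \<in> E r \<longleftrightarrow> z \<in> E r"
  proof -
  have *: "z + a \<in> E r" if "a \<in> \<Gamma>" "z \<in> E r" for z a
    unfolding E_def
  proof safe
    fix p assume "p \<in> H"
    then have "p + - a \<in> H" using H_Gam Gam_minus that by blast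
    then show "r \<le> cmod (z + a - p)" using that(2) by (force simp: E_def algebra_simps)
  qed
  show "a \<in> \<Gamma> \<Longrightarrow> z + a \<in> E r \<longleftrightarrow> z \<in> E r"
    using *[of a z] *[of "-a" "z + a"] Gam_minus by auto
qed

lemma E_near: "z \<in> E r \<Longrightarrow> cmod (z - w) \<le> e \<Longrightarrow> s \<le> r - e \<Longrightarrow> w \<in> E s"
proof -
  assume *: "z \<in> E r" "cmod (z - w) \<le> e" "s \<le> r - e"
  show "w \<in> E s" unfolding E_def
  proof safe
    fix p assume "p \<in> H"
    then have "r \<le> cmod (z - p)" using * by (simp add: E_def)
    also have "\<dots> \<le> cmod (z - w) + cmod (w - p)" using norm_triangle_ineq[of "z - w" "w - p"] by simp
    finally show "s \<le> cmod (w - p)" using * by simp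
  qed
qed

text \<open>Up to radius \<rho> in the image, \<open>F\<close> is multiplication by \<open>l\<close>
  relative to a hole and permutes \<open>H\<close>, so the discs of radius \<open>r\<close> are
  carried exactly to those of radius \<open>l * r\<close>.\<close>

lemma F_E: assumes "0 < r" "l * r \<le> \<rho>" shows "F z \<in> E (l * r) \<longleftrightarrow> z \<in> E r"
proof -
  have r: "r \<le> \<rho> / l" using assms l_gt1 by (simp add: le_divide_eq mult.commute)
  have "\<exists>p\<in>H. cmod (z - p) < r" if q: "q \<in> H" "cmod (F z - q) < l * r" for q
  proof -
    have "G (q + (F z - q)) = hyp (1/l) q + (F z - q) / of_real l"
      using q assms by (intro G_near_cmod) auto
    then have "z = hyp (1/l) q + (F z - q) / of_real l" by simp
    then have "z - hyp (1/l) q = (F z - q) / of_real l" by (metis add_diff_cancel_left')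
    then have "cmod (z - hyp (1/l) q) < r"
      using q l_gt1 by (simp add: norm_divide divide_less_eq mult.commute)
    then show ?thesis using H_hyp_mem q by blast
  qed
  moreover have "\<exists>q\<in>H. cmod (F z - q) < l * r" if p: "p \<in> H" "cmod (z - p) < r" for p
  proof -
    have "F (p + (z - p)) = hyp l p + of_real l * (z - p)"
      using p r by (intro F_near_cmod) auto
    then have "F z = hyp l p + of_real l * (z - p)" by simp
    then have "F z - hyp l p = of_real l * (z - p)" by (metis add_diff_cancel_left')
    then have "cmod (F z - hyp l p) < l * r"
      using p l_gt1 by (simp add: norm_mult)
    then show ?thesis using H_hyp_mem p by blast
  qed
  ultimately show ?thesis unfolding E_def mem_Collect_eq by (meson linorder_not_less)
qed

lemma G_E: "0 < r \<Longrightarrow> l * r \<le> \<rho> \<Longrightarrow> z \<in> E (l * r) \<Longrightarrow> G z \<in> E r"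
  using F_E[of r "G z"] by simp

lemma E_l: "0 < r \<Longrightarrow> E (l * r) \<subseteq> E r"
  using l_gt1 by (intro E_mono) auto

lemma F_E_self: "0 < r \<Longrightarrow> l * r \<le> \<rho> \<Longrightarrow> z \<in> E r \<Longrightarrow> F z \<in> E r"
  using F_E E_l by blast

definition "Box = {z. \<exists>p\<in>H. \<bar>Re (z - p)\<bar> \<le> \<rho> \<and> \<bar>Im (z - p)\<bar> \<le> \<rho>}"

text \<open>Off the box the perturbation does not increase in the upward direction, so it can only
  strengthen the linear contraction, while \<open>F_mono_Im\<close> prevents the order of the two
  points from being reversed.\<close>

lemma contract:
  assumes "Re z = Re w" "\<bar>Im z - Im w\<bar> \<le> \<rho>" "z \<notin> Box" "w \<notin> Box"
  shows "\<bar>Im (F z) - Im (F w)\<bar> \<le> \<bar>Im z - Im w\<bar> / l"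
proof -
  have *: "\<bar>Im (F z) - Im (F w)\<bar> \<le> \<bar>Im z - Im w\<bar> / l"
    if "Im z \<le> Im w" "Re z = Re w" "Im w - Im z \<le> \<rho>" "z \<notin> Box" "w \<notin> Box" for z w
  proof -
    have b: "bmp (w - p) \<le> bmp (z - p)" if "p \<in> H" for p
      using \<open>z \<notin> Box\<close> \<open>w \<notin> Box\<close> \<open>p \<in> H\<close> \<open>Im z \<le> Im w\<close> \<open>Re z = Re w\<close> \<open>Im w - Im z \<le> \<rho>\<close>
      by (intro bmp_antimono) (auto simp: Box_def not_le)
    have "pert w - pert z \<le> 0"
    proof (rule pert_diff[of w z])
      fix p q assume "p \<in> H" "q \<in> H" "pert w - pert z = (bmp (w - p) - bmp (z - p)) + (bmp (w - q) - bmp (z - q))"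
      then show ?thesis using b[of p] b[of q] by linarith
    qed (use b in force)+
    moreover have "Im (F w) - Im (F z) \<ge> 0"
      using F_mono_Im[of z w] that l_gt1 by (smt (verit) divide_nonneg_pos)
    ultimately show ?thesis using that by (simp add: diff_divide_distrib)
  qed
  show ?thesis using *[of z w] *[of w z] assms by (cases "Im z \<le> Im w") (auto simp: abs_minus_commute)
qed

text \<open>The box around a hole is backward invariant, and points of it are attracted to the hole backwards.\<close>
lemma Box_back:
  assumes "p \<in> H" "\<bar>Re (z - p)\<bar> \<le> \<rho>" "\<bar>Im (z - p)\<bar> \<le> \<rho>"
  shows "\<exists>q\<in>H. (G ^^ n) z - q = (z - p) / of_real (l ^ n)"
proof (induction n)
  case 0 then show ?case using assms by auto
next
  case (Suc n)
  then obtain q where q: "q \<in> H" "(G ^^ n) z - q = (z - p) / of_real (l ^ n)" by blast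
  have ln: "1 \<le> l ^ n" using l_gt1 by simp
  have *: "\<bar>a / l ^ n\<bar> \<le> \<rho>" if "\<bar>a\<bar> \<le> \<rho>" for a
    using that ln by (simp add: abs_divide divide_le_eq) (smt (verit) mult_le_cancel_left1 rho_pos)
  have "G (q + ((G ^^ n) z - q)) = hyp (1/l) q + ((G ^^ n) z - q) / of_real l"
    using *[of "Re (z - p)"] *[of "Im (z - p)"] assms
    by (intro G_near[OF q(1)]) (simp_all only: q(2) Re_divide_of_real Im_divide_of_real)
  then show ?case using H_hyp_mem[OF q(1)] q(2) by (intro bexI[of _ "hyp (1/l) q"]) (simp_all add: algebra_simps)
qed

text \<open>Used in contrapositive form: an orbit that has left the box never returns, so vertical
  contraction persists from then on.\<close>

lemma F_Box: "F z \<in> Box \<Longrightarrow> z \<in> Box"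
proof -
  assume "F z \<in> Box"
  then obtain p where p: "p \<in> H" "\<bar>Re (F z - p)\<bar> \<le> \<rho>" "\<bar>Im (F z - p)\<bar> \<le> \<rho>" by (auto simp: Box_def)
  from Box_back[OF p, of 1] obtain q where q: "q \<in> H" "z - q = (F z - p) / of_real l" by auto
  have "\<bar>a / l\<bar> \<le> \<rho>" if "\<bar>a\<bar> \<le> \<rho>" for a
    using that l_gt1 by (simp add: abs_divide divide_le_eq) (smt (verit) mult_le_cancel_left1 rho_pos)
  then show "z \<in> Box" unfolding Box_def using q p
    by (intro CollectI bexI[OF _ q(1)]) (simp only: q(2) Re_divide_of_real Im_divide_of_real)
qed

end

section \<open>Gluing attractors to repellers along necks\<close>

text \<open>Two neck coordinates \<open>w\<close> with the same real part, and the same real part after the inversion,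
  are the two roots of a quadratic polynomial: this is the source of the 2 in 2-expansive.\<close>
lemma neck_solutions:
  assumes "Im C \<noteq> 0"
  shows "finite {w. w \<noteq> 0 \<and> Re w = a \<and> Re (C / w) = b}" "card {w. w \<noteq> 0 \<and> Re w = a \<and> Re (C / w) = b} \<le> 2"
proof -
  let ?p = "[:b * a\<^sup>2 - Re C * a, - Im C, b:]"
  have p0: "?p \<noteq> 0" using assms by simp
  have sub: "{w. w \<noteq> 0 \<and> Re w = a \<and> Re (C / w) = b} \<subseteq> Complex a ` {t. poly ?p t = 0}"
  proof safe
    fix w assume w: "w \<noteq> 0" "a = Re w" "b = Re (C / w)"
    have n: "(Re w)\<^sup>2 + (Im w)\<^sup>2 \<noteq> 0" using w(1) by (simp add: complex_eq_iff sum_power2_eq_zero_iff)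
    have "b = (Re C * Re w + Im C * Im w) / ((Re w)\<^sup>2 + (Im w)\<^sup>2)"
      using w by (simp add: Re_divide)
    then have "b * ((Re w)\<^sup>2 + (Im w)\<^sup>2) = Re C * Re w + Im C * Im w" using n by simp
    then have "poly [:Re (C / w) * (Re w)\<^sup>2 - Re C * Re w, - Im C, Re (C / w):] (Im w) = 0"
      using w by (simp add: algebra_simps power2_eq_square)
    then show "w \<in> Complex (Re w) ` {t. poly [:Re (C / w) * (Re w)\<^sup>2 - Re C * Re w, - Im C, Re (C / w):] t = 0}"
      by (intro image_eqI[of _ _ "Im w"]) auto
  qed
  have fin: "finite {t. poly ?p t = 0}" using p0 by (rule poly_roots_finite)
  then show "finite {w. w \<noteq> 0 \<and> Re w = a \<and> Re (C / w) = b}" using sub finite_subset by blast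
  have "card {w. w \<noteq> 0 \<and> Re w = a \<and> Re (C / w) = b} \<le> card (Complex a ` {t. poly ?p t = 0})"
    using sub fin by (intro card_mono) auto
  also have "\<dots> \<le> card {t. poly ?p t = 0}" using fin by (rule card_image_le)
  also have "\<dots> \<le> degree ?p" using p0 by (rule card_poly_roots_bound)
  also have "\<dots> \<le> 2" by simp
  finally show "card {w. w \<noteq> 0 \<and> Re w = a \<and> Re (C / w) = b} \<le> 2" .
qed

text \<open>A surface covered by the pieces \<open>Q j\<close>, periodic charts of tori with holes of radius \<open>r1\<close> around \<open>H j\<close>;
  \<open>sg j\<close> says that the map is \<open>F\<close> on this piece, and not its inverse. The rings \<open>r1 \<le> \<bar>v\<bar> \<le> r2\<close> around
  holes of pieces of opposite sign are identified by the inversion \<open>v \<mapsto> C / v\<close>.\<close>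
locale necks = Metric_space M d for M :: "'a set" and d :: "'a \<Rightarrow> 'a \<Rightarrow> real" +
  fixes l \<rho> :: real and \<Gamma> :: "complex set" and I :: "nat set" and sg :: "nat \<Rightarrow> bool"
    and H :: "nat \<Rightarrow> complex set" and Q :: "nat \<Rightarrow> complex \<Rightarrow> 'a" and r0 r1 r2 :: real
  assumes da: "\<And>j. da l \<rho> \<Gamma> (H j)"
    and radii: "r2 = \<rho> / l" "r2 = l ^ 3 * r0" "r0 = l ^ 3 * r1"
    and fin_I: "finite I"
    and disc: "\<exists>\<mu>>0. \<forall>a\<in>\<Gamma>. a \<noteq> 0 \<longrightarrow> \<mu> \<le> cmod a"
    and Q_in: "\<And>j z. j \<in> I \<Longrightarrow> z \<in> da.E (H j) r1 \<Longrightarrow> Q j z \<in> M"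
    and Q_same: "\<And>j z w. j \<in> I \<Longrightarrow> z \<in> da.E (H j) r1 \<Longrightarrow> w \<in> da.E (H j) r1 \<Longrightarrow> Q j z = Q j w \<longleftrightarrow> z - w \<in> \<Gamma>"
    and Q_diff: "\<And>j i z w. j \<in> I \<Longrightarrow> i \<in> I \<Longrightarrow> j \<noteq> i \<Longrightarrow> z \<in> da.E (H j) r1 \<Longrightarrow> w \<in> da.E (H i) r1 \<Longrightarrow> Q j z = Q i w \<Longrightarrow>
        \<exists>p\<in>H j. \<exists>q\<in>H i. \<exists>C. sg j \<noteq> sg i \<and> Im C \<noteq> 0 \<and> cmod C = r1 * r2 \<and> cmod (z - p) \<le> r2 \<and>
          (\<forall>v. r1 \<le> cmod v \<and> cmod v \<le> r2 \<longrightarrow> Q j (p + v) = Q i (q + C / v))"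
    and neck_ex: "\<And>j p. j \<in> I \<Longrightarrow> p \<in> H j \<Longrightarrow> 
        \<exists>i\<in>I. \<exists>q\<in>H i. \<exists>C. sg j \<noteq> sg i \<and> Im C \<noteq> 0 \<and> cmod C = r1 * r2 \<and>
          (\<forall>v. r1 \<le> cmod v \<and> cmod v \<le> r2 \<longrightarrow> Q j (p + v) = Q i (q + C / v))"
    and cover: "\<And>x. x \<in> M \<Longrightarrow> \<exists>j\<in>I. \<exists>z\<in>da.E (H j) r0. x = Q j z"
    and Q_cont: "\<And>j. j \<in> I \<Longrightarrow> continuous_map (top_of_set (da.E (H j) r1)) mtopology (Q j)"
    and cocompact: "\<exists>K. compact K \<and> (\<forall>z. \<exists>a\<in>\<Gamma>. z - a \<in> K)"
    and hole: "\<exists>j\<in>I. sg j \<and> H j \<noteq> {}"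
begin

sublocale D: da l \<rho> \<Gamma> "H j" for j by (rule da)

abbreviation "F j \<equiv> da.F l \<rho> (H j)"
abbreviation "G j \<equiv> da.G l \<rho> (H j)"
abbreviation "E j \<equiv> da.E (H j)"
abbreviation "lipF \<equiv> da.lipF l \<rho>"
abbreviation "lipG \<equiv> da.lipG l \<rho>"

definition "neck j p i q C \<longleftrightarrow> j \<in> I \<and> i \<in> I \<and> p \<in> H j \<and> q \<in> H i \<and> sg j \<noteq> sg i \<and> Im C \<noteq> 0 \<and>
  cmod C = r1 * r2 \<and> (\<forall>v. r1 \<le> cmod v \<and> cmod v \<le> r2 \<longrightarrow> Q j (p + v) = Q i (q + C / v))"

section \<open>Geometry of the radii and of a single neck\<close>

lemma l1: "l > 1" and rho: "\<rho> > 0"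
  using D.l_gt1 D.rho_pos by auto

lemma pw: "1 < l ^ 2" "1 < l ^ 3" "l < l ^ 2" "l ^ 2 < l ^ 3"
  using l1 one_less_power[of l 2] one_less_power[of l 3] power_strict_increasing[of 1 2 l] power_strict_increasing[of 2 3 l]
  by simp_all

lemma r_pos: "r1 > 0" "r0 > 0" "r2 > 0"
proof -
  show r2: "r2 > 0" using radii(1) l1 rho by simp
  have l3: "0 < l ^ 3" using l1 by simp
  show r0: "r0 > 0" using r2 radii(2) l3 by (simp add: zero_less_mult_iff)
  show "r1 > 0" using r0 radii(3) l3 by (simp add: zero_less_mult_iff)
qed

lemma r_less: "l * r1 < l\<^sup>2 * r1" "l\<^sup>2 * r1 < r0" "r1 < l * r1" "r1 < r0" "r0 < r2" "r2 < \<rho>" "l * r2 = \<rho>" "l * r1 < \<rho>" "r1 < r2" "l * r1 < r0"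
proof -
  show "l * r1 < l\<^sup>2 * r1" "l\<^sup>2 * r1 < r0" "r1 < l * r1" "r1 < r0" "r0 < r2" 
    using pw r_pos l1 radii(2,3) by auto
  show "l * r2 = \<rho>" using radii(1) l1 by simp
  then show "r2 < \<rho>" using mult_strict_right_mono[OF l1 r_pos(3)] by simp
  show "l * r1 < r0" using \<open>l * r1 < l\<^sup>2 * r1\<close> \<open>l\<^sup>2 * r1 < r0\<close> by simp
  then show "l * r1 < \<rho>" using \<open>r0 < r2\<close> \<open>r2 < \<rho>\<close> by simp
  show "r1 < r2" using \<open>r1 < r0\<close> \<open>r0 < r2\<close> by simp
qed

text \<open>The circle of radius \<open>r0\<close> is invariant under an inversion whose constant
  has modulus \<open>r1 * r2\<close>; it is the middle of the neck, and both sides may be cut there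
  without losing points.\<close>

lemma r0_sq: "r1 * r2 = r0 * r0"
  using radii(2,3) by (metis mult.assoc mult.commute)

text \<open>Distinct holes are at least \<open>2 * rad\<close> apart and \<rho> is at most
  \<open>rad\<close>, so within distance \<rho> of \<open>p\<close> no other hole is closer than
  \<open>p\<close>.\<close>

lemma near_E:
  assumes "p \<in> H j" "r \<le> cmod v" "cmod v \<le> \<rho>" shows "p + v \<in> E j r"
  unfolding D.E_def
proof safe
  fix q assume q: "q \<in> H j"
  show "r \<le> cmod (p + v - q)"
  proof (cases "q = p")
    case True then show ?thesis using assms by simp
  next
    case False
    have "2 * D.rad \<le> cmod (p - q)" using D.H_sep assms(1) q False by auto
    also have "\<dots> \<le> cmod (p + v - q) + cmod v" using norm_triangle_ineq4[of "p + v - q" v] by simp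
    finally have "2 * D.rad \<le> cmod (p + v - q) + cmod v" .
    moreover have "\<rho> \<le> D.rad" using D.ext_gt unfolding D.rad_def by simp
    ultimately show ?thesis using assms by linarith
  qed
qed

text \<open>The inversion determines the second lift only up to the lattice. The norm bounds hold
  because it exchanges the circles \<open>r1\<close> and \<open>r2\<close>.\<close>

lemma neck_Gam:
  assumes "neck j p i q C" "z \<in> E j r1" "cmod (z - p) \<le> r2" "w \<in> E i r1" "Q j z = Q i w"
  shows "w - (q + C / (z - p)) \<in> \<Gamma>" "r1 \<le> cmod (z - p)" "r1 \<le> cmod (C / (z - p))" "cmod (C / (z - p)) \<le> r2" "z \<noteq> p"
proof -
  show 1: "r1 \<le> cmod (z - p)" using assms by (auto simp: D.E_def neck_def)
  then show "z \<noteq> p" using r_pos by auto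
  have pos: "cmod (z - p) > 0" using 1 r_pos by linarith
  have C: "cmod (C / (z - p)) = r1 * r2 / cmod (z - p)" using assms by (simp add: neck_def norm_divide)
  show 2: "r1 \<le> cmod (C / (z - p))" unfolding C using pos assms r_pos by (simp add: le_divide_eq)
  show 3: "cmod (C / (z - p)) \<le> r2" unfolding C using pos 1 r_pos by (simp add: divide_le_eq mult.commute mult_left_mono)
  have "Q j (p + (z - p)) = Q i (q + C / (z - p))" using assms(1) 1 assms(3) unfolding neck_def by blast
  then have "Q i w = Q i (q + C / (z - p))" using assms by simp
  moreover have "q + C / (z - p) \<in> E i r1" using assms(1) 2 3 r_less by (intro near_E) (auto simp: neck_def)
  ultimately show "w - (q + C / (z - p)) \<in> \<Gamma>" using Q_same assms by (auto simp: neck_def)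
qed

lemma Q_diff':
  assumes "j \<in> I" "i \<in> I" "j \<noteq> i" "z \<in> E j r1" "w \<in> E i r1" "Q j z = Q i w"
  obtains p q C where "neck j p i q C" "cmod (z - p) \<le> r2"
  using Q_diff[OF assms] assms unfolding neck_def by blast

lemma E_r1: "E j (l * r1) \<subseteq> E j r1" "E j r0 \<subseteq> E j r1" "E j r0 \<subseteq> E j (l * r1)"
  by (simp_all add: D.E_mono less_imp_le r_less)

lemma closed_E: "closed (E j r)"
proof -
  have "E j r = (\<Inter>p\<in>H j. {z. r \<le> cmod (z - p)})" by (auto simp: D.E_def)
  moreover have "closed {z. r \<le> cmod (z - p)}" for p by (intro closed_Collect_le continuous_intros)
  ultimately show ?thesis by auto
qed

section \<open>Uniform continuity of the charts and lifting of close points\<close>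

lemma Q_eps:
  assumes j: "j \<in> I" and z: "z \<in> E j r1" and e: "e > 0"
  obtains \<delta> where "\<delta> > 0" "\<And>w. w \<in> E j r1 \<Longrightarrow> cmod (w - z) < \<delta> \<Longrightarrow> d (Q j z) (Q j w) < e"
proof -
  have "openin (top_of_set (E j r1)) {w \<in> topspace (top_of_set (E j r1)). Q j w \<in> mball (Q j z) e}"
    by (rule openin_continuous_map_preimage[OF Q_cont[OF j] openin_mball])
  moreover have "z \<in> {w \<in> topspace (top_of_set (E j r1)). Q j w \<in> mball (Q j z) e}"
    using z e Q_in[OF j z] by simp
  ultimately obtain \<delta> where "\<delta> > 0" "\<forall>w\<in>E j r1. dist w z < \<delta> \<longrightarrow> w \<in> {w \<in> topspace (top_of_set (E j r1)). Q j w \<in> mball (Q j z) e}"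
    unfolding openin_euclidean_subtopology_iff by blast
  then show thesis using that[of \<delta>] by (simp add: dist_norm)
qed

lemma Q_seq:
  assumes j: "j \<in> I" and z: "z \<in> E j r1" and w: "\<And>n. w n \<in> E j r1" "w \<longlonglongrightarrow> z"
  shows "(\<lambda>n. d (Q j z) (Q j (w n))) \<longlonglongrightarrow> 0"
proof (rule LIMSEQ_I)
  fix e :: real assume "e > 0"
  then obtain \<delta> where dl: "\<delta> > 0" "\<And>w. w \<in> E j r1 \<Longrightarrow> cmod (w - z) < \<delta> \<Longrightarrow> d (Q j z) (Q j w) < e"
    using Q_eps[OF j z] by metis
  obtain N where "\<And>n. N \<le> n \<Longrightarrow> cmod (w n - z) < \<delta>" using LIMSEQ_D[OF w(2) dl(1)] by blast
  then show "\<exists>N. \<forall>n\<ge>N. norm (d (Q j z) (Q j (w n)) - 0) < e" using dl(2) w(1) by (intro exI[of _ N]) simp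
qed

lemma fundamental:
  obtains K where "compact K" "\<And>j r z. z \<in> E j r \<Longrightarrow> \<exists>a\<in>\<Gamma>. z - a \<in> K \<inter> E j r"
proof -
  obtain K where K: "compact K" "\<forall>z. \<exists>a\<in>\<Gamma>. z - a \<in> K" using cocompact by blast
  have "\<exists>a\<in>\<Gamma>. z - a \<in> K \<inter> E j r" if z: "z \<in> E j r" for j r z
  proof -
    obtain a where a: "a \<in> \<Gamma>" "z - a \<in> K" using K by blast
    then have "z + - a \<in> E j r" using D.E_Gam D.Gam_minus z by blast
    then show ?thesis using a by auto
  qed
  then show thesis using that K by blast
qed

lemma E_shift: "a \<in> \<Gamma> \<Longrightarrow> z - a \<in> E j r \<longleftrightarrow> z \<in> E j r"
  using D.E_Gam[of "- a" z j r] D.Gam_minus by simp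

lemma Q_shift: "j \<in> I \<Longrightarrow> z \<in> E j r1 \<Longrightarrow> a \<in> \<Gamma> \<Longrightarrow> Q j (z - a) = Q j z"
  using Q_same[of j "z - a" z] E_shift D.Gam_minus by simp

text \<open>The domain \<open>E j r1\<close> is not bounded, but a lattice translation brings one
  point of each pair into a compact fundamental set without changing the values of
  \<open>Q j\<close>.\<close>

lemma Q_uc:
  assumes j: "j \<in> I" and e: "e > 0"
  shows "\<exists>\<eta>>0. \<forall>z\<in>E j r1. \<forall>w\<in>E j r1. cmod (z - w) < \<eta> \<longrightarrow> d (Q j z) (Q j w) < e"
proof (rule ccontr)
  assume no: "\<not> ?thesis"
  obtain K where K: "compact K" "\<And>j r z. z \<in> E j r \<Longrightarrow> \<exists>a\<in>\<Gamma>. z - a \<in> K \<inter> E j r" using fundamental by blast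
  have "\<exists>u v. u \<in> K \<inter> E j r1 \<and> v \<in> E j r1 \<and> cmod (u - v) < inverse (real (Suc n)) \<and> e \<le> d (Q j u) (Q j v)" for n
  proof -
    obtain z w where zw: "z \<in> E j r1" "w \<in> E j r1" "cmod (z - w) < inverse (real (Suc n))" "e \<le> d (Q j z) (Q j w)"
      using no inverse_positive_iff_positive[of "real (Suc n)"] by (metis not_le of_nat_0_less_iff zero_less_Suc)
    obtain a where a: "a \<in> \<Gamma>" "z - a \<in> K \<inter> E j r1" using K(2)[OF zw(1)] by blast
    show ?thesis
      using zw a E_shift Q_shift[OF j] by (intro exI[of _ "z - a"] exI[of _ "w - a"]) simp
  qed
  then obtain u v where uv: "\<And>n. u n \<in> K \<inter> E j r1" "\<And>n. v n \<in> E j r1" "\<And>n. cmod (u n - v n) < inverse (real (Suc n))"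
    "\<And>n. e \<le> d (Q j (u n)) (Q j (v n))" by metis
  have "compact (K \<inter> E j r1)" using K(1) closed_E compact_Int_closed by blast
  then obtain x s where x: "x \<in> K \<inter> E j r1" "strict_mono s" "(u \<circ> s) \<longlonglongrightarrow> x"
    using uv(1) unfolding compact_def by metis
  have "(\<lambda>n. u n - v n) \<longlonglongrightarrow> 0"
    by (rule Lim_null_comparison[OF _ LIMSEQ_inverse_real_of_nat]) (use uv(3) in \<open>auto intro!: always_eventually less_imp_le\<close>)
  then have "((\<lambda>n. u n - v n) \<circ> s) \<longlonglongrightarrow> 0" using x(2) by (rule LIMSEQ_subseq_LIMSEQ)
  then have "(\<lambda>n. (u \<circ> s) n - ((\<lambda>n. u n - v n) \<circ> s) n) \<longlonglongrightarrow> x - 0" using x(3) by (intro tendsto_diff)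
  then have vx: "(v \<circ> s) \<longlonglongrightarrow> x" by (simp add: o_def)
  have lim: "(\<lambda>n. d (Q j x) (Q j ((u \<circ> s) n)) + d (Q j x) (Q j ((v \<circ> s) n))) \<longlonglongrightarrow> 0 + 0"
  proof (rule tendsto_add)
    show "(\<lambda>n. d (Q j x) (Q j ((u \<circ> s) n))) \<longlonglongrightarrow> 0" by (rule Q_seq[OF j _ _ x(3)]) (use uv x in auto)
    show "(\<lambda>n. d (Q j x) (Q j ((v \<circ> s) n))) \<longlonglongrightarrow> 0" by (rule Q_seq[OF j _ _ vx]) (use uv x in auto)
  qed
  have "e \<le> d (Q j x) (Q j ((u \<circ> s) n)) + d (Q j x) (Q j ((v \<circ> s) n))" for n
    using uv(4)[of "s n"] triangle[of "Q j (u (s n))" "Q j x" "Q j (v (s n))"] commute[of "Q j (u (s n))" "Q j x"]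
      Q_in[OF j] uv(1,2) x(1) by (fastforce)
  then have "e \<le> 0 + 0" using lim by (intro LIMSEQ_le_const[OF lim]) blast
  then show False using e by simp
qed

text \<open>A uniform form of openness of the chart. A failure yields, by compactness, two limit
  points that represent the same point of the surface, either in one piece or across a neck; near
  them the allegedly missing lift can be written down explicitly.\<close>

lemma Q_lift:
  assumes j: "j \<in> I" and e: "e > 0"
  shows "\<exists>\<alpha>>0. \<forall>z\<in>E j (l * r1). \<forall>y\<in>M. d (Q j z) y \<le> \<alpha> \<longrightarrow> (\<exists>w\<in>E j r1. cmod (z - w) < e \<and> Q j w = y)"
proof (rule ccontr)
  assume no: "\<not> ?thesis"
  obtain K where K: "compact K" "\<And>j r z. z \<in> E j r \<Longrightarrow> \<exists>a\<in>\<Gamma>. z - a \<in> K \<inter> E j r" using fundamental by blast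
  have "\<exists>u x i. u \<in> K \<inter> E j (l * r1) \<and> i \<in> I \<and> x \<in> K \<inter> E i r0 \<and> d (Q j u) (Q i x) \<le> inverse (real (Suc n)) \<and>
      (\<forall>w\<in>E j r1. cmod (u - w) < e \<longrightarrow> Q j w \<noteq> Q i x)" for n
  proof -
    obtain z y where zy: "z \<in> E j (l * r1)" "y \<in> M" "d (Q j z) y \<le> inverse (real (Suc n))" "\<forall>w\<in>E j r1. cmod (z - w) < e \<longrightarrow> Q j w \<noteq> y"
      using no inverse_positive_iff_positive[of "real (Suc n)"] by (metis of_nat_0_less_iff zero_less_Suc)
    obtain i x where ix: "i \<in> I" "x \<in> E i r0" "y = Q i x" using cover[OF zy(2)] by blast
    obtain a where a: "a \<in> \<Gamma>" "z - a \<in> K \<inter> E j (l * r1)" using K(2)[OF zy(1)] by blast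
    obtain b where b: "b \<in> \<Gamma>" "x - b \<in> K \<inter> E i r0" using K(2)[OF ix(2)] by blast
    have q: "Q j (z - a) = Q j z" "Q i (x - b) = y" using Q_shift[OF j _ a(1)] Q_shift[OF ix(1) _ b(1)] E_r1 zy ix by blast+
    have "Q j w \<noteq> y" if w: "w \<in> E j r1" "cmod (z - a - w) < e" for w
    proof -
      have "w - (- a) \<in> E j r1" "Q j (w - (- a)) = Q j w" using w E_shift Q_shift[OF j] D.Gam_minus[OF a(1)] by blast+
      moreover have "cmod (z - (w - (- a))) < e" using w(2) by (simp add: algebra_simps)
      ultimately show ?thesis using zy(4) by metis
    qed
    then show ?thesis using a b ix q zy(3) by (intro exI[of _ "z - a"] exI[of _ "x - b"] exI[of _ i]) auto
  qed
  then obtain u x i where ux: "\<And>n. u n \<in> K \<inter> E j (l * r1)" "\<And>n. i n \<in> I" "\<And>n. x n \<in> K \<inter> E (i n) r0"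
    "\<And>n. d (Q j (u n)) (Q (i n) (x n)) \<le> inverse (real (Suc n))"
    "\<And>n w. w \<in> E j r1 \<Longrightarrow> cmod (u n - w) < e \<Longrightarrow> Q j w \<noteq> Q (i n) (x n)" by metis
  \<comment> \<open>The piece indices are embedded in the reals, so that one compactness argument
    makes them converge too; being integers they are then eventually constant.\<close>
  have comp: "compact (K \<times> K \<times> real ` I)" by (intro compact_Times K(1) finite_imp_compact finite_imageI fin_I)
  have "\<forall>n. (u n, x n, real (i n)) \<in> K \<times> K \<times> real ` I" using ux(1-3) by blast
  then obtain t s where t: "t \<in> K \<times> K \<times> real ` I" "strict_mono s" "((\<lambda>n. (u n, x n, real (i n))) \<circ> s) \<longlonglongrightarrow> t"
    using comp[unfolded compact_def, THEN spec, of "\<lambda>n. (u n, x n, real (i n))"] by blast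
  obtain u' x' m where tm: "t = (u', x', real m)" "m \<in> I" using t(1) by auto
  have us: "(\<lambda>n. u (s n)) \<longlonglongrightarrow> u'" and xs: "(\<lambda>n. x (s n)) \<longlonglongrightarrow> x'" and ms: "(\<lambda>n. real (i (s n))) \<longlonglongrightarrow> real m"
    using tendsto_fst[OF t(3)] tendsto_fst[OF tendsto_snd[OF t(3)]] tendsto_snd[OF tendsto_snd[OF t(3)]] tm by (simp_all add: o_def)
  obtain N where N: "\<And>n. N \<le> n \<Longrightarrow> norm (real (i (s n)) - real m) < 1" using LIMSEQ_D[OF ms, of 1] by auto
  have im: "i (s (n + N)) = m" for n using N[of "n + N"] by simp
  define U X where "U n = u (s (n + N))" and "X n = x (s (n + N))" for n
  have U: "U n \<in> E j (l * r1)" "U n \<in> E j r1" and X: "X n \<in> E m r0" "X n \<in> E m r1" for n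
    using ux(1)[of "s (n + N)"] ux(3)[of "s (n + N)"] im[of n] E_r1 by (auto simp: U_def X_def)
  have Ul: "U \<longlonglongrightarrow> u'" and Xl: "X \<longlonglongrightarrow> x'"
    unfolding U_def X_def using LIMSEQ_ignore_initial_segment[OF us] LIMSEQ_ignore_initial_segment[OF xs] by auto
  have u': "u' \<in> E j (l * r1)" "u' \<in> E j r1" and x': "x' \<in> E m r0" "x' \<in> E m r1"
    using closed_sequentially[OF closed_E _ Ul] closed_sequentially[OF closed_E _ Xl] U X by blast+
  have dUX: "d (Q j (U n)) (Q m (X n)) \<le> inverse (real (Suc n))" for n
  proof -
    have "n \<le> s (n + N)" using seq_suble[OF t(2), of "n + N"] by simp
    then have "inverse (real (Suc (s (n + N)))) \<le> inverse (real (Suc n))" by (simp add: le_imp_inverse_le)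
    from order_trans[OF ux(4) this] show ?thesis by (simp only: U_def X_def im)
  qed
  have nolift: "Q j w \<noteq> Q m (X n)" if "w \<in> E j r1" "cmod (U n - w) < e" for w n
    using ux(5)[of w "s (n + N)"] that im[of n] by (simp add: U_def X_def)
  have "d (Q j u') (Q m x') \<le> d (Q j u') (Q j (U n)) + inverse (real (Suc n)) + d (Q m x') (Q m (X n))" for n
  proof -
    have M: "Q j u' \<in> M" "Q m x' \<in> M" "Q j (U n) \<in> M" "Q m (X n) \<in> M" using Q_in j tm(2) u' x' U X by blast+
    show ?thesis
      using triangle[OF M(1,3,2)] triangle[OF M(3,4,2)] dUX[of n] commute[of "Q m (X n)" "Q m x'"] by linarith
  qed
  moreover have "(\<lambda>n. d (Q j u') (Q j (U n)) + inverse (real (Suc n)) + d (Q m x') (Q m (X n))) \<longlonglongrightarrow> 0 + 0 + 0"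
    using Q_seq[OF j u'(2) U(2) Ul] Q_seq[OF tm(2) x'(2) X(2) Xl] LIMSEQ_inverse_real_of_nat by (intro tendsto_add)
  ultimately have "d (Q j u') (Q m x') \<le> 0 + 0 + 0" by (intro LIMSEQ_le_const) blast+
  then have eq: "Q j u' = Q m x'" using zero[of "Q j u'" "Q m x'"] nonneg[of "Q j u'" "Q m x'"] Q_in j tm(2) u' x' by (smt (verit))
  have fin: False if w: "w \<longlonglongrightarrow> u'" "\<forall>\<^sub>F n in sequentially. w n \<in> E j r1 \<and> Q j (w n) = Q m (X n)" for w
  proof -
    have "(\<lambda>n. U n - w n) \<longlonglongrightarrow> u' - u'" using Ul w(1) by (rule tendsto_diff)
    then have "\<forall>\<^sub>F n in sequentially. dist (U n - w n) 0 < e" using e by (auto dest: tendstoD)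
    then have "\<forall>\<^sub>F n in sequentially. cmod (U n - w n) < e \<and> w n \<in> E j r1 \<and> Q j (w n) = Q m (X n)"
      using w(2) by eventually_elim simp
    then obtain n where "cmod (U n - w n) < e" "w n \<in> E j r1" "Q j (w n) = Q m (X n)"
      using eventually_happens'[OF sequentially_bot] by blast
    then show False using nolift by blast
  qed
  show False
  proof (cases "m = j")
    case True
    have a: "x' - u' \<in> \<Gamma>" using Q_same[OF j x'(2)[unfolded True] u'(2)] eq True by simp
    have "(\<lambda>n. X n - (x' - u')) \<longlonglongrightarrow> x' - (x' - u')" using Xl by (intro tendsto_intros)
    moreover have "X n - (x' - u') \<in> E j r1" "Q j (X n - (x' - u')) = Q m (X n)" for n
      using X(2)[of n] E_shift[OF a] Q_shift[OF j _ a] True by auto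
    ultimately show False using fin[of "\<lambda>n. X n - (x' - u')"] by simp
  next
    case False
    obtain p q C where n: "neck j p m q C" "cmod (u' - p) \<le> r2" using Q_diff'[OF j tm(2) _ u'(2) x'(2) eq] False by metis
    note G = neck_Gam[OF n(1) u'(2) n(2) x'(2) eq]
    have C: "cmod C = r1 * r2" "C \<noteq> 0" using n(1) r_pos by (auto simp: neck_def)
    define a where "a = x' - (q + C / (u' - p))"
    have a: "a \<in> \<Gamma>" using G(1) by (simp add: a_def)
    have pq: "p \<in> H j" "q \<in> H m" using n(1) by (auto simp: neck_def)
    \<comment> \<open>The limit lies strictly inside the ring: \<open>x'\<close> is at least
      \<open>r0\<close> from its hole, so after inversion \<open>u'\<close> is at most
      \<open>r0 < r2\<close> from \<open>p\<close>, and it is at least \<open>l * r1 > r1\<close>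
      away. Hence the inverted sequence eventually stays in the ring.\<close>
    have "q + a \<in> H m" using D.H_Gam[OF pq(2) a] .
    then have "r0 \<le> cmod (x' - (q + a))" using x'(1) by (auto simp: D.E_def)
    also have "x' - (q + a) = C / (u' - p)" by (simp add: a_def)
    finally have "r0 * cmod (u' - p) \<le> r0 * r0" using C(1) r0_sq G(5) by (simp add: norm_divide le_divide_eq)
    then have le: "cmod (u' - p) < r2" using r_pos r_less by (simp add: mult_le_cancel_left)
    have "l * r1 \<le> cmod (u' - p)" using u'(1) pq by (auto simp: D.E_def)
    then have ge: "r1 < cmod (u' - p)" using r_less by linarith
    define V where "V n = C / (X n - a - q)" for n
    have "(\<lambda>n. X n - a - q) \<longlonglongrightarrow> C / (u' - p)" using Xl by (auto intro!: tendsto_eq_intros simp: a_def)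
    moreover have nz: "C / (u' - p) \<noteq> 0" using C G(5) by simp
    ultimately have Vl: "V \<longlonglongrightarrow> C / (C / (u' - p))" unfolding V_def by (intro tendsto_divide tendsto_const)
    have "C / (C / (u' - p)) = u' - p" using C G(5) by simp
    then have Vl: "V \<longlonglongrightarrow> u' - p" using Vl by simp
    have "(\<lambda>n. cmod (V n)) \<longlonglongrightarrow> cmod (u' - p)" using Vl by (rule tendsto_norm)
    then have ev: "\<forall>\<^sub>F n in sequentially. r1 < cmod (V n)" "\<forall>\<^sub>F n in sequentially. cmod (V n) < r2"
      using ge le by (auto intro: order_tendstoD)
    have good: "p + V n \<in> E j r1 \<and> Q j (p + V n) = Q m (X n)" if h: "r1 < cmod (V n)" "cmod (V n) < r2" for n
    proof -
      have "Q j (p + V n) = Q m (q + C / V n)" using n(1) h unfolding neck_def by (auto dest: less_imp_le)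
      moreover have "V n \<noteq> 0" using h r_pos by auto
      then have "q + C / V n = X n - a" using C by (auto simp: V_def)
      moreover have "p + V n \<in> E j r1" using pq h r_less by (intro near_E) auto
      ultimately show ?thesis using Q_shift[OF tm(2) X(2) a] by simp
    qed
    have "\<forall>\<^sub>F n in sequentially. p + V n \<in> E j r1 \<and> Q j (p + V n) = Q m (X n)"
      using ev by eventually_elim (rule good)
    moreover have "(\<lambda>n. p + V n) \<longlonglongrightarrow> p + (u' - p)" using Vl by (intro tendsto_intros)
    ultimately show False using fin[of "\<lambda>n. p + V n"] by simp
  qed
qed

section \<open>The homeomorphism obtained by gluing\<close>

lemma F_E1: "z \<in> E j r1 \<Longrightarrow> F j z \<in> E j (l * r1)"
  using D.F_E[of r1 j z] r_pos r_less by simp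

lemma F_E1': "z \<in> E j r1 \<Longrightarrow> F j z \<in> E j r1"
  using F_E1 E_r1 by blast

text \<open>One relation serves for the map (\<open>s = True\<close>) and its inverse
  (\<open>s = False\<close>): a piece whose sign differs from \<open>s\<close> is traversed by the
  inverse of its own \<open>F\<close>. Flipping \<open>s\<close> gives the converse relation, so
  every statement is proved for both time directions at once.\<close>

definition "stp s x y \<longleftrightarrow> (\<exists>j\<in>I. \<exists>z\<in>E j r1.
  (sg j = s \<and> x = Q j z \<and> y = Q j (F j z)) \<or> (sg j \<noteq> s \<and> x = Q j (F j z) \<and> y = Q j z))"

lemma stp_sym: "stp s x y \<longleftrightarrow> stp (\<not> s) y x"
  unfolding stp_def by (intro bex_cong refl) auto

text \<open>Compatibility of the two sides of a neck: the inversion turns multiplication of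
  \<open>v\<close> by \<open>l\<close> into division of \<open>C / v\<close> by \<open>l\<close>.
  The holes are fixed only modulo \<Gamma>, and the resulting translations are absorbed by
  \<open>Q_same\<close>.\<close>

lemma stp_cross:
  assumes "j \<in> I" "i \<in> I" "sg j \<noteq> sg i" "z \<in> E j r1" "w \<in> E i r1" "Q j z = Q i (F i w)"
  shows "Q j (F j z) = Q i w"
proof -
  have "j \<noteq> i" using assms by auto
  from Q_diff'[OF assms(1,2) this assms(4) F_E1'[OF assms(5)] assms(6)]
  obtain p q C where nk: "neck j p i q C" and zp: "cmod (z - p) \<le> r2" by blast
  note N = neck_Gam[OF nk assms(4) zp F_E1'[OF assms(5)] assms(6)]
  have pq: "p \<in> H j" "q \<in> H i" using nk by (auto simp: neck_def)
  define v where "v = z - p"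
  have v0: "v \<noteq> 0" using N by (simp add: v_def)
  define a where "a = F i w - (q + C / v)"
  have a: "a \<in> \<Gamma>" using N(1) by (simp add: a_def v_def)
  have qa: "q + a \<in> H i" using D.H_Gam pq a by blast
  have Cv: "cmod (C / v) \<le> \<rho>" using N(4) r_less by (simp add: v_def)
  have "F i w = (q + a) + C / v" by (simp add: a_def)
  then have "w = G i ((q + a) + C / v)" by (metis D.GF)
  then have w: "w = hyp (1/l) (q + a) + C / v / of_real l" using D.G_near_cmod[OF qa Cv] by simp
  \<comment> \<open>That \<open>w\<close> itself lies in \<open>E i r1\<close> is exactly what keeps
    \<open>l * v\<close> inside the ring.\<close>
  have "r1 \<le> cmod (C / v / of_real l)"
    using assms(5) D.H_hyp_mem(2)[OF qa] unfolding D.E_def w by force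
  then have "cmod v * (l * r1) \<le> r1 * r2"
    using v0 l1 nk by (simp add: norm_divide neck_def le_divide_eq norm_mult mult_ac)
  then have "r1 * (l * cmod v) \<le> r1 * r2" by (simp add: mult_ac)
  then have vl: "cmod (of_real l * v) \<le> r2" using l1 r_pos by (simp add: norm_mult)
  have v1: "r1 \<le> cmod (of_real l * v)"
    using N(2) l1 r_pos by (simp add: v_def norm_mult) (smt (verit) mult_le_cancel_right1)
  have "cmod v \<le> \<rho> / l" using vl l1 r_less(6) by (simp add: norm_mult le_divide_eq mult.commute)
  from D.F_near_cmod[OF pq(1) this] have Fz: "F j z = hyp l p + of_real l * v" by (simp add: v_def)
  have "Q j (F j z) = Q j (p + of_real l * v)"
  proof (subst Q_same[OF assms(1)])
    show "F j z \<in> E j r1" using F_E1' assms by blast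
    show "p + of_real l * v \<in> E j r1" using near_E[OF pq(1) v1] vl r_less by simp
    show "F j z - (p + of_real l * v) \<in> \<Gamma>" using D.H_hyp[OF pq(1)] by (simp add: Fz)
  qed
  also have "\<dots> = Q i (q + C / (of_real l * v))" using nk vl v1 by (simp add: neck_def)
  also have "\<dots> = Q i w"
  proof (subst Q_same[OF assms(2)])
    have "cmod (C / (of_real l * v)) = r1 * r2 / cmod (of_real l * v)" using nk by (simp add: norm_divide neck_def)
    moreover have "r1 \<le> r1 * r2 / cmod (of_real l * v)" "r1 * r2 / cmod (of_real l * v) \<le> r2"
      using vl v1 r_pos by (auto simp: le_divide_eq divide_le_eq mult.commute mult_left_mono)
    ultimately show "q + C / (of_real l * v) \<in> E i r1" using r_less by (intro near_E[OF pq(2)]) auto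
    show "w \<in> E i r1" by fact
    have "hyp l (q - hyp (1/l) (q + a)) = (hyp l q - q) + - a"
      using l1 by (simp add: hyp_diff hyp_inverse)
    then have "hyp l (q - hyp (1/l) (q + a)) \<in> \<Gamma>"
      using D.Gam_add[OF D.H_hyp[OF pq(2)] D.Gam_minus[OF a]] by simp
    then show "q + C / (of_real l * v) - w \<in> \<Gamma>" unfolding w D.Gam_hyp by (simp add: mult.commute)
  qed
  finally show ?thesis .
qed

text \<open>Necks join pieces of opposite sign only, so two pieces of equal sign with a common point
  coincide and \<open>F_Gam_iff\<close> applies; opposite signs are the case of
  \<open>stp_cross\<close>.\<close>

lemma stp_func: assumes "stp s x y" "stp s x y'" shows "y = y'"
proof -
  from assms(1) obtain j z where j: "j \<in> I" "z \<in> E j r1"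
    and 1: "(sg j = s \<and> x = Q j z \<and> y = Q j (F j z)) \<or> (sg j \<noteq> s \<and> x = Q j (F j z) \<and> y = Q j z)"
    unfolding stp_def by blast
  from assms(2) obtain i w where i: "i \<in> I" "w \<in> E i r1"
    and 2: "(sg i = s \<and> x = Q i w \<and> y' = Q i (F i w)) \<or> (sg i \<noteq> s \<and> x = Q i (F i w) \<and> y' = Q i w)"
    unfolding stp_def by blast
  note FE = F_E1'[OF j(2)] F_E1'[OF i(2)]
  show ?thesis
  proof (cases "sg j = sg i")
    case False
    then show ?thesis using 1 2 stp_cross[of j i z w] stp_cross[of i j w z] j i by metis
  next
    case True
    have "i = j"
    proof (rule ccontr)
      assume "i \<noteq> j"
      then have ne: "j \<noteq> i" by simp
      show False using 1 2 True Q_diff'[OF j(1) i(1) ne j(2) i(2)] Q_diff'[OF j(1) i(1) ne FE]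
        unfolding neck_def by metis
    qed
    then show ?thesis using 1 2 True Q_same[OF j(1)] j i FE D.F_Gam_iff[of j z w] by metis
  qed
qed

definition "fs s x = (THE y. stp s x y)"

lemma fs_eq: "stp s x y \<Longrightarrow> fs s x = y"
  unfolding fs_def using stp_func by blast

lemma fs_F: "j \<in> I \<Longrightarrow> sg j = s \<Longrightarrow> z \<in> E j r1 \<Longrightarrow> fs s (Q j z) = Q j (F j z)"
  by (intro fs_eq) (auto simp: stp_def)

lemma G_E1: "z \<in> E j (l * r1) \<Longrightarrow> G j z \<in> E j r1"
  using D.G_E r_pos r_less by simp

lemma fs_G: assumes "j \<in> I" "sg j \<noteq> s" "z \<in> E j (l * r1)" shows "fs s (Q j z) = Q j (G j z)"
proof (rule fs_eq)
  have "Q j z = Q j (F j (G j z))" by simp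
  then show "stp s (Q j z) (Q j (G j z))" using assms G_E1 unfolding stp_def by blast
qed

lemma stp_total: assumes "x \<in> M" obtains y where "stp s x y"
proof -
  from cover[OF assms] obtain j z where j: "j \<in> I" "z \<in> E j r0" "x = Q j z" by blast
  show thesis
  proof (cases "sg j = s")
    case True then show thesis using that[of "Q j (F j z)"] j E_r1 unfolding stp_def by blast
  next
    case False
    have "G j z \<in> E j r1" using j E_r1 G_E1 by blast
    moreover have "x = Q j (F j (G j z))" using j by simp
    ultimately show thesis using that[of "Q j (G j z)"] j False unfolding stp_def by blast
  qed
qed

lemma stp_in: "stp s x y \<Longrightarrow> x \<in> M \<and> y \<in> M"
  unfolding stp_def using Q_in F_E1' by blast

lemma fs_stp: "x \<in> M \<Longrightarrow> stp s x (fs s x)"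
  using stp_total fs_eq by metis

lemma fs_in: "x \<in> M \<Longrightarrow> fs s x \<in> M"
  using fs_stp stp_in by blast

lemma fs_inv: "x \<in> M \<Longrightarrow> fs (\<not> s) (fs s x) = x"
  using fs_stp[of x s] stp_sym fs_eq by blast

lemma fs_inv': "x \<in> M \<Longrightarrow> s' \<noteq> s \<Longrightarrow> fs s' (fs s x) = x"
  using fs_inv[of x s] by (cases s; cases s') auto

lemma fsn_in: "x \<in> M \<Longrightarrow> (fs s ^^ n) x \<in> M"
  by (induction n) (auto simp: fs_in)

lemma fsn_inv: "x \<in> M \<Longrightarrow> s' \<noteq> s \<Longrightarrow> (fs s' ^^ n) ((fs s ^^ n) x) = x"
proof (induction n)
  case (Suc n)
  have "(fs s' ^^ Suc n) ((fs s ^^ Suc n) x) = (fs s' ^^ n) (fs s' (fs s ((fs s ^^ n) x)))"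
    by (simp add: funpow_swap1)
  then show ?case using Suc fs_inv' fsn_in by simp
qed simp

lemma fs_cont:
  assumes "x \<in> M" "e > 0" shows "\<exists>\<delta>>0. \<forall>y\<in>M. d x y < \<delta> \<longrightarrow> d (fs s x) (fs s y) < e"
proof -
  from cover[OF assms(1)] obtain j z where j: "j \<in> I" "z \<in> E j r0" "x = Q j z" by blast
  from Q_uc[OF j(1) assms(2)] obtain \<eta> where eta: "\<eta> > 0"
    "\<forall>z\<in>E j r1. \<forall>w\<in>E j r1. cmod (z - w) < \<eta> \<longrightarrow> d (Q j z) (Q j w) < e" by blast
  define L where "L = lipF + lipG"
  have L: "L > 0" "lipF \<le> L" "lipG \<le> L" using D.lipF_ge1 D.lipG_ge1 by (auto simp: L_def)
  \<comment> \<open>The bound \<open>r0 - l * r1\<close> keeps the lift of \<open>y\<close> in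
    \<open>E j (l * r1)\<close>, where the inverse step is given by \<open>G j\<close> in the same
    chart.\<close>
  define k where "k = min (\<eta> / L) (r0 - l * r1)"
  have k: "k > 0" "k \<le> \<eta> / L" "k \<le> r0 - l * r1" using eta L r_less by (auto simp: k_def)
  from Q_lift[OF j(1) k(1)] obtain \<alpha> where al: "\<alpha> > 0"
    "\<forall>z\<in>E j (l * r1). \<forall>y\<in>M. d (Q j z) y \<le> \<alpha> \<longrightarrow> (\<exists>w\<in>E j r1. cmod (z - w) < k \<and> Q j w = y)" by blast
  have "d (fs s x) (fs s y) < e" if y: "y \<in> M" "d x y < \<alpha>" for y
  proof -
    obtain w where w: "w \<in> E j r1" "cmod (z - w) < k" "Q j w = y" using al y j E_r1 by force
    have zw: "L * cmod (z - w) < \<eta>" 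
    proof -
      have "cmod (z - w) < \<eta> / L" using w k by linarith
      then show ?thesis using L by (simp add: less_divide_eq mult.commute)
    qed
    have w': "w \<in> E j (l * r1)" using D.E_near[OF j(2), of w k] w k by simp
    have z': "z \<in> E j (l * r1)" "z \<in> E j r1" using j E_r1(2,3)[THEN subsetD] by auto
    show ?thesis
    proof (cases "sg j = s")
      case True
      have "cmod (F j z - F j w) \<le> L * cmod (z - w)"
        by (rule order.trans[OF D.F_lip mult_right_mono[OF L(2) norm_ge_zero]])
      then have "cmod (F j z - F j w) < \<eta>" using zw by simp
      then have "d (Q j (F j z)) (Q j (F j w)) < e" using eta(2) F_E1'[OF w(1)] F_E1'[OF z'(2)] by blast
      then show ?thesis using fs_F[OF j(1) True w(1)] fs_F[OF j(1) True z'(2)] w(3) j(3) by simp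
    next
      case False
      have "cmod (G j z - G j w) \<le> L * cmod (z - w)"
        by (rule order.trans[OF D.G_lip mult_right_mono[OF L(3) norm_ge_zero]])
      then have "cmod (G j z - G j w) < \<eta>" using zw by simp
      then have "d (Q j (G j z)) (Q j (G j w)) < e" using eta(2) G_E1[OF w'] G_E1[OF z'(1)] by blast
      then show ?thesis using fs_G[OF j(1) False w'] fs_G[OF j(1) False z'(1)] w(3) j(3) by simp
    qed
  qed
  then show ?thesis using al by blast
qed

section \<open>Closeness of full orbits and the trapping regions\<close>

definition "ocl \<alpha> x y \<longleftrightarrow> (\<forall>s n. d ((fs s ^^ n) x) ((fs s ^^ n) y) \<le> \<alpha>)"

lemma ocl_step: assumes "x \<in> M" "y \<in> M" "ocl \<alpha> x y" shows "ocl \<alpha> (fs s x) (fs s y)"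
  unfolding ocl_def
proof (intro allI)
  fix s' n
  show "d ((fs s' ^^ n) (fs s x)) ((fs s' ^^ n) (fs s y)) \<le> \<alpha>"
  proof (cases "s' = s")
    case True
    then have "(fs s' ^^ n) (fs s u) = (fs s ^^ Suc n) u" for u by (simp add: funpow_swap1)
    then show ?thesis using assms(3)[unfolded ocl_def, rule_format, of "Suc n" s] by simp
  next
    case ne: False
    show ?thesis
    proof (cases n)
      case 0
      then have "(fs s' ^^ n) (fs s u) = (fs s ^^ 1) u" for u by simp
      then show ?thesis using assms(3)[unfolded ocl_def, rule_format, of 1 s] by simp
    next
      case (Suc m)
      then have "(fs s' ^^ n) (fs s u) = (fs s' ^^ m) u" if "u \<in> M" for u
        using fs_inv'[OF that ne] by (simp add: funpow_swap1)
      then show ?thesis using assms(1,2) assms(3)[unfolded ocl_def, rule_format, of m s'] by simp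
    qed
  qed
qed

lemma ocl_steps: "x \<in> M \<Longrightarrow> y \<in> M \<Longrightarrow> ocl \<alpha> x y \<Longrightarrow> ocl \<alpha> ((fs s ^^ n) x) ((fs s ^^ n) y)"
  by (induction n) (auto simp: ocl_step fsn_in)

lemma ocl_d: "ocl \<alpha> x y \<Longrightarrow> d ((fs s ^^ n) x) ((fs s ^^ n) y) \<le> \<alpha>" "ocl \<alpha> x y \<Longrightarrow> d x y \<le> \<alpha>"
  unfolding ocl_def by (metis funpow_0)+

text \<open>\<open>U True\<close> is a trapping region for the map and \<open>U False\<close> one
  for its inverse. The attractor consists of points whose backward orbit stays in
  \<open>U True\<close>, the repellers of points whose forward orbit stays in
  \<open>U False\<close>.\<close>

definition "U s = {Q j z |j z. j \<in> I \<and> sg j = s \<and> z \<in> E j r0}"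

lemma U_cover: "x \<in> M \<Longrightarrow> x \<in> U s \<or> x \<in> U (\<not> s)"
  using cover[of x] unfolding U_def by blast

lemma U_M: "x \<in> U s \<Longrightarrow> x \<in> M"
  unfolding U_def using Q_in E_r1 by blast

lemma U_forward: assumes "x \<in> U s" shows "fs s x \<in> U s"
proof -
  obtain j z where j: "j \<in> I" "sg j = s" "z \<in> E j r0" "x = Q j z" using assms by (auto simp: U_def)
  have "F j z \<in> E j r0" using D.F_E_self[of r0 z j] j r_pos r_less l1 mult_left_mono[of r0 r2 l] by simp
  moreover have "fs s x = Q j (F j z)" using fs_F j E_r1 by blast
  ultimately show ?thesis using j by (auto simp: U_def)
qed

section \<open>Dynamic balls have at most two points\<close>

lemma disc_const: obtains \<mu> :: real where "\<mu> > 0" "\<And>a. a \<in> \<Gamma> \<Longrightarrow> cmod a < \<mu> \<Longrightarrow> a = 0"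
  using disc by (metis linorder_not_less)

lemma lift_all:
  assumes "e > 0"
  obtains \<alpha> where "\<alpha> > 0" "\<And>j z y. j \<in> I \<Longrightarrow> z \<in> E j (l * r1) \<Longrightarrow> y \<in> M \<Longrightarrow> d (Q j z) y \<le> \<alpha> \<Longrightarrow>
    \<exists>w\<in>E j r1. cmod (z - w) < e \<and> Q j w = y"
proof -
  have "\<forall>j\<in>I. \<exists>\<alpha>>0. \<forall>z\<in>E j (l * r1). \<forall>y\<in>M. d (Q j z) y \<le> \<alpha> \<longrightarrow> (\<exists>w\<in>E j r1. cmod (z - w) < e \<and> Q j w = y)"
    using Q_lift assms by blast
  then obtain A where A: "\<forall>j\<in>I. A j > 0 \<and> (\<forall>z\<in>E j (l * r1). \<forall>y\<in>M. d (Q j z) y \<le> A j \<longrightarrow> (\<exists>w\<in>E j r1. cmod (z - w) < e \<and> Q j w = y))"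
    by metis
  define \<alpha> where "\<alpha> = Min (insert 1 (A ` I))"
  have "\<alpha> > 0" unfolding \<alpha>_def using A fin_I by (subst Min_gr_iff) auto
  moreover have "\<alpha> \<le> A j" if "j \<in> I" for j unfolding \<alpha>_def using fin_I that by (intro Min_le) auto
  ultimately show thesis using that A by (meson order_trans)
qed

lemma F_iter_E: "z \<in> E j r1 \<Longrightarrow> (F j ^^ n) z \<in> E j r1"
  by (induction n) (auto simp: F_E1')

lemma F_iter_Q: "j \<in> I \<Longrightarrow> sg j = s \<Longrightarrow> z \<in> E j r1 \<Longrightarrow> (fs s ^^ n) (Q j z) = Q j ((F j ^^ n) z)"
  by (induction n) (auto simp: fs_F F_iter_E)

lemma F_iter_E2: "z \<in> E j (l * r1) \<Longrightarrow> (F j ^^ n) z \<in> E j (l * r1)"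
proof (induction n)
  case (Suc n)
  then have "(F j ^^ n) z \<in> E j r1" using E_r1(1) by blast
  then show ?case using F_E1 by simp
qed simp

lemma F_iter_Re: "Re ((F j ^^ n) z) = l ^ n * Re z"
  by (induction n) auto

lemma power_unbounded: assumes "\<And>n. l ^ n * a \<le> b" "a \<ge> 0" shows "a = 0"
proof (rule ccontr)
  assume "a \<noteq> 0"
  then obtain n where "b / a < l ^ n" using real_arch_pow[OF l1] by blast
  then show False using assms(1)[of n] assms(2) \<open>a \<noteq> 0\<close> by (simp add: divide_less_eq)
qed

text \<open>The first lattice condition forbids that lifts jump by a period after one application of
  \<open>F\<close> or \<open>G\<close>; the second does so after a neck, where the inversion has
  Lipschitz constant \<open>r2 / r1\<close> on the ring. The other bounds keep perturbed points
  inside the chart domains, the rings and the range of \<open>contract\<close>.\<close>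

definition "tiny e \<longleftrightarrow> e > 0 \<and> (\<forall>a\<in>\<Gamma>. cmod a \<le> (lipF + lipG + 1) * e \<longrightarrow> a = 0) \<and>
  (\<forall>a\<in>\<Gamma>. cmod a \<le> (1 + r2 / r1) * e \<longrightarrow> a = 0) \<and> e \<le> (l\<^sup>2 - l) * r1 \<and> e \<le> r0 - l\<^sup>2 * r1 \<and> e \<le> \<rho> \<and> e \<le> r2 - r0"

lemma tiny_ex: obtains e where "tiny e"
proof -
  obtain \<mu> :: real where mu: "\<mu> > 0" "\<And>a. a \<in> \<Gamma> \<Longrightarrow> cmod a < \<mu> \<Longrightarrow> a = 0" using disc_const by blast
  define K where "K = lipF + lipG + 1"
  define K' where "K' = 1 + r2 / r1"
  have K: "K > 0" "K' > 0" using D.lipF_ge1 D.lipG_ge1 r_pos by (auto simp: K_def K'_def add_pos_pos)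
  define e where "e = Min {\<mu> / (2 * K), \<mu> / (2 * K'), (l\<^sup>2 - l) * r1, r0 - l\<^sup>2 * r1, \<rho>, r2 - r0}"
  have e: "e > 0" "e \<le> \<mu> / (2 * K)" "e \<le> \<mu> / (2 * K')" "e \<le> (l\<^sup>2 - l) * r1" "e \<le> r0 - l\<^sup>2 * r1" "e \<le> \<rho>" "e \<le> r2 - r0"
    using mu K pw r_pos r_less rho unfolding e_def by (auto simp del: min_le_iff_disj Min_insert intro!: Min_le)
  have "K * e < \<mu>" "K' * e < \<mu>" 
  proof -
    have "e < \<mu> / K" "e < \<mu> / K'" using e(2,3) K mu(1) by (auto simp: field_simps intro: le_less_trans)
    then show "K * e < \<mu>" "K' * e < \<mu>" using K by (auto simp: less_divide_eq mult.commute)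
  qed
  then have "tiny e" using e mu unfolding tiny_def K_def[symmetric] K'_def[symmetric] by (metis order_le_less_trans)
  then show thesis by (rule that)
qed

text \<open>The lift \<open>w\<close> supplied by \<open>lifting\<close> and the expected one
  \<open>b\<close> represent the same point, so they differ by a lattice vector, and this vector is
  too short to be nonzero.\<close>

lemma close_same:
  assumes "tiny e" "j \<in> I" "a \<in> E j r1" "b \<in> E j r1" "w \<in> E j r1" "cmod (a - w) < e" "Q j w = Q j b"
    "cmod (a - b) \<le> (lipF + lipG) * e"
  shows "cmod (a - b) < e"
proof -
  have "w - b \<in> \<Gamma>" using assms Q_same by blast
  moreover have "cmod (w - b) \<le> (lipF + lipG + 1) * e"
    using norm_triangle_ineq4[of "a - b" "a - w"] assms(6,8) by (simp add: algebra_simps)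
  ultimately have "w - b = 0" using assms(1) unfolding tiny_def by blast
  then show ?thesis using assms(6) by simp
qed

lemma lip_step:
  assumes "cmod (a - b) < e" shows "cmod (F j a - F j b) \<le> (lipF + lipG) * e" "cmod (G j a - G j b) \<le> (lipF + lipG) * e"
proof -
  have e: "e > 0" using assms by (smt (verit) norm_ge_zero)
  have "cmod (F j a - F j b) \<le> lipF * e"
    using D.F_lip[of j a b] assms D.lipF_ge1 by (smt (verit) mult_left_mono)
  then show "cmod (F j a - F j b) \<le> (lipF + lipG) * e" using D.lipG_ge1 e by (smt (verit) mult_right_mono)
  have "cmod (G j a - G j b) \<le> lipG * e"
    using D.G_lip[of j a b] assms D.lipG_ge1 by (smt (verit) mult_left_mono)
  then show "cmod (G j a - G j b) \<le> (lipF + lipG) * e" using D.lipF_ge1 e by (smt (verit) mult_right_mono)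
qed

definition "lifting e \<alpha> \<longleftrightarrow> (\<forall>j\<in>I. \<forall>z\<in>E j (l * r1). \<forall>y\<in>M. d (Q j z) y \<le> \<alpha> \<longrightarrow> (\<exists>w\<in>E j r1. cmod (z - w) < e \<and> Q j w = y))"

text \<open>In one step the chart distance may grow by a Lipschitz factor, but closeness on the
  surface restores the bound \<open>e\<close> through \<open>close_same\<close>. The difference of
  real parts is multiplied by \<open>l\<close> each time and stays bounded, so it is zero.\<close>

lemma shadow_forward:
  assumes f: "tiny e" and L: "lifting e \<alpha>" and j: "j \<in> I" "z \<in> E j (l * r1)" "w \<in> E j r1" "cmod (z - w) < e"
    and cl: "\<And>n. d ((fs (sg j) ^^ n) (Q j z)) ((fs (sg j) ^^ n) (Q j w)) \<le> \<alpha>"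
  shows "cmod ((F j ^^ n) z - (F j ^^ n) w) < e" "Re z = Re w"
proof -
  have z1: "z \<in> E j r1" using j E_r1(1) by blast
  have *: "cmod ((F j ^^ n) z - (F j ^^ n) w) < e" for n
  proof (induction n)
    case 0 then show ?case using j by simp
  next
    case (Suc n)
    let ?a = "(F j ^^ Suc n) z" and ?b = "(F j ^^ Suc n) w"
    have ab: "?a \<in> E j (l * r1)" "?a \<in> E j r1" "?b \<in> E j r1"
      using F_iter_E2[OF j(2)] F_iter_E[OF z1] F_iter_E[OF j(3)] by blast+
    have "d (Q j ?a) (Q j ?b) \<le> \<alpha>" using cl[of "Suc n"] F_iter_Q[OF j(1) refl z1] F_iter_Q[OF j(1) refl j(3)] by metis
    then obtain v where "v \<in> E j r1" "cmod (?a - v) < e" "Q j v = Q j ?b"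
      using L ab j Q_in unfolding lifting_def by meson
    then show ?case using close_same[OF f j(1) ab(2,3)] lip_step(1)[OF Suc] by simp
  qed
  then show "cmod ((F j ^^ n) z - (F j ^^ n) w) < e" .
  have "l ^ n * \<bar>Re z - Re w\<bar> \<le> e" for n
  proof -
    have "l ^ n * \<bar>Re z - Re w\<bar> = \<bar>Re ((F j ^^ n) z - (F j ^^ n) w)\<bar>"
      using l1 by (simp add: F_iter_Re abs_mult flip: right_diff_distrib)
    also have "\<dots> \<le> e" using abs_Re_le_cmod[of "(F j ^^ n) z - (F j ^^ n) w"] *[of n] by linarith
    finally show ?thesis .
  qed
  from power_unbounded[OF this] show "Re z = Re w" by simp
qed

text \<open>Near the hole a point escapes from every \<open>E j\<close> under backward iteration, so points that stay
  in the attractor forever avoid the box where the stable direction is not contracted.\<close>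
lemma stay_not_Box:
  assumes "\<And>n. (G j ^^ n) z \<in> E j r1" shows "z \<notin> da.Box \<rho> (H j)"
proof
  assume "z \<in> da.Box \<rho> (H j)"
  then obtain p where p: "p \<in> H j" "\<bar>Re (z - p)\<bar> \<le> \<rho>" "\<bar>Im (z - p)\<bar> \<le> \<rho>" by (auto simp: D.Box_def)
  have "l ^ n * r1 \<le> cmod (z - p)" for n
  proof -
    obtain q where q: "q \<in> H j" "(G j ^^ n) z - q = (z - p) / of_real (l ^ n)" using D.Box_back[OF p] by blast
    have "r1 \<le> cmod ((G j ^^ n) z - q)" using assms[of n] q(1) by (simp add: D.E_def)
    also have "\<dots> = cmod (z - p) / l ^ n" using l1 by (simp add: q(2) norm_divide norm_power)
    finally show ?thesis using l1 by (simp add: le_divide_eq mult.commute)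
  qed
  from power_unbounded[OF this] show False using r_pos by simp
qed

text \<open>Closeness in the direction \<open>s\<close> gives equal real parts. In the other
  direction both orbits remain in one chart and avoid the box, so by \<open>contract\<close> the
  vertical distance grows by \<open>l\<close> at every step although it never exceeds
  \<open>e\<close>.\<close>

lemma attractor_expansive:
  assumes f: "tiny e" and L: "lifting e \<alpha>" and x: "\<And>n. (fs (\<not> s) ^^ n) x \<in> U s"
    and y: "y \<in> M" "ocl \<alpha> x y"
  shows "x = y"
proof -
  have "x \<in> U s" using x[of 0] by simp
  then obtain j z where j: "j \<in> I" "sg j = s" "z \<in> E j r0" "x = Q j z" by (auto simp: U_def)
  have ns: "sg j \<noteq> (\<not> s)" using j by simp
  have zn: "(G j ^^ n) z \<in> E j r0 \<and> (fs (\<not> s) ^^ n) x = Q j ((G j ^^ n) z)" for n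
  proof (induction n)
    case 0 then show ?case using j by simp
  next
    case (Suc n)
    let ?a = "(G j ^^ n) z"
    have a1: "?a \<in> E j (l * r1)" "G j ?a \<in> E j r1" using Suc E_r1(3) G_E1 by blast+
    have eq: "(fs (\<not> s) ^^ Suc n) x = Q j (G j ?a)"
      using Suc fs_G[OF j(1) ns a1(1)] by simp
    have "Q j (G j ?a) \<in> U s" using x[of "Suc n"] eq by simp
    then obtain i w where i: "i \<in> I" "sg i = s" "w \<in> E i r0" "Q j (G j ?a) = Q i w" by (auto simp: U_def)
    have w1: "w \<in> E i r1" using i E_r1(2) by blast
    have "i = j"
    proof (rule ccontr)
      assume "i \<noteq> j"
      then show False using Q_diff'[OF j(1) i(1) _ a1(2) w1 i(4)] i(2) j(2) by (metis neck_def)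
    qed
    then have "G j ?a - w \<in> \<Gamma>" using Q_same[OF j(1) a1(2)] w1 i by metis
    then have "G j ?a \<in> E j r0" using D.E_Gam[of "G j ?a - w" w] i \<open>i = j\<close> by simp
    then show ?case using eq by simp
  qed
  have z2: "z \<in> E j (l * r1)" "z \<in> E j r1" using j E_r1(2,3) by blast+
  have "d (Q j z) y \<le> \<alpha>" using ocl_d(2)[OF y(2)] j by simp
  then obtain w where w: "w \<in> E j r1" "cmod (z - w) < e" "Q j w = y"
    using L z2 j y unfolding lifting_def by blast
  have re: "Re z = Re w"
    using shadow_forward(2)[OF f L j(1) z2(1) w(1,2)] ocl_d(1)[OF y(2)] w(3) j(2,4) by simp
  \<comment> \<open>The orbit of \<open>y\<close> is only known to be \<open>e\<close>-close to
    points of \<open>E j r0\<close>; this suffices for \<open>E j (l * r1)\<close>, the domain on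
    which \<open>G j\<close> describes the backward step.\<close>
  have wn: "(G j ^^ n) w \<in> E j (l * r1) \<and> (fs (\<not> s) ^^ n) y = Q j ((G j ^^ n) w) \<and> cmod ((G j ^^ n) z - (G j ^^ n) w) < e" for n
  proof (induction n)
    case 0
    have "w \<in> E j (l * r1)" using D.E_near[OF j(3), of w e] w(2) f r_less unfolding tiny_def by auto
    then show ?case using w by simp
  next
    case (Suc n)
    let ?a = "(G j ^^ n) z" and ?b = "(G j ^^ n) w"
    have eqb: "(fs (\<not> s) ^^ Suc n) y = Q j (G j ?b)" using Suc fs_G[OF j(1) ns] by simp
    have aE: "G j ?a \<in> E j r0" "G j ?a \<in> E j (l * r1)" "G j ?a \<in> E j r1" using zn[of "Suc n"] E_r1(2,3) by auto
    have bE: "G j ?b \<in> E j r1" using Suc G_E1 by blast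
    have "d (Q j (G j ?a)) (Q j (G j ?b)) \<le> \<alpha>"
      using ocl_d(1)[OF y(2), where n = "Suc n" and s = "\<not> s"] eqb zn[of "Suc n"] by simp
    then obtain v where "v \<in> E j r1" "cmod (G j ?a - v) < e" "Q j v = Q j (G j ?b)"
      using L aE bE j Q_in unfolding lifting_def by meson
    then have cl: "cmod (G j ?a - G j ?b) < e" using close_same[OF f j(1) aE(3) bE] lip_step(2)[of ?a ?b e j] Suc by simp
    have "G j ?b \<in> E j (l * r1)" using D.E_near[OF aE(1), of "G j ?b" e] cl f r_less unfolding tiny_def by auto
    then show ?case using eqb cl by simp
  qed
  have reG: "Re ((G j ^^ n) z) = Re ((G j ^^ n) w)" for n
  proof (induction n)
    case (Suc n)
    have "l * Re (G j u) = Re u" for u using D.F_simps(1)[of j "G j u"] by simp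
    then show ?case using Suc l1 by (metis comp_apply funpow.simps(2) mult_cancel_left not_one_less_zero)
  qed (simp add: re)
  have nB: "(G j ^^ n) z \<notin> da.Box \<rho> (H j)" "(G j ^^ n) w \<notin> da.Box \<rho> (H j)" for n
    using zn wn E_r1(1,2) by (intro stay_not_Box; metis (no_types, lifting) funpow_add o_apply subsetD)+
  have "l ^ n * \<bar>Im z - Im w\<bar> \<le> \<bar>Im ((G j ^^ n) z) - Im ((G j ^^ n) w)\<bar>" for n
  proof (induction n)
    case (Suc n)
    let ?a = "(G j ^^ Suc n) z" and ?b = "(G j ^^ Suc n) w"
    have "\<bar>Im ?a - Im ?b\<bar> \<le> \<rho>"
      using abs_Im_le_cmod[of "?a - ?b"] wn[of "Suc n"] f unfolding tiny_def by simp
    from D.contract[OF reG this nB] have "\<bar>Im (F j ?a) - Im (F j ?b)\<bar> \<le> \<bar>Im ?a - Im ?b\<bar> / l" .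
    then have "l * \<bar>Im ((G j ^^ n) z) - Im ((G j ^^ n) w)\<bar> \<le> \<bar>Im ?a - Im ?b\<bar>"
      using l1 by (simp add: le_divide_eq mult.commute)
    moreover have "l * (l ^ n * \<bar>Im z - Im w\<bar>) \<le> l * \<bar>Im ((G j ^^ n) z) - Im ((G j ^^ n) w)\<bar>"
      using Suc l1 by simp
    ultimately show ?case by simp
  qed simp
  moreover have "\<bar>Im ((G j ^^ n) z) - Im ((G j ^^ n) w)\<bar> \<le> e" for n
    using abs_Im_le_cmod[of "(G j ^^ n) z - (G j ^^ n) w"] wn[of n] by simp
  ultimately have "l ^ n * \<bar>Im z - Im w\<bar> \<le> e" for n by (meson order_trans)
  from power_unbounded[OF this] have "Im z = Im w" by simp
  then have "z = w" using re by (simp add: complex_eqI)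
  then show "x = y" using w j by simp
qed

text \<open>Such an \<open>x\<close> has lifts in two pieces of opposite sign. A point
  \<open>y\<close> of its dynamic ball has close lifts in both, and \<open>shadow_forward\<close>,
  applied once in each time direction, equates the real parts on either side of the neck. This
  leaves the solutions counted in \<open>neck_solutions\<close>.\<close>

lemma wandering_two:
  assumes f: "tiny e" and L: "lifting e \<alpha>" and x: "x \<in> U False" "fs True x \<in> U True"
  shows "finite {y\<in>M. ocl \<alpha> x y}" "card {y\<in>M. ocl \<alpha> x y} \<le> 2"
proof -
  have xM: "x \<in> M" using x U_M by blast
  obtain j z' where j: "j \<in> I" "sg j" "z' \<in> E j r0" "fs True x = Q j z'" using x(2) by (auto simp: U_def)
  obtain i w where i: "i \<in> I" "\<not> sg i" "w \<in> E i r0" "x = Q i w" using x(1) by (auto simp: U_def)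
  define z where "z = G j z'"
  \<comment> \<open>Going back one step from \<open>E j r0\<close> loses one factor
    \<open>l\<close>. The ratio \<open>l ^ 3\<close> of the radii leaves
    \<open>l\<^sup>2 * r1\<close>, still above the \<open>l * r1\<close> required for
    lifting.\<close>
  have "r0 = l * (l\<^sup>2 * r1)" using radii(3) by (simp add: power2_eq_square power3_eq_cube)
  then have zE: "z \<in> E j (l\<^sup>2 * r1)" unfolding z_def using D.G_E[of "l\<^sup>2 * r1" z' j] j r_pos r_less l1 by simp
  have zE': "z \<in> E j (l * r1)" "z \<in> E j r1" using zE r_less D.E_mono[of "l * r1" "l\<^sup>2 * r1" j] E_r1(1) by auto
  have xz: "x = Q j z"
  proof -
    have "x = fs False (fs True x)" using fs_inv[OF xM, of True] by simp
    also have "\<dots> = Q j z" unfolding j(4) z_def using fs_G[of j False z'] j E_r1(3) by blast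
    finally show ?thesis .
  qed
  have w1: "w \<in> E i r1" "w \<in> E i (l * r1)" using i E_r1(2,3) by blast+
  have ji: "j \<noteq> i" using i j by auto
  from Q_diff'[OF j(1) i(1) ji zE'(2) w1(1)] xz i(4) 
  obtain p q C where nk: "neck j p i q C" and zp: "cmod (z - p) \<le> r2" by metis
  note N = neck_Gam[OF nk zE'(2) zp w1(1), folded xz i(4), OF refl]
  have pq: "p \<in> H j" "q \<in> H i" "cmod C = r1 * r2" "Im C \<noteq> 0" using nk by (auto simp: neck_def)
  \<comment> \<open>The given lift \<open>w\<close> matches the inverted coordinate of
    \<open>z\<close> only up to a period; its translate \<open>w0\<close> matches exactly.\<close>
  define w0 where "w0 = q + C / (z - p)"
  have w0E: "w0 \<in> E i r0"
    using i(3) D.E_Gam[OF N(1), of w0 i r0] by (simp add: w0_def algebra_simps)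
  have w0E': "w0 \<in> E i (l * r1)" "w0 \<in> E i r1" using w0E E_r1(2,3) by blast+
  have "w - w0 \<in> \<Gamma>" using N(1) by (simp add: w0_def)
  then have xw0: "x = Q i w0" using Q_same[OF i(1) w1(1) w0E'(2)] i(4) by simp
  have "r0 \<le> cmod (w0 - q)" using w0E pq by (simp add: D.E_def)
  then have "r0 \<le> r1 * r2 / cmod (z - p)" by (simp add: w0_def norm_divide pq)
  then have zp0: "cmod (z - p) \<le> r0" using N(5) r_pos r0_sq by (simp add: le_divide_eq)
  let ?S = "{v. v \<noteq> 0 \<and> Re v = Re (z - p) \<and> Re (C / v) = Re (C / (z - p))}"
  have sub: "{y\<in>M. ocl \<alpha> x y} \<subseteq> (\<lambda>v. Q j (p + v)) ` ?S"
  proof safe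
    fix y assume y: "y \<in> M" "ocl \<alpha> x y"
    have "d (Q j z) y \<le> \<alpha>" "d (Q i w0) y \<le> \<alpha>" using ocl_d(2)[OF y(2)] xz xw0 by simp_all
    then have "\<exists>a\<in>E j r1. cmod (z - a) < e \<and> Q j a = y" "\<exists>b\<in>E i r1. cmod (w0 - b) < e \<and> Q i b = y"
      using L zE'(1) w0E'(1) j(1) i(1) y(1) unfolding lifting_def by blast+
    then obtain a b where a: "a \<in> E j r1" "cmod (z - a) < e" "Q j a = y" and b: "b \<in> E i r1" "cmod (w0 - b) < e" "Q i b = y"
      by blast
    have "d ((fs (sg j) ^^ n) (Q j z)) ((fs (sg j) ^^ n) (Q j a)) \<le> \<alpha>" 
      "d ((fs (sg i) ^^ n) (Q i w0)) ((fs (sg i) ^^ n) (Q i b)) \<le> \<alpha>" for n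
      using ocl_d(1)[OF y(2)] xz xw0 a b by simp_all
    then have re: "Re z = Re a" "Re w0 = Re b"
      using shadow_forward(2)[OF f L j(1) zE'(1) a(1,2)] shadow_forward(2)[OF f L i(1) w0E'(1) b(1,2)] by blast+
    have ap: "cmod (a - p) \<le> r2"
      using norm_triangle_ineq4[of "z - p" "z - a"] zp0 a(2) f unfolding tiny_def by simp
    note Na = neck_Gam[OF nk a(1) ap b(1), unfolded a b, OF refl]
    define c where "c = q + C / (a - p)"
    \<comment> \<open>Lipschitz estimate for the inversion on the ring. It shows that
      \<open>b\<close> and \<open>c\<close> differ by a short lattice vector, hence are equal and
      not merely congruent.\<close>
    have "cmod (w0 - c) = cmod (C * (a - z) / ((z - p) * (a - p)))"
      using N(5) Na(5) by (simp add: w0_def c_def divide_simps algebra_simps)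
    also have "\<dots> = (r1 * r2) * cmod (z - a) / (cmod (z - p) * cmod (a - p))"
      by (simp add: norm_mult norm_divide pq norm_minus_commute)
    also have "\<dots> \<le> (r1 * r2) * e / (r1 * r1)"
      using N(2) Na(2) a(2) r_pos f by (intro frac_le mult_left_mono mult_mono mult_pos_pos) (auto simp: tiny_def)
    also have "\<dots> = r2 / r1 * e" using r_pos by simp
    finally have "cmod (b - c) \<le> (1 + r2 / r1) * e"
      using norm_triangle_ineq4[of "w0 - c" "w0 - b"] b(2) by (simp add: algebra_simps)
    moreover have "b - c \<in> \<Gamma>" using Na(1) by (simp add: c_def)
    ultimately have "b = c" using f unfolding tiny_def by auto
    then have "a - p \<in> ?S" using re Na(5) by (simp add: c_def w0_def)
    then show "y \<in> (\<lambda>v. Q j (p + v)) ` ?S" using a(3) by (intro image_eqI[of _ _ "a - p"]) auto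
  qed
  have fin: "finite ?S" "card ?S \<le> 2" using neck_solutions[OF pq(4)] by blast+
  show "finite {y\<in>M. ocl \<alpha> x y}" using sub fin finite_surj by blast
  have "card {y\<in>M. ocl \<alpha> x y} \<le> card ?S" using sub fin surj_card_le by blast
  then show "card {y\<in>M. ocl \<alpha> x y} \<le> 2" using fin by simp
qed

text \<open>An orbit either stays on one side in the relevant time direction or contains a point
  that crosses from \<open>U False\<close> to \<open>U True\<close>. In the second case an iterate
  maps the dynamic ball injectively into that of the crossing point, with the same \<alpha>.\<close>

lemma two_expansive:
  obtains \<alpha> where "\<alpha> > 0" "\<And>x. x \<in> M \<Longrightarrow> finite {y\<in>M. ocl \<alpha> x y} \<and> card {y\<in>M. ocl \<alpha> x y} \<le> 2"
proof -
  obtain e where e: "tiny e" by (rule tiny_ex)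
  then have "e > 0" by (simp add: tiny_def)
  then obtain \<alpha> where al: "\<alpha> > 0" "lifting e \<alpha>" unfolding lifting_def by (rule lift_all) blast
  have "finite {y\<in>M. ocl \<alpha> x y} \<and> card {y\<in>M. ocl \<alpha> x y} \<le> 2" if x: "x \<in> M" for x
  proof (cases "\<exists>s. \<forall>n. (fs (\<not> s) ^^ n) x \<in> U s")
    case True
    then obtain s where "\<And>n. (fs (\<not> s) ^^ n) x \<in> U s" by blast
    from attractor_expansive[OF e al(2) this] have "{y\<in>M. ocl \<alpha> x y} \<subseteq> {x}" by blast
    then have "finite {y\<in>M. ocl \<alpha> x y}" "card {y\<in>M. ocl \<alpha> x y} \<le> card {x}"
      using finite_subset[of _ "{x}"] card_mono[of "{x}"] by auto
    then show ?thesis by simp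
  next
    case False
    then obtain n m where n: "(fs False ^^ n) x \<notin> U True" and m: "(fs True ^^ m) x \<notin> U False" by (metis (full_types))
    define x0 where "x0 = (fs False ^^ n) x"
    have x0: "x0 \<in> M" "x0 \<in> U False" using n U_cover[of x0 True] fsn_in[OF x] by (auto simp: x0_def)
    have xback: "(fs True ^^ n) x0 = x" unfolding x0_def using fsn_inv[OF x, of True False] by simp
    have "(fs True ^^ m) x \<in> U True" using m U_cover[of "(fs True ^^ m) x" False] fsn_in[OF x] by auto
    then have "(fs True ^^ (m + n)) x0 \<in> U True" using xback by (simp add: funpow_add)
    then have ex: "\<exists>k. (fs True ^^ k) x0 \<in> U True" by blast
    define k where "k = (LEAST k. (fs True ^^ k) x0 \<in> U True)"
    have k: "(fs True ^^ k) x0 \<in> U True" "\<And>k'. k' < k \<Longrightarrow> (fs True ^^ k') x0 \<notin> U True"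
      using LeastI_ex[OF ex] not_less_Least by (auto simp: k_def)
    \<comment> \<open>For \<open>k = 0\<close> the subtraction of naturals gives
      \<open>x1 = x0\<close>; this point lies in both regions, and its image is in
      \<open>U True\<close> by forward invariance.\<close>
    define x1 where "x1 = (fs True ^^ (k - 1)) x0"
    have x1: "x1 \<in> U False \<and> fs True x1 \<in> U True"
    proof (cases k)
      case 0
      then have "x1 = x0" "x0 \<in> U True" using k by (auto simp: x1_def)
      then show ?thesis using x0 U_forward by auto
    next
      case (Suc k')
      then have "x1 \<notin> U True" "fs True x1 = (fs True ^^ k) x0" using k(2)[of k'] by (auto simp: x1_def)
      then show ?thesis using k(1) U_cover[of x1 True] fsn_in[OF x0(1)] by (auto simp: x1_def)
    qed
    define h where "h = (\<lambda>u. (fs True ^^ (k - 1)) ((fs False ^^ n) u))"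
    have hx: "h x = x1" by (simp add: h_def x1_def x0_def)
    have "h ` {y\<in>M. ocl \<alpha> x y} \<subseteq> {y\<in>M. ocl \<alpha> x1 y}"
      unfolding hx[symmetric] h_def using fsn_in ocl_steps x by auto
    moreover have "inj_on h {y\<in>M. ocl \<alpha> x y}"
    proof (rule inj_on_inverseI)
      fix u assume "u \<in> {y\<in>M. ocl \<alpha> x y}"
      then have "u \<in> M" by simp
      then show "(fs True ^^ n) ((fs False ^^ (k - 1)) (h u)) = u"
        unfolding h_def using fsn_inv[of _ True False] fsn_inv[of _ False True] fsn_in by simp
    qed
    moreover have two: "finite {y\<in>M. ocl \<alpha> x1 y}" "card {y\<in>M. ocl \<alpha> x1 y} \<le> 2"
      using wandering_two[OF e al(2)] x1 by blast+
    ultimately have "finite {y\<in>M. ocl \<alpha> x y}" "card {y\<in>M. ocl \<alpha> x y} \<le> card {y\<in>M. ocl \<alpha> x1 y}"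
      using inj_on_finite card_inj_on_le by blast+
    then show ?thesis using two by simp
  qed
  then show thesis using that al by blast
qed

end

text \<open>With \<open>\<gamma> = Re C / Im C\<close>, the points \<open>A + i (m \<plusminus> \<epsilon>)\<close> with \<open>\<epsilon>\<^sup>2 = m\<^sup>2 + 2 \<gamma> m A - A\<^sup>2\<close> have the same
  neck coordinates, and \<open>\<epsilon>\<close> tends to 0 when \<open>m\<close> tends to the positive root of the right-hand side.\<close>
lemma neck_pairs:
  assumes C: "Im C \<noteq> 0" and r: "r > 0"
  obtains a where "a > 0" "\<And>\<delta>. \<delta> > 0 \<Longrightarrow> \<exists>v w. v \<noteq> w \<and> Re v = Re w \<and> Re (C / v) = Re (C / w) \<and>
    a \<le> \<bar>Re v\<bar> \<and> a \<le> \<bar>Re (C / v)\<bar> \<and> cmod (v - w) < \<delta> \<and> \<bar>cmod v - r\<bar> < \<delta> \<and> \<bar>cmod w - r\<bar> < \<delta>"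
proof -
  define \<gamma> where "\<gamma> = Re C / Im C"
  \<comment> \<open>The positive solution of \<open>t * t + 2 * \<gamma> * t = 1\<close>:
    \<open>h\<close> vanishes at \<open>m0 = A * t\<close>, and \<open>A\<close> is scaled so that
    the limit point lies on the circle of radius \<open>r\<close>.\<close>
  define t where "t = sqrt (\<gamma>\<^sup>2 + 1) - \<gamma>"
  have t: "t > 0" unfolding t_def using real_less_rsqrt[of \<gamma> "\<gamma>\<^sup>2 + 1"] by simp
  define A where "A = r / sqrt (1 + t\<^sup>2)"
  have st: "sqrt (1 + t\<^sup>2) > 0" by (simp add: add_pos_nonneg)
  have A: "A > 0" using r st by (simp add: A_def)
  define m0 where "m0 = A * t"
  have m0: "m0 > 0" using A t by (simp add: m0_def)
  have nr: "cmod (Complex A m0) = r"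
  proof -
    have "cmod (Complex A m0) = sqrt (A\<^sup>2 * (1 + t\<^sup>2))" by (simp add: cmod_def m0_def algebra_simps power_mult_distrib)
    also have "\<dots> = A * sqrt (1 + t\<^sup>2)" using A by (simp add: real_sqrt_mult)
    also have "\<dots> = r" using st by (simp add: A_def)
    finally show ?thesis .
  qed
  define h where "h m = m\<^sup>2 + 2 * \<gamma> * m * A - A\<^sup>2" for m
  have "sqrt (\<gamma>\<^sup>2 + 1) * sqrt (\<gamma>\<^sup>2 + 1) = \<gamma> * \<gamma> + 1" by (simp add: power2_eq_square)
  then have tt: "t * t + 2 * \<gamma> * t = 1" by (simp add: t_def algebra_simps)
  have "h m0 = A * A * (t * t + 2 * \<gamma> * t - 1)" unfolding h_def m0_def by (simp add: power2_eq_square algebra_simps)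
  then have h0: "h m0 = 0" using tt by simp
  have hf: "h m = (m - m0) * (m + m0 + 2 * \<gamma> * A)" for m
    using h0 unfolding h_def by (simp add: algebra_simps power2_eq_square)
  have m0A: "m0 + \<gamma> * A > 0"
  proof -
    have "m0 + \<gamma> * A = A * sqrt (\<gamma>\<^sup>2 + 1)" by (simp add: m0_def t_def algebra_simps)
    then show ?thesis using A by (simp add: add_nonneg_pos)
  qed
  have hpos: "h m > 0" if "m > m0" for m
    unfolding hf using that m0A by (intro mult_pos_pos) auto
  \<comment> \<open>A lower bound for both real parts that does not depend on \<delta>: keeping
    \<open>m\<close> below \<open>2 * m0\<close> keeps \<open>Im C / (2 * m)\<close> away from
    0.\<close>
  define a where "a = min A (\<bar>Im C\<bar> / (4 * m0))"
  show thesis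
  proof (rule that)
    show "a > 0" using A C m0 by (simp add: a_def)
    fix \<delta> :: real assume \<delta>: "\<delta> > 0"
    have "((\<lambda>m. sqrt (h m)) \<longlongrightarrow> sqrt (h m0)) (at_right m0)"
      unfolding h_def by (intro tendsto_intros) 
    then have "\<forall>\<^sub>F m in at_right m0. dist (sqrt (h m)) (sqrt (h m0)) < \<delta> / 4"
      using \<delta> by (intro tendstoD) auto
    moreover have "\<forall>\<^sub>F m in at_right m0. m \<in> {m0<..<m0 + min (\<delta> / 4) m0}"
      using \<delta> m0 by (intro eventually_at_right_real) simp
    ultimately have "\<forall>\<^sub>F m in at_right m0. dist (sqrt (h m)) (sqrt (h m0)) < \<delta> / 4 \<and> m \<in> {m0<..<m0 + min (\<delta> / 4) m0}"
      by (rule eventually_conj)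
    then obtain m where m: "dist (sqrt (h m)) (sqrt (h m0)) < \<delta> / 4" "m0 < m" "m < m0 + \<delta> / 4" "m < 2 * m0"
      using eventually_happens'[OF trivial_limit_at_right_real] by force
    define \<epsilon> where "\<epsilon> = sqrt (h m)"
    have e: "\<epsilon> > 0" "\<epsilon> < \<delta> / 4" "\<epsilon>\<^sup>2 = h m"
      using m hpos[OF m(2)] by (auto simp: \<epsilon>_def h0 dist_real_def)
    define v where "v = Complex A (m + \<epsilon>)"
    define w where "w = Complex A (m - \<epsilon>)"
    have key: "Re (C / Complex A (m + s)) = Im C / (2 * m)" if "s\<^sup>2 = h m" for s
    proof -
      have sq: "A\<^sup>2 + (m + s)\<^sup>2 = 2 * m * (m + s + \<gamma> * A)"
        using that by (simp add: h_def power2_eq_square algebra_simps)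
      have "A\<^sup>2 + (m + s)\<^sup>2 > 0" using A by (simp add: add_pos_nonneg)
      then have nz: "m + s + \<gamma> * A \<noteq> 0" unfolding sq by auto
      have "Re (C / Complex A (m + s)) = (Re C * A + Im C * (m + s)) / (A\<^sup>2 + (m + s)\<^sup>2)"
        by (simp add: Re_divide)
      also have "Re C * A + Im C * (m + s) = Im C * (m + s + \<gamma> * A)"
        using C by (simp add: \<gamma>_def algebra_simps)
      also have "\<dots> / (A\<^sup>2 + (m + s)\<^sup>2) = Im C / (2 * m)" unfolding sq using nz by simp
      finally show ?thesis .
    qed
    have kv: "Re (C / v) = Im C / (2 * m)" using key[of \<epsilon>] e by (simp add: v_def)
    have kw: "Re (C / w) = Im C / (2 * m)" using key[of "- \<epsilon>"] e by (simp add: w_def)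
    have "\<bar>Im C\<bar> / (4 * m0) \<le> \<bar>Im C\<bar> / (2 * m)" using m m0 by (intro divide_left_mono) auto
    then have "a \<le> \<bar>Re (C / v)\<bar>" using m m0 by (simp add: kv a_def abs_divide)
    moreover have near: "\<bar>cmod (Complex A (m + s)) - r\<bar> < \<delta>" if "\<bar>s\<bar> = \<epsilon>" for s
    proof -
      have "\<bar>cmod (Complex A (m + s)) - cmod (Complex A m0)\<bar> \<le> cmod (Complex A (m + s) - Complex A m0)"
        by (rule norm_triangle_ineq3)
      also have "\<dots> = \<bar>m + s - m0\<bar>" by (simp add: cmod_def)
      also have "\<dots> < \<delta>" using m e that by linarith
      finally show ?thesis using nr by simp
    qed
    moreover have "cmod (v - w) = 2 * \<epsilon>" using e(1) by (simp add: v_def w_def cmod_def real_sqrt_mult)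
    moreover have "v \<noteq> w" using e by (simp add: v_def w_def)
    moreover have "\<bar>cmod v - r\<bar> < \<delta>" "\<bar>cmod w - r\<bar> < \<delta>" using near[of \<epsilon>] near[of "-\<epsilon>"] e by (auto simp: v_def w_def)
    ultimately show "\<exists>v w. v \<noteq> w \<and> Re v = Re w \<and> Re (C / v) = Re (C / w) \<and>
      a \<le> \<bar>Re v\<bar> \<and> a \<le> \<bar>Re (C / v)\<bar> \<and> cmod (v - w) < \<delta> \<and> \<bar>cmod v - r\<bar> < \<delta> \<and> \<bar>cmod w - r\<bar> < \<delta>"
      using e kv kw A by (intro exI[of _ v] exI[of _ w]) (auto simp: v_def w_def a_def)
  qed
qed

section \<open>Arbitrarily close pairs that are never separated\<close>

context necks
begin

text \<open>The real part grows by \<open>l\<close> per step, so after a number \<open>N\<close> of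
  steps that depends only on \<open>a\<close> both orbits are out of the box for good. Until then
  distances grow at most by \<open>lipF ^ N\<close>; afterwards they do not grow, since the
  difference is purely vertical.\<close>

lemma escape:
  assumes p: "p \<in> H j" and a: "a > 0"
  obtains K where "K \<ge> 1" "\<And>v w n. Re v = Re w \<Longrightarrow> a \<le> \<bar>Re v\<bar> \<Longrightarrow> cmod v \<le> \<rho> \<Longrightarrow> cmod w \<le> \<rho> \<Longrightarrow>
    K * cmod (v - w) \<le> \<rho> \<Longrightarrow> cmod ((F j ^^ n) (p + v) - (F j ^^ n) (p + w)) \<le> K * cmod (v - w)"
proof -
  obtain N where N: "\<rho> / a < l ^ N" using real_arch_pow[OF l1] by blast
  define K where "K = lipF ^ N"
  have esc: "(F j ^^ N) (p + v) \<notin> da.Box \<rho> (H j)" if v: "a \<le> \<bar>Re v\<bar>" "cmod v \<le> \<rho>" for v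
  proof
    assume "(F j ^^ N) (p + v) \<in> da.Box \<rho> (H j)"
    then obtain q where q: "q \<in> H j" "\<bar>Re ((F j ^^ N) (p + v) - q)\<bar> \<le> \<rho>" "\<bar>Im ((F j ^^ N) (p + v) - q)\<bar> \<le> \<rho>"
      by (auto simp: D.Box_def)
    have GF: "(G j ^^ n) ((F j ^^ n) u) = u" for n u
    proof (induction n arbitrary: u)
      case (Suc n)
      have "(G j ^^ Suc n) ((F j ^^ Suc n) u) = (G j ^^ n) (G j (F j ((F j ^^ n) u)))" by (simp add: funpow_swap1)
      then show ?case using Suc by simp
    qed simp
    obtain q' where q': "q' \<in> H j" "p + v - q' = ((F j ^^ N) (p + v) - q) / of_real (l ^ N)"
      using D.Box_back[OF q, of N] GF by auto
    have lN: "1 \<le> l ^ N" using l1 by simp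
    have re: "\<bar>Re (p + v - q')\<bar> \<le> \<rho> / l ^ N" "\<bar>Im (p + v - q')\<bar> \<le> \<rho> / l ^ N"
      unfolding q'(2) Re_divide_of_real Im_divide_of_real using q lN by (auto simp: abs_divide intro!: divide_right_mono)
    moreover have "\<rho> / l ^ N \<le> \<rho>" using lN rho by (simp add: divide_le_eq mult_le_cancel_left1)
    ultimately have "cmod (p + v - q') \<le> 2 * \<rho>" using cmod_le[of "p + v - q'"] by linarith
    then have "cmod (p - q') \<le> 3 * \<rho>" using norm_triangle_ineq4[of "p + v - q'" v] v by simp
    moreover have "3 * \<rho> < 2 * D.rad" using D.ext_gt rho unfolding D.rad_def by simp
    \<comment> \<open>Pulled back by \<open>N\<close> steps, the capturing hole is too close to
      \<open>p\<close> to be another one; but then the real part of \<open>v\<close> would be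
      smaller than \<open>a\<close>.\<close>
    ultimately have "q' = p" using D.H_sep[of p j q'] p q' by fastforce
    then have "a \<le> \<rho> / l ^ N" using re v by simp
    then show False using N a lN by (simp add: divide_less_eq le_divide_eq mult.commute)
  qed
  show thesis
  proof (rule that)
    show "K \<ge> 1" using D.lipF_ge1 by (simp add: K_def)
    fix v w n
    assume vw: "Re v = Re w" "a \<le> \<bar>Re v\<bar>" "cmod v \<le> \<rho>" "cmod w \<le> \<rho>" "K * cmod (v - w) \<le> \<rho>"
    let ?D = "\<lambda>n. cmod ((F j ^^ n) (p + v) - (F j ^^ n) (p + w))"
    have lip: "?D n \<le> lipF ^ n * cmod (v - w)" for n
    proof (induction n)
      case (Suc n)
      have "?D (Suc n) \<le> lipF * ?D n" using D.F_lip by simp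
      also have "\<dots> \<le> lipF * (lipF ^ n * cmod (v - w))" using Suc D.lipF_ge1 by (intro mult_left_mono) auto
      finally show ?case by simp
    qed simp
    have notB: "(F j ^^ (N + n)) (p + v) \<notin> da.Box \<rho> (H j) \<and> (F j ^^ (N + n)) (p + w) \<notin> da.Box \<rho> (H j)" for n
      using esc[of v] esc[of w] vw D.F_Box by (induction n) auto
    have reD: "Re ((F j ^^ n) (p + v)) = Re ((F j ^^ n) (p + w))" for n
      using vw by (simp add: F_iter_Re)
    have Dim: "?D n = \<bar>Im ((F j ^^ n) (p + v)) - Im ((F j ^^ n) (p + w))\<bar>" for n
      using reD[of n] by (simp add: cmod_def)
    have big: "?D (N + n) \<le> K * cmod (v - w)" for n
    proof (induction n)
      case 0 then show ?case using lip[of N] by (simp add: K_def)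
    next
      case (Suc n)
      then have "\<bar>Im ((F j ^^ (N + n)) (p + v)) - Im ((F j ^^ (N + n)) (p + w))\<bar> \<le> \<rho>" using Dim[of "N + n"] vw by simp
      from D.contract[OF reD this] notB[of n]
      have "?D (N + Suc n) \<le> ?D (N + n) / l" unfolding Dim by simp
      also have "\<dots> \<le> ?D (N + n)" using l1 by (simp add: divide_le_eq mult_le_cancel_left1)
      finally show ?case using Suc by simp
    qed
    show "?D n \<le> K * cmod (v - w)"
    proof (cases "n \<le> N")
      case True
      then have "lipF ^ n * cmod (v - w) \<le> K * cmod (v - w)"
        unfolding K_def using D.lipF_ge1 by (intro mult_right_mono power_increasing) auto
      then show ?thesis using lip[of n] by simp
    next
      case False then show ?thesis using big[of "n - N"] by simp
    qed
  qed
qed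

text \<open>A pair from \<open>neck_pairs\<close> near the middle circle stays close forwards by
  \<open>escape\<close> in the piece \<open>j\<close>, and backwards by \<open>escape\<close> in the
  piece across the neck, where its coordinates are inverted.\<close>

lemma not_expansive_pair:
  assumes "\<alpha> > 0" obtains x y where "x \<in> M" "y \<in> M" "x \<noteq> y" "ocl \<alpha> x y"
proof -
  obtain j p where j: "j \<in> I" "sg j" "p \<in> H j" using hole by blast
  obtain i q C where nk: "neck j p i q C"
    using neck_ex[OF j(1,3)] j unfolding neck_def by blast
  then have i: "i \<in> I" "\<not> sg i" "q \<in> H i" and C: "Im C \<noteq> 0" "cmod C = r1 * r2"
    and Q: "\<And>v. r1 \<le> cmod v \<Longrightarrow> cmod v \<le> r2 \<Longrightarrow> Q j (p + v) = Q i (q + C / v)"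
    using j by (auto simp: neck_def)
  obtain a where a: "a > 0" "\<And>\<delta>. \<delta> > 0 \<Longrightarrow> \<exists>v w. v \<noteq> w \<and> Re v = Re w \<and> Re (C / v) = Re (C / w) \<and>
    a \<le> \<bar>Re v\<bar> \<and> a \<le> \<bar>Re (C / v)\<bar> \<and> cmod (v - w) < \<delta> \<and> \<bar>cmod v - r0\<bar> < \<delta> \<and> \<bar>cmod w - r0\<bar> < \<delta>"
    using neck_pairs[OF C(1) r_pos(2)] by blast
  obtain \<eta> where eta: "\<eta> > 0" "\<And>z w. z \<in> E j r1 \<Longrightarrow> w \<in> E j r1 \<Longrightarrow> cmod (z - w) < \<eta> \<Longrightarrow> d (Q j z) (Q j w) < \<alpha>"
    using Q_uc[OF j(1) assms] by blast
  obtain \<eta>' where eta': "\<eta>' > 0" "\<And>z w. z \<in> E i r1 \<Longrightarrow> w \<in> E i r1 \<Longrightarrow> cmod (z - w) < \<eta>' \<Longrightarrow> d (Q i z) (Q i w) < \<alpha>"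
    using Q_uc[OF i(1) assms] by blast
  obtain K where K: "K \<ge> 1" "\<And>v w n. Re v = Re w \<Longrightarrow> a \<le> \<bar>Re v\<bar> \<Longrightarrow> cmod v \<le> \<rho> \<Longrightarrow> cmod w \<le> \<rho> \<Longrightarrow>
    K * cmod (v - w) \<le> \<rho> \<Longrightarrow> cmod ((F j ^^ n) (p + v) - (F j ^^ n) (p + w)) \<le> K * cmod (v - w)"
    using escape[OF j(3) a(1)] by blast
  obtain K' where K': "K' \<ge> 1" "\<And>v w n. Re v = Re w \<Longrightarrow> a \<le> \<bar>Re v\<bar> \<Longrightarrow> cmod v \<le> \<rho> \<Longrightarrow> cmod w \<le> \<rho> \<Longrightarrow>
    K' * cmod (v - w) \<le> \<rho> \<Longrightarrow> cmod ((F i ^^ n) (q + v) - (F i ^^ n) (q + w)) \<le> K' * cmod (v - w)"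
    using escape[OF i(3) a(1)] by blast
  obtain \<mu> :: real where mu: "\<mu> > 0" "\<And>b. b \<in> \<Gamma> \<Longrightarrow> cmod b < \<mu> \<Longrightarrow> b = 0" using disc_const by blast
  define s where "s = r2 / r1"
  have s: "s > 0" using r_pos by (simp add: s_def)
  \<comment> \<open>The terms with \<open>K\<close> control the forward orbits; those with
    \<open>K' * s\<close> control the backward ones, \<open>s\<close> being the Lipschitz constant
    of the inversion. The term \<mu> prevents the two points from being congruent, and the last two
    keep both in the ring.\<close>
  define \<delta> where "\<delta> = Min {\<eta> / K, \<rho> / K, \<eta>' / (K' * s), \<rho> / (K' * s), \<mu>, r0 - r1, r2 - r0}"
  have d: "\<delta> > 0" "\<delta> \<le> \<eta> / K" "\<delta> \<le> \<rho> / K" "\<delta> \<le> \<eta>' / (K' * s)" "\<delta> \<le> \<rho> / (K' * s)" "\<delta> \<le> \<mu>" "\<delta> \<le> r0 - r1" "\<delta> \<le> r2 - r0"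
    using eta(1) eta'(1) K(1) K'(1) mu(1) rho r_less s unfolding \<delta>_def
    by (auto simp del: min_le_iff_disj Min_insert intro!: Min_le)
  obtain v w where vw: "v \<noteq> w" "Re v = Re w" "Re (C / v) = Re (C / w)" "a \<le> \<bar>Re v\<bar>" "a \<le> \<bar>Re (C / v)\<bar>"
    "cmod (v - w) < \<delta>" "\<bar>cmod v - r0\<bar> < \<delta>" "\<bar>cmod w - r0\<bar> < \<delta>" using a(2)[OF d(1)] by blast
  have rv: "r1 \<le> cmod v" "cmod v \<le> r2" "r1 \<le> cmod w" "cmod w \<le> r2" using vw(7,8) d(7,8) by linarith+
  have inv: "r1 \<le> cmod (C / u)" "cmod (C / u) \<le> r2" if "r1 \<le> cmod u" "cmod u \<le> r2" for u
  proof -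
    have "cmod u > 0" using that r_pos by linarith
    then show "r1 \<le> cmod (C / u)" "cmod (C / u) \<le> r2" using that r_pos C
      by (auto simp: norm_divide le_divide_eq divide_le_eq mult.commute mult_left_mono)
  qed
  have vw0: "v \<noteq> 0" "w \<noteq> 0" using rv r_pos by auto
  have "cmod (C / v - C / w) = cmod (C * (w - v) / (v * w))" using vw0 by (simp add: divide_simps algebra_simps)
  also have "\<dots> = r1 * r2 * cmod (v - w) / (cmod v * cmod w)" by (simp add: norm_divide norm_mult C norm_minus_commute)
  also have "\<dots> \<le> r1 * r2 * cmod (v - w) / (r1 * r1)"
    using rv r_pos by (intro divide_left_mono mult_mono mult_pos_pos) (auto intro: less_le_trans)
  also have "\<dots> = s * cmod (v - w)" using r_pos by (simp add: s_def)
  finally have Cvw: "cmod (C / v - C / w) \<le> s * cmod (v - w)" .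
  have k1: "K * cmod (v - w) < \<eta>" "K * cmod (v - w) \<le> \<rho>"
    using d(2,3) vw(6) K(1) by (auto simp: le_divide_eq mult.commute) (smt (verit) mult.commute mult_less_cancel_left_pos, smt (verit) mult.commute mult_less_cancel_left_pos)
  have k2: "K' * cmod (C / v - C / w) < \<eta>'" "K' * cmod (C / v - C / w) \<le> \<rho>"
  proof -
    have "K' * cmod (C / v - C / w) \<le> K' * (s * cmod (v - w))" using Cvw K'(1) by simp
    also have "\<dots> < K' * (s * \<delta>)" using vw(6) s K'(1) by simp
    finally have *: "K' * cmod (C / v - C / w) < K' * s * \<delta>" by simp
    have "K' * s > 0" using s K'(1) by simp
    then have "K' * s * \<delta> \<le> \<eta>'" "K' * s * \<delta> \<le> \<rho>" using d(4,5) by (simp_all add: le_divide_eq mult.commute)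
    then show "K' * cmod (C / v - C / w) < \<eta>'" "K' * cmod (C / v - C / w) \<le> \<rho>" using * by linarith+
  qed
  have E: "p + v \<in> E j r1" "p + w \<in> E j r1" "q + C / v \<in> E i r1" "q + C / w \<in> E i r1"
    using near_E[OF j(3)] near_E[OF i(3)] rv inv r_less(6) by (meson less_imp_le order_trans)+
  have bnd: "cmod v \<le> \<rho>" "cmod w \<le> \<rho>" "cmod (C / v) \<le> \<rho>" "cmod (C / w) \<le> \<rho>"
    using rv inv r_less(6) by (meson less_imp_le order_trans)+
  show thesis
  proof (rule that)
    show "Q j (p + v) \<in> M" "Q j (p + w) \<in> M" using E Q_in j by auto
    have "v - w \<notin> \<Gamma>" using mu(2)[of "v - w"] vw d(6) by auto
    then show "Q j (p + v) \<noteq> Q j (p + w)" using Q_same[OF j(1) E(1,2)] by simp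
    have "d ((fs t ^^ n) (Q j (p + v))) ((fs t ^^ n) (Q j (p + w))) \<le> \<alpha>" for t n
    proof (cases t)
      case True
      have "cmod ((F j ^^ n) (p + v) - (F j ^^ n) (p + w)) < \<eta>"
        using K(2)[OF vw(2,4) bnd(1,2) k1(2), of n] k1(1) by linarith
      then have "d (Q j ((F j ^^ n) (p + v))) (Q j ((F j ^^ n) (p + w))) < \<alpha>"
        using eta(2) F_iter_E E by blast
      then show ?thesis using F_iter_Q[OF j(1), of t] E j True by simp
    next
      case False
      have "cmod ((F i ^^ n) (q + C / v) - (F i ^^ n) (q + C / w)) < \<eta>'"
        using K'(2)[OF vw(3,5) bnd(3,4) k2(2), of n] k2(1) by linarith
      then have "d (Q i ((F i ^^ n) (q + C / v))) (Q i ((F i ^^ n) (q + C / w))) < \<alpha>"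
        using eta'(2) F_iter_E E by blast
      then show ?thesis using F_iter_Q[OF i(1), of t] E i False Q rv by simp
    qed
    then show "ocl \<alpha> (Q j (p + v)) (Q j (p + w))" by (simp add: ocl_def)
  qed
qed

section \<open>Translation to integer iterates and dynamic balls\<close>

theorem dynamics:
  "\<exists>f. homeomorphic_map mtopology mtopology f \<and> N_expansive 2 f \<and> \<not> expansive f"
proof (intro exI conjI)
  let ?f = "fs True"
  have cont: "continuous_map mtopology mtopology (fs s)" for s
    unfolding metric_continuous_map[OF Metric_space_axioms] using fs_in fs_cont by (fastforce simp: image_subset_iff)
  have "homeomorphic_maps mtopology mtopology (fs True) (fs False)"
    unfolding homeomorphic_maps_def using cont fs_inv[of _ True] fs_inv[of _ False] by simp
  then show "homeomorphic_map mtopology mtopology ?f" by (simp add: homeomorphic_maps_map)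
  have bij: "bij_betw ?f M M"
    using fs_in fs_inv[of _ True] fs_inv[of _ False] by (intro bij_betwI[of _ _ _ "fs False"]) auto
  have inv: "(inv_into M ?f ^^ n) x = (fs False ^^ n) x" if "x \<in> M" for n x
  proof (induction n)
    case (Suc n)
    have "inv_into M ?f u = fs False u" if "u \<in> M" for u
      using inv_into_f_eq[of ?f M "fs False u" u] bij fs_in[OF that] fs_inv'[OF that, of True False]
      by (simp add: bij_betw_def)
    then show ?case using Suc fsn_in[OF that] by simp
  qed simp
  have it: "int_iterate M ?f (int n) x = (fs True ^^ n) x" "int_iterate M ?f (- int n) x = (fs False ^^ n) x" if "x \<in> M" for n x
    using inv[OF that] by (auto simp: int_iterate_def)
  have ball: "dynamic_ball ?f \<alpha> x = {y\<in>M. ocl \<alpha> x y}" if "x \<in> M" for \<alpha> x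
  proof -
    have "(\<forall>k::int. d (int_iterate M ?f k x) (int_iterate M ?f k y) \<le> \<alpha>) \<longleftrightarrow> ocl \<alpha> x y" if y: "y \<in> M" for y
    proof
      assume *: "\<forall>k::int. d (int_iterate M ?f k x) (int_iterate M ?f k y) \<le> \<alpha>"
      show "ocl \<alpha> x y" unfolding ocl_def
      proof (intro allI)
        fix s n
        show "d ((fs s ^^ n) x) ((fs s ^^ n) y) \<le> \<alpha>"
          using *[rule_format, of "int n"] *[rule_format, of "- int n"] it \<open>x \<in> M\<close> y by (cases s) auto
      qed
    next
      assume o: "ocl \<alpha> x y"
      show "\<forall>k::int. d (int_iterate M ?f k x) (int_iterate M ?f k y) \<le> \<alpha>"
      proof
        fix k :: int
        consider n where "k = int n" | n where "k = - int n" by (metis int_cases2)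
        then show "d (int_iterate M ?f k x) (int_iterate M ?f k y) \<le> \<alpha>"
          using o it \<open>x \<in> M\<close> y unfolding ocl_def by cases auto
      qed
    qed
    then show ?thesis unfolding dynamic_ball_def by blast
  qed
  show "N_expansive 2 ?f"
    unfolding N_expansive_def using two_expansive ball by metis
  show "\<not> expansive ?f"
  proof
    assume "expansive ?f"
    then obtain \<alpha> where al: "\<alpha> > 0" "\<And>x. x \<in> M \<Longrightarrow> finite (dynamic_ball ?f \<alpha> x) \<and> card (dynamic_ball ?f \<alpha> x) \<le> 1"
      unfolding expansive_def N_expansive_def by blast
    obtain x y where xy: "x \<in> M" "y \<in> M" "x \<noteq> y" "ocl \<alpha> x y" by (rule not_expansive_pair[OF al(1)])
    have "ocl \<alpha> x x" using al(1) fsn_in[OF xy(1)] by (simp add: ocl_def)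
    then have "x \<in> dynamic_ball ?f \<alpha> x" "y \<in> dynamic_ball ?f \<alpha> x" using xy ball by auto
    then show False using al(2)[OF xy(1)] xy(3) by (auto simp: card_le_Suc0_iff_eq)
  qed
qed

end

section \<open>Homeomorphisms from continuous surjections with the same kernel\<close>

text \<open>A continuous map from a compact set to a Hausdorff space is closed, hence a quotient map
  onto its image; both images are thus the same quotient of \<open>C\<close>.\<close>

lemma same_kernel_homeomorphism:
  fixes f :: "'a::topological_space \<Rightarrow> 'b::t2_space" and g :: "'a \<Rightarrow> 'c::t2_space"
  assumes C: "compact C" and f: "continuous_on C f" and g: "continuous_on C g"
    and ker: "\<And>x y. x \<in> C \<Longrightarrow> y \<in> C \<Longrightarrow> f x = f y \<longleftrightarrow> g x = g y"
  obtains h h' where "homeomorphism (f ` C) (g ` C) h h'" "\<And>x. x \<in> C \<Longrightarrow> h (f x) = g x"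
proof -
  have half: "continuous_on (f ` C) (\<lambda>u. g (inv_into C f u)) \<and> (\<forall>x\<in>C. g (inv_into C f (f x)) = g x)"
    if C: "compact C" and f: "continuous_on C f" and g: "continuous_on C g"
      and ker: "\<And>x y. x \<in> C \<Longrightarrow> y \<in> C \<Longrightarrow> f x = f y \<Longrightarrow> g x = g y"
    for C :: "'a set" and f :: "'a \<Rightarrow> 'd::t2_space" and g :: "'a \<Rightarrow> 'e::t2_space"
  proof
    let ?h = "\<lambda>u. g (inv_into C f u)"
    have eq: "?h (f x) = g x" if "x \<in> C" for x
      using ker that by (metis f_inv_into_f imageI inv_into_into)
    then show "\<forall>x\<in>C. ?h (f x) = g x" by blast
    show "continuous_on (f ` C) ?h"
    proof (subst continuous_on_closed_vimage)
      show "closed (f ` C)" using C f by (simp add: compact_continuous_image compact_imp_closed)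
      show "\<forall>B. closed B \<longrightarrow> closed (?h -` B \<inter> f ` C)"
      proof (intro allI impI)
        fix B :: "'e set" assume B: "closed B"
        have "?h -` B \<inter> f ` C = f ` (g -` B \<inter> C)" using eq by auto
        moreover have "compact (g -` B \<inter> C)"
          using closedin_compact[OF C continuous_closedin_preimage[OF g B]] by (simp add: Int_commute)
        then have "compact (f ` (g -` B \<inter> C))"
          by (rule compact_continuous_image[OF continuous_on_subset[OF f Int_lower2]])
        ultimately show "closed (?h -` B \<inter> f ` C)"
          using compact_imp_closed by simp
      qed
    qed
  qed
  let ?h = "\<lambda>u. g (inv_into C f u)" and ?h' = "\<lambda>v. f (inv_into C g v)"
  have 1: "continuous_on (f ` C) ?h" "\<And>x. x \<in> C \<Longrightarrow> ?h (f x) = g x"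
    using half[OF C f g] ker by blast+
  have 2: "continuous_on (g ` C) ?h'" "\<And>x. x \<in> C \<Longrightarrow> ?h' (g x) = f x"
    using half[OF C g f] ker by blast+
  have "homeomorphism (f ` C) (g ` C) ?h ?h'"
    unfolding homeomorphism_def using 1 2 by (auto simp: image_image)
  then show thesis using 1(2) that by blast
qed

text \<open>Every ray from an interior point of a convex body meets the frontier exactly once,
  because all earlier points of the ray are interior. So the body is the cone over its frontier,
  with only the apex collapsed.\<close>

lemma polar_convex:
  fixes K :: "'a::euclidean_space set"
  assumes K: "convex K" "compact K" and a: "a \<in> interior K"
    and loop: "\<gamma> ` T = frontier K"
  defines "pol \<equiv> \<lambda>(r, t). a + r *\<^sub>R (\<gamma> t - a)"
  shows "pol ` ({0..1} \<times> T) = K"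
    and "\<And>r s t u. r \<in> {0..1} \<Longrightarrow> s \<in> {0..1} \<Longrightarrow> t \<in> T \<Longrightarrow> u \<in> T \<Longrightarrow>
      pol (r, t) = pol (s, u) \<longleftrightarrow> r = s \<and> (r = 0 \<or> \<gamma> t = \<gamma> u)"
proof -
  have clos: "closed K" using K compact_imp_closed by blast
  have fr: "\<gamma> t \<in> frontier K" if "t \<in> T" for t using loop that by blast
  have frK: "\<gamma> t \<in> K" "\<gamma> t \<notin> interior K" if "t \<in> T" for t
    using fr[OF that] clos by (auto simp: frontier_def)
  have inner: "a + r *\<^sub>R (x - a) \<in> interior K" if "x \<in> K" "0 \<le> r" "r < 1" for r :: real and x
  proof -
    have "x - (1 - r) *\<^sub>R (x - a) \<in> interior K"
      using that by (intro mem_interior_convex_shrink[OF K(1) a]) auto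
    then show ?thesis by (simp add: algebra_simps)
  qed
  show img: "pol ` ({0..1} \<times> T) = K"
  proof
    show "pol ` ({0..1} \<times> T) \<subseteq> K"
    proof safe
      fix r t assume rt: "r \<in> {0..1::real}" "t \<in> T"
      show "pol (r, t) \<in> K"
        using inner[OF frK(1)[OF rt(2)], of r] rt frK[OF rt(2)] interior_subset
        by (cases "r = 1") (auto simp: pol_def)
    qed
    show "K \<subseteq> pol ` ({0..1} \<times> T)"
    proof
      fix x assume x: "x \<in> K"
      have bd: "bounded K" using K compact_imp_bounded by blast
      have neF: "\<exists>d>0. a + d *\<^sub>R l \<in> frontier K \<and> (\<forall>e. 0 \<le> e \<and> e < d \<longrightarrow> a + e *\<^sub>R l \<in> interior K)" if "l \<noteq> 0" for l
        using ray_to_frontier[OF bd a that] by metis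
      show "x \<in> pol ` ({0..1} \<times> T)"
      proof (cases "x = a")
        case True
        obtain l :: 'a where "l \<noteq> 0" using nonzero_Basis nonempty_Basis by blast
        with neF loop obtain t where "t \<in> T" by (metis imageE)
        then show ?thesis using True by (intro image_eqI[of _ _ "(0, t)"]) (auto simp: pol_def)
      next
        case False
        then obtain d where d: "d > 0" "a + d *\<^sub>R (x - a) \<in> frontier K" 
          "\<And>e. 0 \<le> e \<Longrightarrow> e < d \<Longrightarrow> a + e *\<^sub>R (x - a) \<in> interior K"
          using neF[of "x - a"] by auto
        obtain t where t: "t \<in> T" "\<gamma> t = a + d *\<^sub>R (x - a)" using d loop by (metis imageE)
        have "d \<ge> 1"
        proof (rule ccontr)
          assume "\<not> d \<ge> 1"
          then have "a + d *\<^sub>R (x - a) \<in> interior K" using inner[OF x, of d] d by simp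
          then show False using d(2) by (simp add: frontier_def)
        qed
        then show ?thesis using t d by (intro image_eqI[of _ _ "(1 / d, t)"]) (auto simp: pol_def)
      qed
    qed
  qed
  have less: False if "0 < r" "r < s" "s \<le> 1" "t \<in> T" "u \<in> T" "pol (r, t) = pol (s, u)" for r s :: real and t u
  proof -
    have "s *\<^sub>R (\<gamma> u - a) = r *\<^sub>R (\<gamma> t - a)" using that(6) by (simp add: pol_def)
    then have "(1 / s) *\<^sub>R s *\<^sub>R (\<gamma> u - a) = (1 / s) *\<^sub>R r *\<^sub>R (\<gamma> t - a)" by (rule arg_cong)
    then have "\<gamma> u - a = (r / s) *\<^sub>R (\<gamma> t - a)" using that(1,2) by simp
    then have "\<gamma> u = a + (r / s) *\<^sub>R (\<gamma> t - a)" by (simp add: algebra_simps)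
    moreover have "a + (r / s) *\<^sub>R (\<gamma> t - a) \<in> interior K" using that frK by (intro inner) auto
    ultimately show False using frK(2)[OF that(5)] by simp
  qed
  fix r s :: real and t u assume A: "r \<in> {0..1}" "s \<in> {0..1}" "t \<in> T" "u \<in> T"
  have nz: "\<gamma> v \<noteq> a" if "v \<in> T" for v using frK[OF that] a by auto
  show "pol (r, t) = pol (s, u) \<longleftrightarrow> r = s \<and> (r = 0 \<or> \<gamma> t = \<gamma> u)"
  proof
    assume eq: "pol (r, t) = pol (s, u)"
    have "r = s"
    proof (cases "r = 0 \<or> s = 0")
      case True then show ?thesis using eq nz A by (auto simp: pol_def)
    next
      case False
      then have "0 < r" "0 < s" "r \<le> 1" "s \<le> 1" using A by auto
      then show ?thesis using less[of r s t u] less[of s r u t] eq A(3,4) by (cases r s rule: linorder_cases) simp_all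
    qed
    then show "r = s \<and> (r = 0 \<or> \<gamma> t = \<gamma> u)" using eq by (auto simp: pol_def)
  qed (auto simp: pol_def)
qed

text \<open>Both bodies are cones over their frontiers, and a correspondence of frontiers extends
  linearly along the rays. The correspondence is encoded by two parametrizations with equal kernel,
  so they need not be injective.\<close>

lemma loop_extension:
  fixes K :: "'a::euclidean_space set" and L :: "'b::euclidean_space set"
  assumes K: "convex K" "compact K" "interior K \<noteq> {}" and L: "convex L" "compact L" "interior L \<noteq> {}"
    and T: "compact T" "continuous_on T \<gamma>" "continuous_on T \<mu>" "\<gamma> ` T = frontier K" "\<mu> ` T = frontier L"
    and ker: "\<And>t u. t \<in> T \<Longrightarrow> u \<in> T \<Longrightarrow> \<gamma> t = \<gamma> u \<longleftrightarrow> \<mu> t = \<mu> u"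
  obtains h h' where "homeomorphism K L h h'" "\<And>t. t \<in> T \<Longrightarrow> h (\<gamma> t) = \<mu> t"
proof -
  obtain a b where ab: "a \<in> interior K" "b \<in> interior L" using K L by blast
  let ?f = "\<lambda>(r, t). a + r *\<^sub>R (\<gamma> t - a)" and ?g = "\<lambda>(r, t). b + r *\<^sub>R (\<mu> t - b)"
  let ?C = "{0..1::real} \<times> T"
  note pK = polar_convex[OF K(1,2) ab(1) T(4)] and pL = polar_convex[OF L(1,2) ab(2) T(5)]
  have cont: "continuous_on ?C ?f" "continuous_on ?C ?g"
    unfolding case_prod_unfold
    by (intro continuous_intros continuous_on_compose2[OF T(2) continuous_on_snd[OF continuous_on_id]]
          continuous_on_compose2[OF T(3) continuous_on_snd[OF continuous_on_id]]; auto)+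
  have comp: "compact ?C" using T(1) by (simp add: compact_Times)
  have kk: "?f x = ?f y \<longleftrightarrow> ?g x = ?g y" if "x \<in> ?C" "y \<in> ?C" for x y
  proof -
    obtain r t s u where xy: "x = (r, t)" "y = (s, u)" by (metis surj_pair)
    then have m: "r \<in> {0..1}" "s \<in> {0..1}" "t \<in> T" "u \<in> T" using that by auto
    show ?thesis unfolding xy pK(2)[OF m] pL(2)[OF m] ker[OF m(3,4)] by (rule refl)
  qed
  obtain h h' where h: "homeomorphism (?f ` ?C) (?g ` ?C) h h'" "\<And>x. x \<in> ?C \<Longrightarrow> h (?f x) = ?g x"
    using same_kernel_homeomorphism[OF comp cont kk] by blast
  have "h (\<gamma> t) = \<mu> t" if "t \<in> T" for t using h(2)[of "(1, t)"] that by simp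
  then show thesis using h(1) that unfolding pK(1) pL(1) by blast
qed

section \<open>Periodic maps defined by cells\<close>

definition lat :: "complex set" where "lat = {z. Re z \<in> \<int> \<and> Im z \<in> \<int>}"

lemma lat_add: "a \<in> lat \<Longrightarrow> b \<in> lat \<Longrightarrow> a + b \<in> lat" and lat_minus: "a \<in> lat \<Longrightarrow> - a \<in> lat"
  and lat_diff: "a \<in> lat \<Longrightarrow> b \<in> lat \<Longrightarrow> a - b \<in> lat" and lat_0: "0 \<in> lat"
  by (auto simp: lat_def)

lemma lat_diff_commute: "a - b \<in> lat \<longleftrightarrow> b - a \<in> lat"
  using lat_minus by (metis minus_diff_eq)

lemma lat_cases: assumes "a \<in> lat" obtains m n :: int where "Re a = of_int m" "Im a = of_int n"
  using assms by (auto simp: lat_def Ints_def)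

lemma closed_lat: "closed lat"
proof -
  have "lat = Re -` \<int> \<inter> Im -` \<int>" by (auto simp: lat_def)
  moreover have "closed (Re -` \<int>)" "closed (Im -` \<int>)"
    by (auto intro!: closed_vimage closed_Ints continuous_on_Re continuous_on_Im continuous_on_id)
  ultimately show ?thesis by (metis closed_Int)
qed

text \<open>A map into a quotient of the plane need not have a continuous lift; it is given here by
  finitely many compact cells \<open>K c\<close> with a projection \<open>\<phi> c\<close> to the plane.\<close>
lemma periodic_from_cells:
  fixes K :: "'c \<Rightarrow> 'b::t2_space set" and \<phi> :: "'c \<Rightarrow> 'b \<Rightarrow> complex" and q :: "'c \<Rightarrow> 'b \<Rightarrow> 'x"
  assumes I: "finite I" and K: "\<And>c. c \<in> I \<Longrightarrow> compact (K c)"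
    and \<phi>: "\<And>c. c \<in> I \<Longrightarrow> continuous_on (K c) (\<phi> c)"
    and q: "\<And>c. c \<in> I \<Longrightarrow> continuous_map (top_of_set (K c)) X (q c)"
    and ker: "\<And>c e x y. c \<in> I \<Longrightarrow> e \<in> I \<Longrightarrow> x \<in> K c \<Longrightarrow> y \<in> K e \<Longrightarrow> \<phi> c x - \<phi> e y \<in> lat \<Longrightarrow> q c x = q e y"
  obtains G where "continuous_map (top_of_set {w. \<exists>c\<in>I. \<exists>x\<in>K c. w - \<phi> c x \<in> lat}) X G"
    "\<And>c x w. c \<in> I \<Longrightarrow> x \<in> K c \<Longrightarrow> w - \<phi> c x \<in> lat \<Longrightarrow> G w = q c x"
proof -
  let ?E = "{w. \<exists>c\<in>I. \<exists>x\<in>K c. w - \<phi> c x \<in> lat}"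
  define G where "G w = (THE v. \<exists>c\<in>I. \<exists>x\<in>K c. w - \<phi> c x \<in> lat \<and> v = q c x)" for w
  have G: "G w = q c x" if "c \<in> I" "x \<in> K c" "w - \<phi> c x \<in> lat" for c x w
    unfolding G_def
  proof (rule the_equality)
    fix v assume "\<exists>c\<in>I. \<exists>x\<in>K c. w - \<phi> c x \<in> lat \<and> v = q c x"
    then obtain e y where e: "e \<in> I" "y \<in> K e" "w - \<phi> e y \<in> lat" "v = q e y" by blast
    then have "\<phi> e y - \<phi> c x \<in> lat" using lat_diff[OF that(3) e(3)] by simp
    from ker[OF e(1) that(1) e(2) that(2) this] show "v = q c x" using e(4) by simp
  qed (use that in blast)
  have "continuous_map (top_of_set ?E) X G"
    unfolding continuous_map_closedin
  proof (intro conjI allI impI)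
    show "G \<in> topspace (top_of_set ?E) \<rightarrow> topspace X"
    proof
      fix w assume "w \<in> topspace (top_of_set ?E)"
      then obtain c x where c: "c \<in> I" "x \<in> K c" "w - \<phi> c x \<in> lat" by auto
      then have "q c x \<in> topspace X" using q[OF c(1)] by (auto simp: continuous_map_def)
      then show "G w \<in> topspace X" using G[OF c] by simp
    qed
    fix B assume B: "closedin X B"
    let ?P = "\<lambda>c. {x \<in> K c. q c x \<in> B}"
    have P: "compact (?P c)" if "c \<in> I" for c
    proof -
      have "closedin (top_of_set (K c)) {x \<in> topspace (top_of_set (K c)). q c x \<in> B}"
        by (rule closedin_continuous_map_preimage[OF q[OF that] B])
      then show ?thesis using closedin_compact[OF K[OF that]] by simp
    qed
    have "compact (\<phi> c ` ?P c)" if "c \<in> I" for c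
      by (rule compact_continuous_image[OF continuous_on_subset[OF \<phi>[OF that]] P[OF that]]) blast
    \<comment> \<open>A compact set plus a closed set is closed, so the lattice translates of the
      finitely many compact pieces have closed union.\<close>
    then have cl: "closed (\<Union>c\<in>I. (\<Union>x\<in>\<phi> c ` ?P c. \<Union>y\<in>lat. {x + y}))"
      by (intro closed_UN I ballI compact_closed_sums closed_lat)
    have "{w \<in> topspace (top_of_set ?E). G w \<in> B} = ?E \<inter> (\<Union>c\<in>I. (\<Union>x\<in>\<phi> c ` ?P c. \<Union>y\<in>lat. {x + y}))"
    proof (intro equalityI subsetI IntI)
      fix w assume "w \<in> {w \<in> topspace (top_of_set ?E). G w \<in> B}"
      then have w: "w \<in> ?E" "G w \<in> B" by auto
      then obtain c x where c: "c \<in> I" "x \<in> K c" "w - \<phi> c x \<in> lat" by auto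
      then have "x \<in> ?P c" using G[OF c] w by simp
      moreover have "w = \<phi> c x + (w - \<phi> c x)" by simp
      ultimately have "w \<in> (\<Union>x\<in>\<phi> c ` ?P c. \<Union>y\<in>lat. {x + y})" using c(3)
        by (intro UN_I[of "\<phi> c x"] UN_I[of "w - \<phi> c x"] imageI) simp_all
      then show "w \<in> (\<Union>c\<in>I. (\<Union>x\<in>\<phi> c ` ?P c. \<Union>y\<in>lat. {x + y}))" by (rule UN_I[OF c(1)])
      show "w \<in> ?E" by (rule w(1))
    next
      fix w assume w: "w \<in> ?E \<inter> (\<Union>c\<in>I. (\<Union>x\<in>\<phi> c ` ?P c. \<Union>y\<in>lat. {x + y}))"
      then obtain c x b where c: "c \<in> I" "x \<in> K c" "q c x \<in> B" "b \<in> lat" "w = \<phi> c x + b" by blast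
      then have "G w \<in> B" using G[of c x w] by simp
      then show "w \<in> {w \<in> topspace (top_of_set ?E). G w \<in> B}" using w by simp
    qed
    then show "closedin (top_of_set ?E) {w \<in> topspace (top_of_set ?E). G w \<in> B}"
      using closedin_closed_Int[OF cl] by simp
  qed
  then show thesis using G that by blast
qed

section \<open>A one-holed torus as a square torus without a disc around the vertex\<close>

text \<open>\<open>n1\<close> is the \<open>L\<^sup>1\<close> norm, and \<open>om\<close> runs once counterclockwise through its unit sphere on \<open>[0,4]\<close>.\<close>
definition n1 :: "complex \<Rightarrow> real" where "n1 z = \<bar>Re z\<bar> + \<bar>Im z\<bar>"

definition om :: "real \<Rightarrow> complex" where
  "om \<theta> = Complex (\<bar>\<theta> - 2\<bar> - 1) (\<theta> - 2 - \<bar>\<theta> - 1\<bar> + \<bar>\<theta> - 3\<bar>)"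

lemma om_quadrants:
  "0 \<le> \<theta> \<Longrightarrow> \<theta> \<le> 1 \<Longrightarrow> om \<theta> = Complex (1 - \<theta>) \<theta>"
  "1 \<le> \<theta> \<Longrightarrow> \<theta> \<le> 2 \<Longrightarrow> om \<theta> = Complex (1 - \<theta>) (2 - \<theta>)"
  "2 \<le> \<theta> \<Longrightarrow> \<theta> \<le> 3 \<Longrightarrow> om \<theta> = Complex (\<theta> - 3) (2 - \<theta>)"
  "3 \<le> \<theta> \<Longrightarrow> \<theta> \<le> 4 \<Longrightarrow> om \<theta> = Complex (\<theta> - 3) (\<theta> - 4)"
  by (auto simp: om_def)

lemma quadrant_cases:
  assumes "0 \<le> \<theta>" "\<theta> \<le> (4::real)"
  obtains "0 \<le> \<theta>" "\<theta> \<le> 1" | "1 \<le> \<theta>" "\<theta> \<le> 2" | "2 \<le> \<theta>" "\<theta> \<le> 3" | "3 \<le> \<theta>" "\<theta> \<le> 4"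
  using assms by linarith

lemma n1_om: "0 \<le> \<theta> \<Longrightarrow> \<theta> \<le> 4 \<Longrightarrow> n1 (om \<theta>) = 1"
  by (erule quadrant_cases; simp add: om_quadrants n1_def)

lemma n1_scale: "n1 (of_real m * z) = \<bar>m\<bar> * n1 z"
  by (simp add: n1_def abs_mult distrib_left)

lemma n1_triangle: "n1 (z + w) \<le> n1 z + n1 w" "n1 (z - w) \<le> n1 z + n1 w"
  by (auto simp: n1_def)

lemma n1_pos: "0 \<le> n1 z" "n1 z = 0 \<longleftrightarrow> z = 0"
  by (auto simp: n1_def complex_eq_iff)

lemma n1_cmod: "cmod z \<le> n1 z" "n1 z \<le> 2 * cmod z"
  using cmod_le[of z] abs_Re_le_cmod[of z] abs_Im_le_cmod[of z] by (auto simp: n1_def)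

lemma n1_lat: "a \<in> lat \<Longrightarrow> n1 a < 1 \<Longrightarrow> a = 0"
proof -
  assume a: "a \<in> lat" "n1 a < 1"
  then obtain m n :: int where "Re a = m" "Im a = n" by (auto simp: lat_def elim!: Ints_cases)
  then show "a = 0" using a by (auto simp: n1_def complex_eq_iff)
qed

lemma om_inj:
  assumes "0 \<le> a" "a \<le> 4" "0 \<le> b" "b \<le> 4" "om a = om b"
  shows "a = b \<or> a = 0 \<and> b = 4 \<or> a = 4 \<and> b = 0"
  using assms(1,2)
proof (rule quadrant_cases)
qed (rule quadrant_cases[OF assms(3,4)]; use assms(5) in \<open>auto simp: om_quadrants\<close>)+

lemma om_upper: assumes "0 \<le> Im z" "z \<noteq> 0" shows "0 \<le> 1 - Re z / n1 z" "1 - Re z / n1 z \<le> 2" "of_real (n1 z) * om (1 - Re z / n1 z) = z"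
proof -
  have n: "n1 z > 0" using n1_pos[of z] assms by linarith
  show b: "0 \<le> 1 - Re z / n1 z" "1 - Re z / n1 z \<le> 2" using n by (auto simp: le_divide_eq divide_le_eq n1_def)
  show "of_real (n1 z) * om (1 - Re z / n1 z) = z"
  proof (cases "Re z \<ge> 0")
    case t: True
    then have "om (1 - Re z / n1 z) = Complex (Re z / n1 z) (1 - Re z / n1 z)" using b n om_quadrants(1)[of "1 - Re z / n1 z"] by simp
    then show ?thesis using n assms t by (simp add: complex_eq_iff right_diff_distrib n1_def)
  next
    case t: False
    then have "om (1 - Re z / n1 z) = Complex (Re z / n1 z) (1 + Re z / n1 z)"
      using b n om_quadrants(2)[of "1 - Re z / n1 z"] by (simp add: divide_le_0_iff)
    then show ?thesis using n assms t by (simp add: complex_eq_iff distrib_left n1_def)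
  qed
qed

lemma om_lower: assumes "Im z \<le> 0" "z \<noteq> 0" shows "2 \<le> 3 + Re z / n1 z" "3 + Re z / n1 z \<le> 4" "of_real (n1 z) * om (3 + Re z / n1 z) = z"
proof -
  have n: "n1 z > 0" using n1_pos[of z] assms by linarith
  have "- 1 \<le> Re z / n1 z" "Re z / n1 z \<le> 1" using n by (auto simp: le_divide_eq divide_le_eq n1_def)
  then show b: "2 \<le> 3 + Re z / n1 z" "3 + Re z / n1 z \<le> 4" by auto
  show "of_real (n1 z) * om (3 + Re z / n1 z) = z"
  proof (cases "Re z \<ge> 0")
    case t: True
    then have "om (3 + Re z / n1 z) = Complex (Re z / n1 z) (Re z / n1 z - 1)" using b n om_quadrants(4)[of "3 + Re z / n1 z"] by simp
    then show ?thesis using n assms t by (simp add: complex_eq_iff right_diff_distrib n1_def)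
  next
    case t: False
    then have "om (3 + Re z / n1 z) = Complex (Re z / n1 z) (- 1 - Re z / n1 z)"
      using b n om_quadrants(3)[of "3 + Re z / n1 z"] by (simp add: divide_le_0_iff)
    then show ?thesis using n assms t by (simp add: complex_eq_iff right_diff_distrib n1_def)
  qed
qed

lemma om_polar: obtains \<theta> where "0 \<le> \<theta>" "\<theta> \<le> 4" "z = of_real (n1 z) * om \<theta>"
proof (cases "z = 0")
  case True then show thesis using that[of 0] by (simp add: n1_def)
next
  case False
  show thesis
  proof (cases "0 \<le> Im z")
    case True then show thesis using om_upper[OF True False] that[of "1 - Re z / n1 z"] by simp
  next
    case f: False
    then have "Im z \<le> 0" by simp
    from om_lower[OF this False] show thesis using that[of "3 + Re z / n1 z"] by simp
  qed
qed

lemma continuous_om: "continuous_on S om"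
  unfolding om_def Complex_eq by (intro continuous_intros)

lemma continuous_n1 [continuous_intros]: "continuous_on S f \<Longrightarrow> continuous_on S (\<lambda>x. n1 (f x))"
  unfolding n1_def by (intro continuous_intros)

text \<open>Here \<eta> is the radial function of the disc to be removed at the vertex, \<delta> the
  size of the triangle cut from the square, and \<open>r < 1 / 4\<close> keeps the four corner zones
  of the square disjoint.\<close>

locale oct =
  fixes r \<delta> :: real and \<eta> :: "real \<Rightarrow> real"
  assumes r: "r < 1 / 4" and del: "0 < \<delta>" "\<delta> < r"
    and eta: "\<And>t. 0 < \<eta> t" "\<And>t. \<eta> t < r" and eta_cont: "continuous_on UNIV \<eta>" and eta_loop: "\<eta> 0 = \<eta> 4"
begin

text \<open>\<open>Pent\<close> is the unit square without a triangle at the corner \<open>0\<close>, and \<open>L\<close> maps it onto the unit square torus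
  without the disc \<open>n1 < \<eta> \<theta>\<close> in direction \<open>\<theta>\<close> around its vertex. \<open>L\<close> is the identity at distance \<open>r\<close> from the
  corners. The four corner sectors fill the annulus with coordinates \<open>\<theta>\<close> and \<open>\<rho>\<close> (\<open>\<rho> = 0\<close> on the outer and \<open>\<rho> = 1\<close> on
  the inner circle): the sector of the removed triangle occupies \<open>\<theta> \<le> 1 + 3 * \<rho>\<close>, and so the whole inner
  circle. \<open>Kpt\<close> is the inverse of \<open>L\<close> on the annulus.\<close>
definition "ring \<theta> \<rho> = of_real ((1 - \<rho>) * r + \<rho> * \<eta> \<theta>) * om \<theta>"
definition "Pent = {z. 0 \<le> Re z \<and> Re z \<le> 1 \<and> 0 \<le> Im z \<and> Im z \<le> 1 \<and> \<delta> \<le> Re z + Im z}"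
definition "edg s = (if s \<le> r then \<delta> + s * (r - \<delta>) / r else s)"
definition "R0 z = (r - n1 z) / (r - \<delta>)"
definition "T0 z = (1 - Re z / n1 z) * (1 + 3 * R0 z)"
definition "R1 w = 1 - n1 w / r"
definition "T1 w = 4 - (3 * n1 w + Re w) / r"
definition "T2 w = 4 - (n1 w - Re w) / r"
definition "L z = (if n1 z \<le> r then ring (T0 z) (R0 z)
  else if n1 (z - 1) \<le> r then 1 + ring (T1 (z - 1)) (R1 (z - 1))
  else if n1 (z - Complex 1 1) \<le> r then Complex 1 1 + ring (T2 (z - Complex 1 1)) (R1 (z - Complex 1 1))
  else if n1 (z - \<i>) \<le> r then \<i> + ring (T2 (z - \<i>)) (R1 (z - \<i>)) else z)"
definition "Kpt \<theta> \<rho> = (if \<theta> \<le> 1 + 3 * \<rho> then of_real (r - \<rho> * (r - \<delta>)) * om (\<theta> / (1 + 3 * \<rho>))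
  else (if \<theta> \<le> 2 + 2 * \<rho> then 1 else if \<theta> \<le> 3 + \<rho> then Complex 1 1 else \<i>)
    + of_real (r * (1 - \<rho>)) * om ((\<theta> - 4 * \<rho>) / (1 - \<rho>)))"

lemma rad_ring: assumes "0 \<le> \<rho>" "\<rho> \<le> 1" shows "0 < (1 - \<rho>) * r + \<rho> * \<eta> \<theta>" "(1 - \<rho>) * r + \<rho> * \<eta> \<theta> \<le> r"
  "0 < \<rho> \<Longrightarrow> (1 - \<rho>) * r + \<rho> * \<eta> \<theta> < r"
proof -
  have "\<rho> * (r - \<eta> \<theta>) \<ge> 0" "0 < \<rho> \<Longrightarrow> \<rho> * (r - \<eta> \<theta>) > 0" using assms eta(2)[of \<theta>] by auto
  then show "(1 - \<rho>) * r + \<rho> * \<eta> \<theta> \<le> r" "0 < \<rho> \<Longrightarrow> (1 - \<rho>) * r + \<rho> * \<eta> \<theta> < r" by (auto simp: algebra_simps)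
  have "(1 - \<rho>) * \<eta> \<theta> \<le> (1 - \<rho>) * r" using assms eta(2)[of \<theta>] by (intro mult_left_mono) auto
  then show "0 < (1 - \<rho>) * r + \<rho> * \<eta> \<theta>" using eta(1)[of \<theta>] by (simp add: algebra_simps)
qed

lemma n1_ring: assumes "0 \<le> \<rho>" "\<rho> \<le> 1" "0 \<le> \<theta>" "\<theta> \<le> 4" shows "n1 (ring \<theta> \<rho>) = (1 - \<rho>) * r + \<rho> * \<eta> \<theta>"
  using rad_ring(1)[OF assms(1,2), of \<theta>] n1_om[OF assms(3,4)] unfolding ring_def n1_scale by simp

lemma ring_4: "ring 4 \<rho> = ring 0 \<rho>"
  by (simp add: ring_def eta_loop om_def)

lemma ring_0: "ring \<theta> 0 = of_real r * om \<theta>"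
  by (simp add: ring_def)

lemma ring_eq:
  assumes "0 \<le> \<rho>" "\<rho> \<le> 1" "0 \<le> \<theta>" "\<theta> \<le> 4" "0 \<le> \<rho>'" "\<rho>' \<le> 1" "0 \<le> \<theta>'" "\<theta>' \<le> 4" "ring \<theta> \<rho> = ring \<theta>' \<rho>'"
  shows "\<rho> = \<rho>'" "\<theta> = \<theta>' \<or> \<theta> = 0 \<and> \<theta>' = 4 \<or> \<theta> = 4 \<and> \<theta>' = 0"
proof -
  have n: "(1 - \<rho>) * r + \<rho> * \<eta> \<theta> = (1 - \<rho>') * r + \<rho>' * \<eta> \<theta>'"
    using n1_ring assms by metis
  have "om \<theta> = om \<theta>'" using assms(9) n rad_ring(1)[OF assms(1,2), of \<theta>]
    unfolding ring_def by (metis mult_cancel_left of_real_eq_0_iff less_irrefl)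
  then show t: "\<theta> = \<theta>' \<or> \<theta> = 0 \<and> \<theta>' = 4 \<or> \<theta> = 4 \<and> \<theta>' = 0" using om_inj assms by blast
  then have "\<eta> \<theta> = \<eta> \<theta>'" using eta_loop by auto
  then have "(\<rho> - \<rho>') * (r - \<eta> \<theta>) = 0" using n by (simp add: algebra_simps)
  then show "\<rho> = \<rho>'" using eta(2)[of \<theta>] by simp
qed

lemma corner0:
  assumes "z \<in> Pent" "n1 z \<le> r"
  shows "0 \<le> R0 z" "R0 z \<le> 1" "0 \<le> T0 z" "T0 z \<le> 1 + 3 * R0 z" "Kpt (T0 z) (R0 z) = z"
    "n1 z < r \<Longrightarrow> 0 < R0 z" "T0 z \<le> 4"
proof -
  have p: "0 \<le> Re z" "0 \<le> Im z" "n1 z = Re z + Im z" "\<delta> \<le> n1 z" using assms by (auto simp: Pent_def n1_def)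
  then have n: "n1 z > 0" using del by simp
  show R: "0 \<le> R0 z" "R0 z \<le> 1" "n1 z < r \<Longrightarrow> 0 < R0 z" using p assms del by (auto simp: R0_def)
  have s: "0 \<le> 1 - Re z / n1 z" "1 - Re z / n1 z \<le> 1" using n p by (auto simp: divide_le_eq)
  then show "0 \<le> T0 z" using R by (simp add: T0_def)
  show T: "T0 z \<le> 1 + 3 * R0 z" using s R mult_right_mono[OF s(2), of "1 + 3 * R0 z"] by (simp add: T0_def)
  then show "T0 z \<le> 4" using R by linarith
  have "T0 z / (1 + 3 * R0 z) = 1 - Re z / n1 z" using R by (simp add: T0_def)
  moreover have "r - R0 z * (r - \<delta>) = n1 z" using del by (simp add: R0_def)
  ultimately have "Kpt (T0 z) (R0 z) = of_real (n1 z) * om (1 - Re z / n1 z)" using T by (simp add: Kpt_def)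
  also have "\<dots> = z" using n om_quadrants(1)[OF s] p(3) by (simp add: complex_eq_iff right_diff_distrib)
  finally show "Kpt (T0 z) (R0 z) = z" .
qed

lemma R1_range: assumes "n1 w \<le> r" shows "0 \<le> R1 w" "R1 w \<le> 1" "n1 w < r \<Longrightarrow> 0 < R1 w"
  using assms del n1_pos(1)[of w] by (auto simp: R1_def divide_le_eq)

lemma r_pos: "0 < r" using del by simp

lemma corner_scale: "r * (1 - R1 w) = n1 w"
  using r_pos by (simp add: R1_def)

text \<open>For a point with local direction parameter \<sigma>, \<open>T1\<close> (and
  \<open>T2\<close> at the next two corners) equals
  \<open>4 * \<rho> + (1 - \<rho>) * \<sigma>\<close> with \<open>\<rho> = R1 w\<close>: the
  quadrant on the outer circle shrinks to the single parameter 4 on the inner one. On the side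
  shared with the preceding sector \<open>Kpt\<close> returns the point there, which is glued to
  \<open>1 + w\<close>.\<close>

lemma corner1:
  assumes "Re w \<le> 0" "0 \<le> Im w" "n1 w \<le> r"
  shows "1 + 3 * R1 w \<le> T1 w" "T1 w \<le> 2 + 2 * R1 w" "Re w < 0 \<Longrightarrow> Kpt (T1 w) (R1 w) = 1 + w"
    "Re w = 0 \<Longrightarrow> Kpt (T1 w) (R1 w) = Complex 0 (edg (n1 w))"
proof -
  have n: "n1 w = Im w - Re w" using assms by (simp add: n1_def)
  have eq: "T1 w - (1 + 3 * R1 w) = - Re w / r" "2 + 2 * R1 w - T1 w = Im w / r"
    using r_pos by (auto simp: T1_def R1_def n field_simps)
  show le: "1 + 3 * R1 w \<le> T1 w" "T1 w \<le> 2 + 2 * R1 w"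
    using eq assms r_pos by (smt (verit) divide_nonneg_pos)+
  show "Kpt (T1 w) (R1 w) = 1 + w" if "Re w < 0"
  proof -
    have n0: "n1 w > 0" using that assms n by simp
    have "T1 w > 1 + 3 * R1 w" using eq(1) that r_pos by (smt (verit) divide_pos_pos)
    moreover have "(T1 w - 4 * R1 w) / (1 - R1 w) = 1 - Re w / n1 w"
      using n0 r_pos by (simp add: T1_def R1_def field_simps)
    ultimately have "Kpt (T1 w) (R1 w) = 1 + of_real (n1 w) * om (1 - Re w / n1 w)"
      using le by (simp add: Kpt_def corner_scale)
    moreover have "om (1 - Re w / n1 w) = Complex (Re w / n1 w) (1 + Re w / n1 w)"
      using om_quadrants(2)[of "1 - Re w / n1 w"] n0 assms n by (simp add: divide_le_0_iff le_divide_eq minus_divide_left del: minus_divide_left[symmetric])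
    ultimately show ?thesis using n0 n by (simp add: complex_eq_iff distrib_left)
  qed
  show "Kpt (T1 w) (R1 w) = Complex 0 (edg (n1 w))" if "Re w = 0"
  proof -
    have "T1 w = 1 + 3 * R1 w" using eq(1) that by simp
    moreover have "0 \<le> R1 w" using R1_range assms by blast
    ultimately have "Kpt (T1 w) (R1 w) = of_real (r - R1 w * (r - \<delta>)) * om 1" by (simp add: Kpt_def)
    also have "r - R1 w * (r - \<delta>) = edg (n1 w)" using assms r_pos by (simp add: R1_def edg_def field_simps)
    finally show ?thesis by (simp add: om_def complex_eq_iff)
  qed
qed

lemma corner2:
  assumes "Re w \<le> 0" "Im w \<le> 0" "n1 w \<le> r"
  shows "2 + 2 * R1 w \<le> T2 w" "T2 w \<le> 3 + R1 w" "Im w < 0 \<Longrightarrow> Kpt (T2 w) (R1 w) = Complex 1 1 + w"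
    "Im w = 0 \<Longrightarrow> w \<noteq> 0 \<Longrightarrow> Kpt (T2 w) (R1 w) = 1 + w" "w = 0 \<Longrightarrow> Kpt (T2 w) (R1 w) = Complex 0 \<delta>"
proof -
  have n: "n1 w = - Re w - Im w" using assms by (simp add: n1_def)
  have eq: "3 + R1 w - T2 w = - Re w / r" "T2 w - (2 + 2 * R1 w) = - Im w / r" "T2 w - (1 + 3 * R1 w) = (n1 w - Im w) / r"
    using r_pos by (auto simp: T2_def R1_def n field_simps)
  show le: "2 + 2 * R1 w \<le> T2 w" "T2 w \<le> 3 + R1 w"
    using eq assms r_pos by (smt (verit) divide_nonneg_pos)+
  have gen: "om ((T2 w - 4 * R1 w) / (1 - R1 w)) = Complex (Re w / n1 w) (- 1 - Re w / n1 w)" "T2 w > 1 + 3 * R1 w" "n1 w > 0" if "w \<noteq> 0"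
  proof -
    show n0: "n1 w > 0" using that n1_pos[of w] by linarith
    show "T2 w > 1 + 3 * R1 w" using eq(3) n0 assms r_pos by (smt (verit) divide_pos_pos)
    have "(T2 w - 4 * R1 w) / (1 - R1 w) = 3 + Re w / n1 w"
      using n0 r_pos by (simp add: T2_def R1_def field_simps)
    moreover have "- 1 \<le> Re w / n1 w" "Re w / n1 w \<le> 0"
      using n0 assms n by (auto simp: le_divide_eq divide_nonpos_pos)
    then have "om (3 + Re w / n1 w) = Complex (Re w / n1 w) (- 1 - Re w / n1 w)"
      using om_quadrants(3)[of "3 + Re w / n1 w"] by simp
    ultimately show "om ((T2 w - 4 * R1 w) / (1 - R1 w)) = Complex (Re w / n1 w) (- 1 - Re w / n1 w)" by simp
  qed
  show "Kpt (T2 w) (R1 w) = Complex 1 1 + w" if "Im w < 0"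
  proof -
    have w: "w \<noteq> 0" using that by auto
    have "T2 w > 2 + 2 * R1 w" using eq(2) that r_pos by (smt (verit) divide_pos_pos)
    then have "Kpt (T2 w) (R1 w) = Complex 1 1 + of_real (n1 w) * Complex (Re w / n1 w) (- 1 - Re w / n1 w)"
      using gen[OF w] le by (simp add: Kpt_def corner_scale)
    then show ?thesis using gen(3)[OF w] n by (simp add: complex_eq_iff right_diff_distrib)
  qed
  show "Kpt (T2 w) (R1 w) = 1 + w" if "Im w = 0" "w \<noteq> 0"
  proof -
    have "T2 w = 2 + 2 * R1 w" using eq(2) that by simp
    then have "T2 w \<le> 2 + 2 * R1 w" by simp
    then have "Kpt (T2 w) (R1 w) = 1 + of_real (n1 w) * Complex (Re w / n1 w) (- 1 - Re w / n1 w)"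
      using gen[OF that(2)] by (simp add: Kpt_def corner_scale)
    then show ?thesis using gen(3)[OF that(2)] that n by (simp add: complex_eq_iff right_diff_distrib)
  qed
  show "Kpt (T2 w) (R1 w) = Complex 0 \<delta>" if "w = 0"
    using that by (simp add: Kpt_def T2_def R1_def n1_def om_def complex_eq_iff)
qed

lemma corner3:
  assumes "0 \<le> Re w" "Im w \<le> 0" "n1 w \<le> r"
  shows "3 + R1 w \<le> T2 w" "T2 w \<le> 4" "0 < Re w \<Longrightarrow> Kpt (T2 w) (R1 w) = \<i> + w"
    "Re w = 0 \<Longrightarrow> w \<noteq> 0 \<Longrightarrow> Kpt (T2 w) (R1 w) = Complex 1 1 + w" "w = 0 \<Longrightarrow> Kpt (T2 w) (R1 w) = Complex 0 \<delta>"
proof -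
  have n: "n1 w = Re w - Im w" using assms by (simp add: n1_def)
  have eq: "T2 w - (3 + R1 w) = Re w / r" "T2 w - (2 + 2 * R1 w) = (n1 w + Re w) / r" "T2 w - (1 + 3 * R1 w) = (2 * n1 w + Re w) / r"
     "4 - T2 w = - Im w / r"
    using r_pos by (auto simp: T2_def R1_def n field_simps)
  show le: "3 + R1 w \<le> T2 w" "T2 w \<le> 4"
    using eq(1,4) assms r_pos by (smt (verit) divide_nonneg_pos)+
  have gen: "om ((T2 w - 4 * R1 w) / (1 - R1 w)) = Complex (Re w / n1 w) (Re w / n1 w - 1)" "T2 w > 1 + 3 * R1 w" "T2 w > 2 + 2 * R1 w" "n1 w > 0" if "w \<noteq> 0"
  proof -
    show n0: "n1 w > 0" using that n1_pos[of w] by linarith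
    show "T2 w > 1 + 3 * R1 w" "T2 w > 2 + 2 * R1 w" using eq(2,3) n0 assms r_pos by (smt (verit) divide_pos_pos)+
    have "(T2 w - 4 * R1 w) / (1 - R1 w) = 3 + Re w / n1 w"
      using n0 r_pos by (simp add: T2_def R1_def field_simps)
    moreover have "om (3 + Re w / n1 w) = Complex (Re w / n1 w) (Re w / n1 w - 1)"
      using om_quadrants(4)[of "3 + Re w / n1 w"] n0 assms n by (simp add: divide_le_eq)
    ultimately show "om ((T2 w - 4 * R1 w) / (1 - R1 w)) = Complex (Re w / n1 w) (Re w / n1 w - 1)" by simp
  qed
  show "Kpt (T2 w) (R1 w) = \<i> + w" if "0 < Re w"
  proof -
    have w: "w \<noteq> 0" using that by auto
    have "T2 w > 3 + R1 w" using eq(1) that r_pos by (smt (verit) divide_pos_pos)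
    then have "Kpt (T2 w) (R1 w) = \<i> + of_real (n1 w) * Complex (Re w / n1 w) (Re w / n1 w - 1)"
      using gen[OF w] by (simp add: Kpt_def corner_scale)
    then show ?thesis using gen(4)[OF w] n by (simp add: complex_eq_iff right_diff_distrib)
  qed
  show "Kpt (T2 w) (R1 w) = Complex 1 1 + w" if "Re w = 0" "w \<noteq> 0"
  proof -
    have "T2 w = 3 + R1 w" using eq(1) that by simp
    then have "T2 w \<le> 3 + R1 w" by simp
    then have "Kpt (T2 w) (R1 w) = Complex 1 1 + of_real (n1 w) * Complex (Re w / n1 w) (Re w / n1 w - 1)"
      using gen[OF that(2)] by (simp add: Kpt_def corner_scale)
    then show ?thesis using gen(4)[OF that(2)] that n by (simp add: complex_eq_iff right_diff_distrib)
  qed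
  show "Kpt (T2 w) (R1 w) = Complex 0 \<delta>" if "w = 0"
    using that by (simp add: Kpt_def T2_def R1_def n1_def om_def complex_eq_iff)
qed

lemma edg_far: "1 / 4 \<le> u \<Longrightarrow> edg u = u"
  using r by (simp add: edg_def)

lemma edg_near: "u \<le> r \<Longrightarrow> edg u = \<delta> + u * (r - \<delta>) / r"
  by (simp add: edg_def)

lemma zone_unique:
  assumes "0 \<le> Re z" "Re z \<le> 1" "0 \<le> Im z" "Im z \<le> 1"
  shows "n1 z \<le> r \<Longrightarrow> r < n1 (z - 1) \<and> r < n1 (z - Complex 1 1) \<and> r < n1 (z - \<i>)"
    "n1 (z - 1) \<le> r \<Longrightarrow> r < n1 z \<and> r < n1 (z - Complex 1 1) \<and> r < n1 (z - \<i>)"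
    "n1 (z - Complex 1 1) \<le> r \<Longrightarrow> r < n1 z \<and> r < n1 (z - 1) \<and> r < n1 (z - \<i>)"
    "n1 (z - \<i>) \<le> r \<Longrightarrow> r < n1 z \<and> r < n1 (z - 1) \<and> r < n1 (z - Complex 1 1)"
  using assms r by (auto simp: n1_def)

lemma L_zones:
  assumes "0 \<le> Re z" "Re z \<le> 1" "0 \<le> Im z" "Im z \<le> 1"
  shows "n1 z \<le> r \<Longrightarrow> L z = ring (T0 z) (R0 z)"
    "n1 (z - 1) \<le> r \<Longrightarrow> L z = 1 + ring (T1 (z - 1)) (R1 (z - 1))"
    "n1 (z - Complex 1 1) \<le> r \<Longrightarrow> L z = Complex 1 1 + ring (T2 (z - Complex 1 1)) (R1 (z - Complex 1 1))"
    "n1 (z - \<i>) \<le> r \<Longrightarrow> L z = \<i> + ring (T2 (z - \<i>)) (R1 (z - \<i>))"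
  using zone_unique[OF assms] by (auto simp: L_def)

lemma corners_lat: "1 \<in> lat" "Complex 1 1 \<in> lat" "\<i> \<in> lat" "0 \<in> lat"
  by (auto simp: lat_def)

text \<open>The usual torus gluing, with \<open>edg\<close> compensating for the shortened bottom
  and left sides. It identifies the two ends of the oblique side, which thereby becomes the boundary
  circle of a one-holed torus.\<close>

definition "gl x y \<longleftrightarrow> (\<exists>u\<in>{0..1}. (x = Complex (edg u) 0 \<and> y = Complex u 1) \<or> (x = Complex 0 (edg u) \<and> y = Complex 1 u))"

lemma edg_range: "0 \<le> u \<Longrightarrow> u \<le> 1 \<Longrightarrow> \<delta> \<le> edg u \<and> edg u \<le> 1"
proof -
  assume u: "0 \<le> u" "u \<le> 1"
  have "u \<le> r \<Longrightarrow> u * (r - \<delta>) / r \<le> r - \<delta>" using del u r_pos by (simp add: divide_le_eq mult.commute mult_left_mono)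
  moreover have "0 \<le> u * (r - \<delta>) / r" using del u r_pos by simp
  ultimately show ?thesis using del r u by (auto simp: edg_def)
qed

text \<open>Near the ends of a side both images are translates of the same ring point, with
  \<open>ring_4\<close> where the parameters 0 and 4 meet; in between \<open>L\<close> is the
  identity and the points differ by a period.\<close>

lemma L_gl: assumes "gl x y" shows "L x - L y \<in> lat"
proof -
  obtain u where u: "0 \<le> u" "u \<le> 1" and xy: "(x = Complex (edg u) 0 \<and> y = Complex u 1) \<or> (x = Complex 0 (edg u) \<and> y = Complex 1 u)"
    using assms by (auto simp: gl_def)
  note eb = edg_range[OF u]
  have box: "0 \<le> Re x \<and> Re x \<le> 1 \<and> 0 \<le> Im x \<and> Im x \<le> 1" "0 \<le> Re y \<and> Re y \<le> 1 \<and> 0 \<le> Im y \<and> Im y \<le> 1"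
    using xy u eb del by auto
  note Lx = L_zones[of x] and Ly = L_zones[of y]
  consider "u \<le> r" | "r < u" "u < 1 - r" | "1 - r \<le> u" by linarith
  then show ?thesis
  proof cases
    case 1
    have e: "edg u \<le> r" "edg u > 0" "(r - edg u) / (r - \<delta>) = 1 - u / r"
    proof -
      show eu: "edg u > 0" using eb del by linarith
      have "r - edg u = (r - \<delta>) * (1 - u / r)" using 1 r_pos by (simp add: edg_near field_simps)
      then show "(r - edg u) / (r - \<delta>) = 1 - u / r" using del by simp
      have "(r - \<delta>) * (1 - u / r) \<ge> 0" using del 1 r_pos by simp
      then show "edg u \<le> r" using \<open>r - edg u = (r - \<delta>) * (1 - u / r)\<close> by simp
    qed
    from xy show ?thesis
    proof
      assume a: "x = Complex (edg u) 0 \<and> y = Complex u 1"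
      have "L x = ring 0 (1 - u / r)" using Lx(1) box a e by (simp add: n1_def T0_def R0_def)
      moreover have "L y = \<i> + ring 4 (1 - u / r)" using Ly(4) box a 1 u r_pos by (simp add: n1_def T2_def R1_def)
      ultimately show ?thesis using lat_minus[OF corners_lat(3)] by (simp add: ring_4)
    next
      assume a: "x = Complex 0 (edg u) \<and> y = Complex 1 u"
      have "L x = ring (1 + 3 * (1 - u / r)) (1 - u / r)" using Lx(1) box a e by (simp add: n1_def T0_def R0_def)
      moreover have "L y = 1 + ring (4 - 3 * u / r) (1 - u / r)" using Ly(2) box a 1 u r_pos by (simp add: n1_def T1_def R1_def)
      moreover have "1 + 3 * (1 - u / r) = 4 - 3 * u / r" by (simp add: algebra_simps)
      ultimately show ?thesis using lat_minus[OF corners_lat(1)] by simp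
    qed
  next
    case 2
    then have "edg u = u" by (simp add: edg_def)
    then have "r < n1 z \<and> r < n1 (z - 1) \<and> r < n1 (z - Complex 1 1) \<and> r < n1 (z - \<i>)" if "z = x \<or> z = y" for z
      using that xy 2 u r by (elim disjE conjE) (simp_all add: n1_def)
    then have "L x = x" "L y = y" unfolding L_def by (simp_all add: not_le[symmetric])
    then show ?thesis using xy \<open>edg u = u\<close> by (auto simp: lat_def)
  next
    case 3
    then have eu: "edg u = u" using r by (intro edg_far) simp
    from xy show ?thesis
    proof
      assume a: "x = Complex (edg u) 0 \<and> y = Complex u 1"
      have "L x = 1 + ring (4 - 2 * (1 - u) / r) (1 - (1 - u) / r)" using Lx(2) box a eu 3 u by (simp add: n1_def T1_def R1_def algebra_simps)
      moreover have "L y = Complex 1 1 + ring (4 - 2 * (1 - u) / r) (1 - (1 - u) / r)" using Ly(3) box a 3 u by (simp add: n1_def T2_def R1_def algebra_simps)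
      ultimately show ?thesis using lat_diff[OF corners_lat(1,2)] by simp
    next
      assume a: "x = Complex 0 (edg u) \<and> y = Complex 1 u"
      have "L x = \<i> + ring (4 - (1 - u) / r) (1 - (1 - u) / r)" using Lx(4) box a eu 3 u by (simp add: n1_def T2_def R1_def algebra_simps)
      moreover have "L y = Complex 1 1 + ring (4 - (1 - u) / r) (1 - (1 - u) / r)" using Ly(3) box a 3 u by (simp add: n1_def T2_def R1_def algebra_simps)
      ultimately show ?thesis using lat_diff[OF corners_lat(3,2)] by simp
    qed
  qed
qed

text \<open>On the circles \<open>n1 = r\<close> around the corners the ring coordinate is 0, so
  each corner formula reduces to the identity there. These are the matching conditions for
  continuity of \<open>L\<close>.\<close>

lemma L_edge:
  assumes "z \<in> Pent" "r \<le> n1 z" "r \<le> n1 (z - 1)" "r \<le> n1 (z - Complex 1 1)" "r \<le> n1 (z - \<i>)"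
  shows "L z = z"
proof -
  have box: "0 \<le> Re z" "Re z \<le> 1" "0 \<le> Im z" "Im z \<le> 1" using assms(1) by (auto simp: Pent_def)
  note Z = L_zones[OF box]
  consider "n1 z = r" | "n1 (z - 1) = r" | "n1 (z - Complex 1 1) = r" | "n1 (z - \<i>) = r"
    | "r < n1 z \<and> r < n1 (z - 1) \<and> r < n1 (z - Complex 1 1) \<and> r < n1 (z - \<i>)" using assms by linarith
  then show ?thesis
  proof cases
    case 1
    then have "z \<noteq> 0" using r_pos by (auto simp: n1_def)
    from om_upper(3)[OF box(3) this] show ?thesis using Z(1) 1 by (simp add: R0_def T0_def ring_0)
  next
    case 2
    then have "z - 1 \<noteq> 0" "0 \<le> Im (z - 1)" using r_pos box by (auto simp: n1_def)
    moreover have "T1 (z - 1) = 1 - Re (z - 1) / n1 (z - 1)" using 2 r_pos by (simp add: T1_def field_simps)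
    ultimately show ?thesis using om_upper(3)[of "z - 1"] Z(2) 2 r_pos by (simp add: R1_def ring_0)
  next
    case 3
    then have "z - Complex 1 1 \<noteq> 0" "Im (z - Complex 1 1) \<le> 0" using r_pos box by (auto simp: n1_def)
    moreover have "T2 (z - Complex 1 1) = 3 + Re (z - Complex 1 1) / n1 (z - Complex 1 1)" using 3 r_pos by (simp add: T2_def field_simps)
    ultimately show ?thesis using om_lower(3)[of "z - Complex 1 1"] Z(3) 3 r_pos by (simp add: R1_def ring_0)
  next
    case 4
    then have "z - \<i> \<noteq> 0" "Im (z - \<i>) \<le> 0" using r_pos box by (auto simp: n1_def)
    moreover have "T2 (z - \<i>) = 3 + Re (z - \<i>) / n1 (z - \<i>)" using 4 r_pos by (simp add: T2_def field_simps)
    ultimately show ?thesis using om_lower(3)[of "z - \<i>"] Z(4) 4 r_pos by (simp add: R1_def ring_0)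
  next
    case 5 then show ?thesis by (simp add: L_def)
  qed
qed

lemma continuous_ring: "continuous_on S f \<Longrightarrow> continuous_on S g \<Longrightarrow> continuous_on S (\<lambda>x. ring (f x) (g x))"
  unfolding ring_def
  by (intro continuous_intros continuous_on_compose2[OF eta_cont] continuous_on_compose2[OF continuous_om[of UNIV]]) auto

lemma continuous_L: "continuous_on Pent L"
  unfolding L_def
proof (intro continuous_on_cases_le)
  let ?S = "Pent"
  show "continuous_on {t \<in> ?S. n1 t \<le> r} (\<lambda>z. ring (T0 z) (R0 z))"
    unfolding T0_def R0_def using del n1_pos
    by (intro continuous_ring continuous_intros) (auto simp: Pent_def complex_eq_iff)
  fix t assume t: "t \<in> Pent" "n1 t = r"
  then have box: "0 \<le> Re t" "Re t \<le> 1" "0 \<le> Im t" "Im t \<le> 1" by (auto simp: Pent_def)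
  note U = zone_unique(1)[OF box]
  have "L t = t" using U t by (intro L_edge) auto
  then have "ring (T0 t) (R0 t) = t" using L_zones(1)[OF box] t by simp
  then show "ring (T0 t) (R0 t) = (if n1 (t - 1) \<le> r then 1 + ring (T1 (t - 1)) (R1 (t - 1))
     else if n1 (t - Complex 1 1) \<le> r then Complex 1 1 + ring (T2 (t - Complex 1 1)) (R1 (t - Complex 1 1))
     else if n1 (t - \<i>) \<le> r then \<i> + ring (T2 (t - \<i>)) (R1 (t - \<i>)) else t)" using U t by auto
next
  show "continuous_on {t \<in> {t \<in> Pent. r \<le> n1 t}. n1 (t - 1) \<le> r} (\<lambda>z. 1 + ring (T1 (z - 1)) (R1 (z - 1)))"
    unfolding T1_def R1_def using r_pos by (intro continuous_ring continuous_intros) auto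
  fix t assume t: "t \<in> {t \<in> Pent. r \<le> n1 t}" "n1 (t - 1) = r"
  then have box: "0 \<le> Re t" "Re t \<le> 1" "0 \<le> Im t" "Im t \<le> 1" by (auto simp: Pent_def)
  note U = zone_unique(2)[OF box]
  have "L t = t" using U t by (intro L_edge) auto
  then have "1 + ring (T1 (t - 1)) (R1 (t - 1)) = t" using L_zones(2)[OF box] t by simp
  then show "1 + ring (T1 (t - 1)) (R1 (t - 1)) = (if n1 (t - Complex 1 1) \<le> r then Complex 1 1 + ring (T2 (t - Complex 1 1)) (R1 (t - Complex 1 1))
     else if n1 (t - \<i>) \<le> r then \<i> + ring (T2 (t - \<i>)) (R1 (t - \<i>)) else t)" using U t by auto
next
  show "continuous_on {t \<in> {t \<in> {t \<in> Pent. r \<le> n1 t}. r \<le> n1 (t - 1)}. n1 (t - Complex 1 1) \<le> r} (\<lambda>z. Complex 1 1 + ring (T2 (z - Complex 1 1)) (R1 (z - Complex 1 1)))"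
    unfolding T2_def R1_def using r_pos by (intro continuous_ring continuous_intros) auto
  fix t assume t: "t \<in> {t \<in> {t \<in> Pent. r \<le> n1 t}. r \<le> n1 (t - 1)}" "n1 (t - Complex 1 1) = r"
  then have box: "0 \<le> Re t" "Re t \<le> 1" "0 \<le> Im t" "Im t \<le> 1" by (auto simp: Pent_def)
  note U = zone_unique(3)[OF box]
  have "L t = t" using U t by (intro L_edge) auto
  then have "Complex 1 1 + ring (T2 (t - Complex 1 1)) (R1 (t - Complex 1 1)) = t" using L_zones(3)[OF box] t by simp
  then show "Complex 1 1 + ring (T2 (t - Complex 1 1)) (R1 (t - Complex 1 1)) = (if n1 (t - \<i>) \<le> r then \<i> + ring (T2 (t - \<i>)) (R1 (t - \<i>)) else t)"
    using U t by auto
next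
  show "continuous_on {t \<in> {t \<in> {t \<in> {t \<in> Pent. r \<le> n1 t}. r \<le> n1 (t - 1)}. r \<le> n1 (t - Complex 1 1)}. n1 (t - \<i>) \<le> r} (\<lambda>z. \<i> + ring (T2 (z - \<i>)) (R1 (z - \<i>)))"
    unfolding T2_def R1_def using r_pos by (intro continuous_ring continuous_intros) auto
  fix t assume t: "t \<in> {t \<in> {t \<in> {t \<in> Pent. r \<le> n1 t}. r \<le> n1 (t - 1)}. r \<le> n1 (t - Complex 1 1)}" "n1 (t - \<i>) = r"
  then have box: "0 \<le> Re t" "Re t \<le> 1" "0 \<le> Im t" "Im t \<le> 1" by (auto simp: Pent_def)
  have "L t = t" using t by (intro L_edge) auto
  then show "\<i> + ring (T2 (t - \<i>)) (R1 (t - \<i>)) = t" using L_zones(4)[OF box] t by simp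
qed (intro continuous_intros)+

lemma compact_Pent: "compact Pent" and convex_Pent: "convex Pent"
proof -
  have eq: "Pent = cbox 0 (Complex 1 1) \<inter> {z. \<delta> \<le> Complex 1 1 \<bullet> z}"
    by (auto simp: Pent_def in_cbox_complex_iff inner_complex_def)
  show "compact Pent" unfolding eq by (intro compact_Int_closed compact_cbox closed_halfspace_ge)
  show "convex Pent" unfolding eq by (intro convex_Int convex_box convex_halfspace_ge)
qed

section \<open>The gluing of \<open>Pent\<close> is congruence of \<open>L\<close> modulo the
  lattice\<close>

context
  fixes q :: "complex \<Rightarrow> 'x"
  assumes q_gl: "\<And>x y. gl x y \<Longrightarrow> q x = q y"
begin

lemma q_vertices: "q (Complex \<delta> 0) = q 1" "q (Complex 0 \<delta>) = q 1" "q (Complex 1 1) = q 1" "q \<i> = q 1"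
proof -
  have e: "edg 0 = \<delta>" "edg 1 = 1" using r r_pos by (auto simp: edg_def)
  have "gl (Complex \<delta> 0) (Complex 0 1)" "gl (Complex 0 \<delta>) (Complex 1 0)" "gl (Complex 1 0) (Complex 1 1)" "gl (Complex 0 1) (Complex 1 1)"
    unfolding gl_def using e by (metis atLeastAtMost_iff order_refl zero_le_one)+
  then have "q (Complex \<delta> 0) = q (Complex 0 1)" "q (Complex 0 \<delta>) = q (Complex 1 0)" "q (Complex 1 0) = q (Complex 1 1)" "q (Complex 0 1) = q (Complex 1 1)"
    using q_gl by blast+
  moreover have "Complex 1 0 = 1" "Complex 0 1 = \<i>" by (simp_all add: complex_eq_iff)
  ultimately show "q (Complex \<delta> 0) = q 1" "q (Complex 0 \<delta>) = q 1" "q (Complex 1 1) = q 1" "q \<i> = q 1" by simp_all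
qed

lemma q_gl1: "0 \<le> u \<Longrightarrow> u \<le> 1 \<Longrightarrow> q (Complex (edg u) 0) = q (Complex u 1)"
  and q_gl2: "0 \<le> u \<Longrightarrow> u \<le> 1 \<Longrightarrow> q (Complex 0 (edg u)) = q (Complex 1 u)"
  unfolding gl_def by (auto intro!: q_gl[unfolded gl_def] bexI[of _ u])

text \<open>A normal form up to gluing. \<open>Kpt\<close> inverts the ring coordinates only up to
  the choice of a side between neighbouring sectors, which \<open>q\<close> does not see; this is
  why the value of \<open>q\<close> and not the point itself is recorded.\<close>

lemma zone_rep:
  assumes "x \<in> Pent"
  shows "(\<exists>a \<theta> \<rho>. a \<in> lat \<and> 0 \<le> \<theta> \<and> \<theta> \<le> 4 \<and> 0 < \<rho> \<and> \<rho> \<le> 1 \<and> L x = a + ring \<theta> \<rho> \<and> q x = q (Kpt \<theta> \<rho>))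
    \<or> (L x = x \<and> (\<forall>a\<in>lat. r \<le> n1 (x - a)))"
proof -
  have box: "0 \<le> Re x" "Re x \<le> 1" "0 \<le> Im x" "Im x \<le> 1" using assms by (auto simp: Pent_def)
  note Z = L_zones[OF box]
  let ?R = "\<exists>a \<theta> \<rho>. a \<in> lat \<and> 0 \<le> \<theta> \<and> \<theta> \<le> 4 \<and> 0 < \<rho> \<and> \<rho> \<le> 1 \<and> L x = a + ring \<theta> \<rho> \<and> q x = q (Kpt \<theta> \<rho>)"
  have R: ?R if "a \<in> lat" "0 \<le> \<theta>" "\<theta> \<le> 4" "0 < \<rho>" "\<rho> \<le> 1" "L x = a + ring \<theta> \<rho>" "q x = q (Kpt \<theta> \<rho>)" for a \<theta> \<rho>
    using that by blast
  consider "n1 x < r" | "n1 (x - 1) < r" | "n1 (x - Complex 1 1) < r" | "n1 (x - \<i>) < r"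
    | "r \<le> n1 x" "r \<le> n1 (x - 1)" "r \<le> n1 (x - Complex 1 1)" "r \<le> n1 (x - \<i>)" by linarith
  then show ?thesis
  proof cases
    case 1
    then show ?thesis using corner0[OF assms] Z(1) R[of 0 "T0 x" "R0 x"] lat_0 by simp
  next
    case 2
    define w where "w = x - 1"
    have w: "Re w \<le> 0" "0 \<le> Im w" "n1 w \<le> r" "n1 w < r" "x = 1 + w" using box 2 by (auto simp: w_def)
    note C = corner1[OF w(1,2,3)]
    have R1: "0 < R1 w" "R1 w \<le> 1" using R1_range[OF w(3)] w(4) by auto
    have "q x = q (Kpt (T1 w) (R1 w))"
    proof (cases "Re w = 0")
      case True
      have "n1 w \<le> 1" "0 \<le> n1 w" "x = Complex 1 (n1 w)" using w r True by (auto simp: n1_def complex_eq_iff)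
      then show ?thesis using C(4)[OF True] q_gl2[of "n1 w"] by simp
    next
      case False then show ?thesis using C(3) w by simp
    qed
    then show ?thesis using R[of 1 "T1 w" "R1 w"] R1 C(1,2) Z(2) 2 corners_lat(1) by (simp add: w_def)
  next
    case 3
    define w where "w = x - Complex 1 1"
    have w: "Re w \<le> 0" "Im w \<le> 0" "n1 w \<le> r" "n1 w < r" "x = Complex 1 1 + w" using box 3 by (auto simp: w_def)
    note C = corner2[OF w(1,2,3)]
    have R1: "0 < R1 w" "R1 w \<le> 1" using R1_range[OF w(3)] w(4) by auto
    have "q x = q (Kpt (T2 w) (R1 w))"
    proof -
      consider "w = 0" | "Im w = 0" "w \<noteq> 0" | "Im w < 0" using w(2) by linarith
      then show ?thesis
      proof cases
        case 1 then show ?thesis using C(5) w(5) q_vertices by simp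
      next
        case 2
        have "edg (1 + Re w) = 1 + Re w" using w r by (intro edg_far) (simp add: n1_def)
        moreover have "1 + w = Complex (1 + Re w) 0" "x = Complex (1 + Re w) 1" using 2 w(5) by (auto simp: complex_eq_iff)
        ultimately show ?thesis using C(4)[OF 2] q_gl1[of "1 + Re w"] w r 2 by (simp add: n1_def)
      next
        case 3 then show ?thesis using C(3) w(5) by simp
      qed
    qed
    then show ?thesis using R[of "Complex 1 1" "T2 w" "R1 w"] R1 C(1,2) Z(3) 3 corners_lat(2) by (simp add: w_def)
  next
    case 4
    define w where "w = x - \<i>"
    have w: "0 \<le> Re w" "Im w \<le> 0" "n1 w \<le> r" "n1 w < r" "x = \<i> + w" using box 4 by (auto simp: w_def)
    note C = corner3[OF w(1,2,3)]
    have R1: "0 < R1 w" "R1 w \<le> 1" using R1_range[OF w(3)] w(4) by auto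
    have "q x = q (Kpt (T2 w) (R1 w))"
    proof -
      consider "w = 0" | "Re w = 0" "w \<noteq> 0" | "Re w > 0" using w(1) by linarith
      then show ?thesis
      proof cases
        case 1 then show ?thesis using C(5) w(5) q_vertices by simp
      next
        case 2
        have "edg (1 + Im w) = 1 + Im w" using w r by (intro edg_far) (simp add: n1_def)
        moreover have "x = Complex 0 (1 + Im w)" "Complex 1 1 + w = Complex 1 (1 + Im w)" using 2 w(5) by (auto simp: complex_eq_iff)
        ultimately show ?thesis using C(4)[OF 2] q_gl2[of "1 + Im w"] w r 2 by (simp add: n1_def)
      next
        case 3 then show ?thesis using C(3) w(5) by simp
      qed
    qed
    then show ?thesis using R[of "\<i>" "T2 w" "R1 w"] R1 C(1,2) Z(4) 4 corners_lat(3) by (simp add: w_def)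
  next
    case 5
    have "r \<le> n1 (x - a)" if "a \<in> lat" for a
    proof -
      obtain m n :: int where mn: "Re a = m" "Im a = n" using lat_cases[OF \<open>a \<in> lat\<close>] by auto
      have *: "\<bar>t\<bar> \<le> \<bar>t - of_int m\<bar> \<or> \<bar>t - 1\<bar> \<le> \<bar>t - of_int m\<bar>" if "0 \<le> t" "t \<le> 1" for t :: real and m :: int
      proof (cases "m \<le> 0")
        case True then have "of_int m \<le> (0::real)" by simp
        then show ?thesis using that by linarith
      next
        case False then have "1 \<le> (of_int m :: real)" by simp
        then show ?thesis using that by linarith
      qed
      show ?thesis using 5 *[OF box(1,2), of m] *[OF box(3,4), of n] mn by (auto simp: n1_def)
    qed
    then show ?thesis using L_edge[OF assms 5] by blast
  qed
qed

text \<open>The ring closes up along the glued horizontal sides: parameter 0 lies on the bottom side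
  and parameter 4 on the top side; for \<open>\<rho> = 1\<close> both are vertices.\<close>

lemma q_Kpt_loop: assumes "0 < \<rho>" "\<rho> \<le> 1" shows "q (Kpt 0 \<rho>) = q (Kpt 4 \<rho>)"
proof (cases "\<rho> = 1")
  case True
  then have "Kpt 0 \<rho> = Complex \<delta> 0" "Kpt 4 \<rho> = Complex 0 \<delta>" by (auto simp: Kpt_def om_def complex_eq_iff)
  then show ?thesis using q_vertices by simp
next
  case False
  then have f: "\<rho> < 1" using assms by simp
  define u where "u = r * (1 - \<rho>)"
  have u: "0 \<le> u" "u \<le> 1" "u \<le> r" 
  proof -
    have "r * (1 - \<rho>) \<le> r * 1" using assms r_pos by (intro mult_left_mono) auto
    then show "u \<le> r" by (simp add: u_def)
    then show "u \<le> 1" using r by simp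
    show "0 \<le> u" using f r_pos by (simp add: u_def)
  qed
  have "r * (1 - \<rho>) * (r - \<delta>) / r = (1 - \<rho>) * (r - \<delta>)" using r_pos by simp
  then have "edg u = r - \<rho> * (r - \<delta>)" using edg_near[OF u(3)] unfolding u_def by (simp add: algebra_simps)
  then have "Kpt 0 \<rho> = Complex (edg u) 0" using assms by (simp add: Kpt_def om_def complex_eq_iff)
  moreover have "(4 - 4 * \<rho>) / (1 - \<rho>) = 4" using f by (simp add: field_simps)
  then have "Kpt 4 \<rho> = Complex u 1" using f assms by (simp add: Kpt_def om_def complex_eq_iff u_def)
  ultimately show ?thesis using q_gl1 u by simp
qed

text \<open>Converse of \<open>L_gl\<close>. Congruent ring points are equal, being short, and so
  have the same coordinates up to closing the loop; a ring point is never congruent to a far point;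
  and two congruent far points are equal or lie on opposite sides of the square.\<close>

lemma q_of_L: assumes x: "x \<in> Pent" and y: "y \<in> Pent" and L: "L x - L y \<in> lat" shows "q x = q y"
proof -
  let ?R = "\<lambda>x a \<theta> \<rho>. a \<in> lat \<and> 0 \<le> \<theta> \<and> \<theta> \<le> 4 \<and> 0 < \<rho> \<and> \<rho> \<le> 1 \<and> L x = a + ring \<theta> \<rho> \<and> q x = q (Kpt \<theta> \<rho>)"
  have mixed: False if "?R x a \<theta> \<rho>" "L y = y" "\<forall>a\<in>lat. r \<le> n1 (y - a)" "L x - L y \<in> lat" for x y a \<theta> \<rho>
  proof -
    have "y - ring \<theta> \<rho> = a - (L x - L y)" using that by (simp add: algebra_simps)
    moreover have "a - (L x - L y) \<in> lat" using lat_diff[of a "L x - L y"] that by blast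
    ultimately have "y - ring \<theta> \<rho> \<in> lat" by simp
    then have "r \<le> n1 (ring \<theta> \<rho>)" using that(3) by force
    moreover have "n1 (ring \<theta> \<rho>) < r" using that n1_ring[of \<rho> \<theta>] rad_ring(3)[of \<rho> \<theta>] by simp
    ultimately show False by simp
  qed
  let ?far = "\<lambda>x. L x = x \<and> (\<forall>a\<in>lat. r \<le> n1 (x - a))"
  have Zx: "(\<exists>a \<theta> \<rho>. ?R x a \<theta> \<rho>) \<or> ?far x" and Zy: "(\<exists>a \<theta> \<rho>. ?R y a \<theta> \<rho>) \<or> ?far y"
    using zone_rep x y by blast+
  consider "\<not> ?far x" "\<not> ?far y" | "\<not> ?far x" "?far y" | "?far x" "\<not> ?far y" | "?far x" "?far y" by argo
  then show ?thesis
  proof cases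
    case 1
    have "\<exists>a \<theta> \<rho>. ?R x a \<theta> \<rho>" "\<exists>a \<theta> \<rho>. ?R y a \<theta> \<rho>" using Zx Zy 1 by argo+
    then obtain a \<theta> \<rho> b \<theta>' \<rho>' where x1: "?R x a \<theta> \<rho>" and y1: "?R y b \<theta>' \<rho>'" by (elim exE) (erule that)
    note 1 = x1 y1
    have "ring \<theta> \<rho> - ring \<theta>' \<rho>' = (L x - L y) - (a - b)" using 1 by simp
    moreover have "(L x - L y) - (a - b) \<in> lat" using lat_diff[OF L lat_diff[of a b]] 1 by blast
    ultimately have "ring \<theta> \<rho> - ring \<theta>' \<rho>' \<in> lat" by simp
    moreover have "n1 (ring \<theta> \<rho> - ring \<theta>' \<rho>') < 1"
    proof -
      have "n1 (ring \<theta> \<rho>) \<le> r" "n1 (ring \<theta>' \<rho>') \<le> r"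
        using 1 n1_ring[of \<rho> \<theta>] rad_ring(2)[of \<rho> \<theta>] n1_ring[of \<rho>' \<theta>'] rad_ring(2)[of \<rho>' \<theta>'] by auto
      then show ?thesis using n1_triangle(2)[of "ring \<theta> \<rho>" "ring \<theta>' \<rho>'"] r by linarith
    qed
    ultimately have "ring \<theta> \<rho> = ring \<theta>' \<rho>'" using n1_lat by fastforce
    then have "\<rho> = \<rho>'" "\<theta> = \<theta>' \<or> \<theta> = 0 \<and> \<theta>' = 4 \<or> \<theta> = 4 \<and> \<theta>' = 0" using ring_eq[of \<rho> \<theta> \<rho>' \<theta>'] 1 by auto
    then show ?thesis using 1 q_Kpt_loop[of \<rho>] by auto
  next
    case 2
    have "\<exists>a \<theta> \<rho>. ?R x a \<theta> \<rho>" using Zx 2 by argo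
    then obtain a \<theta> \<rho> where "?R x a \<theta> \<rho>" by (elim exE) (erule that)
    from mixed[OF this _ _ L] show ?thesis using 2(2) by blast
  next
    case 3
    have "\<exists>a \<theta> \<rho>. ?R y a \<theta> \<rho>" using Zy 3 by argo
    then obtain a \<theta> \<rho> where R: "?R y a \<theta> \<rho>" by (elim exE) (erule that)
    have "L y - L x \<in> lat" using L lat_diff_commute by blast
    from mixed[OF R _ _ this] show ?thesis using 3(1) by blast
  next
    case 4
    have xy: "x - y \<in> lat" using L 4 by simp
    have bx: "0 \<le> Re x" "Re x \<le> 1" "0 \<le> Im x" "Im x \<le> 1" and bY: "0 \<le> Re y" "Re y \<le> 1" "0 \<le> Im y" "Im y \<le> 1"
      using x y by (auto simp: Pent_def)
    obtain m n :: int where mn: "Re x - Re y = m" "Im x - Im y = n" using lat_cases[OF xy] by auto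
    have m: "m = -1 \<or> m = 0 \<or> m = 1" "n = -1 \<or> n = 0 \<or> n = 1" using mn bx bY by linarith+
    have e: "edg t = t" if "r \<le> t" for t using that r_pos del by (auto simp: edg_def)
    have far: "r \<le> n1 z" "r \<le> n1 (z - 1)" "r \<le> n1 (z - \<i>)" "r \<le> n1 (z - Complex 1 1)" if "z = x \<or> z = y" for z
      using that 4 corners_lat by auto
    have nn: "m = 0 \<or> n = 0"
    proof (rule ccontr)
      assume "\<not> (m = 0 \<or> n = 0)"
      then have "(Re x = 0 \<or> Re x = 1) \<and> (Im x = 0 \<or> Im x = 1)" using m mn bx bY by auto
      then show False using far[of x] r_pos by (auto simp: n1_def)
    qed
    show ?thesis
    proof (cases "m = 0")
      case True
      show ?thesis
      proof (cases "n = 0")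
        case t: True
        then have "x = y" using mn True by (simp add: complex_eq_iff)
        then show ?thesis by simp
      next
        case False
        then have "Im x = 0 \<and> Im y = 1 \<or> Im x = 1 \<and> Im y = 0" "Re x = Re y" using m mn bx bY True by auto
        moreover have "r \<le> Re x" "r \<le> Re y" using calculation far(1)[of x] far(1)[of y] bx bY by (auto simp: n1_def)
        then have "q (Complex (Re x) 0) = q (Complex (Re x) 1)" using q_gl1[of "Re x"] bx e by simp
        ultimately show ?thesis by (metis complex_surj)
      qed
    next
      case False
      then have "Re x = 0 \<and> Re y = 1 \<or> Re x = 1 \<and> Re y = 0" "Im x = Im y" using m mn bx bY nn by auto
      moreover have "r \<le> Im x" "r \<le> Im y" using calculation far(1)[of x] far(1)[of y] bx bY by (auto simp: n1_def)
      then have "q (Complex 0 (Im x)) = q (Complex 1 (Im x))" using q_gl2[of "Im x"] bx e by simp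
      ultimately show ?thesis by (metis complex_surj)
    qed
  qed
qed

end

lemma Kpt_onto:
  assumes "0 \<le> \<theta>" "\<theta> \<le> 4" "0 \<le> \<rho>" "\<rho> \<le> 1" shows "\<exists>x\<in>Pent. L x - ring \<theta> \<rho> \<in> lat"
proof -
  have Pent_I: "z \<in> Pent" if "0 \<le> Re z" "Re z \<le> 1" "0 \<le> Im z" "Im z \<le> 1" "\<delta> \<le> Re z + Im z" for z
    using that by (simp add: Pent_def)
  show ?thesis
  proof (cases "\<theta> \<le> 1 + 3 * \<rho>")
    case True
    define \<sigma> where "\<sigma> = \<theta> / (1 + 3 * \<rho>)"
    have s: "0 \<le> \<sigma>" "\<sigma> \<le> 1" using assms True by (auto simp: \<sigma>_def)
    define n where "n = r - \<rho> * (r - \<delta>)"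
    have n: "\<delta> \<le> n" "n \<le> r"
    proof -
      have "\<rho> * (r - \<delta>) \<le> 1 * (r - \<delta>)" "0 \<le> \<rho> * (r - \<delta>)" using assms del by (auto intro!: mult_right_mono)
      then show "\<delta> \<le> n" "n \<le> r" by (auto simp: n_def)
    qed
    define z where "z = of_real n * om \<sigma>"
    have z: "Re z = n * (1 - \<sigma>)" "Im z = n * \<sigma>" using om_quadrants(1)[OF s] by (auto simp: z_def)
    have zp: "0 \<le> Re z" "0 \<le> Im z" "Re z + Im z = n" "n1 z = n"
    proof -
      show a: "0 \<le> Re z" "0 \<le> Im z" unfolding z using s n del by auto
      show b: "Re z + Im z = n" by (simp add: z algebra_simps)
      show "n1 z = n" using a b by (simp add: n1_def)
    qed
    have "z \<in> Pent" using zp n r by (intro Pent_I) auto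
    moreover have "R0 z = \<rho>" using zp del by (simp add: R0_def n_def)
    moreover have "T0 z = \<theta>" using zp z n del assms unfolding T0_def \<open>R0 z = \<rho>\<close> by (simp add: \<sigma>_def)
    ultimately have "L z = ring \<theta> \<rho>" using L_zones(1)[of z] zp n by (auto simp: Pent_def)
    then show ?thesis using \<open>z \<in> Pent\<close> lat_0 by (intro bexI[of _ z]) simp_all
  next
    case False
    then have p1: "\<rho> < 1" "1 + 3 * \<rho> < \<theta>" using assms by auto
    define \<sigma> where "\<sigma> = (\<theta> - 4 * \<rho>) / (1 - \<rho>)"
    have s1: "1 \<le> \<sigma>" "\<sigma> \<le> 4" using p1 assms by (auto simp: \<sigma>_def le_divide_eq divide_le_eq)
    define n where "n = r * (1 - \<rho>)"
    have n: "0 < n" "n \<le> r" using p1 assms r_pos mult_left_mono[of "1 - \<rho>" 1 r] by (auto simp: n_def)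
    have R: "1 - n / r = \<rho>" using r_pos by (simp add: n_def)
    have nr: "n / r = 1 - \<rho>" using r_pos by (simp add: n_def)
    have sn: "\<sigma> * (1 - \<rho>) = \<theta> - 4 * \<rho>" using p1 by (simp add: \<sigma>_def)
    define w where "w = of_real n * om \<sigma>"
    have nw: "n1 w = n" using n n1_om[of \<sigma>] s1 by (simp only: w_def n1_scale)
    from s1 consider "1 \<le> \<sigma>" "\<sigma> \<le> 2" | "2 \<le> \<sigma>" "\<sigma> \<le> 3" | "3 \<le> \<sigma>" "\<sigma> \<le> 4" by linarith
    then show ?thesis
    proof cases
      case 1
      then have w: "Re w = n * (1 - \<sigma>)" "Im w = n * (2 - \<sigma>)" using om_quadrants(2)[OF 1] by (auto simp: w_def)
      have wb: "Re w \<le> 0" "0 \<le> Im w" using w n 1 by (auto simp: mult_nonneg_nonpos)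
      have box: "0 \<le> Re (1 + w)" "Re (1 + w) \<le> 1" "0 \<le> Im (1 + w)" "Im (1 + w) \<le> 1" using wb nw n r by (auto simp: n1_def)
      have P: "1 + w \<in> Pent" using box wb nw n r del by (intro Pent_I) (auto simp: n1_def)
      have "T1 w = 4 - (n / r) * (4 - \<sigma>)" unfolding T1_def nw w by (simp add: algebra_simps diff_divide_distrib add_divide_distrib)
      also have "\<dots> = \<theta>" unfolding nr using sn by (simp add: algebra_simps)
      finally have "L (1 + w) = 1 + ring \<theta> \<rho>" using L_zones(2)[OF box] nw n R by (simp add: R1_def)
      then show ?thesis using P corners_lat by (intro bexI[of _ "1 + w"]) auto
    next
      case 2
      then have w: "Re w = n * (\<sigma> - 3)" "Im w = n * (2 - \<sigma>)" using om_quadrants(3)[OF 2] by (auto simp: w_def)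
      have wb: "Re w \<le> 0" "Im w \<le> 0" using w n 2 by (auto simp: mult_nonneg_nonpos)
      let ?z = "Complex 1 1 + w"
      have box: "0 \<le> Re ?z" "Re ?z \<le> 1" "0 \<le> Im ?z" "Im ?z \<le> 1" using wb nw n r by (auto simp: n1_def)
      have P: "?z \<in> Pent" using box wb nw n r del by (intro Pent_I) (auto simp: n1_def)
      have "T2 w = 4 - (n / r) * (4 - \<sigma>)" unfolding T2_def nw w by (simp add: algebra_simps diff_divide_distrib add_divide_distrib)
      also have "\<dots> = \<theta>" unfolding nr using sn by (simp add: algebra_simps)
      finally have "L ?z = Complex 1 1 + ring \<theta> \<rho>" using L_zones(3)[OF box] nw n R by (simp add: R1_def)
      then show ?thesis using P corners_lat by (intro bexI[of _ ?z]) auto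
    next
      case 3
      then have w: "Re w = n * (\<sigma> - 3)" "Im w = n * (\<sigma> - 4)" using om_quadrants(4)[OF 3] by (auto simp: w_def)
      have wb: "0 \<le> Re w" "Im w \<le> 0" using w n 3 by (auto simp: mult_nonneg_nonpos)
      let ?z = "\<i> + w"
      have box: "0 \<le> Re ?z" "Re ?z \<le> 1" "0 \<le> Im ?z" "Im ?z \<le> 1" using wb nw n r by (auto simp: n1_def)
      have P: "?z \<in> Pent" using box wb nw n r del by (intro Pent_I) (auto simp: n1_def)
      have "T2 w = 4 - (n / r) * (4 - \<sigma>)" unfolding T2_def nw w by (simp add: algebra_simps diff_divide_distrib add_divide_distrib)
      also have "\<dots> = \<theta>" unfolding nr using sn by (simp add: algebra_simps)
      finally have "L ?z = \<i> + ring \<theta> \<rho>" using L_zones(4)[OF box] nw n R by (simp add: R1_def)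
      then show ?thesis using P corners_lat by (intro bexI[of _ ?z]) auto
    qed
  qed
qed

text \<open>The hypothesis excludes the removed disc around every lattice point. After translation
  to the unit square the ring coordinate is solved from the radius \<open>m\<close> as
  \<open>(r - m) / (r - \<eta> \<theta>)\<close>.\<close>

lemma L_onto:
  assumes w: "\<And>a m \<theta>. a \<in> lat \<Longrightarrow> 0 \<le> \<theta> \<Longrightarrow> \<theta> \<le> 4 \<Longrightarrow> 0 \<le> m \<Longrightarrow> m \<le> r \<Longrightarrow> w = a + of_real m * om \<theta> \<Longrightarrow> \<eta> \<theta> \<le> m"
  shows "\<exists>x\<in>Pent. w - L x \<in> lat"
proof -
  define b where "b = Complex (of_int \<lfloor>Re w\<rfloor>) (of_int \<lfloor>Im w\<rfloor>)"
  have b: "b \<in> lat" by (simp add: b_def lat_def)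
  define v where "v = w - b"
  have v: "0 \<le> Re v" "Re v \<le> 1" "0 \<le> Im v" "Im v \<le> 1"
    unfolding v_def b_def by (simp_all; linarith)+
  show ?thesis
  proof (cases "\<exists>e\<in>{0, 1, Complex 1 1, \<i>}. n1 (v - e) \<le> r")
    case True
    then obtain e where e: "e \<in> lat" "n1 (v - e) \<le> r" using corners_lat by blast
    obtain \<theta> where th: "0 \<le> \<theta>" "\<theta> \<le> 4" "v - e = of_real (n1 (v - e)) * om \<theta>" by (rule om_polar)
    define m where "m = n1 (v - e)"
    have m: "0 \<le> m" "m \<le> r" using e n1_pos by (auto simp: m_def)
    have "w = (b + e) + of_real m * om \<theta>" using th(3) by (simp add: v_def m_def algebra_simps)
    from w[OF lat_add[OF b e(1)] th(1,2) m this] have em: "\<eta> \<theta> \<le> m" .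
    define \<rho> where "\<rho> = (r - m) / (r - \<eta> \<theta>)"
    have rho: "0 \<le> \<rho>" "\<rho> \<le> 1" using m em eta(2)[of \<theta>] by (auto simp: \<rho>_def)
    have "\<rho> * (r - \<eta> \<theta>) = r - m" using eta(2)[of \<theta>] by (simp add: \<rho>_def)
    then have "(1 - \<rho>) * r + \<rho> * \<eta> \<theta> = m" by (simp add: algebra_simps)
    then have rg: "ring \<theta> \<rho> = v - e" using th(3) by (simp only: ring_def m_def)
    obtain x where x: "x \<in> Pent" "L x - ring \<theta> \<rho> \<in> lat" using Kpt_onto[OF th(1,2) rho] by blast
    have "w - L x = (b + e) - (L x - ring \<theta> \<rho>)" unfolding rg by (simp add: v_def)
    then have "w - L x \<in> lat" using lat_diff[OF lat_add[OF b e(1)] x(2)] by (simp only:)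
    then show ?thesis using x(1) by blast
  next
    case False
    then have far: "r < n1 v" "r < n1 (v - 1)" "r < n1 (v - Complex 1 1)" "r < n1 (v - \<i>)" by (auto simp: not_le)
    then have "v \<in> Pent" using v del by (auto simp: Pent_def n1_def)
    moreover have "L v = v" using far by (simp add: L_def)
    ultimately show ?thesis using b by (intro bexI[of _ v]) (simp_all add: v_def)
  qed
qed

text \<open>By \<open>L_gl\<close> and \<open>q_of_L\<close>, equivalence under \<open>gl\<close> is
  the same as congruence of the values of \<open>L\<close>, so any space glued from
  \<open>Pent\<close> in this way gets a periodic chart on the punctured plane.\<close>

theorem handle_map:
  assumes q: "continuous_map (top_of_set Pent) X q"
    and q_gl: "\<And>x y. gl x y \<Longrightarrow> q x = q y"
    and ker: "\<And>x y. x \<in> Pent \<Longrightarrow> y \<in> Pent \<Longrightarrow> q x = q y \<Longrightarrow> equivclp gl x y"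
  obtains Y E where "continuous_map (top_of_set E) X Y"
    "\<And>w. w \<in> E \<longleftrightarrow> (\<exists>x\<in>Pent. w - L x \<in> lat)"
    "\<And>w x. x \<in> Pent \<Longrightarrow> w - L x \<in> lat \<Longrightarrow> Y w = q x"
    "\<And>w v. w \<in> E \<Longrightarrow> v \<in> E \<Longrightarrow> Y w = Y v \<longleftrightarrow> w - v \<in> lat"
proof -
  have ql: "q x = q y" if "x \<in> Pent" "y \<in> Pent" "L x - L y \<in> lat" for x y
    using q_of_L[of q x y] q_gl that by blast
  have lq: "L x - L y \<in> lat" if "equivclp gl x y" for x y
    using that
  proof (induction rule: equivclp_induct)
    case base then show ?case by (simp add: lat_0)
  next
    case (step y z)
    then have "L y - L z \<in> lat" using L_gl lat_diff_commute by metis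
    from lat_add[OF step(3) this] show ?case by simp
  qed
  obtain Y where Y: "continuous_map (top_of_set {w. \<exists>c\<in>{()}. \<exists>x\<in>Pent. w - L x \<in> lat}) X Y"
    "\<And>c x w. c \<in> {()} \<Longrightarrow> x \<in> Pent \<Longrightarrow> w - L x \<in> lat \<Longrightarrow> Y w = q x"
    using periodic_from_cells[of "{()}" "\<lambda>_. Pent" "\<lambda>_. L" X "\<lambda>_. q"] compact_Pent continuous_L q ql by auto
  let ?E = "{w. \<exists>x\<in>Pent. w - L x \<in> lat}"
  have Yq: "Y w = q x" if "x \<in> Pent" "w - L x \<in> lat" for w x using Y(2)[of "()"] that by simp
  show thesis
  proof (rule that)
    show "continuous_map (top_of_set ?E) X Y" using Y(1) by simp
    show "w \<in> ?E \<longleftrightarrow> (\<exists>x\<in>Pent. w - L x \<in> lat)" for w by simp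
    show "Y w = q x" if "x \<in> Pent" "w - L x \<in> lat" for w x using Yq that by blast
    show "Y w = Y v \<longleftrightarrow> w - v \<in> lat" if wv: "w \<in> ?E" "v \<in> ?E" for w v
    proof -
      obtain x y where xy: "x \<in> Pent" "w - L x \<in> lat" "y \<in> Pent" "v - L y \<in> lat" using wv by blast
      have eq: "w - v = (w - L x) - (v - L y) + (L x - L y)" "L x - L y = (w - v) - ((w - L x) - (v - L y))" by simp_all
      have d: "(w - L x) - (v - L y) \<in> lat" using xy lat_diff by blast
      show ?thesis
      proof
        assume "Y w = Y v"
        then have "q x = q y" using Yq xy by metis
        then have "L x - L y \<in> lat" using ker lq xy by blast
        then show "w - v \<in> lat" using eq(1) d lat_add by metis
      next
        assume "w - v \<in> lat"
        then have "L x - L y \<in> lat" using eq(2) d lat_diff by metis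
        then show "Y w = Y v" using ql Yq xy by metis
      qed
    qed
  qed
qed

end

section \<open>The boundary loop of the polygon\<close>

locale poly =
  fixes g :: nat
  assumes g: "2 \<le> g"
begin

definition "N = real (4 * g)"
definition "\<alpha> = 2 * pi / N"
definition "eP t = edge g (nat \<lfloor>t\<rfloor>) (frac t)"
text \<open>The outward unit normal of the edge from corner \<open>m\<close> to corner
  \<open>m + 1\<close>; \<open>cos (\<alpha> / 2)\<close> is the distance of that edge from the
  centre.\<close>

definition "nu m = cis ((real_of_int m + 1 / 2) * \<alpha>)"

lemma N: "8 \<le> N" using g by (simp add: N_def)
lemma N_alpha: "N * \<alpha> = 2 * pi" using N by (simp add: \<alpha>_def)

lemma alpha: "0 < \<alpha>" "\<alpha> \<le> pi / 4"
proof -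
  show "0 < \<alpha>" using N by (simp add: \<alpha>_def)
  have "8 * \<alpha> \<le> N * \<alpha>" using N \<open>0 < \<alpha>\<close> by (intro mult_right_mono) auto
  then show "\<alpha> \<le> pi / 4" using N_alpha by simp
qed

lemma corner_alt: "corner g n = cis (real n * \<alpha>)"
  by (simp add: corner_def \<alpha>_def N_def field_simps)

lemma cos_alpha_pos: "0 < cos (\<alpha> / 2)"
  using alpha pi_gt_zero by (intro cos_gt_zero_pi) linarith+

lemma cos_periodic_int: "cos (x + of_int k * (N * \<alpha>)) = cos x"
  unfolding N_alpha by (metis cos_int_2pin cos_add sin_int_2pin mult.commute mult_cancel_left2 diff_zero mult_zero_right)

text \<open>This cosine is the inner product of a corner with an edge normal. The bound says that
  every edge line supports the polygon, and the residues 0 and 1 in the equality case are the two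
  ends of that edge.\<close>

lemma cos_step:
  fixes j :: int
  defines "c \<equiv> cos ((of_int j - 1 / 2) * \<alpha>)"
  shows "c \<le> cos (\<alpha> / 2)" "c = cos (\<alpha> / 2) \<Longrightarrow> j mod (4 * int g) \<in> {0, 1}"
proof -
  define i where "i = j mod (4 * int g)"
  have i: "0 \<le> i" "i < 4 * int g" using g by (auto simp: i_def)
  have "j = i + (4 * int g) * (j div (4 * int g))" by (simp add: i_def)
  then have "real_of_int j = of_int i + N * of_int (j div (4 * int g))"
    by (metis N_def of_int_add of_int_mult of_int_of_nat_eq of_nat_mult of_nat_numeral)
  then have "(of_int j - 1 / 2) * \<alpha> = (of_int i - 1 / 2) * \<alpha> + of_int (j div (4 * int g)) * (N * \<alpha>)"
    by (simp add: algebra_simps)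
  then have c: "c = cos ((of_int i - 1 / 2) * \<alpha>)" unfolding c_def by (simp only: cos_periodic_int)
  have big: "cos ((of_int i - 1 / 2) * \<alpha>) < cos (\<alpha> / 2)" if "2 \<le> i"
  proof -
    define x where "x = (of_int i - 1 / 2) * \<alpha>"
    have "real_of_int i \<le> N - 1" using i by (simp add: N_def)
    then have "x \<le> (N - 3 / 2) * \<alpha>" unfolding x_def using alpha by (intro mult_right_mono) auto
    then have x2: "x \<le> 2 * pi - 3 / 2 * \<alpha>" using N_alpha by (simp add: algebra_simps)
    have "2 \<le> real_of_int i" using that by simp
    then have "(3 / 2) * \<alpha> \<le> x" unfolding x_def using alpha by (intro mult_right_mono) auto
    then have x1: "\<alpha> / 2 < x" using alpha by simp
    show ?thesis
    proof (cases "x \<le> pi")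
      case True then show ?thesis using cos_monotone_0_pi[of "\<alpha> / 2" x] x1 alpha by (simp add: x_def)
    next
      case False
      have "cos (2 * pi - x) < cos (\<alpha> / 2)" using cos_monotone_0_pi[of "\<alpha> / 2" "2 * pi - x"] x2 alpha False by simp
      then show ?thesis by (simp add: x_def)
    qed
  qed
  have "i = 0 \<or> i = 1 \<or> 2 \<le> i" using i by linarith
  moreover have "c = cos (\<alpha> / 2)" if "i = 0 \<or> i = 1"
    using that unfolding c by auto
  ultimately have "c = cos (\<alpha> / 2) \<and> i \<in> {0, 1} \<or> c < cos (\<alpha> / 2)" using big c by auto
  then show "c \<le> cos (\<alpha> / 2)" "c = cos (\<alpha> / 2) \<Longrightarrow> j mod (4 * int g) \<in> {0, 1}"
    unfolding i_def by linarith+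
qed

lemma inner_corner: "corner g n \<bullet> nu m = cos ((of_int (int n - m) - 1 / 2) * \<alpha>)"
proof -
  have "corner g n \<bullet> nu m = cos (real n * \<alpha> - (of_int m + 1 / 2) * \<alpha>)"
    by (simp add: corner_alt nu_def inner_complex_def cos_diff)
  then show ?thesis by (simp add: algebra_simps)
qed

lemma eP_expand: "eP t = (1 - frac t) *\<^sub>R corner g (nat \<lfloor>t\<rfloor>) + frac t *\<^sub>R corner g (Suc (nat \<lfloor>t\<rfloor>))"
  by (simp add: eP_def edge_def linepath_def)

lemma eP_edge: assumes "0 \<le> s" "s \<le> 1" shows "eP (real n + s) = edge g n s"
proof (cases "s = 1")
  case True
  have fl: "\<lfloor>real n + 1\<rfloor> = int n + 1" by linarith
  then show ?thesis using True by (simp add: eP_def edge_def linepath_def nat_add_distrib frac_def)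
next
  case False
  then have "\<lfloor>real n + s\<rfloor> = int n" using assms by linarith
  then show ?thesis by (simp add: eP_def frac_def)
qed

lemma continuous_eP: "continuous_on {0..} eP"
proof -
  have piece: "continuous_on {real n..real (Suc n)} eP" for n
  proof -
    have "continuous_on {real n..real (Suc n)} (\<lambda>t. edge g n (t - real n))"
      unfolding edge_def linepath_def by (intro continuous_intros)
    then show ?thesis
    proof (rule continuous_on_eq)
      fix t assume "t \<in> {real n..real (Suc n)}"
      then show "edge g n (t - real n) = eP t" using eP_edge[of "t - real n" n] by simp
    qed
  qed
  have upto: "continuous_on {0..real n} eP" for n
  proof (induction n)
    case (Suc n)
    have "{0..real (Suc n)} = {0..real n} \<union> {real n..real (Suc n)}" by auto
    then show ?case using continuous_on_closed_Un[OF _ _ Suc piece] by simp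
  qed simp
  show ?thesis
  proof (subst continuous_on_eq_continuous_within, intro ballI)
    fix t :: real assume t: "t \<in> {0..}"
    obtain n where n: "t < real n" using reals_Archimedean2 by blast
    have "continuous (at t within {0..real n}) eP" using upto[of n] t n by (auto simp: continuous_on_eq_continuous_within)
    moreover have "at t within {0..real n} = at t within {0..}"
      using n t by (intro at_within_nhd[of _ "{..<real n}"]) auto
    ultimately show "continuous (at t within {0..}) eP" by simp
  qed
qed

lemma eP_inner_own: assumes "0 \<le> t" shows "eP t \<bullet> nu \<lfloor>t\<rfloor> = cos (\<alpha> / 2)"
proof -
  have f: "0 \<le> \<lfloor>t\<rfloor>" using assms by simp
  have "corner g (nat \<lfloor>t\<rfloor>) \<bullet> nu \<lfloor>t\<rfloor> = cos (\<alpha> / 2)" "corner g (Suc (nat \<lfloor>t\<rfloor>)) \<bullet> nu \<lfloor>t\<rfloor> = cos (\<alpha> / 2)"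
    unfolding inner_corner using f by (auto simp: nat_add_distrib)
  then show ?thesis by (simp add: eP_expand inner_add_left algebra_simps)
qed

lemma eP_inner_eq:
  assumes t: "0 \<le> t" and eq: "eP t \<bullet> nu m = cos (\<alpha> / 2)"
  shows "(\<lfloor>t\<rfloor> - m) mod (4 * int g) \<in> {0, 1}" "frac t \<noteq> 0 \<Longrightarrow> (\<lfloor>t\<rfloor> + 1 - m) mod (4 * int g) \<in> {0, 1}"
proof -
  let ?c = "cos (\<alpha> / 2)" and ?a = "corner g (nat \<lfloor>t\<rfloor>) \<bullet> nu m" and ?b = "corner g (Suc (nat \<lfloor>t\<rfloor>)) \<bullet> nu m"
  have f: "0 \<le> \<lfloor>t\<rfloor>" using t by simp
  have ab: "?a \<le> ?c" "?b \<le> ?c" unfolding inner_corner by (rule cos_step)+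
  have "(1 - frac t) * (?c - ?a) + frac t * (?c - ?b) = 0"
    using eq by (simp add: eP_expand inner_add_left algebra_simps)
  moreover have "0 \<le> (1 - frac t) * (?c - ?a)" "0 \<le> frac t * (?c - ?b)"
    using ab frac_lt_1[of t] by auto
  ultimately have z: "(1 - frac t) * (?c - ?a) = 0" "frac t * (?c - ?b) = 0" by linarith+
  have "?a = ?c" using z(1) frac_lt_1[of t] by auto
  then show "(\<lfloor>t\<rfloor> - m) mod (4 * int g) \<in> {0, 1}" using cos_step(2)[of "\<lfloor>t\<rfloor> - m"] f by (simp add: inner_corner)
  show "(\<lfloor>t\<rfloor> + 1 - m) mod (4 * int g) \<in> {0, 1}" if "frac t \<noteq> 0"
  proof -
    have "?b = ?c" using z(2) that by simp
    then show ?thesis using cos_step(2)[of "\<lfloor>t\<rfloor> + 1 - m"] f by (simp add: inner_corner nat_add_distrib algebra_simps)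
  qed
qed

lemma corner_periodic: "int n mod (4 * int g) = int m mod (4 * int g) \<Longrightarrow> corner g n = corner g m"
proof -
  assume "int n mod (4 * int g) = int m mod (4 * int g)"
  then obtain k where "int n = int m + (4 * int g) * k" by (metis mod_eqE)
  then have "real n = real m + N * of_int k"
    by (metis N_def of_int_add of_int_mult of_int_of_nat_eq of_nat_mult of_nat_numeral)
  then have "real n * \<alpha> = real m * \<alpha> + 2 * pi * of_int k" using N_alpha by (simp add: algebra_simps)
  then have "corner g n = cis (real m * \<alpha> + 2 * pi * of_int k)" by (simp only: corner_alt)
  also have "\<dots> = cis (real m * \<alpha>) * cis (2 * pi * of_int k)" by (rule cis_mult[symmetric])
  also have "\<dots> = corner g m" by (simp only: cis_multiple_2pi Ints_of_int mult_1_right corner_alt)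
  finally show ?thesis .
qed

lemma corner_next: "corner g n \<noteq> corner g (Suc n)"
proof
  assume "corner g n = corner g (Suc n)"
  then have "corner g n \<bullet> corner g n = corner g n \<bullet> corner g (Suc n)" by simp
  then have "1 = cos \<alpha>" by (simp add: corner_alt inner_complex_def algebra_simps flip: cos_diff power2_eq_square)
  moreover have "cos \<alpha> < cos 0" using alpha pi_gt_zero by (intro cos_monotone_0_pi) linarith+
  ultimately show False by simp
qed

text \<open>A common point lies on the supporting lines of both edges, so the index difference has
  residue 0 or 1 in both directions; as \<open>4 * g\<close> is at least 8 only 0 remains, and then
  the positions on the edge agree.\<close>

lemma eP_eq_iff: assumes "0 \<le> t" "0 \<le> u" shows "eP t = eP u \<longleftrightarrow> (\<exists>k::int. t - u = N * of_int k)"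
proof
  assume eq: "eP t = eP u"
  let ?M = "4 * int g"
  have M: "8 \<le> ?M" using g by simp
  have 1: "eP t \<bullet> nu \<lfloor>u\<rfloor> = cos (\<alpha> / 2)" "eP u \<bullet> nu \<lfloor>t\<rfloor> = cos (\<alpha> / 2)" using eP_inner_own assms eq by metis+
  define e where "e = \<lfloor>t\<rfloor> - \<lfloor>u\<rfloor>"
  have 2: "e mod ?M \<in> {0, 1}" "(- e) mod ?M \<in> {0, 1}"
    using eP_inner_eq(1)[OF assms(1) 1(1)] eP_inner_eq(1)[OF assms(2) 1(2)] by (auto simp: e_def)
  have "e mod ?M = 0"
  proof (rule ccontr)
    assume ne: "e mod ?M \<noteq> 0"
    then have "e mod ?M = 1" using 2 by auto
    then have "(- e) mod ?M = ?M - 1" using M by (simp add: zmod_zminus1_eq_if)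
    then show False using 2(2) M by auto
  qed
  then have fl: "\<lfloor>t\<rfloor> mod ?M = \<lfloor>u\<rfloor> mod ?M" unfolding e_def by (simp add: mod_eq_dvd_iff mod_eq_0_iff_dvd)
  have nn: "0 \<le> \<lfloor>t\<rfloor>" "0 \<le> \<lfloor>u\<rfloor>" using assms by auto
  have c1: "corner g (nat \<lfloor>t\<rfloor>) = corner g (nat \<lfloor>u\<rfloor>)" by (rule corner_periodic) (use nn fl in simp)
  have c2: "corner g (Suc (nat \<lfloor>t\<rfloor>)) = corner g (Suc (nat \<lfloor>u\<rfloor>))"
    by (rule corner_periodic) (use nn mod_add_cong[OF fl refl, of 1] in \<open>simp add: add.commute\<close>)
  define a where "a = corner g (nat \<lfloor>u\<rfloor>)"
  define b where "b = corner g (Suc (nat \<lfloor>u\<rfloor>))"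
  have "(frac t - frac u) *\<^sub>R (b - a) = 0"
    using eq unfolding eP_expand c1 c2 by (simp add: a_def b_def algebra_simps)
  moreover have "b \<noteq> a" using corner_next[of "nat \<lfloor>u\<rfloor>"] by (auto simp: a_def b_def)
  ultimately have "frac t = frac u" by simp
  then have "t - u = of_int e" by (simp add: e_def frac_def)
  moreover obtain k where "e = ?M * k" using \<open>e mod ?M = 0\<close> by (metis mod_0_imp_dvd dvdE)
  ultimately show "\<exists>k::int. t - u = N * of_int k" by (intro exI[of _ k]) (simp add: N_def)
next
  assume "\<exists>k::int. t - u = N * of_int k"
  then obtain k :: int where k: "t - u = N * of_int k" by blast
  define z where "z = 4 * int g * k"
  have "t = u + of_int z" using k by (simp add: N_def z_def)
  then have f: "frac t = frac u" "\<lfloor>t\<rfloor> = \<lfloor>u\<rfloor> + 4 * int g * k" by (auto simp: frac_def z_def[symmetric])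
  have nn: "0 \<le> \<lfloor>t\<rfloor>" "0 \<le> \<lfloor>u\<rfloor>" using assms by auto
  have m: "\<lfloor>t\<rfloor> mod (4 * int g) = \<lfloor>u\<rfloor> mod (4 * int g)" by (simp add: f)
  have c1: "corner g (nat \<lfloor>t\<rfloor>) = corner g (nat \<lfloor>u\<rfloor>)" by (rule corner_periodic) (use nn m in simp)
  have c2: "corner g (Suc (nat \<lfloor>t\<rfloor>)) = corner g (Suc (nat \<lfloor>u\<rfloor>))"
    by (rule corner_periodic) (use nn mod_add_cong[OF m refl, of 1] in \<open>simp add: add.commute\<close>)
  show "eP t = eP u" unfolding eP_expand c1 c2 f(1) ..
qed

abbreviation "P \<equiv> polygon_4g g"

lemma P_compact: "compact P" and P_convex: "convex P"
  by (auto simp: polygon_4g_def finite_imp_compact_convex_hull)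

lemma corner_P: "corner g n \<in> P"
proof -
  have "corner g n = corner g (n mod (4 * g))" by (rule corner_periodic) (simp add: zmod_int)
  moreover have "n mod (4 * g) < 4 * g" using g by simp
  ultimately show ?thesis unfolding polygon_4g_def by (metis hull_inc imageI lessThan_iff)
qed

lemma eP_P: "eP t \<in> P"
  unfolding eP_expand using frac_lt_1[of t] by (intro convexD[OF P_convex] corner_P) auto

lemma P_halfplane: assumes "x \<in> P" shows "x \<bullet> nu m \<le> cos (\<alpha> / 2)"
proof -
  have "P \<subseteq> {x. nu m \<bullet> x \<le> cos (\<alpha> / 2)}"
    unfolding polygon_4g_def
  proof (rule hull_minimal)
    show "corner g ` {..<4 * g} \<subseteq> {x. nu m \<bullet> x \<le> cos (\<alpha> / 2)}"
      using inner_corner[of _ m] cos_step(1)[of "int n - m" for n] by (auto simp: inner_commute simp del: of_int_diff)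
  qed (rule convex_halfspace_le)
  then show ?thesis using assms by (auto simp: inner_commute)
qed

lemma sector:
  obtains t r where "0 \<le> t" "t < N" "0 \<le> r" "z = r *\<^sub>R eP t"
proof -
  define \<phi> where "\<phi> = Arg2pi z"
  have phi: "0 \<le> \<phi>" "\<phi> < 2 * pi" "z = of_real (cmod z) * cis \<phi>"
    using Arg2pi[of z] by (auto simp: \<phi>_def cis_conv_exp is_Arg_def)
  define n where "n = nat \<lfloor>\<phi> / \<alpha>\<rfloor>"
  define \<beta> where "\<beta> = \<phi> - real n * \<alpha>"
  have fl: "real n = of_int \<lfloor>\<phi> / \<alpha>\<rfloor>" using phi alpha by (simp add: n_def)
  have "real n \<le> \<phi> / \<alpha>" "\<phi> / \<alpha> < real n + 1" unfolding fl by linarith+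
  then have b: "0 \<le> \<beta>" "\<beta> < \<alpha>" using alpha by (auto simp: \<beta>_def le_divide_eq divide_less_eq algebra_simps)
  have nN: "real n < N"
  proof -
    have "real n * \<alpha> < N * \<alpha>" using phi b N_alpha by (simp add: \<beta>_def)
    then show ?thesis using alpha by simp
  qed
  have nN1: "real n + 1 \<le> N"
  proof -
    have "n + 1 \<le> 4 * g" using nN unfolding N_def of_nat_less_iff by simp
    then have "real (n + 1) \<le> real (4 * g)" by (rule of_nat_mono)
    then show ?thesis by (simp add: N_def)
  qed
  have sa: "0 < sin \<alpha>" using alpha pi_gt_zero by (intro sin_gt_zero) linarith+
  \<comment> \<open>Sine rule: \<open>x\<close> and \<open>y\<close> are the coordinates of
    \<open>cis \<beta>\<close> in the basis \<open>1\<close>, \<open>cis \<alpha>\<close> spanned by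
    two consecutive corners.\<close>
  define y where "y = sin \<beta> / sin \<alpha>"
  define x where "x = sin (\<alpha> - \<beta>) / sin \<alpha>"
  have y: "0 \<le> y" unfolding y_def using sa b alpha pi_gt_zero by (intro divide_nonneg_pos sin_ge_zero) linarith+
  have x: "0 < x" unfolding x_def using sa b alpha pi_gt_zero by (intro divide_pos_pos sin_gt_zero) linarith+
  have xy: "x + y * cos \<alpha> = cos \<beta>" "y * sin \<alpha> = sin \<beta>"
    using sa by (auto simp: x_def y_def sin_diff field_simps)
  have "cis \<beta> = x *\<^sub>R 1 + y *\<^sub>R cis \<alpha>" using xy by (simp add: complex_eq_iff)
  then have "cis (real n * \<alpha>) * cis \<beta> = cis (real n * \<alpha>) * (x *\<^sub>R 1 + y *\<^sub>R cis \<alpha>)" by simp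
  also have "\<dots> = x *\<^sub>R corner g n + y *\<^sub>R corner g (Suc n)"
    by (simp add: corner_alt distrib_left algebra_simps flip: cis_mult)
  finally have cph: "cis \<phi> = x *\<^sub>R corner g n + y *\<^sub>R corner g (Suc n)" by (simp add: cis_mult \<beta>_def)
  define f where "f = y / (x + y)"
  have f: "0 \<le> f" "f < 1" using x y by (auto simp: f_def)
  have "(x + y) *\<^sub>R edge g n f = x *\<^sub>R corner g n + y *\<^sub>R corner g (Suc n)"
  proof -
    have "(x + y) * (1 - f) = x" "(x + y) * f = y" using x y by (auto simp: f_def field_simps)
    then show ?thesis by (simp add: edge_def linepath_def scaleR_add_right)
  qed
  then have "z = (cmod z * (x + y)) *\<^sub>R eP (real n + f)"
    using phi(3) cph eP_edge[of f n] f by (simp add: scaleR_conv_of_real mult.assoc)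
  then show thesis using that[of "real n + f" "cmod z * (x + y)"] f x y nN1 by simp
qed

lemma P_interior: "0 \<in> interior P"
proof -
  have cP: "0 \<in> P"
  proof -
    have "corner g 0 + corner g (2 * g) = 0"
    proof -
      have "real (2 * g) * \<alpha> = pi" using N_alpha by (simp add: N_def)
      then show ?thesis by (simp add: corner_alt complex_eq_iff)
    qed
    then have "(1 / 2) *\<^sub>R corner g 0 + (1 / 2) *\<^sub>R corner g (2 * g) = 0" by (simp flip: scaleR_add_right)
    moreover have "(1 / 2) *\<^sub>R corner g 0 + (1 / 2) *\<^sub>R corner g (2 * g) \<in> P" by (intro convexD[OF P_convex] corner_P) auto
    ultimately show ?thesis by simp
  qed
  have "ball 0 (cos (\<alpha> / 2)) \<subseteq> P"
  proof
    fix z :: complex assume "z \<in> ball 0 (cos (\<alpha> / 2))"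
    then have z: "norm z < cos (\<alpha> / 2)" by simp
    obtain t r where t: "0 \<le> t" "t < N" "0 \<le> r" "z = r *\<^sub>R eP t" by (rule sector)
    have "r * cos (\<alpha> / 2) = z \<bullet> nu \<lfloor>t\<rfloor>" using eP_inner_own[OF t(1)] t(4) by simp
    also have "\<dots> \<le> norm z * norm (nu \<lfloor>t\<rfloor>)" by (rule norm_cauchy_schwarz)
    also have "\<dots> < cos (\<alpha> / 2)" using z by (simp add: nu_def)
    finally have "r < 1" using cos_alpha_pos by simp
    then have "r *\<^sub>R eP t + (1 - r) *\<^sub>R 0 \<in> P" using t by (intro convexD[OF P_convex eP_P cP]) auto
    then show "z \<in> P" using t by simp
  qed
  then show ?thesis using cos_alpha_pos mem_interior by blast
qed

text \<open>The starting point \<open>c\<close> is left free because the loop around the rectangle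
  starts with the second handle.\<close>

lemma P_frontier: assumes "0 \<le> c" shows "frontier P = eP ` {c..c + N}"
proof -
  have clP: "closed P" using P_compact compact_imp_closed by blast
  have fr: "eP t \<in> frontier P" if "0 \<le> t" for t
  proof -
    have "P \<subseteq> {x. nu \<lfloor>t\<rfloor> \<bullet> x \<le> cos (\<alpha> / 2)}" using P_halfplane by (auto simp: inner_commute)
    then have "interior P \<subseteq> {x. nu \<lfloor>t\<rfloor> \<bullet> x < cos (\<alpha> / 2)}"
      using interior_mono interior_halfspace_le[of "nu \<lfloor>t\<rfloor>"] by (metis nu_def cis_neq_zero)
    then have "eP t \<notin> interior P" using eP_inner_own[OF that] by (auto simp: inner_commute)
    then show ?thesis using eP_P clP by (simp add: frontier_def)
  qed
  have all: "\<exists>u\<in>{c..c + N}. eP u = eP t" if t: "0 \<le> t" for t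
  proof -
    define k where "k = \<lfloor>(t - c) / N\<rfloor>"
    define u where "u = t - N * of_int k"
    have "of_int k \<le> (t - c) / N" "(t - c) / N < of_int k + 1" unfolding k_def by linarith+
    then have u: "c \<le> u" "u \<le> c + N" using N by (auto simp: u_def le_divide_eq divide_less_eq algebra_simps)
    have "u - t = N * of_int (- k)" by (simp add: u_def)
    then have "eP u = eP t" using eP_eq_iff[of u t] u assms t by (metis order_trans)
    then show ?thesis using u by auto
  qed
  show ?thesis
  proof
    show "eP ` {c..c + N} \<subseteq> frontier P" using fr assms by auto
    show "frontier P \<subseteq> eP ` {c..c + N}"
    proof
      fix x assume x: "x \<in> frontier P"
      then have xP: "x \<in> P" "x \<notin> interior P" using clP by (auto simp: frontier_def)
      obtain t r where t: "0 \<le> t" "t < N" "0 \<le> r" "x = r *\<^sub>R eP t" by (rule sector)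
      have sh: "s *\<^sub>R y \<in> interior P" if "y \<in> P" "0 \<le> s" "s < 1" for s y
        using mem_interior_convex_shrink[OF P_convex P_interior that(1), of "1 - s"] that by (simp add: algebra_simps)
      have "r = 1"
      proof (cases r "1::real" rule: linorder_cases)
        case less then show ?thesis using sh[OF eP_P t(3)] t xP by auto
      next
        case greater
        then have "(1 / r) *\<^sub>R x \<in> interior P" using sh[OF xP(1), of "1 / r"] by simp
        then show ?thesis using fr[OF t(1)] t(4) greater by (simp add: frontier_def)
      qed
      then show "x \<in> eP ` {c..c + N}" using all[OF t(1)] t(4) by (metis imageI scaleR_one)
    qed
  qed
qed

end

text \<open>The polygon as the rectangle \<open>[0,k] \<times> [0,1]\<close>: the edges of the first handle form the right,
  top and left sides, the \<open>i\<close>-th of the other \<open>k = g - 1\<close> handles is the segment \<open>[i,i+1]\<close> of the bottom.\<close>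

definition rect :: "nat \<Rightarrow> complex set" where
  "rect k = {z. 0 \<le> Re z \<and> Re z \<le> real k \<and> 0 \<le> Im z \<and> Im z \<le> 1}"

text \<open>The parameter is that of \<open>eP\<close>, starting at 4 with the second handle: each
  of the \<open>k\<close> handles takes four units on the bottom, and the edges of the first handle
  come last, with one unit on the right, two on the top and one on the left.\<close>

definition rect_loop :: "nat \<Rightarrow> real \<Rightarrow> complex" where
  "rect_loop k t = (if t \<le> 4 * real k + 4 then Complex ((t - 4) / 4) 0
     else if t \<le> 4 * real k + 5 then Complex (real k) (t - 4 * real k - 4)
     else if t \<le> 4 * real k + 7 then Complex (real k - (t - 4 * real k - 5) * real k / 2) 1
     else Complex 0 (4 * real k + 8 - t))"

definition rect_glued :: "nat \<Rightarrow> complex \<Rightarrow> complex \<Rightarrow> bool" where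
  "rect_glued k x y \<longleftrightarrow> (\<exists>s\<in>{0..1::real}.
     (x = Complex (real k) s \<and> y = Complex (real k * s / 2) 1) \<or>
     (x = Complex (real k - real k * s / 2) 1 \<and> y = Complex 0 s) \<or>
     (\<exists>i<k. (x = Complex (real i + s / 4) 0 \<and> y = Complex (real i + (3 - s) / 4) 0) \<or>
            (x = Complex (real i + (1 + s) / 4) 0 \<and> y = Complex (real i + (4 - s) / 4) 0)))"

lemma rect_cbox: "rect k = cbox 0 (Complex (real k) 1)"
  by (auto simp: rect_def in_cbox_complex_iff)

lemma rect_frontier:
  assumes "1 \<le> k"
  shows "frontier (rect k) = {z \<in> rect k. Re z = 0 \<or> Re z = real k \<or> Im z = 0 \<or> Im z = 1}" "interior (rect k) \<noteq> {}"
proof -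
  have int: "interior (rect k) = {z. 0 < Re z \<and> Re z < real k \<and> 0 < Im z \<and> Im z < 1}"
    unfolding rect_cbox interior_cbox by (auto simp: in_box_complex_iff)
  then have "Complex (1 / 2) (1 / 2) \<in> interior (rect k)" using assms by simp
  then show "interior (rect k) \<noteq> {}" by blast
  have "closed (rect k)" by (simp add: rect_cbox closed_cbox)
  then show "frontier (rect k) = {z \<in> rect k. Re z = 0 \<or> Re z = real k \<or> Im z = 0 \<or> Im z = 1}"
    unfolding frontier_def int by (auto simp: rect_def)
qed

lemma continuous_rect_loop: "continuous_on S (rect_loop k)"
proof -
  have "continuous_on UNIV (rect_loop k)"
    unfolding rect_loop_def Complex_eq
    by (intro continuous_on_cases_le continuous_intros) (auto simp: algebra_simps)
  then show ?thesis by (rule continuous_on_subset) simp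
qed

lemma rect_loop_cases:
  assumes "t \<in> {4..4 * real k + 8}" "1 \<le> k"
  obtains "4 \<le> t" "t \<le> 4 * real k + 4" "rect_loop k t = Complex ((t - 4) / 4) 0"
  | "4 * real k + 4 \<le> t" "t \<le> 4 * real k + 5" "rect_loop k t = Complex (real k) (t - 4 * real k - 4)"
  | "4 * real k + 5 \<le> t" "t \<le> 4 * real k + 7" "rect_loop k t = Complex (real k - (t - 4 * real k - 5) * real k / 2) 1"
  | "4 * real k + 7 \<le> t" "t \<le> 4 * real k + 8" "rect_loop k t = Complex 0 (4 * real k + 8 - t)"
proof -
  consider "4 \<le> t \<and> t \<le> 4 * real k + 4" | "4 * real k + 4 < t \<and> t \<le> 4 * real k + 5"
    | "4 * real k + 5 < t \<and> t \<le> 4 * real k + 7" | "4 * real k + 7 < t \<and> t \<le> 4 * real k + 8"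
    using assms by fastforce
  then show thesis
    using that by cases (auto simp: rect_loop_def)
qed

lemma rect_loop_image: assumes "1 \<le> k" shows "rect_loop k ` {4..4 * real k + 8} = frontier (rect k)"
proof
  have k: "1 \<le> real k" using assms by simp
  show "rect_loop k ` {4..4 * real k + 8} \<subseteq> frontier (rect k)"
  proof safe
    fix t assume t: "t \<in> {4..4 * real k + 8}"
    from t assms show "rect_loop k t \<in> frontier (rect k)"
    proof (rule rect_loop_cases)
      assume *: "4 * real k + 5 \<le> t" "t \<le> 4 * real k + 7" "rect_loop k t = Complex (real k - (t - 4 * real k - 5) * real k / 2) 1"
      have "(t - 4 * real k - 5) * real k \<le> 2 * real k" using * by (intro mult_right_mono) auto
      then show ?thesis using * rect_frontier[OF assms] by (auto simp: rect_def)
    qed (use rect_frontier[OF assms] k in \<open>auto simp: rect_def\<close>)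
  qed
  show "frontier (rect k) \<subseteq> rect_loop k ` {4..4 * real k + 8}"
  proof
    fix z assume "z \<in> frontier (rect k)"
    then have z: "0 \<le> Re z" "Re z \<le> real k" "0 \<le> Im z" "Im z \<le> 1" "Re z = 0 \<or> Re z = real k \<or> Im z = 0 \<or> Im z = 1"
      using rect_frontier[OF assms] by (auto simp: rect_def)
    consider "Im z = 0" | "Re z = real k" "0 < Im z" | "Im z = 1" "Re z < real k" | "Re z = 0" "Im z < 1" using z by fastforce
    then show "z \<in> rect_loop k ` {4..4 * real k + 8}"
    proof cases
      case 1 then show ?thesis using z by (intro image_eqI[of _ _ "4 + 4 * Re z"]) (auto simp: rect_loop_def complex_eq_iff)
    next
      case 2 then show ?thesis using z by (intro image_eqI[of _ _ "4 * real k + 4 + Im z"]) (auto simp: rect_loop_def complex_eq_iff)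
    next
      case 3
      define c where "c = (real k - Re z) / real k"
      have t: "0 < c" "c \<le> 1" using z k 3 by (auto simp: c_def divide_le_eq)
      define t where "t = 4 * real k + 5 + 2 * c"
      have "c * real k = real k - Re z" using k by (simp add: c_def)
      then have "(t - 4 * real k - 5) * real k / 2 = real k - Re z" by (simp add: t_def)
      then have "rect_loop k t = z" using t z 3 by (auto simp: rect_loop_def t_def complex_eq_iff)
      then show ?thesis using t by (intro image_eqI[of _ _ t]) (auto simp: t_def)
    next
      case 4
      show ?thesis
      proof (cases "Im z = 0")
        case True then show ?thesis using 4 by (intro image_eqI[of _ _ 4]) (auto simp: rect_loop_def complex_eq_iff)
      next
        case False
        then show ?thesis using z 4 by (intro image_eqI[of _ _ "4 * real k + 8 - Im z"]) (auto simp: rect_loop_def complex_eq_iff)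
      qed
    qed
  qed
qed

lemma rect_loop_inj:
  assumes k: "1 \<le> k" and t: "t \<in> {4..4 * real k + 8}" and u: "u \<in> {4..4 * real k + 8}" and eq: "rect_loop k t = rect_loop k u"
  shows "t = u \<or> t = 4 \<and> u = 4 * real k + 8 \<or> u = 4 \<and> t = 4 * real k + 8"
proof -
  have k': "1 \<le> real k" using k by simp
  have less: "t = 4 \<and> u = 4 * real k + 8" if tu: "t < u" "t \<in> {4..4 * real k + 8}" "u \<in> {4..4 * real k + 8}" "rect_loop k t = rect_loop k u" for t u
    using tu(2) k
  proof (rule rect_loop_cases)
    assume a: "4 \<le> t" "t \<le> 4 * real k + 4" "rect_loop k t = Complex ((t - 4) / 4) 0"
    show ?thesis using tu(3) k by (rule rect_loop_cases) (use a tu k' in auto)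
  next
    assume a: "4 * real k + 4 \<le> t" "t \<le> 4 * real k + 5" "rect_loop k t = Complex (real k) (t - 4 * real k - 4)"
    show ?thesis using tu(3) k by (rule rect_loop_cases) (use a tu k' in \<open>auto simp: mult_eq_0_iff\<close>)
  next
    assume a: "4 * real k + 5 \<le> t" "t \<le> 4 * real k + 7" "rect_loop k t = Complex (real k - (t - 4 * real k - 5) * real k / 2) 1"
    show ?thesis using tu(3) k by (rule rect_loop_cases) (use a tu k' in auto)
  next
    assume a: "4 * real k + 7 \<le> t" "t \<le> 4 * real k + 8" "rect_loop k t = Complex 0 (4 * real k + 8 - t)"
    show ?thesis using tu(3) k by (rule rect_loop_cases) (use a tu k' in auto)
  qed
  show ?thesis using less[of t u] less[of u t] t u eq by (cases t u rule: linorder_cases) auto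
qed

lemma rect_glued_in: "rect_glued k x y \<Longrightarrow> x \<in> rect k \<and> y \<in> rect k"
proof -
  assume "rect_glued k x y"
  then obtain s where s': "s \<in> {0..1}" and c: "(x = Complex (real k) s \<and> y = Complex (real k * s / 2) 1) \<or>
      (x = Complex (real k - real k * s / 2) 1 \<and> y = Complex 0 s) \<or>
      (\<exists>i<k. (x = Complex (real i + s / 4) 0 \<and> y = Complex (real i + (3 - s) / 4) 0) \<or>
            (x = Complex (real i + (1 + s) / 4) 0 \<and> y = Complex (real i + (4 - s) / 4) 0))"
    unfolding rect_glued_def by (rule bexE)
  have s: "0 \<le> s" "s \<le> 1" using s' by auto
  have ks: "0 \<le> real k * s" "real k * s \<le> real k" using s by (auto simp: mult_left_le)
  have ik: "real i + 1 \<le> real k" if "i < k" for i using that by simp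
  from c show ?thesis
  proof (elim disjE exE conjE)
    fix i assume "i < k" "x = Complex (real i + s / 4) 0" "y = Complex (real i + (3 - s) / 4) 0"
    then have xy: "x = Complex (real i + s / 4) 0" "y = Complex (real i + (3 - s) / 4) 0" and i: "real i + 1 \<le> real k" using ik by auto
    have "0 \<le> s / 4" "s / 4 \<le> 1" "0 \<le> (3 - s) / 4" "(3 - s) / 4 \<le> 1" using s by simp_all
    then have "0 \<le> real i + s / 4" "real i + s / 4 \<le> real k" "0 \<le> real i + (3 - s) / 4" "real i + (3 - s) / 4 \<le> real k"
      using order_trans[OF add_left_mono i] by (simp_all only: add_nonneg_nonneg of_nat_0_le_iff)
    then show ?thesis unfolding xy by (simp add: rect_def)
  next
    fix i assume "i < k" "x = Complex (real i + (1 + s) / 4) 0" "y = Complex (real i + (4 - s) / 4) 0"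
    then have xy: "x = Complex (real i + (1 + s) / 4) 0" "y = Complex (real i + (4 - s) / 4) 0" and i: "real i + 1 \<le> real k" using ik by auto
    have "0 \<le> (1 + s) / 4" "(1 + s) / 4 \<le> 1" "0 \<le> (4 - s) / 4" "(4 - s) / 4 \<le> 1" using s by simp_all
    then have "0 \<le> real i + (1 + s) / 4" "real i + (1 + s) / 4 \<le> real k" "0 \<le> real i + (4 - s) / 4" "real i + (4 - s) / 4 \<le> real k"
      using order_trans[OF add_left_mono i] by (simp_all only: add_nonneg_nonneg of_nat_0_le_iff)
    then show ?thesis unfolding xy by (simp add: rect_def)
  qed (use ks s in \<open>auto simp: rect_def\<close>)
qed

lemma rect_gluedI:
  assumes "0 \<le> s" "s \<le> 1"
  shows "rect_glued k (Complex (real k) s) (Complex (real k * s / 2) 1)"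
    "rect_glued k (Complex (real k - real k * s / 2) 1) (Complex 0 s)"
    "i < k \<Longrightarrow> rect_glued k (Complex (real i + s / 4) 0) (Complex (real i + (3 - s) / 4) 0)"
    "i < k \<Longrightarrow> rect_glued k (Complex (real i + (1 + s) / 4) 0) (Complex (real i + (4 - s) / 4) 0)"
proof -
  have "s \<in> {0..1}" using assms by simp
  then show "rect_glued k (Complex (real k) s) (Complex (real k * s / 2) 1)"
    "rect_glued k (Complex (real k - real k * s / 2) 1) (Complex 0 s)"
    "i < k \<Longrightarrow> rect_glued k (Complex (real i + s / 4) 0) (Complex (real i + (3 - s) / 4) 0)"
    "i < k \<Longrightarrow> rect_glued k (Complex (real i + (1 + s) / 4) 0) (Complex (real i + (4 - s) / 4) 0)"
    unfolding rect_glued_def by blast+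
qed

context poly
begin

text \<open>The loops \<open>rect_loop\<close> and \<open>eP\<close> have the same kernel, so
  \<open>loop_extension\<close> gives a homeomorphism of rectangle and polygon that carries one
  gluing to the other edge by edge.\<close>

theorem surface_rect:
  assumes X: "surface_of_genus g X" and k: "k = g - 1"
  obtains q where "continuous_map (top_of_set (rect k)) X q" "q ` rect k = topspace X"
    "\<And>x y. x \<in> rect k \<Longrightarrow> y \<in> rect k \<Longrightarrow> q x = q y \<longleftrightarrow> equivclp (rect_glued k) x y"
proof -
  have k1: "1 \<le> k" using g k by simp
  have Nk: "N = 4 * real k + 4" using g k by (simp add: N_def of_nat_diff)
  let ?T = "{4..4 * real k + 8}"
  have T: "?T = {4..4 + N}" by (simp add: Nk)
  have ker: "rect_loop k t = rect_loop k u \<longleftrightarrow> eP t = eP u" if tu: "t \<in> ?T" "u \<in> ?T" for t u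
  proof
    assume "rect_loop k t = rect_loop k u"
    then have "t = u \<or> t = 4 \<and> u = 4 * real k + 8 \<or> u = 4 \<and> t = 4 * real k + 8" by (rule rect_loop_inj[OF k1 tu])
    moreover have "eP 4 = eP (4 * real k + 8)" by (subst eP_eq_iff) (auto simp: Nk intro: exI[of _ "- 1"])
    ultimately show "eP t = eP u" by auto
  next
    assume "eP t = eP u"
    then obtain i :: int where i: "t - u = N * of_int i" using eP_eq_iff[of t u] tu by auto
    have "N * of_int i \<le> N * 1" "N * (- 1) \<le> N * of_int i" unfolding i[symmetric] using tu Nk by auto
    then have "- 1 \<le> real_of_int i" "real_of_int i \<le> 1" using N by (auto simp only: mult_le_cancel_left_pos)
    then have "i = -1 \<or> i = 0 \<or> i = 1" by linarith
    then have "t = u \<or> t = 4 \<and> u = 4 * real k + 8 \<or> u = 4 \<and> t = 4 * real k + 8" using i tu Nk by auto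
    moreover have "rect_loop k 4 = rect_loop k (4 * real k + 8)" using k1 by (simp add: rect_loop_def)
    ultimately show "rect_loop k t = rect_loop k u" by auto
  qed
  have ceP: "continuous_on ?T eP" by (rule continuous_on_subset[OF continuous_eP]) auto
  have conv: "convex (rect k)" "compact (rect k)" by (auto simp: rect_cbox)
  have iP: "interior P \<noteq> {}" using P_interior by auto
  have fP: "eP ` ?T = frontier P" using P_frontier[of 4] by (simp add: T)
  obtain h h' where h: "homeomorphism (rect k) P h h'" "\<And>t. t \<in> ?T \<Longrightarrow> h (rect_loop k t) = eP t"
    using loop_extension[OF conv rect_frontier(2)[OF k1] P_convex P_compact iP compact_Icc continuous_rect_loop ceP rect_loop_image[OF k1] fP ker]
    by blast
  have hinj: "inj_on h (rect k)" using h(1) unfolding homeomorphism_def by (metis inj_on_inverseI)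
  have him: "h ` rect k = P" and hcont: "continuous_on (rect k) h" using h(1) by (auto simp: homeomorphism_def)
  have edges: "h (Complex (real k) s) = edge g 0 s" "h (Complex (real k * s / 2) 1) = edge g 2 (1 - s)"
    "h (Complex (real k - real k * s / 2) 1) = edge g 1 s" "h (Complex 0 s) = edge g 3 (1 - s)" if s: "0 \<le> s" "s \<le> 1" for s
  proof -
    have per: "eP (N + t) = eP t" if "0 \<le> t" for t
      by (subst eP_eq_iff) (use that N in \<open>auto intro: exI[of _ 1]\<close>)
    have "eP (N + s) = edge g 0 s" "eP (N + (3 - s)) = edge g 2 (1 - s)" "eP (N + (1 + s)) = edge g 1 s" "eP (N + (4 - s)) = edge g 3 (1 - s)"
      using per[of s] per[of "3 - s"] per[of "1 + s"] per[of "4 - s"] eP_edge[of s 0] eP_edge[of "1 - s" 2] eP_edge[of s 1] eP_edge[of "1 - s" 3] s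
      by (simp_all add: algebra_simps)
    moreover have "rect_loop k (N + s) = Complex (real k) s" "rect_loop k (N + (3 - s)) = Complex (real k * s / 2) 1"
      "rect_loop k (N + (1 + s)) = Complex (real k - real k * s / 2) 1" "rect_loop k (N + (4 - s)) = Complex 0 s"
      using s k1 by (auto simp: rect_loop_def Nk complex_eq_iff algebra_simps diff_divide_distrib add_divide_distrib)
    moreover have "N + s \<in> ?T" "N + (3 - s) \<in> ?T" "N + (1 + s) \<in> ?T" "N + (4 - s) \<in> ?T" using s by (auto simp: Nk)
    ultimately show "h (Complex (real k) s) = edge g 0 s" "h (Complex (real k * s / 2) 1) = edge g 2 (1 - s)"
      "h (Complex (real k - real k * s / 2) 1) = edge g 1 s" "h (Complex 0 s) = edge g 3 (1 - s)"
      using h(2) by metis+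
  qed
  have bot: "h (Complex (real i + (real j + s) / 4) 0) = edge g (4 * Suc i + j) s" if s: "0 \<le> s" "s \<le> 1" "i < k" "j < 4" for i j s
  proof -
    let ?t = "real (4 * Suc i + j) + s"
    have ik: "real i + 1 \<le> real k" "real j \<le> 3" using that by auto
    have "?t \<in> ?T" using s ik by auto
    moreover have "rect_loop k ?t = Complex (real i + (real j + s) / 4) 0" using s ik by (auto simp: rect_loop_def field_simps)
    ultimately show ?thesis using h(2)[of ?t] eP_edge[OF s(1,2)] by metis
  qed
  have glue1: "glued g (h x) (h y)" if gl: "rect_glued k x y" for x y
  proof -
    obtain s where s': "s \<in> {0..1}" and c: "(x = Complex (real k) s \<and> y = Complex (real k * s / 2) 1) \<or>
      (x = Complex (real k - real k * s / 2) 1 \<and> y = Complex 0 s) \<or>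
      (\<exists>i<k. (x = Complex (real i + s / 4) 0 \<and> y = Complex (real i + (3 - s) / 4) 0) \<or>
            (x = Complex (real i + (1 + s) / 4) 0 \<and> y = Complex (real i + (4 - s) / 4) 0))"
      using gl unfolding rect_glued_def by (rule bexE)
    have s: "0 \<le> s" "s \<le> 1" using s' by auto
    from c show ?thesis
    proof (elim disjE exE conjE)
      fix i assume i: "i < k" "x = Complex (real i + s / 4) 0" "y = Complex (real i + (3 - s) / 4) 0"
      have "h x = edge g (4 * Suc i) s" "h y = edge g (4 * Suc i + 2) (1 - s)"
        using bot[of s i 0] bot[of "1 - s" i 2] s i by (simp_all add: algebra_simps)
      then show ?thesis unfolding glued_def using s i k by (intro exI[of _ "Suc i"] conjI bexI[of _ s]) auto
    next
      fix i assume i: "i < k" "x = Complex (real i + (1 + s) / 4) 0" "y = Complex (real i + (4 - s) / 4) 0"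
      have "h x = edge g (4 * Suc i + 1) s" "h y = edge g (4 * Suc i + 3) (1 - s)"
        using bot[of s i 1] bot[of "1 - s" i 3] s i by (simp_all add: algebra_simps)
      then show ?thesis unfolding glued_def using s i k by (intro exI[of _ "Suc i"] conjI bexI[of _ s]) auto
    qed (use edges[OF s] s g in \<open>auto simp: glued_def eval_nat_numeral intro!: exI[of _ 0] bexI[of _ s]\<close>)
  qed
  have glue2: "\<exists>x y. rect_glued k x y \<and> a = h x \<and> b = h y" if gl: "glued g a b" for a b
  proof -
    obtain i s where s: "0 \<le> s" "s \<le> 1" "i < g" and c: "(a = edge g (4 * i) s \<and> b = edge g (4 * i + 2) (1 - s)) \<or>
      (a = edge g (4 * i + 1) s \<and> b = edge g (4 * i + 3) (1 - s))" using gl unfolding glued_def by auto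
    show ?thesis
    proof (cases i)
      case 0
      from c show ?thesis
      proof
        assume "a = edge g (4 * i) s \<and> b = edge g (4 * i + 2) (1 - s)"
        then have "a = h (Complex (real k) s)" "b = h (Complex (real k * s / 2) 1)" using edges[OF s(1,2)] 0 by (simp_all add: eval_nat_numeral)
        then show ?thesis using rect_gluedI(1)[OF s(1,2)] by blast
      next
        assume "a = edge g (4 * i + 1) s \<and> b = edge g (4 * i + 3) (1 - s)"
        then have "a = h (Complex (real k - real k * s / 2) 1)" "b = h (Complex 0 s)" using edges[OF s(1,2)] 0 by (simp_all add: eval_nat_numeral)
        then show ?thesis using rect_gluedI(2)[OF s(1,2)] by blast
      qed
    next
      case (Suc j)
      then have j: "j < k" using s k by simp
      from c show ?thesis
      proof
        assume "a = edge g (4 * i) s \<and> b = edge g (4 * i + 2) (1 - s)"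
        then have "a = h (Complex (real j + s / 4) 0)" "b = h (Complex (real j + (3 - s) / 4) 0)"
          using bot[of s j 0] bot[of "1 - s" j 2] Suc s j by (simp_all add: algebra_simps)
        then show ?thesis using rect_gluedI(3)[OF s(1,2) j] by blast
      next
        assume "a = edge g (4 * i + 1) s \<and> b = edge g (4 * i + 3) (1 - s)"
        then have "a = h (Complex (real j + (1 + s) / 4) 0)" "b = h (Complex (real j + (4 - s) / 4) 0)"
          using bot[of s j 1] bot[of "1 - s" j 3] Suc s j by (simp_all add: algebra_simps)
        then show ?thesis using rect_gluedI(4)[OF s(1,2) j] by blast
      qed
    qed
  qed
  have eq1: "equivclp (glued g) (h x) (h y)" if "equivclp (rect_glued k) x y" for x y
    using that
  proof (induction rule: equivclp_induct)
    case (step y z)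
    then have "glued g (h y) (h z) \<or> glued g (h z) (h y)" using glue1 by blast
    with step(3) show ?case by (meson equivclp_into_equivclp)
  qed simp
  have eq2: "\<exists>y\<in>rect k. b = h y \<and> equivclp (rect_glued k) x y" if "equivclp (glued g) (h x) b" "x \<in> rect k" for x b
    using that
  proof (induction rule: equivclp_induct)
    case base then show ?case by auto
  next
    case (step b c)
    then obtain y where y: "y \<in> rect k" "b = h y" "equivclp (rect_glued k) x y" by blast
    obtain y' z where yz: "rect_glued k y' z \<or> rect_glued k z y'" "b = h y'" "c = h z"
      using step(2) glue2 by blast
    then have in_r: "y' \<in> rect k" "z \<in> rect k" using rect_glued_in by blast+
    then have "y' = y" using hinj y yz by (metis inj_onD)
    then have "equivclp (rect_glued k) x z" using yz(1) y(3) by (meson equivclp_into_equivclp)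
    then show ?case using in_r yz by blast
  qed
  from X obtain q where q: "quotient_map (top_of_set P) X q"
    "\<And>x y. x \<in> P \<Longrightarrow> y \<in> P \<Longrightarrow> q x = q y \<longleftrightarrow> equivclp (glued g) x y"
    unfolding surface_of_genus_def by blast
  show thesis
  proof (rule that[of "q \<circ> h"])
    have "continuous_map (top_of_set (rect k)) (top_of_set P) h"
      using hcont him by auto
    then show "continuous_map (top_of_set (rect k)) X (q \<circ> h)"
      using q(1) by (meson continuous_map_compose quotient_imp_continuous_map)
    show "(q \<circ> h) ` rect k = topspace X"
      using quotient_imp_surjective_map[OF q(1)] him by (metis image_comp topspace_euclidean_subtopology)
    show "(q \<circ> h) x = (q \<circ> h) y \<longleftrightarrow> equivclp (rect_glued k) x y" if xy: "x \<in> rect k" "y \<in> rect k" for x y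
    proof -
      have "(q \<circ> h) x = (q \<circ> h) y \<longleftrightarrow> equivclp (glued g) (h x) (h y)" using q(2) xy him by auto
      also have "\<dots> \<longleftrightarrow> equivclp (rect_glued k) x y"
        using eq1 eq2[of x "h y"] xy hinj by (metis inj_onD)
      finally show ?thesis .
    qed
  qed
qed

end

section \<open>The first handle as a square, with the other handles in sectors at a corner\<close>

definition cr :: "complex \<Rightarrow> complex \<Rightarrow> real" where "cr a b = Re a * Im b - Im a * Re b"

lemma not_interior_halfplane:
  assumes "v \<noteq> 0" "S \<subseteq> {x::complex. v \<bullet> x \<le> b}" "v \<bullet> z = b" shows "z \<notin> interior S"
proof -
  have "interior S \<subseteq> {x. v \<bullet> x < b}" using interior_mono[OF assms(2)] interior_halfspace_le[OF assms(1)] by simp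
  then show ?thesis using assms(3) by auto
qed

locale center =
  fixes k :: nat
  assumes k: "1 \<le> k"
begin

lemma k': "1 \<le> real k" using k by simp

definition "Gm x = (if x \<le> real k / 2 then Complex (2 * x / real k) 1 else Complex 1 (2 - 2 * x / real k))"

text \<open>The bottom side of the rectangle is collapsed to the corner \<open>0\<close> of the unit square; the right side
  goes to the bottom side of the square, the top to its right and top sides, the left side to its left side.\<close>
definition "Cc z = of_real (Im z) * Gm (Re z)"

definition "cell i = {z. real i \<le> Re z \<and> Re z \<le> real i + 1 \<and> 0 \<le> Im z \<and> Im z \<le> 1 / 2}"
definition "rim i = {z \<in> cell i. Re z = real i \<or> Re z = real i + 1 \<or> Im z = 1 / 2}"
text \<open>\<open>W\<close> consists of the points whose identifications are given by congruence of \<open>Cc\<close> modulo \<open>lat\<close>. Outside \<open>W\<close>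
  points are identified only within one \<open>cell i\<close>.\<close>
definition "W = {z \<in> rect k. 1 / 2 \<le> Im z \<or> Re z \<in> \<int> \<or> Im z = 0 \<and> 4 * Re z \<in> \<int>}"
definition "pt i = Cc (Complex (real i + 1 / 2) (1 / 4))"

lemma Gm_box: assumes "0 \<le> x" "x \<le> real k"
  shows "0 \<le> Re (Gm x)" "Re (Gm x) \<le> 1" "0 \<le> Im (Gm x)" "Im (Gm x) \<le> 1" "Re (Gm x) = 1 \<or> Im (Gm x) = 1"
  using assms k' by (auto simp: Gm_def divide_le_eq)

lemma Cc_simps: "Re (Cc z) = Im z * Re (Gm (Re z))" "Im (Cc z) = Im z * Im (Gm (Re z))"
  by (simp_all add: Cc_def)

lemma continuous_Cc: "continuous_on S Cc"
proof -
  have c: "continuous_on UNIV (\<lambda>x. Complex (2 * x / real k) 1)" "continuous_on UNIV (\<lambda>x. Complex 1 (2 - 2 * x / real k))"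
    unfolding Complex_eq using k' by (auto intro!: continuous_intros)
  have "Complex (2 * x / real k) 1 = Complex 1 (2 - 2 * x / real k)" if "x = real k / 2" for x
  proof -
    have "2 * x / real k = 1" using that k' by simp
    then show ?thesis by simp
  qed
  note m = this
  have "continuous_on UNIV (\<lambda>x. if x \<le> real k / 2 then Complex (2 * x / real k) 1 else Complex 1 (2 - 2 * x / real k))"
  proof (rule continuous_on_cases_le)
    show "continuous_on {t \<in> UNIV. t \<le> real k / 2} (\<lambda>x. Complex (2 * x / real k) 1)"
      by (rule continuous_on_subset[OF c(1) subset_UNIV])
    show "continuous_on {t \<in> UNIV. real k / 2 \<le> t} (\<lambda>x. Complex 1 (2 - 2 * x / real k))"
      by (rule continuous_on_subset[OF c(2) subset_UNIV])
  qed (simp_all only: m continuous_on_id)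
  moreover have "Gm = (\<lambda>x. if x \<le> real k / 2 then Complex (2 * x / real k) 1 else Complex 1 (2 - 2 * x / real k))"
    by (rule ext) (simp add: Gm_def)
  ultimately have "continuous_on UNIV Gm" by simp
  then have "continuous_on UNIV (\<lambda>z. Gm (Re z))"
    by (rule continuous_on_compose2) (auto intro: continuous_intros)
  then have "continuous_on UNIV Cc"
    unfolding Cc_def by (intro continuous_on_mult continuous_on_of_real continuous_on_Im continuous_on_id)
  then show ?thesis by (rule continuous_on_subset) simp
qed

text \<open>The path \<open>Gm\<close> runs along the top and then down the right side of the unit
  square, turning clockwise as seen from 0. This orders the sectors by signs of cross
  products.\<close>

lemma cr_Gm_less: assumes "0 \<le> a" "a < b" "b \<le> real k" shows "cr (Gm a) (Gm b) < 0"
proof -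
  define x where "x = 2 * a / real k"
  define y where "y = 2 * b / real k"
  have xy: "0 \<le> x" "x < y" "y \<le> 2" using assms k' by (auto simp: x_def y_def divide_strict_right_mono divide_le_eq)
  have c: "a \<le> real k / 2 \<longleftrightarrow> x \<le> 1" "b \<le> real k / 2 \<longleftrightarrow> y \<le> 1" using k' by (auto simp: x_def y_def divide_le_eq)
  have G: "Gm a = (if x \<le> 1 then Complex x 1 else Complex 1 (2 - x))" "Gm b = (if y \<le> 1 then Complex y 1 else Complex 1 (2 - y))"
    using c by (simp_all add: Gm_def x_def y_def)
  have "x * (2 - y) \<le> 1 * (2 - y)" if "x \<le> 1" using that xy by (intro mult_right_mono) auto
  then show ?thesis unfolding G using xy by (auto simp: cr_def)
qed

lemma cr_antisym: "cr a b = - cr b a" by (simp add: cr_def)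
lemma cr_self [simp]: "cr a a = 0" by (simp add: cr_def)
lemma cr_scale: "cr a (of_real y * b) = y * cr a b" by (simp add: cr_def algebra_simps)
lemma cr_inner: "cr a b = Complex (- Im a) (Re a) \<bullet> b" by (simp add: cr_def inner_complex_def)

lemma cr_Gm_iff: assumes "0 \<le> a" "a \<le> real k" "0 \<le> b" "b \<le> real k"
  shows "cr (Gm a) (Gm b) \<le> 0 \<longleftrightarrow> a \<le> b" "cr (Gm a) (Gm b) = 0 \<longleftrightarrow> a = b"
  using cr_Gm_less[of a b] cr_Gm_less[of b a] cr_antisym[of "Gm a" "Gm b"] assms
  by (cases a b rule: linorder_cases; force)+

lemma Gm_nz: "Gm x \<noteq> 0" by (simp add: Gm_def complex_eq_iff)

text \<open>The direction of \<open>Cc x\<close> determines \<open>Re x\<close> and its length then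
  determines \<open>Im x\<close>; only the bottom side is collapsed.\<close>

lemma Cc_inj:
  assumes "0 \<le> Re x" "Re x \<le> real k" "0 \<le> Re y" "Re y \<le> real k" "0 < Im x" "0 \<le> Im y" "Cc x = Cc y"
  shows "x = y"
proof -
  have "Im y \<noteq> 0" using assms Gm_nz by (auto simp: Cc_def)
  have "cr (Gm (Re x)) (Cc x) = 0" by (simp add: Cc_def cr_scale)
  then have "cr (Gm (Re x)) (Cc y) = 0" by (simp only: assms(7))
  then have "Im y * cr (Gm (Re x)) (Gm (Re y)) = 0" by (simp add: Cc_def cr_scale)
  then have "Re x = Re y" using cr_Gm_iff(2)[of "Re x" "Re y"] assms \<open>Im y \<noteq> 0\<close> by simp
  then have "of_real (Im x) * Gm (Re x) = of_real (Im y) * Gm (Re x)" using assms(7) by (simp add: Cc_def)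
  then have "Im x = Im y" using Gm_nz by simp
  then show ?thesis using \<open>Re x = Re y\<close> by (simp add: complex_eq_iff)
qed

lemma Cc_onto:
  assumes "0 \<le> Re z" "0 \<le> Im z" "z \<noteq> 0"
  obtains x where "0 \<le> Re x" "Re x \<le> real k" "Im x = max (Re z) (Im z)" "0 < Im x" "Cc x = z"
proof (cases "Re z \<le> Im z")
  case True
  then have p: "0 < Im z" using assms by (auto simp: complex_eq_iff)
  define t where "t = Re z / Im z"
  have t: "0 \<le> t" "t \<le> 1" "Im z * t = Re z" using True p assms by (auto simp: t_def divide_le_eq)
  have kt: "0 \<le> real k * t" "real k * t \<le> real k" using t by (auto simp: mult_left_le)
  have "Cc (Complex (real k * t / 2) (Im z)) = z" using t kt k' by (simp add: Cc_def Gm_def complex_eq_iff)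
  then show thesis using True p kt
    by (intro that[of "Complex (real k * t / 2) (Im z)"]) auto
next
  case False
  then have p: "0 < Re z" using assms by auto
  define t where "t = Im z / Re z"
  have t: "0 \<le> t" "t < 1" "t * Re z = Im z" using False p assms by (auto simp: t_def)
  have kt: "real k * t < real k" using t k' by simp
  have x1: "\<not> real k - real k * t / 2 \<le> real k / 2" using kt by simp
  have "2 - 2 * (real k - real k * t / 2) / real k = t" using k' by (simp add: diff_divide_distrib)
  then have "Cc (Complex (real k - real k * t / 2) (Re z)) = z"
    using x1 t by (simp add: Cc_def Gm_def complex_eq_iff mult.commute)
  then show thesis using False p t kt
    by (intro that[of "Complex (real k - real k * t / 2) (Re z)"]) auto
qed

lemma Cc_max: assumes "0 \<le> Re x" "Re x \<le> real k" "0 \<le> Im x"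
  shows "max (Re (Cc x)) (Im (Cc x)) = Im x" "0 \<le> Re (Cc x)" "0 \<le> Im (Cc x)" "Re (Cc x) \<le> Im x" "Im (Cc x) \<le> Im x"
proof -
  note G = Gm_box[OF assms(1,2)]
  show a: "0 \<le> Re (Cc x)" "0 \<le> Im (Cc x)" "Re (Cc x) \<le> Im x" "Im (Cc x) \<le> Im x"
    using G assms by (auto simp: Cc_simps mult_left_le)
  show "max (Re (Cc x)) (Im (Cc x)) = Im x" using G(5) a by (auto simp: Cc_simps)
qed

lemma cell_bounds: assumes "i < k" "x \<in> cell i"
  shows "0 \<le> Re x" "Re x \<le> real k" "0 \<le> Im x" "Im x \<le> 1 / 2" "x \<in> rect k" "real i \<le> Re x" "Re x \<le> real i + 1"
proof -
  have "real i + 1 \<le> real k" using assms by simp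
  then show "0 \<le> Re x" "Re x \<le> real k" "0 \<le> Im x" "Im x \<le> 1 / 2" "x \<in> rect k" "real i \<le> Re x" "Re x \<le> real i + 1"
    using assms by (auto simp: cell_def rect_def)
qed

definition "sec i = Cc ` cell i"

text \<open>\<open>Cc\<close> does not preserve convexity in general; the description by half planes
  is what shows that the image of a cell is convex.\<close>

lemma sec_halfplanes:
  assumes i: "i < k"
  shows "sec i = {z. 0 \<le> Re z \<and> Re z \<le> 1 / 2 \<and> 0 \<le> Im z \<and> Im z \<le> 1 / 2 \<and> cr (Gm (real i)) z \<le> 0 \<and> 0 \<le> cr (Gm (real i + 1)) z}"
    (is "_ = ?R")
proof
  have ik: "real i + 1 \<le> real k" using i by simp
  show "sec i \<subseteq> ?R"
  proof
    fix z assume "z \<in> sec i"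
    then obtain x where x: "x \<in> cell i" "z = Cc x" by (auto simp: sec_def)
    note b = cell_bounds[OF i x(1)]
    have "cr (Gm (real i)) (Gm (Re x)) \<le> 0" using cr_Gm_iff(1)[of "real i" "Re x"] b ik by simp
    moreover have "cr (Gm (Re x)) (Gm (real i + 1)) \<le> 0" using cr_Gm_iff(1)[of "Re x" "real i + 1"] b ik by simp
    then have "0 \<le> cr (Gm (real i + 1)) (Gm (Re x))" by (subst cr_antisym) simp
    ultimately show "z \<in> ?R" using Cc_max[OF b(1-3)] b(3,4) x
      by (auto simp: Cc_def cr_scale mult_nonneg_nonpos)
  qed
  show "?R \<subseteq> sec i"
  proof
    fix z assume z: "z \<in> ?R"
    show "z \<in> sec i"
    proof (cases "z = 0")
      case True
      then have "z = Cc (Complex (real i) 0)" by (simp add: Cc_def)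
      then show ?thesis unfolding sec_def by (rule image_eqI) (simp add: cell_def)
    next
      case False
      then obtain x where x: "0 \<le> Re x" "Re x \<le> real k" "Im x = max (Re z) (Im z)" "0 < Im x" "Cc x = z"
        using Cc_onto z by auto
      have "Im x * cr (Gm (real i)) (Gm (Re x)) \<le> 0" "0 \<le> Im x * cr (Gm (real i + 1)) (Gm (Re x))"
        using z unfolding x(5)[symmetric] by (simp_all add: Cc_def cr_scale)
      then have "cr (Gm (real i)) (Gm (Re x)) \<le> 0" "0 \<le> cr (Gm (real i + 1)) (Gm (Re x))"
        using x(4) by (auto simp: mult_le_0_iff zero_le_mult_iff)
      then have "cr (Gm (real i)) (Gm (Re x)) \<le> 0" "cr (Gm (Re x)) (Gm (real i + 1)) \<le> 0"
        by (simp, subst cr_antisym, simp)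
      then have "real i \<le> Re x" "Re x \<le> real i + 1"
        using cr_Gm_iff(1)[of "real i" "Re x"] cr_Gm_iff(1)[of "Re x" "real i + 1"] x ik by auto
      then have "x \<in> cell i" using x z by (auto simp: cell_def)
      then show ?thesis using x by (auto simp: sec_def)
    qed
  qed
qed

lemma compact_cell: "compact (cell i)" and convex_cell: "convex (cell i)"
proof -
  have "cell i = cbox (Complex (real i) 0) (Complex (real i + 1) (1 / 2))"
    by (auto simp: cell_def in_cbox_complex_iff)
  then show "compact (cell i)" "convex (cell i)" by (auto simp: compact_cbox convex_box)
qed

lemma sec_convex: assumes "i < k" shows "convex (sec i)"
proof -
  have eq: "sec i = cbox 0 (Complex (1/2) (1/2)) \<inter> {z. Complex (- Im (Gm (real i))) (Re (Gm (real i))) \<bullet> z \<le> 0}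
    \<inter> {z. Complex (- Im (Gm (real i + 1))) (Re (Gm (real i + 1))) \<bullet> z \<ge> 0}"
    unfolding sec_halfplanes[OF assms] cr_inner by (auto simp: in_cbox_complex_iff)
  show ?thesis unfolding eq by (intro convex_Int convex_box convex_halfspace_le convex_halfspace_ge)
qed

lemma sec_compact: "compact (sec i)"
  unfolding sec_def by (intro compact_continuous_image continuous_Cc compact_cell)

text \<open>\<open>Cc\<close> is injective on the open cell, so invariance of domain makes its image
  open.\<close>

lemma sec_interior: assumes "i < k" "real i < Re x" "Re x < real i + 1" "0 < Im x" "Im x < 1 / 2" shows "Cc x \<in> interior (sec i)"
proof -
  let ?O = "box (Complex (real i) 0) (Complex (real i + 1) (1 / 2))"
  have O: "y \<in> ?O \<longleftrightarrow> real i < Re y \<and> Re y < real i + 1 \<and> 0 < Im y \<and> Im y < 1 / 2" for y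
    by (simp add: in_box_complex_iff)
  have sub: "?O \<subseteq> cell i"
  proof
    fix y assume "y \<in> ?O"
    then show "y \<in> cell i" unfolding O by (simp add: cell_def)
  qed
  have "inj_on Cc ?O"
  proof (rule inj_onI)
    fix y z assume "y \<in> ?O" "z \<in> ?O" "Cc y = Cc z"
    then have yz: "y \<in> cell i" "z \<in> cell i" "0 < Im y" "Cc y = Cc z" using sub O by blast+
    show "y = z"
      by (rule Cc_inj[OF cell_bounds(1,2)[OF assms(1) yz(1)] cell_bounds(1,2)[OF assms(1) yz(2)] yz(3)
            cell_bounds(3)[OF assms(1) yz(2)] yz(4)])
  qed
  then have "open (Cc ` ?O)" using invariance_of_domain[OF continuous_Cc] open_box by blast
  moreover have "Cc ` ?O \<subseteq> sec i" using sub by (auto simp: sec_def)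
  moreover have "Cc x \<in> Cc ` ?O" using O assms by blast
  ultimately show ?thesis by (meson interiorI)
qed

lemma pt_interior: "i < k \<Longrightarrow> pt i \<in> interior (sec i)"
  unfolding pt_def by (rule sec_interior) auto

lemma sec_frontier: assumes i: "i < k" shows "frontier (sec i) = Cc ` rim i"
proof
  have ik: "real i + 1 \<le> real k" using i by simp
  have cl: "closed (sec i)" using sec_compact compact_imp_closed by blast
  show "frontier (sec i) \<subseteq> Cc ` rim i"
  proof
    fix z assume "z \<in> frontier (sec i)"
    then have z: "z \<in> sec i" "z \<notin> interior (sec i)" using cl by (auto simp: frontier_def)
    then obtain x where x: "x \<in> cell i" "z = Cc x" by (auto simp: sec_def)
    show "z \<in> Cc ` rim i"
    proof (cases "Im x = 0")
      case True
      then have "z = Cc (Complex (real i) 0)" using x by (simp add: Cc_def)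
      then show ?thesis by (rule image_eqI) (simp add: rim_def cell_def)
    next
      case False
      have "x \<in> rim i"
      proof (rule ccontr)
        assume "x \<notin> rim i"
        then have "real i < Re x" "Re x < real i + 1" "0 < Im x" "Im x < 1 / 2"
          using x False by (auto simp: rim_def cell_def)
        then show False using sec_interior[OF i] x z by blast
      qed
      then show ?thesis using x by blast
    qed
  qed
  show "Cc ` rim i \<subseteq> frontier (sec i)"
  proof safe
    fix x assume x: "x \<in> rim i"
    then have xc: "x \<in> cell i" by (simp add: rim_def)
    note b = cell_bounds[OF i xc]
    let ?u = "\<lambda>t. Complex (- Im (Gm t)) (Re (Gm t))"
    have u: "?u t \<noteq> 0" for t using Gm_nz[of t] by (auto simp: complex_eq_iff)
    have "Cc x \<notin> interior (sec i)"
    proof -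
      consider "Re x = real i" | "Re x = real i + 1" | "Im x = 1 / 2" using x by (auto simp: rim_def)
      then show ?thesis
      proof cases
        case 1
        show ?thesis
        proof (rule not_interior_halfplane[OF u[of "real i"]])
          show "sec i \<subseteq> {z. ?u (real i) \<bullet> z \<le> 0}" using sec_halfplanes[OF i] cr_inner by auto
          show "?u (real i) \<bullet> Cc x = 0" unfolding cr_inner[symmetric] Cc_def cr_scale 1 by simp
        qed
      next
        case 2
        show ?thesis
        proof (rule not_interior_halfplane)
          show "- ?u (real i + 1) \<noteq> 0" using u[of "real i + 1"] by simp
          show "sec i \<subseteq> {z. - ?u (real i + 1) \<bullet> z \<le> 0}" using sec_halfplanes[OF i] cr_inner by auto
          show "- ?u (real i + 1) \<bullet> Cc x = 0" unfolding inner_minus_left cr_inner[symmetric] Cc_def cr_scale 2 by simp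
        qed
      next
        case 3
        show ?thesis
        proof (cases "Re (Gm (Re x)) = 1")
          case True
          show ?thesis
          proof (rule not_interior_halfplane[of 1])
            show "sec i \<subseteq> {z. 1 \<bullet> z \<le> 1 / 2}" using sec_halfplanes[OF i] by (auto simp: inner_complex_def)
          qed (use True 3 in \<open>auto simp: inner_complex_def Cc_simps\<close>)
        next
          case False
          then have "Im (Gm (Re x)) = 1" using Gm_box(5)[OF b(1,2)] by blast
          then show ?thesis
          proof (intro not_interior_halfplane[of \<i>])
            show "sec i \<subseteq> {z. \<i> \<bullet> z \<le> 1 / 2}" using sec_halfplanes[OF i] by (auto simp: inner_complex_def)
          qed (use 3 in \<open>auto simp: inner_complex_def Cc_simps\<close>)
        qed
      qed
    qed
    then show "Cc x \<in> frontier (sec i)" using xc cl by (auto simp: frontier_def sec_def)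
  qed
qed

section \<open>The identifications of the rectangle, in terms of \<open>Cc\<close> and of single
  handles\<close>

lemma lat_Complex: "Complex a b \<in> lat \<longleftrightarrow> a \<in> \<int> \<and> b \<in> \<int>" by (simp add: lat_def)

lemma glued_cases:
  assumes "rect_glued k x y"
  obtains (a) s where "0 \<le> s" "s \<le> 1" "x = Complex (real k) s" "y = Complex (real k * s / 2) 1"
  | (b) s where "0 \<le> s" "s \<le> 1" "x = Complex (real k - real k * s / 2) 1" "y = Complex 0 s"
  | (c) i s where "i < k" "0 \<le> s" "s \<le> 1" "x = Complex (real i + s / 4) 0" "y = Complex (real i + (3 - s) / 4) 0"
  | (d) i s where "i < k" "0 \<le> s" "s \<le> 1" "x = Complex (real i + (1 + s) / 4) 0" "y = Complex (real i + (4 - s) / 4) 0"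
  using assms unfolding rect_glued_def by fastforce

lemma Cc_top: "0 \<le> s \<Longrightarrow> s \<le> 1 \<Longrightarrow> Cc (Complex (real k * s / 2) 1) = Complex s 1"
  and Cc_right: "Cc (Complex (real k) s) = Complex s 0"
  and Cc_top': "0 \<le> s \<Longrightarrow> s \<le> 1 \<Longrightarrow> Cc (Complex (real k - real k * s / 2) 1) = Complex 1 s"
  and Cc_left: "Cc (Complex 0 s) = Complex 0 s"
proof -
  show "Cc (Complex (real k) s) = Complex s 0" "Cc (Complex 0 s) = Complex 0 s"
    using k' by (auto simp: Cc_def Gm_def complex_eq_iff)
  assume s: "0 \<le> s" "s \<le> 1"
  have ks: "real k * s \<le> real k" using s by (simp add: mult_left_le)
  then show "Cc (Complex (real k * s / 2) 1) = Complex s 1" using k' by (simp add: Cc_def Gm_def complex_eq_iff)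
  show "Cc (Complex (real k - real k * s / 2) 1) = Complex 1 s"
  proof (cases "s = 1")
    case True then show ?thesis using k' by (simp add: Cc_def Gm_def complex_eq_iff)
  next
    case False
    then have "real k * s < real k" using s k' by simp
    then show ?thesis using k' by (simp add: Cc_def Gm_def complex_eq_iff diff_divide_distrib)
  qed
qed

lemma quarter_int: "4 * (real i + t / 4) \<in> \<int> \<longleftrightarrow> t \<in> \<int>"
proof -
  have "4 * (real i + t / 4) = of_int (4 * int i) + t" by simp
  moreover have "of_int (4 * int i) + t \<in> \<int> \<Longrightarrow> (of_int (4 * int i) + t) - of_int (4 * int i) \<in> \<int>"
    by (intro Ints_diff Ints_of_int)
  moreover have "t \<in> \<int> \<Longrightarrow> of_int (4 * int i) + t \<in> \<int>" by (intro Ints_add Ints_of_int)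
  ultimately show ?thesis by (simp only: add_diff_cancel_left') blast
qed

abbreviation "eqv \<equiv> equivclp (rect_glued k)"

text \<open>Gluings of the first handle become unit translations under \<open>Cc\<close>. Those of
  the other handles take place on the bottom, where \<open>Cc\<close> vanishes, and they match
  quarter-integral points with quarter-integral points.\<close>

lemma glued_W:
  assumes "rect_glued k x y"
  shows "x \<in> W \<longleftrightarrow> y \<in> W" "Cc x - Cc y \<in> lat"
proof -
  have xy: "x \<in> rect k" "y \<in> rect k" using rect_glued_in[OF assms] by auto
  have "(x \<in> W \<longleftrightarrow> y \<in> W) \<and> Cc x - Cc y \<in> lat"
    using assms
  proof (cases rule: glued_cases)
    case (a s)
    have "x \<in> W" "y \<in> W" using xy a by (auto simp: W_def)
    moreover have "Cc x - Cc y = Complex 0 (- 1)" unfolding a(3,4) Cc_right Cc_top[OF a(1,2)] by (simp add: complex_eq_iff)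
    ultimately show ?thesis by (simp add: lat_Complex)
  next
    case (b s)
    have "x \<in> W" "y \<in> W" using xy b by (auto simp: W_def)
    moreover have "Cc x - Cc y = Complex 1 0" unfolding b(3,4) Cc_left Cc_top'[OF b(1,2)] by (simp add: complex_eq_iff)
    ultimately show ?thesis by (simp add: lat_Complex)
  next
    case (c i s)
    have "Cc x = 0" "Cc y = 0" using c by (simp_all add: Cc_def)
    moreover have i4: "t \<in> \<int> \<Longrightarrow> 4 * t \<in> \<int>" for t :: real by (simp add: Ints_mult)
    have "x \<in> W \<longleftrightarrow> s \<in> \<int>"
      using xy(1) c quarter_int[of i s] i4[of "real i + s / 4"] by (auto simp: W_def)
    moreover have "y \<in> W \<longleftrightarrow> 3 - s \<in> \<int>"
      using xy(2) c quarter_int[of i "3 - s"] i4[of "real i + (3 - s) / 4"] by (auto simp: W_def)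
    moreover have "3 - s \<in> \<int> \<longleftrightarrow> s \<in> \<int>"
      using Ints_diff[of 3 s] Ints_diff[of 3 "3 - s"] by auto
    ultimately show ?thesis by (simp add: lat_0)
  next
    case (d i s)
    have "Cc x = 0" "Cc y = 0" using d by (simp_all add: Cc_def)
    moreover have i4: "t \<in> \<int> \<Longrightarrow> 4 * t \<in> \<int>" for t :: real by (simp add: Ints_mult)
    have "x \<in> W \<longleftrightarrow> 1 + s \<in> \<int>"
      using xy(1) d quarter_int[of i "1 + s"] i4[of "real i + (1 + s) / 4"] by (auto simp: W_def)
    moreover have "y \<in> W \<longleftrightarrow> 4 - s \<in> \<int>"
      using xy(2) d quarter_int[of i "4 - s"] i4[of "real i + (4 - s) / 4"] by (auto simp: W_def)
    moreover have "4 - s \<in> \<int> \<longleftrightarrow> 1 + s \<in> \<int>"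
      using Ints_diff[of 5 "1 + s"] Ints_diff[of 5 "4 - s"] by auto
    ultimately show ?thesis by (simp add: lat_0)
  qed
  then show "x \<in> W \<longleftrightarrow> y \<in> W" "Cc x - Cc y \<in> lat" by auto
qed

lemma eqv_W:
  assumes "eqv x y"
  shows "x \<in> W \<longleftrightarrow> y \<in> W" "Cc x - Cc y \<in> lat"
proof -
  have "(x \<in> W \<longleftrightarrow> y \<in> W) \<and> Cc x - Cc y \<in> lat"
    using assms
  proof (induction rule: equivclp_induct)
    case base then show ?case by (simp add: lat_0)
  next
    case (step y z)
    have yz: "y \<in> W \<longleftrightarrow> z \<in> W" "Cc y - Cc z \<in> lat"
      using step(2) glued_W[of y z] glued_W[of z y] lat_diff_commute by auto
    have "Cc x - Cc z = (Cc x - Cc y) + (Cc y - Cc z)" by simp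
    then have "Cc x - Cc z \<in> lat" using lat_add step(3) yz(2) by metis
    then show ?case using step(3) yz(1) by simp
  qed
  then show "x \<in> W \<longleftrightarrow> y \<in> W" "Cc x - Cc y \<in> lat" by auto
qed

lemma eqv_glued: "rect_glued k x y \<Longrightarrow> eqv x y"
  by (rule r_into_equivclp)

lemma eqv_sym: "eqv x y \<Longrightarrow> eqv y x" by (rule equivclp_sym)
lemma eqv_trans: "eqv x y \<Longrightarrow> eqv y z \<Longrightarrow> eqv x z" by (rule equivclp_trans)

definition handle_glued :: "nat \<Rightarrow> complex \<Rightarrow> complex \<Rightarrow> bool" where
  "handle_glued i x y \<longleftrightarrow> (\<exists>s\<in>{0..1::real}.
     (x = Complex (real i + s / 4) 0 \<and> y = Complex (real i + (3 - s) / 4) 0) \<or>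
     (x = Complex (real i + (1 + s) / 4) 0 \<and> y = Complex (real i + (4 - s) / 4) 0))"

lemma handle_gluedI:
  assumes "0 \<le> s" "s \<le> 1"
  shows "handle_glued i (Complex (real i + s / 4) 0) (Complex (real i + (3 - s) / 4) 0)"
    "handle_glued i (Complex (real i + (1 + s) / 4) 0) (Complex (real i + (4 - s) / 4) 0)"
proof -
  have "s \<in> {0..1}" using assms by simp
  then show "handle_glued i (Complex (real i + s / 4) 0) (Complex (real i + (3 - s) / 4) 0)"
    "handle_glued i (Complex (real i + (1 + s) / 4) 0) (Complex (real i + (4 - s) / 4) 0)"
    unfolding handle_glued_def by blast+
qed

lemma handle_glued_rect: assumes "i < k" "handle_glued i x y" shows "rect_glued k x y"
proof -
  from assms(2) obtain s where s: "s \<in> {0..1}" "(x = Complex (real i + s / 4) 0 \<and> y = Complex (real i + (3 - s) / 4) 0) \<or>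
     (x = Complex (real i + (1 + s) / 4) 0 \<and> y = Complex (real i + (4 - s) / 4) 0)" unfolding handle_glued_def by blast
  then have s': "0 \<le> s" "s \<le> 1" by auto
  show ?thesis using s(2) rect_gluedI(3,4)[OF s' assms(1)] by blast
qed

lemma handle_eqv: assumes "i < k" "equivclp (handle_glued i) x y" shows "eqv x y"
  using assms(2)
proof (induction rule: equivclp_induct)
  case (step y z)
  then have "eqv y z" using handle_glued_rect[OF assms(1)] eqv_glued eqv_sym by blast
  then show ?case using step(3) eqv_trans by blast
qed simp

lemma handle_vertices:
  assumes "j \<le> 4"
  shows "equivclp (handle_glued i) (Complex (real i + real j / 4) 0) (Complex (real i) 0)"
proof -
  let ?e = "equivclp (handle_glued i)"
  let ?v = "\<lambda>j. Complex (real i + j / 4) 0"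
  have "handle_glued i (?v 0) (?v 3)" "handle_glued i (?v 1) (?v 2)" "handle_glued i (?v 1) (?v 4)" "handle_glued i (?v 2) (?v 3)"
    using handle_gluedI[of 0 i] handle_gluedI[of 1 i] by simp_all
  then have e: "?e (?v 3) (?v 0)" "?e (?v 2) (?v 3)" "?e (?v 1) (?v 2)" "?e (?v 4) (?v 1)"
    by (auto intro: r_into_equivclp equivclp_sym)
  have e2: "?e (?v 2) (?v 0)" using equivclp_trans[OF e(2,1)] .
  have e1: "?e (?v 1) (?v 0)" using equivclp_trans[OF e(3) e2] .
  have e4: "?e (?v 4) (?v 0)" using equivclp_trans[OF e(4) e1] .
  have "j = 0 \<or> j = 1 \<or> j = 2 \<or> j = 3 \<or> j = 4" using assms by linarith
  then show ?thesis using e(1) e2 e1 e4 by auto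
qed

text \<open>All vertices of the polygon are one point: each handle links its own five vertices, and
  consecutive handles share one.\<close>

lemma eqv_vertex: "i \<le> k \<Longrightarrow> eqv (Complex (real i) 0) 0"
proof (induction i)
  case 0
  have "Complex (real 0) 0 = 0" by (simp add: complex_eq_iff)
  then show ?case by simp
next
  case (Suc i)
  have "equivclp (handle_glued i) (Complex (real i + real 4 / 4) 0) (Complex (real i) 0)"
    by (rule handle_vertices) simp
  then have "eqv (Complex (real i + real 4 / 4) 0) (Complex (real i) 0)" using handle_eqv[of i] Suc(2) by simp
  then have "eqv (Complex (real (Suc i)) 0) (Complex (real i) 0)" by (simp add: add.commute)
  then show ?case using Suc eqv_trans by (meson Suc_leD)
qed

lemma bottom_vertex:
  assumes "x \<in> W" "Im x = 0" "x \<in> cell i"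
  shows "equivclp (handle_glued i) x (Complex (real i) 0)"
proof -
  have "4 * Re x \<in> \<int>" using assms by (auto simp: W_def Ints_mult)
  then obtain m where m: "4 * Re x = of_int m" by (auto elim: Ints_cases)
  have b: "4 * real i \<le> of_int m" "of_int m \<le> 4 * real i + 4" using m assms by (auto simp: cell_def)
  define j where "j = nat (m - 4 * int i)"
  have "4 * int i \<le> m" "m \<le> 4 * int i + 4" using b by linarith+
  then have j: "real j = of_int m - 4 * real i" "j \<le> 4" by (auto simp: j_def)
  have "x = Complex (real i + real j / 4) 0" using m assms(2) j by (simp add: complex_eq_iff field_simps)
  then show ?thesis using handle_vertices[OF j(2)] by simp
qed

lemma cell_exists: assumes "x \<in> rect k" "Im x \<le> 1 / 2" obtains i where "i < k" "x \<in> cell i"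
proof (cases "Re x = real k")
  case True
  have "x \<in> cell (k - 1)" using True assms k by (auto simp: cell_def rect_def of_nat_diff)
  then show thesis using that[of "k - 1"] k by simp
next
  case False
  define i where "i = nat \<lfloor>Re x\<rfloor>"
  have x: "0 \<le> Re x" "Re x < real k" using assms False by (auto simp: rect_def)
  then have i: "real i = of_int \<lfloor>Re x\<rfloor>" by (simp add: i_def)
  have "real i \<le> Re x" "Re x < real i + 1" unfolding i by linarith+
  then show thesis using that[of i] x assms by (auto simp: cell_def rect_def)
qed

lemma eqv_corner:
  assumes x: "x \<in> W" and l: "Cc x \<in> lat"
  shows "eqv x 0"
proof (cases "Im x = 0")
  case True
  have "x \<in> rect k" using x by (simp add: W_def)
  then obtain i where i: "i < k" "x \<in> cell i" by (rule cell_exists) (use True in auto)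
  have "eqv x (Complex (real i) 0)" using bottom_vertex[OF x True i(2)] handle_eqv[OF i(1)] by blast
  then show ?thesis using eqv_vertex[of i] i eqv_trans by (meson less_imp_le)
next
  case False
  have b: "0 \<le> Re x" "Re x \<le> real k" "0 \<le> Im x" "Im x \<le> 1" using x by (auto simp: W_def rect_def)
  have p: "0 < Im x" using False b by simp
  note C = Cc_max[OF b(1-3)]
  obtain m n :: int where mn: "Re (Cc x) = m" "Im (Cc x) = n" using l lat_cases by blast
  have mb: "m = 0 \<or> m = 1" "n = 0 \<or> n = 1" using C(2-5) b(4) mn by linarith+
  have "Im x = 1" using C(1) p mn mb by auto
  have inj: "x = y" if "y \<in> rect k" "Cc x = Cc y" for y
    using Cc_inj[of x y] b p that by (simp add: rect_def)
  have R: "Complex 0 1 \<in> rect k" "Complex (real k) 1 \<in> rect k" "Complex (real k / 2) 1 \<in> rect k" using k' by (auto simp: rect_def)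
  have C': "Cc (Complex 0 1) = Complex 0 1" "Cc (Complex (real k) 1) = Complex 1 0" "Cc (Complex (real k / 2) 1) = Complex 1 1"
    using Cc_left[of 1] Cc_right[of 1] Cc_top[of 1] by auto
  have g: "rect_glued k (Complex (real k) 0) (Complex 0 1)" "rect_glued k (Complex (real k) 1) (Complex (real k / 2) 1)"
    "rect_glued k (Complex (real k) 1) (Complex 0 0)"
    using rect_gluedI(1)[of 0 k] rect_gluedI(1)[of 1 k] rect_gluedI(2)[of 0 k] by simp_all
  have "eqv (Complex (real k) 1) (Complex 0 0)" using g(3) eqv_glued by blast
  then have e1: "eqv (Complex (real k) 1) 0" by (simp add: zero_complex.code)
  have e2: "eqv (Complex (real k / 2) 1) 0" using g(2) e1 eqv_glued eqv_sym eqv_trans by blast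
  have e3: "eqv (Complex 0 1) 0" using g(1) eqv_vertex[of k] eqv_glued eqv_sym eqv_trans by blast
  have "Cc x = Complex 0 1 \<or> Cc x = Complex 1 0 \<or> Cc x = Complex 1 1"
    using mn mb C(1) \<open>Im x = 1\<close> by (auto simp: complex_eq_iff)
  then show ?thesis using inj R C' e1 e2 e3 by metis
qed

text \<open>Converse of \<open>eqv_W\<close> on \<open>W\<close>. Outside the class of the corner,
  two congruent points of the unit square are equal or lie opposite each other on two sides, and
  there they are glued directly.\<close>

lemma eqv_of_Cc:
  assumes x: "x \<in> W" and y: "y \<in> W" and l: "Cc x - Cc y \<in> lat"
  shows "eqv x y"
proof (cases "Cc x \<in> lat")
  case True
  from lat_diff[OF this l] have "Cc x - (Cc x - Cc y) \<in> lat" .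
  then have "Cc y \<in> lat" by simp
  then show ?thesis using eqv_corner x y True eqv_sym eqv_trans by meson
next
  case False
  have yl: "Cc y \<notin> lat"
  proof
    assume "Cc y \<in> lat"
    from lat_add[OF l this] have "(Cc x - Cc y) + Cc y \<in> lat" .
    then show False using False by simp
  qed
  have bx: "0 \<le> Re x" "Re x \<le> real k" "0 \<le> Im x" "Im x \<le> 1" and bY: "0 \<le> Re y" "Re y \<le> real k" "0 \<le> Im y" "Im y \<le> 1"
    using x y by (auto simp: W_def rect_def)
  have c0: "Cc z = 0" if "Im z = 0" for z using that by (simp add: Cc_def)
  have "Im x \<noteq> 0" "Im y \<noteq> 0" using c0[of x] c0[of y] False yl lat_0 by metis+
  then have px: "0 < Im x" "0 < Im y" using bx bY by linarith+
  note C = Cc_max[OF bx(1-3)] Cc_max[OF bY(1-3)]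
  obtain m n :: int where mn: "Re (Cc x) - Re (Cc y) = m" "Im (Cc x) - Im (Cc y) = n" using lat_cases[OF l] by auto
  have mb: "m = -1 \<or> m = 0 \<or> m = 1" "n = -1 \<or> n = 0 \<or> n = 1" using C mn bx bY by linarith+
  have lx: "\<not> (Re (Cc x) \<in> \<int> \<and> Im (Cc x) \<in> \<int>)" using False by (simp add: lat_def)
  have right: "eqv u v" if uv: "u \<in> rect k" "v \<in> rect k" "0 < Im u" "0 < Im v" "Re (Cc u) = 1" "Re (Cc v) = 0" "Im (Cc u) = Im (Cc v)" for u v
  proof -
    define s where "s = Im (Cc v)"
    have b: "0 \<le> Re u" "Re u \<le> real k" "0 \<le> Im u" "Im u \<le> 1" "0 \<le> Re v" "Re v \<le> real k" "0 \<le> Im v" "Im v \<le> 1" using uv by (auto simp: rect_def)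
    have s: "0 \<le> s" "s \<le> 1" using Cc_max[OF b(5-7)] b(8) by (auto simp: s_def)
    have ks: "0 \<le> real k * s" "real k * s \<le> real k" using s by (auto simp: mult_left_le)
    have "Cc v = Cc (Complex 0 s)" "Cc u = Cc (Complex (real k - real k * s / 2) 1)"
      unfolding Cc_left Cc_top'[OF s] using uv by (auto simp: s_def complex_eq_iff)
    then have "v = Complex 0 s" "u = Complex (real k - real k * s / 2) 1"
      using Cc_inj[of v "Complex 0 s"] Cc_inj[of u "Complex (real k - real k * s / 2) 1"] b uv s ks by auto
    then show ?thesis using eqv_glued[OF rect_gluedI(2)[OF s]] by simp
  qed
  have top: "eqv u v" if uv: "u \<in> rect k" "v \<in> rect k" "0 < Im u" "0 < Im v" "Im (Cc u) = 0" "Im (Cc v) = 1" "Re (Cc u) = Re (Cc v)" for u v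
  proof -
    define s where "s = Re (Cc v)"
    have b: "0 \<le> Re u" "Re u \<le> real k" "0 \<le> Im u" "Im u \<le> 1" "0 \<le> Re v" "Re v \<le> real k" "0 \<le> Im v" "Im v \<le> 1" using uv by (auto simp: rect_def)
    have s: "0 \<le> s" "s \<le> 1" using Cc_max[OF b(5-7)] b(8) by (auto simp: s_def)
    have ks: "0 \<le> real k * s" "real k * s \<le> real k" using s by (auto simp: mult_left_le)
    have "Cc u = Cc (Complex (real k) s)" "Cc v = Cc (Complex (real k * s / 2) 1)"
      unfolding Cc_right Cc_top[OF s] using uv by (auto simp: s_def complex_eq_iff)
    then have "u = Complex (real k) s" "v = Complex (real k * s / 2) 1"
      using Cc_inj[of u "Complex (real k) s"] Cc_inj[of v "Complex (real k * s / 2) 1"] b uv s ks by auto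
    then show ?thesis using eqv_glued[OF rect_gluedI(1)[OF s]] by simp
  qed
  have r: "x \<in> rect k" "y \<in> rect k" using x y by (auto simp: W_def)
  consider "m = 0" "n = 0" | "m = 1" "n = 0" | "m = -1" "n = 0" | "m = 0" "n = 1" | "m = 0" "n = -1" | "m \<noteq> 0" "n \<noteq> 0"
    using mb by blast
  then show ?thesis
  proof cases
    case 1
    then have "Cc x = Cc y" using mn by (simp add: complex_eq_iff)
    then have "x = y" using Cc_inj[of x y] bx bY px by simp
    then show ?thesis by simp
  next
    case 2
    then have "Re (Cc x) = 1" "Re (Cc y) = 0" "Im (Cc x) = Im (Cc y)" using mn C bx bY by auto
    then show ?thesis using right[of x y] r px by blast
  next
    case 3
    then have "Re (Cc y) = 1" "Re (Cc x) = 0" "Im (Cc y) = Im (Cc x)" using mn C bx bY by auto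
    then show ?thesis using right[of y x] r px eqv_sym by blast
  next
    case 4
    then have "Im (Cc y) = 0" "Im (Cc x) = 1" "Re (Cc y) = Re (Cc x)" using mn C bx bY by auto
    then show ?thesis using top[of y x] r px eqv_sym by blast
  next
    case 5
    then have "Im (Cc x) = 0" "Im (Cc y) = 1" "Re (Cc x) = Re (Cc y)" using mn C bx bY by auto
    then show ?thesis using top[of x y] r px by blast
  next
    case 6
    then have "m = 1 \<or> m = -1" "n = 1 \<or> n = -1" using mb by auto
    then have "Re (Cc x) = 0 \<or> Re (Cc x) = 1" "Im (Cc x) = 0 \<or> Im (Cc x) = 1" using mn C bx bY by auto
    then have "Re (Cc x) \<in> \<int> \<and> Im (Cc x) \<in> \<int>" by auto
    then show ?thesis using lx by blast
  qed
qed

lemma cell_meet: assumes "i \<noteq> j" "x \<in> cell i" "x \<in> cell j" shows "Re x \<in> \<int>"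
proof -
  have b: "real i \<le> Re x" "Re x \<le> real i + 1" "real j \<le> Re x" "Re x \<le> real j + 1" using assms by (auto simp: cell_def)
  have "i < j \<or> j < i" using assms(1) by auto
  then have "real i + 1 \<le> real j \<or> real j + 1 \<le> real i" by auto
  then have "Re x = real i \<or> Re x = real j" using b by linarith
  then show ?thesis by auto
qed

lemma glued_cell:
  assumes "rect_glued k x y" "x \<in> cell i - W \<or> y \<in> cell i - W"
  shows "x \<in> cell i - W" "y \<in> cell i - W" "handle_glued i x y"
proof -
  note w = glued_W(1)[OF assms(1)]
  have xy: "x \<in> rect k" "y \<in> rect k" using rect_glued_in[OF assms(1)] by auto
  have n: "x \<notin> W" "y \<notin> W" using assms(2) w by auto
  obtain j where j: "j < k" "handle_glued j x y"
    using assms(1)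
  proof (cases rule: glued_cases)
    case (a s) then show ?thesis using n xy by (auto simp: W_def)
  next
    case (b s) then show ?thesis using n xy by (auto simp: W_def)
  next
    case (c j s) then show ?thesis using that[of j] handle_gluedI(1)[of s j] by simp
  next
    case (d j s) then show ?thesis using that[of j] handle_gluedI(2)[of s j] by simp
  qed
  have cj: "x \<in> cell j" "y \<in> cell j"
  proof -
    obtain s where s: "0 \<le> s" "s \<le> 1" and e: "(x = Complex (real j + s / 4) 0 \<and> y = Complex (real j + (3 - s) / 4) 0) \<or>
     (x = Complex (real j + (1 + s) / 4) 0 \<and> y = Complex (real j + (4 - s) / 4) 0)"
      using j(2) unfolding handle_glued_def by auto
    show "x \<in> cell j" "y \<in> cell j" using e s by (auto simp: cell_def)
  qed
  have nz: "Re x \<notin> \<int>" "Re y \<notin> \<int>" using n xy by (auto simp: W_def)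
  have "i = j" using assms(2) cell_meet[of i j x] cell_meet[of i j y] cj nz by blast
  then show "x \<in> cell i - W" "y \<in> cell i - W" "handle_glued i x y" using cj n j by auto
qed

text \<open>A chain of gluings that starts off \<open>W\<close> stays off \<open>W\<close>, so each
  of its steps belongs to the handle of one and the same cell.\<close>

lemma eqv_cell:
  assumes "eqv x y" "x \<in> cell i - W"
  shows "y \<in> cell i - W" "equivclp (handle_glued i) x y"
proof -
  have "y \<in> cell i - W \<and> equivclp (handle_glued i) x y"
    using assms(1)
  proof (induction rule: equivclp_induct)
    case base then show ?case using assms(2) by simp
  next
    case (step y z)
    then have y: "y \<in> cell i - W" "equivclp (handle_glued i) x y" by auto
    have "z \<in> cell i - W \<and> equivclp (handle_glued i) y z"
      using step(2)
    proof
      assume g: "rect_glued k y z"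
      from glued_cell(2,3)[OF g disjI1[OF y(1)]] show ?thesis by (auto intro: r_into_equivclp)
    next
      assume g: "rect_glued k z y"
      from glued_cell(1,3)[OF g disjI2[OF y(1)]] show ?thesis by (auto intro: r_into_equivclp equivclp_sym)
    qed
    then show ?case using y(2) equivclp_trans by (metis (full_types))
  qed
  then show "y \<in> cell i - W" "equivclp (handle_glued i) x y" by auto
qed

lemma cell_half: assumes "i < k" "x \<in> cell i" "j < k" "y \<in> cell j" "Cc x - Cc y \<in> lat" shows "Cc x = Cc y"
proof -
  note bx = cell_bounds[OF assms(1,2)] and bY = cell_bounds[OF assms(3,4)]
  note C = Cc_max[OF bx(1-3)] Cc_max[OF bY(1-3)]
  obtain m n :: int where mn: "Re (Cc x) - Re (Cc y) = m" "Im (Cc x) - Im (Cc y) = n" using lat_cases[OF assms(5)] by auto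
  have "m = 0" "n = 0" using mn C bx bY by linarith+
  then show ?thesis using mn by (simp add: complex_eq_iff)
qed

text \<open>A chain may leave the cell only within \<open>W\<close>. There \<open>Cc\<close>
  separates the points of the cell except for the bottom vertices, and these are already linked by
  the handle itself.\<close>

lemma eqv_same_cell:
  assumes i: "i < k" and xy: "x \<in> cell i" "y \<in> cell i" and e: "eqv x y"
  shows "equivclp (handle_glued i) x y"
proof (cases "x \<in> W")
  case False
  then show ?thesis using eqv_cell[OF e] xy by blast
next
  case True
  then have y: "y \<in> W" and "Cc x - Cc y \<in> lat" using eqv_W[OF e] by auto
  then have C: "Cc x = Cc y" using cell_half[OF i xy(1) i xy(2)] by blast
  note bx = cell_bounds[OF i xy(1)] and bY = cell_bounds[OF i xy(2)]
  show ?thesis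
  proof (cases "Im x = 0 \<and> Im y = 0")
    case t: True
    then show ?thesis using bottom_vertex[of x i] bottom_vertex[of y i] True y xy equivclp_trans equivclp_sym by metis
  next
    case False
    then have "0 < Im x \<or> 0 < Im y" using bx bY by linarith
    then have "x = y" using Cc_inj[of x y] Cc_inj[of y x] bx bY C by auto
    then show ?thesis by simp
  qed
qed

lemma rim_W: assumes "i < k" "x \<in> rim i" shows "x \<in> W" "x \<in> cell i"
proof -
  show c: "x \<in> cell i" using assms by (simp add: rim_def)
  have "Re x \<in> \<int> \<or> 1 / 2 \<le> Im x" using assms by (auto simp: rim_def)
  then show "x \<in> W" using cell_bounds(5)[OF assms(1) c] by (auto simp: W_def)
qed

lemma base_rim: "Complex (real i) 0 \<in> rim i"
  by (simp add: rim_def cell_def)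

lemma W_cell_rim:
  assumes i: "i < k" and x: "x \<in> W" "x \<in> cell i"
  obtains y where "y \<in> rim i" "eqv x y"
proof (cases "Im x = 0")
  case True
  then show thesis using that[OF base_rim] handle_eqv[OF i bottom_vertex[OF x(1) _ x(2)]] by blast
next
  case False
  have "1 / 2 \<le> Im x \<or> Re x \<in> \<int>" using x(1) False by (auto simp: W_def)
  moreover have "Re x = real i \<or> Re x = real i + 1" if "Re x \<in> \<int>"
  proof -
    obtain m where m: "Re x = of_int m" using \<open>Re x \<in> \<int>\<close> by (auto elim: Ints_cases)
    have "of_int (int i) \<le> Re x" "Re x \<le> of_int (int i + 1)" using x(2) by (auto simp: cell_def)
    then have "m = int i \<or> m = int i + 1" unfolding m by linarith
    then show ?thesis using m by auto
  qed
  ultimately have "x \<in> rim i" using x(2) by (auto simp: rim_def cell_def)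
  then show thesis using that by simp
qed

lemma sec_meet:
  assumes "i < k" "j < k" "i \<noteq> j" "z \<in> sec i" "z' \<in> sec j" "z - z' \<in> lat"
  obtains x y where "x \<in> rim i" "y \<in> rim j" "z = Cc x" "z' = Cc y" "z = z'"
proof -
  obtain x y where xy: "x \<in> cell i" "z = Cc x" "y \<in> cell j" "z' = Cc y" using assms by (auto simp: sec_def)
  have C: "Cc x = Cc y" using cell_half[OF assms(1) xy(1) assms(2) xy(3)] assms(6) xy by simp
  show thesis
  proof (cases "z = 0")
    case True
    have "Cc (Complex t 0) = 0" for t by (simp add: Cc_def)
    then show thesis using that[OF base_rim base_rim] xy C True by simp
  next
    case False
    note bx = cell_bounds[OF assms(1) xy(1)] and bY = cell_bounds[OF assms(2) xy(3)]
    have "Im x \<noteq> 0" using False xy by (auto simp: Cc_def)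
    then have "x = y" using Cc_inj[of x y] bx bY C by auto
    have "real i + 1 \<le> real j \<or> real j + 1 \<le> real i" using assms(3) by linarith
    then have "Re x = real i \<and> Re x = real j + 1 \<or> Re x = real i + 1 \<and> Re x = real j"
      using bx(6,7) bY(6,7)[folded \<open>x = y\<close>] by linarith
    then have "x \<in> rim i" "x \<in> rim j" using xy \<open>x = y\<close> by (auto simp: rim_def)
    then show thesis using that[of x x] xy \<open>x = y\<close> C by simp
  qed
qed

text \<open>A sector reaches at most half way across the square. A nonzero lattice difference forces
  a zero coordinate, and this occurs only on the outer side of the first or of the last sector,
  which belongs to the rim.\<close>

lemma upper_sec:
  assumes x: "x \<in> rect k" "1 / 2 \<le> Im x" and i: "i < k" and z: "z \<in> sec i" and l: "Cc x - z \<in> lat"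
  obtains y where "y \<in> rim i" "z = Cc y"
proof -
  obtain y where y: "y \<in> cell i" "z = Cc y" using z by (auto simp: sec_def)
  note bY = cell_bounds[OF i y(1)]
  have bx: "0 \<le> Re x" "Re x \<le> real k" "0 \<le> Im x" "Im x \<le> 1" using x by (auto simp: rect_def)
  note C = Cc_max[OF bx(1-3)] Cc_max[OF bY(1-3)]
  note G = Gm_box[OF bY(1,2)]
  show thesis
  proof (cases "Im y = 0")
    case True
    then show thesis using that[OF base_rim] y by (simp add: Cc_def)
  next
    case False
    obtain m n :: int where mn: "Re (Cc x) - Re z = m" "Im (Cc x) - Im z = n" using lat_cases[OF l] by auto
    have mb: "m = 0 \<or> m = 1" "n = 0 \<or> n = 1" using mn[unfolded y(2)] C bx bY by linarith+
    have "y \<in> rim i"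
    proof (cases "m = 0 \<and> n = 0")
      case True
      then have "Cc x = Cc y" using mn y by (simp add: complex_eq_iff)
      then have "x = y" using Cc_inj[of x y] bx bY x by auto
      then show ?thesis using x y bY by (auto simp: rim_def)
    next
      case t: False
      then have "Re (Cc y) = 0 \<or> Im (Cc y) = 0" using mb mn[unfolded y(2)] C bx bY by auto
      then have "Re (Gm (Re y)) = 0 \<or> Im (Gm (Re y)) = 0" using False by (simp add: Cc_simps)
      then have "Re y = 0 \<or> Re y = real k" using k' bY by (auto simp: Gm_def divide_eq_eq split: if_splits)
      moreover have "Re y = 0 \<Longrightarrow> i = 0" using bY(6) by simp
      moreover have "real i + 1 \<le> real k" using i by simp
      ultimately show ?thesis using y bY(7) by (auto simp: rim_def)
    qed
    then show thesis using that y by blast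
  qed
qed

end

section \<open>The outer handles\<close>

context oct
begin

text \<open>The boundary path of \<open>Pent\<close> from \<open>\<delta>\<close> to
  \<open>\<i> * \<delta>\<close> without the oblique side, with one unit of time for each glued
  side.\<close>

definition "pe t = (if t \<le> 1 then Complex (edg t) 0 else if t \<le> 2 then Complex 1 (t - 1)
  else if t \<le> 3 then Complex (3 - t) 1 else Complex 0 (edg (4 - t)))"

lemma edg_strict: assumes "s < t" shows "edg s < edg t"
proof -
  have d: "0 < (r - \<delta>) / r" using del r_pos by simp
  have e: "edg x = \<delta> + x * ((r - \<delta>) / r)" if "x \<le> r" for x using that by (simp add: edg_def)
  have rr: "edg r = r" using e[of r] r_pos by simp
  have mono: "edg x < edg y" if "x < y" "y \<le> r" for x y
    using that d e[of x] e[of y] mult_strict_right_mono[of x y "(r - \<delta>) / r"] by simp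
  consider "t \<le> r" | "s \<le> r" "r < t" | "r < s" using assms by linarith
  then show ?thesis
  proof cases
    case 1 then show ?thesis using mono assms by blast
  next
    case 2
    have "edg s \<le> r" using mono[of s r] rr 2 by (cases "s = r") auto
    then show ?thesis using 2 by (simp add: edg_def)
  next
    case 3 then show ?thesis using assms by (simp add: edg_def)
  qed
qed

lemma edg_inj: "edg s = edg t \<Longrightarrow> s = t"
  using edg_strict[of s t] edg_strict[of t s] by (cases s t rule: linorder_cases) auto

lemma edg_ends: "edg 0 = \<delta>" "edg 1 = 1"
  using r del by (auto simp: edg_def)

lemma edg_onto: assumes "\<delta> \<le> y" "y \<le> 1" obtains u where "0 \<le> u" "u \<le> 1" "edg u = y"
proof (cases "y \<le> r")
  case True
  define u where "u = (y - \<delta>) * r / (r - \<delta>)"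
  have "(y - \<delta>) * r \<le> (r - \<delta>) * r" using True r_pos by (intro mult_right_mono) auto
  then have u: "0 \<le> u" "u \<le> r" using True assms del r_pos by (auto simp: u_def divide_le_eq mult.commute)
  have "u * (r - \<delta>) / r = y - \<delta>" using del r_pos by (simp add: u_def)
  then have "edg u = y" using u by (simp add: edg_def)
  then show thesis using that u r by simp
next
  case False then show thesis using that[of y] assms r_pos by (simp add: edg_def)
qed

lemma continuous_edg: "continuous_on S edg"
proof -
  have "continuous_on UNIV edg"
    unfolding edg_def using r_pos by (intro continuous_on_cases_le continuous_intros) auto
  then show ?thesis by (rule continuous_on_subset) simp
qed

lemma pe_cases:
  assumes "0 \<le> t" "t \<le> 4"
  obtains (1) "0 \<le> t" "t \<le> 1" "pe t = Complex (edg t) 0" | (2) "1 \<le> t" "t \<le> 2" "pe t = Complex 1 (t - 1)"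
    | (3) "2 \<le> t" "t \<le> 3" "pe t = Complex (3 - t) 1" | (4) "3 \<le> t" "t \<le> 4" "pe t = Complex 0 (edg (4 - t))"
proof -
  have p: "t \<le> 1 \<Longrightarrow> pe t = Complex (edg t) 0" "1 < t \<Longrightarrow> t \<le> 2 \<Longrightarrow> pe t = Complex 1 (t - 1)"
    "2 < t \<Longrightarrow> t \<le> 3 \<Longrightarrow> pe t = Complex (3 - t) 1" "3 < t \<Longrightarrow> pe t = Complex 0 (edg (4 - t))"
    by (simp_all add: pe_def)
  show thesis
  proof (cases "t \<le> 1")
    case True then show thesis using that(1) p assms by blast
  next
    case a: False
    show thesis
    proof (cases "t \<le> 2")
      case True then show thesis using that(2) p(2) a by simp
    next
      case b: False
      show thesis
      proof (cases "t \<le> 3")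
        case True then show thesis using that(3) p(3) b by simp
      next
        case False then show thesis using that(4) p(4) assms by simp
      qed
    qed
  qed
qed

lemma continuous_pe: "continuous_on S pe"
proof -
  have c: "continuous_on T (\<lambda>t. Complex (f t) (g t))" if "continuous_on T f" "continuous_on T g" for f g and T :: "real set"
    using that unfolding Complex_eq by (intro continuous_intros)
  have e: "continuous_on T edg" "continuous_on T (\<lambda>t. edg (4 - t))" for T
    by (rule continuous_edg) (rule continuous_on_compose2[OF continuous_edg[of UNIV]]; auto intro!: continuous_intros)
  have C: "continuous_on T (\<lambda>t. Complex (edg t) 0)" "continuous_on T (\<lambda>t. Complex 1 (t - 1))"
    "continuous_on T (\<lambda>t. Complex (3 - t) 1)" "continuous_on T (\<lambda>t. Complex 0 (edg (4 - t)))" for T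
    by (rule c; rule e continuous_intros; (rule continuous_intros)?)+
  have e3: "edg (4 - 3) = 1" using edg_ends by simp
  have "continuous_on UNIV (\<lambda>t. if t \<le> 3 then Complex (3 - t) 1 else Complex 0 (edg (4 - t)))"
    by (rule continuous_on_cases_le[OF C(3) C(4) continuous_on_id]) (simp add: edg_ends)
  then have c2: "continuous_on T (\<lambda>t. if t \<le> 3 then Complex (3 - t) 1 else Complex 0 (edg (4 - t)))" for T
    by (rule continuous_on_subset) simp
  have "continuous_on UNIV (\<lambda>t. if t \<le> 2 then Complex 1 (t - 1) else if t \<le> 3 then Complex (3 - t) 1 else Complex 0 (edg (4 - t)))"
    by (rule continuous_on_cases_le[OF C(2) c2 continuous_on_id]) simp
  then have c1: "continuous_on T (\<lambda>t. if t \<le> 2 then Complex 1 (t - 1) else if t \<le> 3 then Complex (3 - t) 1 else Complex 0 (edg (4 - t)))" for T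
    by (rule continuous_on_subset) simp
  have "continuous_on UNIV pe"
    unfolding pe_def by (rule continuous_on_cases_le[OF C(1) c1 continuous_on_id]) (simp add: edg_ends)
  then show ?thesis by (rule continuous_on_subset) simp
qed

lemma pe_inj:
  assumes "0 \<le> t" "t \<le> 4" "0 \<le> u" "u \<le> 4" "pe t = pe u" shows "t = u"
proof -
  have pos: "0 < edg x" if "0 \<le> x" for x
    using edg_strict[of 0 x] edg_ends(1) del that by (cases "x = 0") auto
  have one: "x = 1" if "edg x = 1" for x
    using edg_inj[of x 1] edg_ends(2) that by simp
  show ?thesis
    using assms(1,2)
  proof (cases rule: pe_cases)
    case t: 1
    show ?thesis using assms(3,4) by (cases rule: pe_cases) (use t assms(5) edg_inj pos[of t] one[of t] in auto)
  next
    case t: 2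
    show ?thesis using assms(3,4) by (cases rule: pe_cases) (use t assms(5) one[of u] in auto)
  next
    case t: 3
    show ?thesis using assms(3,4) by (cases rule: pe_cases) (use t assms(5) one[of "4 - u"] in auto)
  next
    case t: 4
    show ?thesis
      using assms(3,4)
    proof (cases rule: pe_cases)
      case 4
      then have "edg (4 - t) = edg (4 - u)" using t assms(5) by simp
      from edg_inj[OF this] show ?thesis by simp
    next
      case 1 then show ?thesis using t assms(5) pos[of u] by auto
    next
      case 2 then show ?thesis using t assms(5) by auto
    next
      case 3 then show ?thesis using t assms(5) one[of "4 - t"] by auto
    qed
  qed
qed

lemma Pent_frontier:
  "frontier Pent = {z \<in> Pent. Re z = 0 \<or> Re z = 1 \<or> Im z = 0 \<or> Im z = 1 \<or> Re z + Im z = \<delta>}" "interior Pent \<noteq> {}"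
proof -
  have eq: "Pent = cbox 0 (Complex 1 1) \<inter> {z. Complex 1 1 \<bullet> z \<ge> \<delta>}"
    by (auto simp: Pent_def in_cbox_complex_iff inner_complex_def)
  have nz: "Complex 1 1 \<noteq> 0" by (simp add: complex_eq_iff)
  have int: "interior Pent = {z. 0 < Re z \<and> Re z < 1 \<and> 0 < Im z \<and> Im z < 1 \<and> \<delta> < Re z + Im z}"
    unfolding eq interior_Int interior_cbox interior_halfspace_ge[OF nz]
    by (auto simp: in_box_complex_iff inner_complex_def)
  have "Complex (1 / 2) (1 / 2) \<in> interior Pent" unfolding int using del r by simp
  then show "interior Pent \<noteq> {}" by blast
  have "closed Pent" using compact_Pent compact_imp_closed by blast
  then show "frontier Pent = {z \<in> Pent. Re z = 0 \<or> Re z = 1 \<or> Im z = 0 \<or> Im z = 1 \<or> Re z + Im z = \<delta>}"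
    unfolding frontier_def int by (auto simp: Pent_def)
qed

lemma pe_frontier: assumes "0 \<le> t" "t \<le> 4" shows "pe t \<in> frontier Pent" "Re (pe t) + Im (pe t) = \<delta> \<Longrightarrow> t = 0 \<or> t = 4"
proof -
  have "pe t \<in> frontier Pent \<and> (Re (pe t) + Im (pe t) = \<delta> \<longrightarrow> t = 0 \<or> t = 4)"
    using assms
  proof (cases rule: pe_cases)
    case 1
    then show ?thesis using edg_range[of t] edg_inj[of t 0] edg_ends del unfolding Pent_frontier(1) by (auto simp: Pent_def)
  next
    case 2 then show ?thesis using del r unfolding Pent_frontier(1) by (auto simp: Pent_def)
  next
    case 3 then show ?thesis using del r unfolding Pent_frontier(1) by (auto simp: Pent_def)
  next
    case 4
    then show ?thesis using edg_range[of "4 - t"] edg_inj[of "4 - t" 0] edg_ends del unfolding Pent_frontier(1) by (auto simp: Pent_def)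
  qed
  then show "pe t \<in> frontier Pent" "Re (pe t) + Im (pe t) = \<delta> \<Longrightarrow> t = 0 \<or> t = 4" by auto
qed

text \<open>The oblique side is the inner circle of the ring: with this parametrization
  \<open>L\<close> sends it to the boundary of the removed disc at direction \<theta>.\<close>

lemma hyp_frontier: assumes "0 \<le> \<theta>" "\<theta> \<le> 4"
  shows "of_real \<delta> * om (\<theta> / 4) \<in> frontier Pent" "Re (of_real \<delta> * om (\<theta> / 4)) = \<delta> - \<delta> * \<theta> / 4" "Im (of_real \<delta> * om (\<theta> / 4)) = \<delta> * \<theta> / 4"
    "L (of_real \<delta> * om (\<theta> / 4)) = of_real (\<eta> \<theta>) * om \<theta>" "of_real \<delta> * om (\<theta> / 4) \<in> Pent"
proof -
  let ?z = "of_real \<delta> * om (\<theta> / 4)"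
  have o: "om (\<theta> / 4) = Complex (1 - \<theta> / 4) (\<theta> / 4)" using om_quadrants(1)[of "\<theta> / 4"] assms by simp
  show R: "Re ?z = \<delta> - \<delta> * \<theta> / 4" "Im ?z = \<delta> * \<theta> / 4" unfolding o by (simp_all add: right_diff_distrib)
  have dt: "0 \<le> \<delta> * \<theta> / 4" "\<delta> * \<theta> / 4 \<le> \<delta>" using assms del mult_left_mono[of \<theta> 4 \<delta>] by auto
  show P: "?z \<in> Pent" unfolding Pent_def mem_Collect_eq R using dt del r by (intro conjI; linarith)
  then show "?z \<in> frontier Pent" unfolding Pent_frontier(1) using R by simp
  have n: "n1 ?z = \<delta>" unfolding n1_def R using dt by simp
  have "R0 ?z = 1" using n del by (simp add: R0_def)
  moreover have "T0 ?z = \<theta>" unfolding T0_def \<open>R0 ?z = 1\<close> n R using del by (simp add: diff_divide_distrib)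
  ultimately have "L ?z = ring \<theta> 1" using L_zones(1)[of ?z] P n del by (auto simp: Pent_def)
  then show "L ?z = of_real (\<eta> \<theta>) * om \<theta>" by (simp add: ring_def)
qed

lemma frontier_Pent_cases:
  assumes "z \<in> frontier Pent"
  shows "(\<exists>t\<in>{0..4}. z = pe t) \<or> (\<exists>\<theta>\<in>{0..4}. z = of_real \<delta> * om (\<theta> / 4))"
proof -
  have z: "0 \<le> Re z" "Re z \<le> 1" "0 \<le> Im z" "Im z \<le> 1" "\<delta> \<le> Re z + Im z"
    and c: "Re z = 0 \<or> Re z = 1 \<or> Im z = 0 \<or> Im z = 1 \<or> Re z + Im z = \<delta>"
    using assms unfolding Pent_frontier(1) by (auto simp: Pent_def)
  have p: "\<exists>t\<in>{0..4}. z = pe t" if "0 \<le> t" "t \<le> 4" "pe t = z" for t using that by auto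
  consider "Re z + Im z = \<delta>" | "Im z = 0" | "Re z = 1" "0 < Im z" | "Im z = 1" "Re z < 1" | "Re z = 0" "Im z < 1"
    using z c by fastforce
  then show ?thesis
  proof cases
    case 1
    have th: "0 \<le> 4 * Im z / \<delta>" "4 * Im z / \<delta> \<le> 4" using 1 z del by (auto simp: divide_le_eq)
    have "z = of_real \<delta> * om (4 * Im z / \<delta> / 4)"
      using hyp_frontier(2,3)[OF th] 1 del by (simp add: complex_eq_iff)
    then show ?thesis using th by (intro disjI2 bexI[of _ "4 * Im z / \<delta>"]) auto
  next
    case 2
    then obtain u where u: "0 \<le> u" "u \<le> 1" "edg u = Re z" using edg_onto[of "Re z"] z by auto
    then show ?thesis using 2 by (intro disjI1 p[of u]) (auto simp: pe_def complex_eq_iff)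
  next
    case 3 then show ?thesis using z by (intro disjI1 p[of "1 + Im z"]) (auto simp: pe_def complex_eq_iff)
  next
    case 4
    show ?thesis
    proof (cases "Re z = 0")
      case True
      have "pe 3 = z" using True 4 by (simp add: pe_def complex_eq_iff)
      then show ?thesis by (intro disjI1 p[of 3]) auto
    next
      case False
      then show ?thesis using 4 z by (intro disjI1 p[of "3 - Re z"]) (auto simp: pe_def complex_eq_iff)
    qed
  next
    case 5
    then obtain u where u: "0 \<le> u" "u \<le> 1" "edg u = Im z" using edg_onto[of "Im z"] z by auto
    then have "u \<noteq> 1" using 5 edg_ends by auto
    then show ?thesis using u 5 by (intro disjI1 p[of "4 - u"]) (auto simp: pe_def complex_eq_iff)
  qed
qed

lemma gl_pe:
  assumes "gl x y"
  obtains u where "0 \<le> u" "u \<le> 1" "x = pe u" "y = pe (3 - u)" | u where "0 \<le> u" "u \<le> 1" "x = pe (4 - u)" "y = pe (1 + u)"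
proof -
  obtain u where u: "0 \<le> u" "u \<le> 1" and c: "(x = Complex (edg u) 0 \<and> y = Complex u 1) \<or> (x = Complex 0 (edg u) \<and> y = Complex 1 u)"
    using assms unfolding gl_def by auto
  have "pe u = Complex (edg u) 0" using u by (simp add: pe_def)
  moreover have "pe (3 - u) = Complex u 1"
    using u by (cases "u = 1") (auto simp: pe_def)
  moreover have "pe (4 - u) = Complex 0 (edg u)"
    using u by (cases "u = 1") (auto simp: pe_def edg_ends)
  moreover have "pe (1 + u) = Complex 1 u"
    using u by (cases "u = 0") (auto simp: pe_def edg_ends)
  ultimately show thesis using that u c by metis
qed

lemma pe_gl:
  assumes "0 \<le> u" "u \<le> 1" shows "gl (pe u) (pe (3 - u))" "gl (pe (4 - u)) (pe (1 + u))"
proof -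
  have "pe u = Complex (edg u) 0" using assms by (simp add: pe_def)
  moreover have "pe (3 - u) = Complex u 1"
    using assms by (cases "u = 1") (auto simp: pe_def)
  moreover have "pe (4 - u) = Complex 0 (edg u)"
    using assms by (cases "u = 1") (auto simp: pe_def edg_ends)
  moreover have "pe (1 + u) = Complex 1 u"
    using assms by (cases "u = 0") (auto simp: pe_def edg_ends)
  ultimately show "gl (pe u) (pe (3 - u))" "gl (pe (4 - u)) (pe (1 + u))" unfolding gl_def using assms by auto
qed

text \<open>Counterpart of \<open>L_onto\<close>: near a lattice point the image of \<open>L\<close>
  consists of ring points only, so it does not enter the removed disc.\<close>

lemma L_near:
  assumes x: "x \<in> Pent" and w: "w - L x \<in> lat" "n1 w < r"
  obtains \<theta> m where "0 \<le> \<theta>" "\<theta> \<le> 4" "w = of_real m * om \<theta>" "\<eta> \<theta> \<le> m"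
proof -
  let ?R = "\<exists>a \<theta> \<rho>. a \<in> lat \<and> 0 \<le> \<theta> \<and> \<theta> \<le> 4 \<and> 0 < \<rho> \<and> \<rho> \<le> 1 \<and> L x = a + ring \<theta> \<rho>"
  have "?R \<or> (L x = x \<and> (\<forall>a\<in>lat. r \<le> n1 (x - a)))" using zone_rep[of "\<lambda>_. ()", OF _ x] by blast
  moreover have "\<not> (L x = x \<and> (\<forall>a\<in>lat. r \<le> n1 (x - a)))"
  proof
    assume a: "L x = x \<and> (\<forall>a\<in>lat. r \<le> n1 (x - a))"
    then have "x - w \<in> lat" using w lat_diff_commute by metis
    then have "r \<le> n1 (x - (x - w))" using a by blast
    then show False using w by simp
  qed
  ultimately obtain a \<theta> \<rho> where R: "a \<in> lat" "0 \<le> \<theta>" "\<theta> \<le> 4" "0 < \<rho>" "\<rho> \<le> 1" "L x = a + ring \<theta> \<rho>" by blast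
  have nr: "n1 (ring \<theta> \<rho>) = (1 - \<rho>) * r + \<rho> * \<eta> \<theta>" using n1_ring R by simp
  have rr: "(1 - \<rho>) * r + \<rho> * \<eta> \<theta> \<le> r" using rad_ring(2)[of \<rho> \<theta>] R by simp
  have "(w - L x) + a \<in> lat" using lat_add[OF w(1) R(1)] .
  then have "w - ring \<theta> \<rho> \<in> lat" using R(6) by simp
  moreover have "n1 (w - ring \<theta> \<rho>) < 1" using n1_triangle(2)[of w "ring \<theta> \<rho>"] nr rr w r by linarith
  ultimately have "w - ring \<theta> \<rho> = 0" by (rule n1_lat)
  then have "w = of_real ((1 - \<rho>) * r + \<rho> * \<eta> \<theta>) * om \<theta>" by (simp add: ring_def)
  moreover have "(1 - \<rho>) * \<eta> \<theta> \<le> (1 - \<rho>) * r" using R eta(2)[of \<theta>] by (intro mult_left_mono) auto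
  then have "\<eta> \<theta> \<le> (1 - \<rho>) * r + \<rho> * \<eta> \<theta>" by (simp add: algebra_simps)
  ultimately show thesis using that R by blast
qed

end

section \<open>The boundary of a sector as seen from the centre of its hole\<close>

context center
begin

text \<open>\<open>dir i a\<close> has the direction of the image of \<open>Cc a\<close> under the inversion \<open>z \<mapsto> nc \<kappa> i / (z - pt i)\<close>, and \<open>ang i a\<close> is
  its parameter for \<open>om\<close>. The corner of the square, where the curve \<open>Cc ` rim i\<close> closes up, has the direction \<open>1\<close>.\<close>
definition "dir i a = cnj (1 - Cc a / pt i)"
definition "ang i a = (if Re a \<le> real i + 1 / 2 then 1 - Re (dir i a) / n1 (dir i a) else 3 + Re (dir i a) / n1 (dir i a))"

lemma pt_Gm: "pt i = of_real (1 / 4) * Gm (real i + 1 / 2)"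
  by (simp add: pt_def Cc_def)

lemma pt_nz: "pt i \<noteq> 0"
  using Gm_nz by (simp add: pt_Gm)

lemma rim_pt: assumes "i < k" "a \<in> rim i" shows "Cc a \<noteq> pt i" "dir i a \<noteq> 0" "Cc a \<in> sec i" "Cc a \<notin> interior (sec i)"
proof -
  have f: "Cc a \<in> frontier (sec i)" using sec_frontier assms by blast
  then show n: "Cc a \<notin> interior (sec i)" by (simp add: frontier_def)
  then show "Cc a \<noteq> pt i" using pt_interior[OF assms(1)] by auto
  then show "dir i a \<noteq> 0" using pt_nz[of i] by (auto simp: dir_def divide_eq_eq)
  show "Cc a \<in> sec i" using rim_W(2)[OF assms] by (auto simp: sec_def)
qed

text \<open>The imaginary part has the sign of a cross product and thus tells on which side of the
  midline of the cell the point lies. This justifies the case distinction in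
  \<open>ang\<close>.\<close>

lemma Im_dir: "Im (dir i a) = Im a / 4 * cr (Gm (real i + 1 / 2)) (Gm (Re a)) / (cmod (pt i))\<^sup>2"
proof -
  have "Im (dir i a) = Im (Cc a / pt i)" by (simp add: dir_def del: complex_cnj_divide complex_cnj_diff)
  also have "\<dots> = cr (pt i) (Cc a) / (cmod (pt i))\<^sup>2"
    by (simp add: Im_divide cmod_power2 cr_def mult.commute)
  also have "cr (pt i) (Cc a) = Im a / 4 * cr (Gm (real i + 1 / 2)) (Gm (Re a))"
    unfolding pt_Gm by (simp add: Cc_def cr_def algebra_simps)
  finally show ?thesis .
qed

lemma ang_polar:
  assumes i: "i < k" and a: "a \<in> rim i"
  shows "0 \<le> ang i a" "ang i a \<le> 4" "of_real (n1 (dir i a)) * om (ang i a) = dir i a"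
proof -
  note b = cell_bounds[OF i rim_W(2)[OF i a]]
  have ik: "real i + 1 \<le> real k" using i by simp
  note w = rim_pt(2)[OF i a]
  have p: "0 < (cmod (pt i))\<^sup>2" using pt_nz by simp
  have c: "cr (Gm (real i + 1 / 2)) (Gm (Re a)) \<le> 0 \<longleftrightarrow> real i + 1 / 2 \<le> Re a"
    "cr (Gm (real i + 1 / 2)) (Gm (Re a)) = 0 \<longleftrightarrow> real i + 1 / 2 = Re a"
    using cr_Gm_iff[of "real i + 1 / 2" "Re a"] b ik by auto
  have "0 \<le> ang i a \<and> ang i a \<le> 4 \<and> of_real (n1 (dir i a)) * om (ang i a) = dir i a"
  proof (cases "Re a \<le> real i + 1 / 2")
    case True
    then have "0 \<le> cr (Gm (real i + 1 / 2)) (Gm (Re a))" using c by (smt (verit))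
    then have "0 \<le> Im (dir i a)" unfolding Im_dir using b(3) p by simp
    from om_upper[OF this w] show ?thesis using True by (simp add: ang_def)
  next
    case False
    then have "cr (Gm (real i + 1 / 2)) (Gm (Re a)) \<le> 0" using c by simp
    then have "Im (dir i a) \<le> 0" unfolding Im_dir using b(3) p by (simp add: divide_nonpos_pos mult_nonneg_nonpos)
    from om_lower[OF this w] show ?thesis using False by (simp add: ang_def)
  qed
  then show "0 \<le> ang i a" "ang i a \<le> 4" "of_real (n1 (dir i a)) * om (ang i a) = dir i a" by auto
qed

lemma ang_ends: "ang i (Complex (real i) 0) = 0" "ang i (Complex (real i + 1) 0) = 4"
  by (simp_all add: ang_def dir_def Cc_def n1_def)

lemma compact_rim: "compact (rim i)"
proof -
  have "closed ({z. Re z = real i} \<union> {z. Re z = real i + 1} \<union> {z. Im z = 1 / 2})"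
    by (intro closed_Un closed_Collect_eq continuous_on_Re continuous_on_Im continuous_on_id continuous_on_const)
  moreover have "rim i = cell i \<inter> ({z. Re z = real i} \<union> {z. Re z = real i + 1} \<union> {z. Im z = 1 / 2})"
    by (auto simp: rim_def)
  ultimately show ?thesis using compact_cell compact_Int_closed by metis
qed

lemma connected_rim: "connected (rim i)"
proof -
  let ?A = "cbox (Complex (real i) 0) (Complex (real i) (1 / 2))"
  let ?B = "cbox (Complex (real i) (1 / 2)) (Complex (real i + 1) (1 / 2))"
  let ?C = "cbox (Complex (real i + 1) 0) (Complex (real i + 1) (1 / 2))"
  have eq: "rim i = ?A \<union> (?B \<union> ?C)"
    by (auto simp: rim_def cell_def in_cbox_complex_iff)
  have c: "connected ?A" "connected ?B" "connected ?C" by (auto intro: convex_connected convex_box)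
  have "Complex (real i) (1 / 2) \<in> ?A \<inter> ?B" "Complex (real i + 1) (1 / 2) \<in> ?B \<inter> ?C" by (auto simp: in_cbox_complex_iff)
  then show ?thesis unfolding eq using c by (intro connected_Un) blast+
qed

lemma continuous_dir: "continuous_on S (dir i)"
  unfolding dir_def using pt_nz by (intro continuous_intros continuous_Cc) auto

lemma continuous_ang: assumes i: "i < k" shows "continuous_on (rim i) (ang i)"
proof -
  have nz: "n1 (dir i a) \<noteq> 0" if "a \<in> rim i" for a using rim_pt(2)[OF i that] n1_pos(2) by blast
  have c: "continuous_on (rim i) (\<lambda>a. 1 - Re (dir i a) / n1 (dir i a))" "continuous_on (rim i) (\<lambda>a. 3 + Re (dir i a) / n1 (dir i a))"
    using nz by (auto intro!: continuous_intros continuous_dir)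
  have eq: "ang i = (\<lambda>a. if Re a \<le> real i + 1 / 2 then 1 - Re (dir i a) / n1 (dir i a) else 3 + Re (dir i a) / n1 (dir i a))"
    by (rule ext) (simp add: ang_def)
  show ?thesis unfolding eq
  proof (rule continuous_on_cases_le)
    show "continuous_on {t \<in> rim i. Re t \<le> real i + 1 / 2} (\<lambda>a. 1 - Re (dir i a) / n1 (dir i a))"
      by (rule continuous_on_subset[OF c(1)]) auto
    show "continuous_on {t \<in> rim i. real i + 1 / 2 \<le> Re t} (\<lambda>a. 3 + Re (dir i a) / n1 (dir i a))"
      by (rule continuous_on_subset[OF c(2)]) auto
    show "continuous_on (rim i) Re" by (intro continuous_intros)
    fix a assume a: "a \<in> rim i" "Re a = real i + 1 / 2"
    then have "Im a = 1 / 2" by (auto simp: rim_def)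
    \<comment> \<open>At the middle of the rim the direction is \<open>- 1\<close>, where both
      branches of \<open>ang\<close> take the value 2.\<close>
    then have "Cc a = 2 * pt i" using a by (simp add: complex_eq_iff Cc_simps pt_Gm)
    then have "dir i a = -1" using pt_nz[of i] by (simp add: dir_def)
    then show "1 - Re (dir i a) / n1 (dir i a) = 3 + Re (dir i a) / n1 (dir i a)" by (simp add: n1_def)
  qed
qed

text \<open>Of two rim points in the same direction from \<open>pt i\<close> the nearer one would be
  an interior point of the convex sector. The two ends of the rim, both mapped to 0 by
  \<open>Cc\<close>, are told apart by the values 0 and 4.\<close>

lemma ang_inj:
  assumes i: "i < k" and ab: "a \<in> rim i" "b \<in> rim i" "ang i a = ang i b"
  shows "a = b"
proof -
  have main: "Cc a = Cc b" if ab: "a \<in> rim i" "b \<in> rim i" "ang i a = ang i b" "n1 (dir i a) \<le> n1 (dir i b)" for a b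
  proof -
    define s where "s = n1 (dir i a) / n1 (dir i b)"
    have n: "0 < n1 (dir i a)" "0 < n1 (dir i b)" using rim_pt(2)[OF i] ab n1_pos by (metis less_eq_real_def)+
    have s: "0 < s" "s \<le> 1" "n1 (dir i a) = s * n1 (dir i b)" using n ab(4) by (auto simp: s_def)
    have "dir i a = of_real (n1 (dir i a)) * om (ang i b)" using ang_polar(3)[OF i ab(1)] ab(3) by simp
    also have "\<dots> = of_real s * (of_real (n1 (dir i b)) * om (ang i b))" unfolding s(3) by simp
    also have "\<dots> = of_real s * dir i b" using ang_polar(3)[OF i ab(2)] by simp
    finally have "cnj (dir i a) = cnj (of_real s * dir i b)" by simp
    then have "1 - Cc a / pt i = of_real s * (1 - Cc b / pt i)" by (simp add: dir_def)
    then have "pt i * (1 - Cc a / pt i) = pt i * (of_real s * (1 - Cc b / pt i))" by simp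
    then have "pt i - Cc a = of_real s * (pt i - Cc b)" using pt_nz[of i] by (simp add: algebra_simps)
    then have e: "Cc a = Cc b - (1 - s) *\<^sub>R (Cc b - pt i)" by (simp add: scaleR_conv_of_real algebra_simps)
    show ?thesis
    proof (cases "s = 1")
      case True then show ?thesis using e by simp
    next
      case False
      then have "Cc a \<in> interior (sec i)" unfolding e
        using s sec_convex[OF i] pt_interior[OF i] rim_pt(3)[OF i ab(2)] by (intro mem_interior_convex_shrink) auto
      then show ?thesis using rim_pt(4)[OF i ab(1)] by blast
    qed
  qed
  have C: "Cc a = Cc b" using main[of a b] main[of b a] ab by (cases "n1 (dir i a) \<le> n1 (dir i b)") auto
  note ba = cell_bounds[OF i rim_W(2)[OF i ab(1)]] and bb = cell_bounds[OF i rim_W(2)[OF i ab(2)]]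
  show ?thesis
  proof (cases "Im a = 0 \<and> Im b = 0")
    case True
    then have "(a = Complex (real i) 0 \<or> a = Complex (real i + 1) 0) \<and> (b = Complex (real i) 0 \<or> b = Complex (real i + 1) 0)"
      using ab by (auto simp: rim_def complex_eq_iff)
    then show ?thesis using ang_ends[of i] ab(3) by auto
  next
    case False
    then have "0 < Im a \<or> 0 < Im b" using ba bb by linarith
    then show ?thesis using Cc_inj[of a b] Cc_inj[of b a] ba bb C by auto
  qed
qed

lemma ang_image: assumes i: "i < k" shows "ang i ` rim i = {0..4}"
proof
  show "ang i ` rim i \<subseteq> {0..4}" using ang_polar[OF i] by auto
  have "connected (ang i ` rim i)" using connected_continuous_image[OF continuous_ang[OF i] connected_rim] .
  moreover have "0 \<in> ang i ` rim i" "4 \<in> ang i ` rim i"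
    using ang_ends[of i] base_rim[of i] by (force simp: rim_def cell_def)+
  ultimately show "{0..4} \<subseteq> ang i ` rim i" using connected_contains_Icc by blast
qed

lemma frontier_cell: "frontier (cell i) = {z \<in> cell i. Im z = 0} \<union> rim i" "interior (cell i) \<noteq> {}"
proof -
  have eq: "cell i = cbox (Complex (real i) 0) (Complex (real i + 1) (1 / 2))"
    by (auto simp: cell_def in_cbox_complex_iff)
  have int: "interior (cell i) = {z. real i < Re z \<and> Re z < real i + 1 \<and> 0 < Im z \<and> Im z < 1 / 2}"
    unfolding eq interior_cbox by (auto simp: in_box_complex_iff)
  have "Complex (real i + 1 / 2) (1 / 4) \<in> interior (cell i)" unfolding int by simp
  then show "interior (cell i) \<noteq> {}" by blast
  have "closed (cell i)" using compact_cell compact_imp_closed by blast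
  then show "frontier (cell i) = {z \<in> cell i. Im z = 0} \<union> rim i"
    unfolding frontier_def int by (auto simp: cell_def rim_def)
qed

text \<open>An application of \<open>loop_extension\<close> with the frontier of the cell as its own
  parameter set: the bottom goes to the four glued sides of \<open>Pent\<close>, and the rim to the
  oblique side at the speed prescribed by \<open>ang\<close>.\<close>

lemma handle_chart:
  assumes i: "i < k" and "oct r \<delta> \<eta>"
  obtains h h' where "homeomorphism (cell i) (oct.Pent \<delta>) h h'"
    "\<And>a. a \<in> rim i \<Longrightarrow> h a = of_real \<delta> * om (ang i a / 4)"
    "\<And>t. 0 \<le> t \<Longrightarrow> t \<le> 4 \<Longrightarrow> h (Complex (real i + t / 4) 0) = oct.pe r \<delta> t"
proof -
  interpret oct r \<delta> \<eta> by fact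
  let ?B = "{z \<in> cell i. Im z = 0}"
  let ?p = "\<lambda>z. pe (4 * (Re z - real i))" and ?o = "\<lambda>z. of_real \<delta> * om (ang i z / 4)"
  define \<mu> where "\<mu> z = (if z \<in> ?B then ?p z else ?o z)" for z
  have Bc: "compact ?B"
  proof -
    have "?B = cell i \<inter> {z. Im z = 0}" by auto
    moreover have "closed {z. Im z = 0}" by (intro closed_Collect_eq continuous_intros)
    ultimately show ?thesis using compact_cell compact_Int_closed by metis
  qed
  have match: "?p z = ?o z" if "z \<in> ?B" "z \<in> rim i" for z
  proof -
    have "z = Complex (real i) 0 \<or> z = Complex (real i + 1) 0" using that by (auto simp: rim_def complex_eq_iff)
    then consider "z = Complex (real i) 0" | "z = Complex (real i + 1) 0" by blast
    then show ?thesis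
    proof cases
      case 1
      then have "ang i z = 0" "Re z = real i" using ang_ends by simp_all
      then show ?thesis using edg_ends by (simp add: pe_def om_def complex_eq_iff)
    next
      case 2
      then have "ang i z = 4" "Re z = real i + 1" using ang_ends by simp_all
      then show ?thesis using edg_ends by (simp add: pe_def om_def complex_eq_iff)
    qed
  qed
  have mu: "z \<in> ?B \<Longrightarrow> \<mu> z = ?p z" "z \<in> rim i \<Longrightarrow> \<mu> z = ?o z" for z using match[of z] by (auto simp: \<mu>_def)
  have tB: "0 \<le> 4 * (Re z - real i)" "4 * (Re z - real i) \<le> 4" if "z \<in> ?B" for z using that by (auto simp: cell_def)
  have cont: "continuous_on (?B \<union> rim i) \<mu>"
  proof (rule continuous_on_closed_Un)
    show "closed ?B" "closed (rim i)" using Bc compact_rim compact_imp_closed by auto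
    have "continuous_on ?B ?p" by (rule continuous_on_compose2[OF continuous_pe[of UNIV]]) (auto intro!: continuous_intros)
    then show "continuous_on ?B \<mu>" by (rule continuous_on_eq) (simp add: mu(1))
    have "continuous_on (rim i) ?o"
      by (intro continuous_intros continuous_on_compose2[OF continuous_om[of UNIV]] continuous_ang[OF i]) auto
    then show "continuous_on (rim i) \<mu>" by (rule continuous_on_eq) (simp add: mu(2))
  qed
  have mixed: "z = u" if z: "z \<in> ?B" and u: "u \<in> rim i" and e: "\<mu> z = \<mu> u" for z u
  proof -
    have eq: "?p z = ?o u" using mu z u e by simp
    have "Re (?o u) + Im (?o u) = \<delta>" using hyp_frontier(2,3)[OF ang_polar(1,2)[OF i u]] by simp
    then have "4 * (Re z - real i) = 0 \<or> 4 * (Re z - real i) = 4" using pe_frontier(2)[OF tB[OF z]] eq by metis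
    then have "z \<in> rim i" using z by (auto simp: rim_def)
    have "?o z = ?o u" using match[OF z \<open>z \<in> rim i\<close>] eq by simp
    then have "\<delta> * ang i z / 4 = \<delta> * ang i u / 4"
      using hyp_frontier(3)[OF ang_polar(1,2)[OF i u]] hyp_frontier(3)[OF ang_polar(1,2)[OF i \<open>z \<in> rim i\<close>]] by metis
    then show ?thesis using ang_inj[OF i \<open>z \<in> rim i\<close> u] del by simp
  qed
  have inj: "z = u" if zu: "z \<in> ?B \<union> rim i" "u \<in> ?B \<union> rim i" "\<mu> z = \<mu> u" for z u
  proof -
    consider "z \<in> ?B" "u \<in> ?B" | "z \<in> ?B" "u \<in> rim i" | "z \<in> rim i" "u \<in> ?B" | "z \<in> rim i" "u \<in> rim i" using zu by blast
    then show ?thesis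
    proof cases
      case 1
      then have "?p z = ?p u" using mu(1) zu(3) by metis
      from pe_inj[OF tB[OF 1(1)] tB[OF 1(2)] this] have "Re z = Re u" by simp
      then show ?thesis using 1 by (simp add: complex_eq_iff)
    next
      case 2 then show ?thesis using mixed zu(3) by blast
    next
      case 3 then show ?thesis using mixed[of u z] zu(3) by metis
    next
      case 4
      then have "?o z = ?o u" using mu(2) zu(3) by metis
      then have "\<delta> * ang i z / 4 = \<delta> * ang i u / 4"
        using hyp_frontier(3)[OF ang_polar(1,2)[OF i 4(1)]] hyp_frontier(3)[OF ang_polar(1,2)[OF i 4(2)]] by metis
      then show ?thesis using ang_inj[OF i 4] del by simp
    qed
  qed
  have img: "\<mu> ` (?B \<union> rim i) = frontier Pent"
  proof
    show "\<mu> ` (?B \<union> rim i) \<subseteq> frontier Pent"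
    proof safe
      fix z assume "z \<in> cell i" "Im z = 0"
      then have "z \<in> ?B" by simp
      then show "\<mu> z \<in> frontier Pent" using mu(1) pe_frontier(1)[OF tB] by simp
    next
      fix z assume "z \<in> rim i"
      then show "\<mu> z \<in> frontier Pent" using mu(2) hyp_frontier(1)[OF ang_polar(1,2)[OF i]] by simp
    qed
    show "frontier Pent \<subseteq> \<mu> ` (?B \<union> rim i)"
    proof
      fix z assume "z \<in> frontier Pent"
      from frontier_Pent_cases[OF this] show "z \<in> \<mu> ` (?B \<union> rim i)"
      proof (elim disjE bexE)
        fix t assume t: "t \<in> {0..4}" "z = pe t"
        then have "Complex (real i + t / 4) 0 \<in> ?B" by (auto simp: cell_def)
        moreover from mu(1)[OF this] have "\<mu> (Complex (real i + t / 4) 0) = z" using t by simp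
        ultimately show ?thesis by blast
      next
        fix \<theta> assume t: "\<theta> \<in> {0..4}" "z = of_real \<delta> * om (\<theta> / 4)"
        then obtain a where a: "a \<in> rim i" "ang i a = \<theta>" using ang_image[OF i] by (metis imageE)
        then have "\<mu> a = z" using mu(2)[of a] t by simp
        then show ?thesis using a(1) by blast
      qed
    qed
  qed
  have T: "compact (?B \<union> rim i)" using Bc compact_rim by (rule compact_Un)
  have f: "id ` (?B \<union> rim i) = frontier (cell i)" using frontier_cell(1) by simp
  obtain h h' where h: "homeomorphism (cell i) Pent h h'" "\<And>t. t \<in> ?B \<union> rim i \<Longrightarrow> h (id t) = \<mu> t"
    by (rule loop_extension[OF convex_cell compact_cell frontier_cell(2) convex_Pent compact_Pent Pent_frontier(2) T continuous_on_id' cont f img, folded id_def])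
      (use inj in auto)
  show thesis
  proof (rule that[OF h(1)])
    show "h a = of_real \<delta> * om (ang i a / 4)" if "a \<in> rim i" for a using h(2)[of a] mu(2) that by simp
    show "h (Complex (real i + t / 4) 0) = pe t" if "0 \<le> t" "t \<le> 4" for t
    proof -
      have "Complex (real i + t / 4) 0 \<in> ?B" using that by (auto simp: cell_def)
      then show ?thesis using h(2)[of "Complex (real i + t / 4) 0"] mu(1)[of "Complex (real i + t / 4) 0"] by simp
    qed
  qed
qed

lemma rim_far:
  assumes "i < k" "ball (pt i) \<iota> \<subseteq> sec i" "a \<in> rim i" shows "\<iota> \<le> cmod (Cc a - pt i)"
proof (rule ccontr)
  assume "\<not> \<iota> \<le> cmod (Cc a - pt i)"
  then have "Cc a \<in> ball (pt i) \<iota>" by (simp add: dist_norm norm_minus_commute)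
  then have "Cc a \<in> interior (sec i)" using assms(2) interior_maximal[OF _ open_ball] by blast
  then show False using rim_pt(4)[OF assms(1,3)] by blast
qed

end

section \<open>The chart of an outer torus\<close>

locale surf = center +
  fixes X :: "'a topology" and q :: "complex \<Rightarrow> 'a"
  assumes q_cont: "continuous_map (top_of_set (rect k)) X q"
    and q_onto: "q ` rect k = topspace X"
    and q_eq: "\<And>x y. x \<in> rect k \<Longrightarrow> y \<in> rect k \<Longrightarrow> q x = q y \<longleftrightarrow> eqv x y"
begin

text \<open>The constant of the neck at \<open>pt i\<close>: by its argument, inversion sends the corner \<open>0\<close> of the square, as seen from
  \<open>pt i\<close>, to the positive real axis.\<close>
definition "nc \<kappa> i = - of_real (\<kappa> / cmod (pt i)) * pt i"

lemma cmod_nc: "0 < \<kappa> \<Longrightarrow> cmod (nc \<kappa> i) = \<kappa>"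
  using pt_nz[of i] by (simp add: nc_def norm_mult norm_divide)

definition "hh \<kappa> i a = nc \<kappa> i / (Cc a - pt i)"

lemma hh_polar:
  assumes i: "i < k" and a: "a \<in> rim i" and \<kappa>: "0 < \<kappa>"
  shows "hh \<kappa> i a = of_real (n1 (hh \<kappa> i a)) * om (ang i a)" "hh \<kappa> i a \<noteq> 0" "cmod (hh \<kappa> i a) = \<kappa> / cmod (Cc a - pt i)"
proof -
  let ?w = "dir i a"
  note w = rim_pt(1,2)[OF i a] and p = pt_nz[of i]
  define c where "c = \<kappa> / cmod (pt i) / (cmod ?w)\<^sup>2"
  have c: "0 < c" using \<kappa> w p by (simp add: c_def)
  show nz: "hh \<kappa> i a \<noteq> 0" using w p \<kappa> by (simp add: hh_def nc_def)
  show "cmod (hh \<kappa> i a) = \<kappa> / cmod (Cc a - pt i)" by (simp add: hh_def norm_divide cmod_nc \<kappa>)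
  have cw: "cnj ?w \<noteq> 0" using w by simp
  have e: "cnj ?w = (pt i - Cc a) / pt i" using p by (simp add: dir_def diff_divide_distrib)
  have "hh \<kappa> i a = of_real (\<kappa> / cmod (pt i)) * (pt i / (pt i - Cc a))"
    unfolding hh_def nc_def by (metis (no_types, lifting) minus_diff_eq minus_divide_right minus_mult_left mult.commute times_divide_eq_right minus_divide_left)
  also have "pt i / (pt i - Cc a) = 1 / cnj ?w" unfolding e by simp
  also have "1 / cnj ?w = ?w / of_real ((cmod ?w)\<^sup>2)" using w(2) complex_norm_square[of ?w] by (simp add: field_simps)
  finally have h: "hh \<kappa> i a = of_real c * ?w" by (simp add: c_def)
  then have "n1 (hh \<kappa> i a) = c * n1 ?w" using c by (simp add: n1_scale)
  then have "of_real (n1 (hh \<kappa> i a)) * om (ang i a) = of_real c * (of_real (n1 ?w) * om (ang i a))" by simp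
  also have "\<dots> = hh \<kappa> i a" unfolding ang_polar(3)[OF i a] h ..
  finally show "hh \<kappa> i a = of_real (n1 (hh \<kappa> i a)) * om (ang i a)" by simp
qed

text \<open>The hole of the torus is given the inverted rim as its boundary. The inversion about
  \<open>pt i\<close> then takes the rim of the sector exactly to the edge of the hole, and the
  charts on both sides name the same points of the surface there.\<close>

theorem outer:
  assumes i: "i < k" and \<iota>: "0 < \<iota>" "ball (pt i) \<iota> \<subseteq> sec i" and \<kappa>: "0 < \<kappa>" "16 * \<kappa> < \<iota>"
  obtains Y E where "continuous_map (top_of_set E) X Y"
    "\<And>w v. w \<in> E \<Longrightarrow> v \<in> E \<Longrightarrow> Y w = Y v \<longleftrightarrow> w - v \<in> lat"
    "\<And>w. w \<in> E \<Longrightarrow> \<exists>u\<in>cell i. Y w = q u"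
    "\<And>u. u \<in> cell i \<Longrightarrow> \<exists>w\<in>E. Y w = q u"
    "\<And>a. a \<in> rim i \<Longrightarrow> hh \<kappa> i a \<in> E \<and> Y (hh \<kappa> i a) = q a"
    "\<And>z. z \<in> sec i \<Longrightarrow> z \<noteq> pt i \<Longrightarrow> cmod (nc \<kappa> i / (z - pt i)) < 7 / 16 \<Longrightarrow> nc \<kappa> i / (z - pt i) \<in> E"
    "\<And>w. (\<forall>a\<in>lat. 2 * \<kappa> / \<iota> \<le> cmod (w - a)) \<Longrightarrow> w \<in> E"
    "\<And>w. w \<in> E \<Longrightarrow> cmod w < 1 / 16 \<Longrightarrow> w \<noteq> 0 \<and> pt i + nc \<kappa> i / w \<in> sec i"
    "\<And>w a. w \<in> E \<Longrightarrow> a \<in> lat \<Longrightarrow> w + a \<in> E"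
proof -
  have rim_far: "\<iota> \<le> cmod (Cc a - pt i)" if "a \<in> rim i" for a
    using rim_far[OF i \<iota>(2) that] .
  have hh_le: "n1 (hh \<kappa> i a) \<le> 2 * \<kappa> / \<iota>" "0 < n1 (hh \<kappa> i a)" if "a \<in> rim i" for a
  proof -
    have "n1 (hh \<kappa> i a) \<le> 2 * (\<kappa> / cmod (Cc a - pt i))" using n1_cmod(2)[of "hh \<kappa> i a"] hh_polar(3)[OF i that \<kappa>(1)] by simp
    also have "\<kappa> / cmod (Cc a - pt i) \<le> \<kappa> / \<iota>" using rim_far[OF that] \<kappa> \<iota> by (intro divide_left_mono) (auto intro!: mult_pos_pos)
    finally show "n1 (hh \<kappa> i a) \<le> 2 * \<kappa> / \<iota>" by simp
    show "0 < n1 (hh \<kappa> i a)" using n1_pos[of "hh \<kappa> i a"] hh_polar(2)[OF i that \<kappa>(1)] by linarith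
  qed
  have k8: "2 * \<kappa> / \<iota> < 1 / 8" using \<kappa> \<iota> by (simp add: divide_less_eq)
  have "inj_on (ang i) (rim i)" using ang_inj[OF i] by (auto intro: inj_onI)
  then obtain ai where ai: "homeomorphism (rim i) {0..4} (ang i) ai"
    using homeomorphism_compact[OF compact_rim continuous_ang[OF i] ang_image[OF i]] by blast
  have ai_in: "ai t \<in> rim i" "ang i (ai t) = t" if "0 \<le> t" "t \<le> 4" for t
    using ai that unfolding homeomorphism_def by auto
  have ai_ang: "ai (ang i a) = a" if "a \<in> rim i" for a
    using ai that unfolding homeomorphism_def by auto
  \<comment> \<open>Clamping to \<open>[0,4]\<close> extends the radial function to all reals, as
    \<open>oct\<close> requires.\<close>
  define cl where "cl t = max 0 (min 4 t)" for t :: real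
  have cl: "0 \<le> cl t" "cl t \<le> 4" for t by (auto simp: cl_def)
  define \<eta> where "\<eta> t = n1 (hh \<kappa> i (ai (cl t)))" for t
  have eta_eq: "\<eta> t = n1 (hh \<kappa> i (ai t))" if "0 \<le> t" "t \<le> 4" for t using that by (simp add: \<eta>_def cl_def)
  \<comment> \<open>The estimate \<open>2 * \<kappa> / \<iota> < 1 / 8\<close> puts the hole inside
    the corner zone of radius \<open>1 / 8\<close>; the triangle may have any smaller size.\<close>
  have octo: "oct (1/8) (1/16) \<eta>"
  proof (unfold_locales; (simp; fail)?)
    fix t
    show "0 < \<eta> t" unfolding \<eta>_def using hh_le(2) ai_in cl by blast
    show "\<eta> t < 1 / 8" unfolding \<eta>_def using hh_le(1)[OF ai_in(1)[OF cl]] k8 by (rule order_le_less_trans)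
  next
    have "continuous_on (rim i) (hh \<kappa> i)"
      unfolding hh_def using rim_pt(1)[OF i] by (intro continuous_intros continuous_Cc) auto
    moreover have "continuous_on UNIV (\<lambda>t. ai (cl t))"
    proof (rule continuous_on_compose2[of "{0..4}" ai UNIV cl])
      show "continuous_on {0..4} ai" using ai by (simp add: homeomorphism_def)
      show "continuous_on UNIV cl" unfolding cl_def by (intro continuous_intros)
    qed (use cl in auto)
    ultimately have "continuous_on UNIV (\<lambda>t. hh \<kappa> i (ai (cl t)))"
      by (rule continuous_on_compose2) (use ai_in cl in auto)
    then show "continuous_on UNIV \<eta>" unfolding \<eta>_def by (intro continuous_intros)
    have "ai 0 = Complex (real i) 0" using ai_ang[OF base_rim[of i]] ang_ends by simp
    moreover have "Complex (real i + 1) 0 \<in> rim i" by (simp add: rim_def cell_def)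
    from ai_ang[OF this] have "ai 4 = Complex (real i + 1) 0" using ang_ends by simp
    ultimately show "\<eta> 0 = \<eta> 4" using eta_eq[of 0] eta_eq[of 4] by (simp add: hh_def Cc_def)
  qed
  interpret oct "1/8" "1/16" \<eta> by (rule octo)
  obtain h h' where h: "homeomorphism (cell i) Pent h h'"
    "\<And>a. a \<in> rim i \<Longrightarrow> h a = of_real (1/16) * om (ang i a / 4)"
    "\<And>t. 0 \<le> t \<Longrightarrow> t \<le> 4 \<Longrightarrow> h (Complex (real i + t / 4) 0) = pe t"
    using handle_chart[OF i octo] by metis
  have hh': "h' x \<in> cell i" "h (h' x) = x" if "x \<in> Pent" for x using h(1) that unfolding homeomorphism_def by auto
  have h'h: "h a \<in> Pent" "h' (h a) = a" if "a \<in> cell i" for a using h(1) that unfolding homeomorphism_def by auto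
  have cell_rect: "u \<in> rect k" if "u \<in> cell i" for u using cell_bounds(5)[OF i that] .
  have h'pe: "h' (pe t) = Complex (real i + t / 4) 0" if "0 \<le> t" "t \<le> 4" for t
  proof -
    have "Complex (real i + t / 4) 0 \<in> cell i" using that by (auto simp: cell_def)
    from h'h(2)[OF this] show ?thesis using h(3)[OF that] by simp
  qed
  have cont: "continuous_map (top_of_set Pent) X (\<lambda>x. q (h' x))"
  proof -
    have "continuous_on Pent h'" using h(1) by (simp add: homeomorphism_def)
    then have "continuous_map (top_of_set Pent) (top_of_set (rect k)) h'"
      using hh'(1) cell_rect by (auto simp: continuous_map_in_subtopology)
    from continuous_map_compose[OF this q_cont] show ?thesis by (simp add: o_def)
  qed
  have glq: "q (h' x) = q (h' y)" if g: "gl x y" for x y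
  proof -
    have "handle_glued i (h' x) (h' y) \<or> handle_glued i (h' y) (h' x)"
      using g
    proof (cases rule: gl_pe)
      case (1 u)
      have "handle_glued i (Complex (real i + u / 4) 0) (Complex (real i + (3 - u) / 4) 0)" using handle_gluedI(1) 1 by blast
      then show ?thesis using h'pe[of u] h'pe[of "3 - u"] 1 by simp
    next
      case (2 u)
      have "handle_glued i (Complex (real i + (1 + u) / 4) 0) (Complex (real i + (4 - u) / 4) 0)" using handle_gluedI(2) 2 by blast
      then show ?thesis using h'pe[of "1 + u"] h'pe[of "4 - u"] 2 by simp
    qed
    then have "rect_glued k (h' x) (h' y) \<or> rect_glued k (h' y) (h' x)" using handle_glued_rect[OF i] by blast
    then have "eqv (h' x) (h' y)" "h' x \<in> rect k" "h' y \<in> rect k" using eqv_glued eqv_sym rect_glued_in by blast+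
    then show ?thesis using q_eq by blast
  qed
  have hgl: "equivclp gl (h a) (h b)" if "equivclp (handle_glued i) a b" for a b
    using that
  proof (induction rule: equivclp_induct)
    case (step b c)
    have g: "gl (h x) (h y) \<or> gl (h y) (h x)" if hxy: "handle_glued i x y" for x y
    proof -
      obtain s where s: "0 \<le> s" "s \<le> 1" and e: "(x = Complex (real i + s / 4) 0 \<and> y = Complex (real i + (3 - s) / 4) 0) \<or>
       (x = Complex (real i + (1 + s) / 4) 0 \<and> y = Complex (real i + (4 - s) / 4) 0)"
        using hxy unfolding handle_glued_def by auto
      have "h (Complex (real i + s / 4) 0) = pe s" "h (Complex (real i + (3 - s) / 4) 0) = pe (3 - s)"
        "h (Complex (real i + (1 + s) / 4) 0) = pe (1 + s)" "h (Complex (real i + (4 - s) / 4) 0) = pe (4 - s)"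
        using h(3) s by simp_all
      then show ?thesis using e pe_gl[OF s] by auto
    qed
    have "gl (h b) (h c) \<or> gl (h c) (h b)" using step(2) g[of b c] g[of c b] by blast
    then have "equivclp gl (h b) (h c)" by (auto intro: r_into_equivclp equivclp_sym)
    then show ?case using step(3) equivclp_trans by metis
  qed simp
  have ker: "equivclp gl x y" if "x \<in> Pent" "y \<in> Pent" "q (h' x) = q (h' y)" for x y
  proof -
    have "eqv (h' x) (h' y)" using q_eq cell_rect hh'(1) that by blast
    then have "equivclp (handle_glued i) (h' x) (h' y)" using eqv_same_cell[OF i] hh'(1) that by blast
    from hgl[OF this] show ?thesis using hh'(2) that by simp
  qed
  obtain Y E where YE: "continuous_map (top_of_set E) X Y"
    "\<And>w. w \<in> E \<longleftrightarrow> (\<exists>x\<in>Pent. w - L x \<in> lat)"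
    "\<And>w x. x \<in> Pent \<Longrightarrow> w - L x \<in> lat \<Longrightarrow> Y w = q (h' x)"
    "\<And>w v. w \<in> E \<Longrightarrow> v \<in> E \<Longrightarrow> Y w = Y v \<longleftrightarrow> w - v \<in> lat"
    by (rule handle_map[OF cont glq ker]) (assumption | rule that)+
  have ring_hh: "of_real (\<eta> \<theta>) * om \<theta> = hh \<kappa> i (ai \<theta>)" if "0 \<le> \<theta>" "\<theta> \<le> 4" for \<theta>
    using hh_polar(1)[OF i ai_in(1)[OF that] \<kappa>(1)] ai_in(2)[OF that] eta_eq[OF that] by simp
  have onto: "w \<in> E" if "\<And>a m \<theta>. a \<in> lat \<Longrightarrow> 0 \<le> \<theta> \<Longrightarrow> \<theta> \<le> 4 \<Longrightarrow> 0 \<le> m \<Longrightarrow> m \<le> 1 / 8 \<Longrightarrow> w = a + of_real m * om \<theta> \<Longrightarrow> \<eta> \<theta> \<le> m" for w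
    using L_onto[of w] that YE(2) by blast
  show thesis
  proof (rule that[OF YE(1) YE(4)])
    show "\<exists>u\<in>cell i. Y w = q u" if "w \<in> E" for w using that YE(2,3) hh'(1) by blast
    show "\<exists>w\<in>E. Y w = q u" if u: "u \<in> cell i" for u
    proof -
      have "L (h u) - L (h u) \<in> lat" using lat_0 by simp
      then have "L (h u) \<in> E" "Y (L (h u)) = q u" using YE(2,3) h'h[OF u] by (blast, metis)
      then show ?thesis by blast
    qed
    show "hh \<kappa> i a \<in> E \<and> Y (hh \<kappa> i a) = q a" if a: "a \<in> rim i" for a
    proof -
      have ac: "a \<in> cell i" using rim_W(2)[OF i a] .
      note t = ang_polar(1,2)[OF i a]
      have "L (h a) = hh \<kappa> i a" unfolding h(2)[OF a] hyp_frontier(4)[OF t] ring_hh[OF t] ai_ang[OF a] ..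
      then have "hh \<kappa> i a - L (h a) \<in> lat" using lat_0 by simp
      then show ?thesis using YE(2,3) h'h[OF ac] by metis
    qed
    show "nc \<kappa> i / (z - pt i) \<in> E" if z: "z \<in> sec i" "z \<noteq> pt i" "cmod (nc \<kappa> i / (z - pt i)) < 7 / 16" for z
    proof (rule onto)
      fix a m \<theta> assume a: "a \<in> lat" and t: "0 \<le> \<theta>" "\<theta> \<le> 4" and m: "0 \<le> m" "m \<le> 1 / 8"
        and e: "nc \<kappa> i / (z - pt i) = a + of_real m * om \<theta>"
      let ?v = "nc \<kappa> i / (z - pt i)"
      have ncz: "nc \<kappa> i \<noteq> 0" using cmod_nc[OF \<kappa>(1), of i] \<kappa>(1) by auto
      have "a = ?v - of_real m * om \<theta>" using e by simp
      then have "n1 a \<le> n1 ?v + n1 (of_real m * om \<theta>)" using n1_triangle(2) by metis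
      also have "n1 ?v \<le> 2 * cmod ?v" by (rule n1_cmod)
      also have "n1 (of_real m * om \<theta>) = m" unfolding n1_scale using m n1_om[OF t] by simp
      finally have "n1 a < 1" using z(3) m by linarith
      then have "a = 0" using n1_lat a by blast
      then have v: "?v = of_real m * om \<theta>" using e by simp
      let ?b = "ai \<theta>"
      note b = ai_in(1)[OF t]
      show "\<eta> \<theta> \<le> m"
      proof (rule ccontr)
        assume "\<not> \<eta> \<theta> \<le> m"
        then have lt: "m < \<eta> \<theta>" by simp
        have m0: "0 < m" using v ncz z m by (cases "m = 0") auto
        \<comment> \<open>If the inverted point were inside the hole, the rim point in its direction
          would lie strictly between \<open>pt i\<close> and \<open>z\<close>, hence in the interior
          of the sector.\<close>
        define s where "s = m / \<eta> \<theta>"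
        have s: "0 < s" "s < 1" "m = s * \<eta> \<theta>" using lt m0 by (auto simp: s_def)
        have "?v = of_real s * (of_real (\<eta> \<theta>) * om \<theta>)" using v s(3) by simp
        then have "nc \<kappa> i / (z - pt i) = of_real s * (nc \<kappa> i / (Cc ?b - pt i))" unfolding ring_hh[OF t] hh_def .
        then have "nc \<kappa> i * (Cc ?b - pt i) = nc \<kappa> i * (of_real s * (z - pt i))"
          using z(2) rim_pt(1)[OF i b] by (simp add: divide_eq_eq eq_divide_eq mult.assoc mult.left_commute mult.commute)
        then have "Cc ?b - pt i = of_real s * (z - pt i)" using mult_left_cancel[OF ncz] by blast
        then have "Cc ?b = z - (1 - s) *\<^sub>R (z - pt i)" by (simp add: scaleR_conv_of_real algebra_simps)
        then have "Cc ?b \<in> interior (sec i)"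
          using s sec_convex[OF i] pt_interior[OF i] z(1) by (simp only:) (intro mem_interior_convex_shrink; simp)
        then show False using rim_pt(4)[OF i b] by blast
      qed
    qed
    show "w \<in> E" if w: "\<forall>a\<in>lat. 2 * \<kappa> / \<iota> \<le> cmod (w - a)" for w
    proof (rule onto)
      fix a m \<theta> assume a: "a \<in> lat" and t: "0 \<le> \<theta>" "\<theta> \<le> 4" and m: "0 \<le> m" "m \<le> 1 / 8"
        and e: "w = a + of_real m * om \<theta>"
      have "\<eta> \<theta> \<le> 2 * \<kappa> / \<iota>" unfolding eta_eq[OF t] using hh_le(1) ai_in(1)[OF t] by blast
      also have "\<dots> \<le> cmod (w - a)" using w a by blast
      also have "\<dots> \<le> n1 (of_real m * om \<theta>)" using n1_cmod(1)[of "of_real m * om \<theta>"] e by simp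
      also have "\<dots> = m" unfolding n1_scale using m n1_om[OF t] by simp
      finally show "\<eta> \<theta> \<le> m" .
    qed
    show "w \<noteq> 0 \<and> pt i + nc \<kappa> i / w \<in> sec i" if w: "w \<in> E" "cmod w < 1 / 16" for w
    proof -
      obtain x where x: "x \<in> Pent" "w - L x \<in> lat" using w YE(2) by blast
      have "n1 w < 1 / 8" using n1_cmod(2)[of w] w by linarith
      then obtain \<theta> m where t: "0 \<le> \<theta>" "\<theta> \<le> 4" and wm: "w = of_real m * om \<theta>" "\<eta> \<theta> \<le> m"
        using L_near[OF x] by metis
      let ?b = "ai \<theta>"
      note b = ai_in(1)[OF t]
      have ep: "0 < \<eta> \<theta>" by (rule eta)
      \<comment> \<open>A point beyond the edge of the hole by the factor \<open>1 / s\<close>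
        inverts to the convex combination of \<open>pt i\<close> and the rim point with weight
        \<open>s\<close> on the latter.\<close>
      define s where "s = \<eta> \<theta> / m"
      have m0: "0 < m" using ep wm by simp
      have s: "0 \<le> s" "s \<le> 1" "\<eta> \<theta> = s * m" using wm ep m0 by (auto simp: s_def)
      have "hh \<kappa> i ?b = of_real (s * m) * om \<theta>" using ring_hh[OF t] s(3) by simp
      then have hw: "hh \<kappa> i ?b = of_real s * w" using wm(1) by simp
      have nz: "w \<noteq> 0" "s \<noteq> 0" using hw hh_polar(2)[OF i b \<kappa>(1)] by auto
      have ncz: "nc \<kappa> i \<noteq> 0" using cmod_nc[OF \<kappa>(1), of i] \<kappa>(1) by auto
      have "nc \<kappa> i / w = of_real s * (nc \<kappa> i / (of_real s * w))" using nz by simp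
      also have "of_real s * w = nc \<kappa> i / (Cc ?b - pt i)" using hw by (simp add: hh_def)
      also have "nc \<kappa> i / (nc \<kappa> i / (Cc ?b - pt i)) = Cc ?b - pt i" using ncz rim_pt(1)[OF i b] by simp
      finally have "nc \<kappa> i / w = of_real s * (Cc ?b - pt i)" .
      then have e: "pt i + nc \<kappa> i / w = (1 - s) *\<^sub>R pt i + s *\<^sub>R Cc ?b" by (simp add: scaleR_conv_of_real algebra_simps)
      have pti: "pt i \<in> sec i" using pt_interior[OF i] interior_subset by blast
      have "(1 - s) *\<^sub>R pt i + s *\<^sub>R Cc ?b \<in> sec i"
        using convexD[OF sec_convex[OF i] pti rim_pt(3)[OF i b], of "1 - s" s] s by linarith
      then have "pt i + nc \<kappa> i / w \<in> sec i" unfolding e .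
      then show ?thesis using nz by simp
    qed
    show "w + a \<in> E" if wa: "w \<in> E" "a \<in> lat" for w a
    proof -
      obtain x where x: "x \<in> Pent" "w - L x \<in> lat" using wa YE(2) by blast
      have "(w - L x) + a \<in> lat" using lat_add[OF x(2) wa(2)] .
      then have "w + a - L x \<in> lat" by (simp add: algebra_simps)
      then show ?thesis using x YE(2) by blast
    qed
  qed
qed

end

section \<open>Distances between sectors, their translates and the holes\<close>

context center
begin

lemma inradius:
  obtains \<iota> where "0 < \<iota>" "\<And>i. i < k \<Longrightarrow> ball (pt i) \<iota> \<subseteq> sec i"
proof -
  have "\<exists>e>0. \<forall>i<n. ball (pt i) e \<subseteq> sec i" if "n \<le> k" for n
    using that
  proof (induction n)
    case 0 then show ?case by (intro exI[of _ 1]) auto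
  next
    case (Suc n)
    then obtain e where e: "0 < e" "\<forall>i<n. ball (pt i) e \<subseteq> sec i" by auto
    have "pt n \<in> interior (sec n)" using pt_interior Suc by simp
    then obtain f where f: "0 < f" "ball (pt n) f \<subseteq> sec n" by (auto simp: mem_interior)
    have "ball (pt i) (min e f) \<subseteq> sec i" if "i < Suc n" for i
      using that e(2) f(2) by (cases "i = n") (fastforce simp: less_Suc_eq)+
    then show ?case using e(1) f(1) by (intro exI[of _ "min e f"]) auto
  qed
  then show thesis using that by blast
qed

text \<open>A ball contained in sector \<open>j\<close> contains no rim point of it, while different
  sectors meet translates of each other only along their rims.\<close>

lemma sec_far:
  assumes i: "i < k" and j: "j < k" and b: "ball (pt j) \<iota> \<subseteq> sec j" and z: "z \<in> sec i" and a: "a \<in> lat"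
    and lt: "cmod (z - (pt j + a)) < \<iota>"
  shows "i = j \<and> a = 0"
proof -
  let ?s = "z - a"
  have "?s \<in> ball (pt j) \<iota>" using lt by (simp add: dist_norm norm_minus_commute algebra_simps)
  then have s: "?s \<in> sec j" using b by blast
  have l: "z - ?s \<in> lat" using a by simp
  show ?thesis
  proof (cases "i = j")
    case True
    obtain x y where "x \<in> cell i" "z = Cc x" "y \<in> cell i" "?s = Cc y" using z s True by (auto simp: sec_def)
    then have "z = ?s" using cell_half[OF i _ i] l by metis
    then show ?thesis using True by simp
  next
    case False
    obtain x y where "y \<in> rim j" "?s = Cc y" using sec_meet[OF i j False z s l] by metis
    then have "\<iota> \<le> cmod (?s - pt j)" using rim_far[OF j b] by simp
    then show ?thesis using lt by (simp add: algebra_simps)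
  qed
qed

lemma upper_far:
  assumes x: "x \<in> rect k" "1 / 2 \<le> Im x" and j: "j < k" and b: "ball (pt j) \<iota> \<subseteq> sec j" and a: "a \<in> lat"
  shows "\<iota> \<le> cmod (Cc x - (pt j + a))"
proof (rule ccontr)
  assume lt: "\<not> ?thesis"
  let ?s = "Cc x - a"
  have "?s \<in> ball (pt j) \<iota>" using lt by (simp add: dist_norm norm_minus_commute algebra_simps)
  then have s: "?s \<in> sec j" using b by blast
  have "Cc x - ?s \<in> lat" using a by simp
  then obtain y where "y \<in> rim j" "?s = Cc y" using upper_sec[OF x j s] by metis
  then have "\<iota> \<le> cmod (?s - pt j)" using rim_far[OF j b] by simp
  then show False using lt by (simp add: algebra_simps)
qed

lemma pt_sep:
  assumes i: "i < k" and j: "j < k" and b: "ball (pt j) \<iota> \<subseteq> sec j" and a: "a \<in> lat" and ne: "pt i \<noteq> pt j + a"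
  shows "\<iota> \<le> cmod (pt i - (pt j + a))"
proof (rule ccontr)
  assume "\<not> ?thesis"
  moreover have "pt i \<in> sec i" using pt_interior[OF i] interior_subset by blast
  ultimately have "i = j \<and> a = 0" using sec_far[OF i j b _ a, of "pt i"] by simp
  then show False using ne by simp
qed

definition "center_dom r = {z. \<forall>i<k. \<forall>a\<in>lat. r \<le> cmod (z - (pt i + a))}"

end

definition "handle_dom r = {z. \<forall>a\<in>lat. r \<le> cmod (z - a)}"

context surf
begin

text \<open>The conclusions of \<open>outer\<close> bundled into one predicate, so that charts for
  all handles can be chosen simultaneously.\<close>

definition "handle \<kappa> \<iota> i Y E \<longleftrightarrow> continuous_map (top_of_set E) X Y \<and>
    (\<forall>w v. w \<in> E \<longrightarrow> v \<in> E \<longrightarrow> (Y w = Y v \<longleftrightarrow> w - v \<in> lat)) \<and>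
    (\<forall>w. w \<in> E \<longrightarrow> (\<exists>u\<in>cell i. Y w = q u)) \<and>
    (\<forall>u. u \<in> cell i \<longrightarrow> (\<exists>w\<in>E. Y w = q u)) \<and>
    (\<forall>a. a \<in> rim i \<longrightarrow> hh \<kappa> i a \<in> E \<and> Y (hh \<kappa> i a) = q a) \<and>
    (\<forall>z. z \<in> sec i \<longrightarrow> z \<noteq> pt i \<longrightarrow> cmod (nc \<kappa> i / (z - pt i)) < 7 / 16 \<longrightarrow> nc \<kappa> i / (z - pt i) \<in> E) \<and>
    (\<forall>w. (\<forall>a\<in>lat. 2 * \<kappa> / \<iota> \<le> cmod (w - a)) \<longrightarrow> w \<in> E) \<and>
    (\<forall>w. w \<in> E \<longrightarrow> cmod w < 1 / 16 \<longrightarrow> w \<noteq> 0 \<and> pt i + nc \<kappa> i / w \<in> sec i) \<and>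
    (\<forall>w a. w \<in> E \<longrightarrow> a \<in> lat \<longrightarrow> w + a \<in> E)"

lemma handle_exists:
  assumes "i < k" "0 < \<iota>" "ball (pt i) \<iota> \<subseteq> sec i" "0 < \<kappa>" "16 * \<kappa> < \<iota>"
  shows "\<exists>Y E. handle \<kappa> \<iota> i Y E"
  unfolding handle_def by (rule outer[OF assms]) (intro exI conjI allI impI; assumption | blast)

end

section \<open>Charts of the central torus and their overlap with the outer ones\<close>

locale surf_radii = surf +
  fixes \<iota> r0 r1 r2 :: real
  assumes iota: "0 < \<iota>" "\<And>i. i < k \<Longrightarrow> ball (pt i) \<iota> \<subseteq> sec i"
    and rad: "0 < r1" "r1 < r0" "r0 < r2" "r1 * r2 = r0 * r0" "2 * r2 \<le> \<iota>" "r2 < 1 / 16"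
begin

definition "\<kappa> = r1 * r2"

lemma kap: "0 < \<kappa>" "16 * \<kappa> < \<iota>" "2 * \<kappa> / \<iota> \<le> r1"
proof -
  show "0 < \<kappa>" using rad by (simp add: \<kappa>_def)
  have "r1 * r2 \<le> r1 * (\<iota> / 2)" using rad by (intro mult_left_mono) auto
  then have k: "2 * \<kappa> \<le> r1 * \<iota>" by (simp add: \<kappa>_def)
  then show "2 * \<kappa> / \<iota> \<le> r1" using iota by (simp add: divide_le_eq)
  have "r1 * \<iota> < 1 / 16 * \<iota>" using rad iota by (intro mult_strict_right_mono) auto
  moreover have "16 * r1 < 1" using rad by simp
  have "\<kappa> < 1 / 16 * r2" unfolding \<kappa>_def using rad by (intro mult_strict_right_mono) auto
  then show "16 * \<kappa> < \<iota>" using rad by simp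
qed

lemma handles: "\<exists>Y E. \<forall>i<k. handle \<kappa> \<iota> i (Y i) (E i)"
proof -
  have "\<forall>i. \<exists>Y E. i < k \<longrightarrow> handle \<kappa> \<iota> i Y E" using handle_exists iota kap by blast
  then show ?thesis by metis
qed

definition "Yh = (SOME Y. \<exists>E. \<forall>i<k. handle \<kappa> \<iota> i (Y i) (E i))"
definition "Eh = (SOME E. \<forall>i<k. handle \<kappa> \<iota> i (Yh i) (E i))"

lemma YE:
  assumes "i < k"
  shows "continuous_map (top_of_set (Eh i)) X (Yh i)"
    "\<And>w v. w \<in> Eh i \<Longrightarrow> v \<in> Eh i \<Longrightarrow> Yh i w = Yh i v \<longleftrightarrow> w - v \<in> lat"
    "\<And>w. w \<in> Eh i \<Longrightarrow> \<exists>u\<in>cell i. Yh i w = q u"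
    "\<And>u. u \<in> cell i \<Longrightarrow> \<exists>w\<in>Eh i. Yh i w = q u"
    "\<And>a. a \<in> rim i \<Longrightarrow> hh \<kappa> i a \<in> Eh i \<and> Yh i (hh \<kappa> i a) = q a"
    "\<And>z. z \<in> sec i \<Longrightarrow> z \<noteq> pt i \<Longrightarrow> cmod (nc \<kappa> i / (z - pt i)) < 7 / 16 \<Longrightarrow> nc \<kappa> i / (z - pt i) \<in> Eh i"
    "\<And>w. (\<forall>a\<in>lat. 2 * \<kappa> / \<iota> \<le> cmod (w - a)) \<Longrightarrow> w \<in> Eh i"
    "\<And>w. w \<in> Eh i \<Longrightarrow> cmod w < 1 / 16 \<Longrightarrow> w \<noteq> 0 \<and> pt i + nc \<kappa> i / w \<in> sec i"
    "\<And>w a. w \<in> Eh i \<Longrightarrow> a \<in> lat \<Longrightarrow> w + a \<in> Eh i"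
proof -
  have "\<exists>E. \<forall>i<k. handle \<kappa> \<iota> i (Yh i) (E i)" unfolding Yh_def using someI_ex[OF handles] .
  then have "\<forall>i<k. handle \<kappa> \<iota> i (Yh i) (Eh i)" unfolding Eh_def by (rule someI_ex)
  then have "handle \<kappa> \<iota> i (Yh i) (Eh i)" using assms by blast
  note H = this[unfolded handle_def]
  note H1 = conjunct2[OF H]
  note H2 = conjunct2[OF H1]
  note H3 = conjunct2[OF H2]
  note H4 = conjunct2[OF H3]
  note H5 = conjunct2[OF H4]
  note H6 = conjunct2[OF H5]
  note H7 = conjunct2[OF H6]
  show "continuous_map (top_of_set (Eh i)) X (Yh i)" using H by (rule conjunct1)
  show "Yh i w = Yh i v \<longleftrightarrow> w - v \<in> lat" if "w \<in> Eh i" "v \<in> Eh i" for w v using conjunct1[OF H1] that by blast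
  show "\<exists>u\<in>cell i. Yh i w = q u" if "w \<in> Eh i" for w using conjunct1[OF H2] that by blast
  show "\<exists>w\<in>Eh i. Yh i w = q u" if "u \<in> cell i" for u using conjunct1[OF H3] that by blast
  show "hh \<kappa> i a \<in> Eh i \<and> Yh i (hh \<kappa> i a) = q a" if "a \<in> rim i" for a using conjunct1[OF H4] that by blast
  show "nc \<kappa> i / (z - pt i) \<in> Eh i" if "z \<in> sec i" "z \<noteq> pt i" "cmod (nc \<kappa> i / (z - pt i)) < 7 / 16" for z
    using conjunct1[OF H5] that by blast
  show "w \<in> Eh i" if "\<forall>a\<in>lat. 2 * \<kappa> / \<iota> \<le> cmod (w - a)" for w using conjunct1[OF H6] that by blast
  show "w \<noteq> 0 \<and> pt i + nc \<kappa> i / w \<in> sec i" if "w \<in> Eh i" "cmod w < 1 / 16" for w using conjunct1[OF H7] that by blast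
  show "w + a \<in> Eh i" if "w \<in> Eh i" "a \<in> lat" for w a using conjunct2[OF H7] that by blast
qed

lemma handle_dom_Eh: "i < k \<Longrightarrow> handle_dom r1 \<subseteq> Eh i"
proof
  fix w assume "i < k" and w: "w \<in> handle_dom r1"
  have "\<forall>a\<in>lat. 2 * \<kappa> / \<iota> \<le> cmod (w - a)"
    using w kap(3) unfolding handle_dom_def by (auto intro: order_trans)
  then show "w \<in> Eh i" using YE(7)[OF \<open>i < k\<close>] by blast
qed

lemma cell_rect: "i < k \<Longrightarrow> u \<in> cell i \<Longrightarrow> u \<in> rect k"
  using cell_bounds(5) by blast

lemma W_rect: "x \<in> W \<Longrightarrow> x \<in> rect k" by (simp add: W_def)

lemma hh_small: assumes "i < k" "a \<in> rim i" shows "cmod (hh \<kappa> i a) < r1"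
proof -
  have far: "\<iota> \<le> cmod (Cc a - pt i)" using rim_far[OF assms(1) iota(2)[OF assms(1)] assms(2)] .
  have "cmod (hh \<kappa> i a) = \<kappa> / cmod (Cc a - pt i)" using hh_polar(3)[OF assms kap(1)] .
  also have "\<dots> \<le> \<kappa> / \<iota>" using far iota(1) kap(1) by (intro divide_left_mono) (auto intro!: mult_pos_pos)
  also have "\<dots> < r1" using kap(3) rad(1) by simp
  finally show ?thesis .
qed

text \<open>Classes meeting both \<open>W\<close> and the cell have a representative on the rim, and
  the rim is the edge of the hole in the chart of the handle.\<close>

lemma W_on_handle:
  assumes i: "i < k" and w: "w \<in> Eh i" and y: "y \<in> W" and e: "Yh i w = q y"
  obtains y' where "y' \<in> rim i" "q y' = q y" "w - hh \<kappa> i y' \<in> lat"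
proof -
  obtain u where u: "u \<in> cell i" "Yh i w = q u" using YE(3)[OF i w] by blast
  have "eqv u y" using q_eq[OF cell_rect[OF i u(1)] W_rect[OF y]] u e by simp
  then have "u \<in> W" using eqv_W(1) y by blast
  then obtain y' where y': "y' \<in> rim i" "eqv u y'" using W_cell_rim[OF i _ u(1)] by blast
  have "q u = q y'" using q_eq[OF cell_rect[OF i u(1)] cell_rect[OF i rim_W(2)[OF i y'(1)]]] y' by simp
  then have "Yh i w = Yh i (hh \<kappa> i y')" using u(2) YE(5)[OF i y'(1)] by simp
  then have "w - hh \<kappa> i y' \<in> lat" using YE(2)[OF i w] YE(5)[OF i y'(1)] by blast
  then show thesis using that y'(1) \<open>q u = q y'\<close> u(2) e by simp
qed

lemma two_handles:
  assumes i: "i < k" and j: "j < k" and ij: "i \<noteq> j" and w: "w \<in> Eh i" "w' \<in> Eh j" and e: "Yh i w = Yh j w'"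
  obtains y y' where "y \<in> rim i" "y' \<in> rim j" "q y = q y'" "w - hh \<kappa> i y \<in> lat" "w' - hh \<kappa> j y' \<in> lat"
proof -
  obtain u where u: "u \<in> cell i" "Yh i w = q u" using YE(3)[OF i w(1)] by blast
  obtain u' where u': "u' \<in> cell j" "Yh j w' = q u'" using YE(3)[OF j w(2)] by blast
  have eq: "eqv u u'" using q_eq[OF cell_rect[OF i u(1)] cell_rect[OF j u'(1)]] u u' e by simp
  have uW: "u \<in> W"
  proof (rule ccontr)
    assume "u \<notin> W"
    then have u'i: "u' \<in> cell i - W" using eqv_cell(1)[OF eq] u by blast
    then have "Re u' \<in> \<int>" using cell_meet[OF ij] u' by blast
    then have "u' \<in> W" using cell_rect[OF j u'(1)] by (simp add: W_def)
    then show False using u'i by blast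
  qed
  then have "u' \<in> W" using eqv_W(1)[OF eq] by blast
  obtain y where y: "y \<in> rim i" "q y = q u" "w - hh \<kappa> i y \<in> lat" using W_on_handle[OF i w(1) uW u(2)] by blast
  obtain y' where y': "y' \<in> rim j" "q y' = q u'" "w' - hh \<kappa> j y' \<in> lat" using W_on_handle[OF j w(2) \<open>u' \<in> W\<close> u'(2)] by blast
  show thesis using that y y' u u' e by metis
qed

text \<open>The edge of the hole is within distance \<open>r1\<close> of the lattice, so the trimmed
  chart domain never touches it. This excludes overlaps other than the necks.\<close>

lemma handle_dom_no_rim: assumes "i < k" "w \<in> handle_dom r1" "y \<in> rim i" shows "w - hh \<kappa> i y \<notin> lat"
proof
  assume "w - hh \<kappa> i y \<in> lat"
  then have "r1 \<le> cmod (w - (w - hh \<kappa> i y))" using assms(2) unfolding handle_dom_def by blast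
  then show False using hh_small[OF assms(1,3)] by simp
qed

definition "upper = {x \<in> rect k. 1 / 2 \<le> Im x}"
definition "ann i = sec i - ball (pt i) r1"
text \<open>In the central torus a punctured sector stands for the handle inside it:
  \<open>z\<close> is read through the inversion in the chart of that handle. This extends the
  central chart into the neck.\<close>

definition "nk i z = Yh i (nc \<kappa> i / (z - pt i))"

lemma upper_W: "x \<in> upper \<Longrightarrow> x \<in> W"
  by (simp add: upper_def W_def)

lemma nc_cmod: "cmod (nc \<kappa> i / v) = \<kappa> / cmod v"
  using kap(1) by (simp add: norm_divide cmod_nc)

lemma nc_nz: "nc \<kappa> i \<noteq> 0"
  using cmod_nc[OF kap(1), of i] kap(1) by auto

lemma ann_iff: "z \<in> ann i \<longleftrightarrow> z \<in> sec i \<and> r1 \<le> cmod (z - pt i)"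
  by (auto simp: ann_def dist_norm norm_minus_commute)

lemma kappa_bound: assumes "r1 \<le> a" shows "\<kappa> / a \<le> r2"
proof -
  have "r1 * r2 \<le> a * r2" using assms rad by (intro mult_right_mono) auto
  then show ?thesis using assms rad by (simp add: \<kappa>_def divide_le_eq mult.commute)
qed

lemma ann_nk:
  assumes i: "i < k" and z: "z \<in> ann i"
  shows "z \<noteq> pt i" "cmod (nc \<kappa> i / (z - pt i)) \<le> r2" "nc \<kappa> i / (z - pt i) \<in> Eh i"
proof -
  have z': "z \<in> sec i" "r1 \<le> cmod (z - pt i)" using z ann_iff by auto
  then show n: "z \<noteq> pt i" using rad by auto
  show b: "cmod (nc \<kappa> i / (z - pt i)) \<le> r2" unfolding nc_cmod by (rule kappa_bound[OF z'(2)])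
  then show "nc \<kappa> i / (z - pt i) \<in> Eh i" using YE(6)[OF i z'(1) n] rad by simp
qed

lemma ann_rim: assumes "i < k" "y \<in> rim i" "z = Cc y" shows "nk i z = q y"
  using YE(5)[OF assms(1,2)] assms(3) by (simp add: nk_def hh_def)

lemma upper_ann:
  assumes "i < k" "z \<in> ann i" "x \<in> upper" "Cc x - z \<in> lat" shows "q x = nk i z"
proof -
  have x: "x \<in> rect k" "1 / 2 \<le> Im x" using assms by (auto simp: upper_def)
  obtain y where y: "y \<in> rim i" "z = Cc y" using upper_sec[OF x assms(1) _ assms(4)] assms(2) ann_iff by blast
  have yW: "y \<in> W" using rim_W(1)[OF assms(1) y(1)] .
  have "eqv x y" using eqv_of_Cc[OF upper_W[OF assms(3)] yW] assms(4) y by simp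
  then have "q x = q y" using q_eq[OF x(1) W_rect[OF yW]] by simp
  then show ?thesis using ann_rim[OF assms(1) y] by simp
qed

lemma sec_same: assumes "i < k" "z \<in> sec i" "z' \<in> sec i" "z - z' \<in> lat" shows "z = z'"
proof -
  obtain x y where "x \<in> cell i" "z = Cc x" "y \<in> cell i" "z' = Cc y" using assms by (auto simp: sec_def)
  then show ?thesis using cell_half[OF assms(1) _ assms(1)] assms(4) by metis
qed

lemma ann_ann:
  assumes "i < k" "j < k" "z \<in> ann i" "z' \<in> ann j" "z - z' \<in> lat" shows "nk i z = nk j z'"
proof (cases "i = j")
  case True
  then have "z = z'" using sec_same[of i z z'] assms ann_iff by blast
  then show ?thesis using True by simp
next
  case False
  have zs: "z \<in> sec i" "z' \<in> sec j" using assms ann_iff by auto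
  obtain x y where xy: "x \<in> rim i" "y \<in> rim j" "z = Cc x" "z' = Cc y" "z = z'"
    using sec_meet[OF assms(1,2) False zs assms(5)] by blast
  have W: "x \<in> W" "y \<in> W" using rim_W(1) xy assms by auto
  have "eqv x y" using eqv_of_Cc[OF W] xy lat_0 by simp
  then have "q x = q y" using q_eq W_rect W by blast
  then show ?thesis using ann_rim[OF assms(1) xy(1,3)] ann_rim[OF assms(2) xy(2,4)] by simp
qed

lemma center_cells:
  assumes z: "z \<in> center_dom r1"
  shows "(\<exists>x\<in>upper. z - Cc x \<in> lat) \<or> (\<exists>i<k. \<exists>s\<in>ann i. z - s \<in> lat)"
proof -
  define b where "b = Complex (of_int \<lfloor>Re z\<rfloor>) (of_int \<lfloor>Im z\<rfloor>)"
  have b: "b \<in> lat" by (simp add: b_def lat_def)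
  define v where "v = z - b"
  have v: "0 \<le> Re v" "Re v \<le> 1" "0 \<le> Im v" "Im v \<le> 1"
    unfolding v_def b_def by (simp_all; linarith)+
  have zv: "z - v \<in> lat" using b by (simp add: v_def)
  have far: "r1 \<le> cmod (v - pt i)" if "i < k" for i
  proof -
    have "r1 \<le> cmod (z - (pt i + b))" using z b that by (simp add: center_dom_def)
    then show ?thesis by (simp add: v_def algebra_simps)
  qed
  have "\<exists>x\<in>rect k. v = Cc x"
  proof (cases "v = 0")
    case True
    have "v = Cc 0" using True by (simp add: Cc_def)
    then show ?thesis by (intro bexI[of _ 0]) (auto simp: rect_def)
  next
    case False
    obtain x where x: "0 \<le> Re x" "Re x \<le> real k" "Im x = max (Re v) (Im v)" "0 < Im x" "Cc x = v"
      using Cc_onto[OF v(1,3) False] by blast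
    then show ?thesis using v by (intro bexI[of _ x]) (auto simp: rect_def)
  qed
  then obtain x where x: "x \<in> rect k" "v = Cc x" by blast
  show ?thesis
  proof (cases "1 / 2 \<le> Im x")
    case True
    then have "x \<in> upper" using x by (simp add: upper_def)
    then show ?thesis using x zv by blast
  next
    case False
    then obtain i where i: "i < k" "x \<in> cell i" using cell_exists[OF x(1)] by (metis linear)
    then have "v \<in> ann i" using x far by (auto simp: ann_iff sec_def)
    then show ?thesis using i zv by blast
  qed
qed

text \<open>The cells are the punctured sectors and the upper part of the square, with index
  \<open>k\<close> standing for the upper part; the maps agree on congruent points by
  \<open>upper_ann\<close> and \<open>ann_ann\<close>.\<close>

lemma center_map:
  "\<exists>G. continuous_map (top_of_set (center_dom r1)) X G \<and> (\<forall>x\<in>upper. \<forall>w. w - Cc x \<in> lat \<longrightarrow> G w = q x) \<and>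
    (\<forall>i<k. \<forall>z\<in>ann i. \<forall>w. w - z \<in> lat \<longrightarrow> G w = nk i z)"
proof -
  let ?K = "\<lambda>c. if c < k then ann c else upper" and ?\<phi> = "\<lambda>c. if c < k then id else Cc" and ?q = "\<lambda>c. if c < k then nk c else q"
  let ?U = "{w. \<exists>c\<in>{..k}. \<exists>x\<in>?K c. w - ?\<phi> c x \<in> lat}"
  have cu: "compact upper"
  proof -
    have "upper = rect k \<inter> {z. 1 / 2 \<le> Im z}" by (auto simp: upper_def)
    moreover have "closed {z. 1 / 2 \<le> Im z}" by (intro closed_Collect_le continuous_intros)
    moreover have "compact (rect k)" by (simp add: rect_cbox compact_cbox)
    ultimately show ?thesis by (metis compact_Int_closed)
  qed
  have ca: "compact (ann c)" for c unfolding ann_def by (intro compact_diff sec_compact open_ball)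
  have qa: "continuous_map (top_of_set (ann c)) X (nk c)" if "c < k" for c
  proof -
    have "continuous_on (ann c) (\<lambda>z. nc \<kappa> c / (z - pt c))"
      using ann_nk(1)[OF that] by (intro continuous_intros) auto
    then have "continuous_map (top_of_set (ann c)) (top_of_set (Eh c)) (\<lambda>z. nc \<kappa> c / (z - pt c))"
      using ann_nk(3)[OF that] by (auto simp: continuous_map_in_subtopology)
    from continuous_map_compose[OF this YE(1)[OF that]] show ?thesis by (simp add: o_def nk_def[abs_def])
  qed
  have qu: "continuous_map (top_of_set upper) X q"
    using continuous_map_from_subtopology[OF q_cont, of upper]
    by (simp add: subtopology_subtopology upper_def Int_absorb1 Collect_restrict inf.absorb2)
  obtain G where G: "continuous_map (top_of_set ?U) X G"
    "\<And>c x w. c \<in> {..k} \<Longrightarrow> x \<in> ?K c \<Longrightarrow> w - ?\<phi> c x \<in> lat \<Longrightarrow> G w = ?q c x"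
  proof (rule periodic_from_cells[of "{..k}" ?K ?\<phi> X ?q])
    show "finite {..k}" by simp
    show "compact (?K c)" for c using cu ca by simp
    show "continuous_on (?K c) (?\<phi> c)" for c using continuous_Cc by (simp add: continuous_on_id')
    show "continuous_map (top_of_set (?K c)) X (?q c)" for c using qa qu by simp
    show "?q c x = ?q e y" if h: "c \<in> {..k}" "e \<in> {..k}" "x \<in> ?K c" "y \<in> ?K e" "?\<phi> c x - ?\<phi> e y \<in> lat" for c e x y
    proof -
      consider "c < k" "e < k" | "c < k" "\<not> e < k" | "\<not> c < k" "e < k" | "\<not> c < k" "\<not> e < k" by blast
      then show ?thesis
      proof cases
        case 1 then show ?thesis using ann_ann[of c e x y] h by simp
      next
        case 2 then show ?thesis using upper_ann[of c x y] h lat_diff_commute[of x "Cc y"] by simp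
      next
        case 3 then show ?thesis using upper_ann[of e y x] h by simp
      next
        case 4
        then have xy: "x \<in> upper" "y \<in> upper" "Cc x - Cc y \<in> lat" using h by auto
        then have "eqv x y" using eqv_of_Cc upper_W by blast
        then show ?thesis using q_eq xy 4 W_rect upper_W by simp
      qed
    qed
  qed blast
  have Gu: "G w = q x" if "x \<in> upper" "w - Cc x \<in> lat" for x w using G(2)[of k x w] that by simp
  have Ga: "G w = nk i z" if "i < k" "z \<in> ann i" "w - z \<in> lat" for i z w using G(2)[of i z w] that by simp
  have "center_dom r1 \<subseteq> ?U"
  proof
    fix z assume z: "z \<in> center_dom r1"
    show "z \<in> ?U"
      using center_cells[OF z]
      by (elim disjE bexE exE conjE) (force intro: bexI[of _ k], (rule CollectI, rule bexI, rule bexI, auto))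
  qed
  then have "continuous_map (top_of_set (center_dom r1)) X G"
    using continuous_map_from_subtopology[OF G(1), of "center_dom r1"] by (simp add: subtopology_subtopology inf.absorb2)
  then show ?thesis using Gu Ga by blast
qed

definition "Qc = (SOME G. continuous_map (top_of_set (center_dom r1)) X G \<and> (\<forall>x\<in>upper. \<forall>w. w - Cc x \<in> lat \<longrightarrow> G w = q x) \<and>
    (\<forall>i<k. \<forall>z\<in>ann i. \<forall>w. w - z \<in> lat \<longrightarrow> G w = nk i z))"

lemma Qc:
  shows Qc_cont: "continuous_map (top_of_set (center_dom r1)) X Qc"
    and Qc_upper: "x \<in> upper \<Longrightarrow> w - Cc x \<in> lat \<Longrightarrow> Qc w = q x"
    and Qc_ann: "i < k \<Longrightarrow> z \<in> ann i \<Longrightarrow> w - z \<in> lat \<Longrightarrow> Qc w = nk i z"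
  using someI_ex[OF center_map, folded Qc_def] by blast+

lemma lat_small: "a \<in> lat \<Longrightarrow> cmod a < 1 / 2 \<Longrightarrow> a = 0"
  using n1_lat n1_cmod(2)[of a] by simp

lemma nk_rim:
  assumes i: "i < k" "s \<in> ann i" and y: "y \<in> rim i" and l: "nc \<kappa> i / (s - pt i) - hh \<kappa> i y \<in> lat"
  shows "s = Cc y"
proof -
  have "cmod (nc \<kappa> i / (s - pt i) - hh \<kappa> i y) < 1 / 2"
    using norm_triangle_ineq4[of "nc \<kappa> i / (s - pt i)" "hh \<kappa> i y"] ann_nk(2)[OF i] hh_small[OF i(1) y] rad by linarith
  then have "nc \<kappa> i / (s - pt i) = nc \<kappa> i / (Cc y - pt i)" using lat_small[OF l] by (simp add: hh_def)
  then show ?thesis using nc_nz[of i] ann_nk(1)[OF i] rim_pt(1)[OF i(1) y] by simp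
qed

text \<open>A point common to different sectors, or to a sector and the upper part, comes from the
  rims, where \<open>Cc\<close> decides. Within one sector the inverted coordinates are too short to
  differ by a nonzero period.\<close>

lemma Qc_eq:
  assumes z: "z \<in> center_dom r1" and w: "w \<in> center_dom r1"
  shows "Qc z = Qc w \<longleftrightarrow> z - w \<in> lat"
proof
  assume l: "z - w \<in> lat"
  have shift: "w - c \<in> lat" if "z - c \<in> lat" for c
  proof -
    have "(z - c) - (z - w) \<in> lat" using lat_diff[OF that l] .
    then show ?thesis by simp
  qed
  from center_cells[OF z] show "Qc z = Qc w"
  proof (elim disjE bexE exE conjE)
    fix x assume "x \<in> upper" "z - Cc x \<in> lat"
    then show ?thesis using Qc_upper[of x z] Qc_upper[of x w] shift by simp
  next
    fix i s assume "i < k" "s \<in> ann i" "z - s \<in> lat"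
    then show ?thesis using Qc_ann[of i s z] Qc_ann[of i s w] shift by simp
  qed
next
  assume e: "Qc z = Qc w"
  have comb: "z - w \<in> lat" if "z - a \<in> lat" "w - b \<in> lat" "a - b \<in> lat" for a b
  proof -
    have "(z - a) - (w - b) + (a - b) \<in> lat" using lat_add[OF lat_diff[OF that(1,2)] that(3)] .
    then show ?thesis by simp
  qed
  have up_ann: "Cc x - s \<in> lat" if x: "x \<in> upper" and i: "i < k" "s \<in> ann i" and eq: "q x = nk i s" for x i s
  proof -
    obtain y where y: "y \<in> rim i" "q y = q x" "nc \<kappa> i / (s - pt i) - hh \<kappa> i y \<in> lat"
      using W_on_handle[OF i(1) ann_nk(3)[OF i] upper_W[OF x]] eq by (metis nk_def)
    have "s = Cc y"
      by (rule nk_rim[OF i y(1,3)])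
    moreover have "eqv x y"
      using q_eq[OF W_rect[OF upper_W[OF x]] cell_rect[OF i(1) rim_W(2)[OF i(1) y(1)]]] y(2) by simp
    ultimately show ?thesis using eqv_W(2) by simp
  qed
  from center_cells[OF z] show "z - w \<in> lat"
  proof (elim disjE bexE exE conjE)
    fix x assume x: "x \<in> upper" "z - Cc x \<in> lat"
    note qx = Qc_upper[OF x]
    from center_cells[OF w] show ?thesis
    proof (elim disjE bexE exE conjE)
      fix y assume y: "y \<in> upper" "w - Cc y \<in> lat"
      then have "q x = q y" using Qc_upper[OF y] qx e by simp
      then have "eqv x y" using q_eq W_rect upper_W x y by blast
      then show ?thesis using comb[OF x(2) y(2)] eqv_W(2) by blast
    next
      fix i s assume i: "i < k" "s \<in> ann i" and s: "w - s \<in> lat"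
      then show ?thesis using comb[OF x(2) s] up_ann[OF x(1) i] Qc_ann[OF i s] qx e by simp
    qed
  next
    fix i s assume i: "i < k" "s \<in> ann i" and s: "z - s \<in> lat"
    note qs = Qc_ann[OF i s]
    from center_cells[OF w] show ?thesis
    proof (elim disjE bexE exE conjE)
      fix y assume y: "y \<in> upper" "w - Cc y \<in> lat"
      have "Cc y - s \<in> lat" using up_ann[OF y(1) i] Qc_upper[OF y] qs e by simp
      then show ?thesis using comb[OF s y(2)] lat_diff_commute by blast
    next
      fix j t assume j: "j < k" "t \<in> ann j" and t: "w - t \<in> lat"
      have eq: "nk i s = nk j t" using Qc_ann[OF j t] qs e by simp
      show ?thesis
      proof (cases "i = j")
        case True
        then have j': "t \<in> ann i" using j by simp
        have "nc \<kappa> i / (s - pt i) - nc \<kappa> i / (t - pt i) \<in> lat"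
          using YE(2)[OF i(1) ann_nk(3)[OF i] ann_nk(3)[OF i(1) j']] eq True by (simp add: nk_def)
        moreover have "cmod (nc \<kappa> i / (s - pt i) - nc \<kappa> i / (t - pt i)) < 1 / 2"
          using norm_triangle_ineq4[of "nc \<kappa> i / (s - pt i)" "nc \<kappa> i / (t - pt i)"] ann_nk(2)[OF i] ann_nk(2)[OF i(1) j'] rad(6) by linarith
        ultimately have "nc \<kappa> i / (s - pt i) = nc \<kappa> i / (t - pt i)" using lat_small by fastforce
        then have "s = t" using nc_nz[of i] ann_nk(1)[OF i] ann_nk(1)[OF i(1) j'] by simp
        then show ?thesis using comb[OF s t] lat_0 by simp
      next
        case False
        obtain y y' where y: "y \<in> rim i" "y' \<in> rim j" "q y = q y'"
          "nc \<kappa> i / (s - pt i) - hh \<kappa> i y \<in> lat" "nc \<kappa> j / (t - pt j) - hh \<kappa> j y' \<in> lat"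
          using two_handles[OF i(1) j(1) False ann_nk(3)[OF i] ann_nk(3)[OF j]] eq unfolding nk_def by metis
        have "s = Cc y" "t = Cc y'" using nk_rim[OF i y(1,4)] nk_rim[OF j y(2,5)] by auto
        moreover have "eqv y y'"
          using q_eq[OF cell_rect[OF i(1) rim_W(2)[OF i(1) y(1)]] cell_rect[OF j(1) rim_W(2)[OF j(1) y(2)]]] y(3) by simp
        ultimately show ?thesis using comb[OF s t] eqv_W(2) by simp
      qed
    qed
  qed
qed

lemma Yh_cont: "i < k \<Longrightarrow> continuous_map (top_of_set (handle_dom r1)) X (Yh i)"
  using continuous_map_from_subtopology[OF YE(1), of i "handle_dom r1"] handle_dom_Eh[of i]
  by (simp add: subtopology_subtopology inf.absorb2)

lemma Yh_eq: "i < k \<Longrightarrow> z \<in> handle_dom r1 \<Longrightarrow> w \<in> handle_dom r1 \<Longrightarrow> Yh i z = Yh i w \<longleftrightarrow> z - w \<in> lat"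
  using YE(2) handle_dom_Eh by blast

lemma Yh_disjoint:
  assumes "i < k" "j < k" "i \<noteq> j" "w \<in> handle_dom r1" "w' \<in> handle_dom r1" shows "Yh i w \<noteq> Yh j w'"
proof
  assume "Yh i w = Yh j w'"
  moreover have "w \<in> Eh i" "w' \<in> Eh j" using handle_dom_Eh assms by blast+
  ultimately obtain y where "y \<in> rim i" "w - hh \<kappa> i y \<in> lat" using two_handles[OF assms(1-3)] by metis
  then show False using handle_dom_no_rim[OF assms(1,4)] by blast
qed

lemma neck_map:
  assumes i: "i < k" and ab: "a \<in> lat" "b \<in> lat" and v: "r1 \<le> cmod v" "cmod v \<le> r2"
  shows "Qc (pt i + a + v) = Yh i (b + nc \<kappa> i / v)"
proof -
  have "pt i + v \<in> ball (pt i) \<iota>" using v rad by (simp add: dist_norm)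
  then have s: "pt i + v \<in> ann i" using iota(2)[OF i] v ann_iff by auto
  have "Qc (pt i + a + v) = nk i (pt i + v)" by (rule Qc_ann[OF i s]) (use ab in simp)
  also have "\<dots> = Yh i (nc \<kappa> i / v)" by (simp add: nk_def)
  also have "\<dots> = Yh i (nc \<kappa> i / v + b)"
  proof -
    have E: "nc \<kappa> i / v \<in> Eh i" using ann_nk(3)[OF i s] by simp
    have "nc \<kappa> i / v - (nc \<kappa> i / v + b) \<in> lat" using lat_minus[OF ab(2)] by simp
    then show ?thesis using YE(2)[OF i E YE(9)[OF i E ab(2)]] by simp
  qed
  finally show ?thesis by (simp add: add.commute)
qed

text \<open>The upper part and other sectors could meet the handle only over its rim, which is
  excluded. In its own sector the two neck coordinates have moduli with product
  \<open>\<kappa> = r1 * r2\<close>, and each is at least \<open>r1\<close>, so each is at most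
  \<open>r2\<close>.\<close>

lemma center_meets_handle:
  assumes z: "z \<in> center_dom r1" and i: "i < k" and w: "w \<in> handle_dom r1" and e: "Qc z = Yh i w"
  obtains a b where "a \<in> lat" "b \<in> lat" "cmod (z - (pt i + a)) \<le> r2" "cmod (w - b) \<le> r2"
proof -
  have wE: "w \<in> Eh i" using handle_dom_Eh i w by blast
  from center_cells[OF z] show thesis
  proof (elim disjE bexE exE conjE)
    fix x assume x: "x \<in> upper" "z - Cc x \<in> lat"
    then have "Yh i w = q x" using Qc_upper[OF x] e by simp
    then obtain y where "y \<in> rim i" "w - hh \<kappa> i y \<in> lat" using W_on_handle[OF i wE upper_W[OF x(1)]] by metis
    then show ?thesis using handle_dom_no_rim[OF i w] by blast
  next
    fix j s assume j: "j < k" "s \<in> ann j" and s: "z - s \<in> lat"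
    have eq: "Yh i w = Yh j (nc \<kappa> j / (s - pt j))" using Qc_ann[OF j s] e by (simp add: nk_def)
    show ?thesis
    proof (cases "i = j")
      case False
      then obtain y where "y \<in> rim i" "w - hh \<kappa> i y \<in> lat" using two_handles[OF i j(1) False wE ann_nk(3)[OF j] eq] by metis
      then show ?thesis using handle_dom_no_rim[OF i w] by blast
    next
      case True
      let ?b = "w - nc \<kappa> i / (s - pt i)"
      have j': "s \<in> ann i" using j True by simp
      have b: "?b \<in> lat" using YE(2)[OF i wE ann_nk(3)[OF i j']] eq True by simp
      have wb: "cmod (w - ?b) = \<kappa> / cmod (s - pt i)" using nc_cmod[of i "s - pt i"] by simp
      then have 1: "cmod (w - ?b) \<le> r2" using ann_nk(2)[OF i j'] nc_cmod[of i "s - pt i"] by simp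
      have "r1 \<le> cmod (w - ?b)" using w b unfolding handle_dom_def by blast
      then have "\<kappa> / (\<kappa> / cmod (s - pt i)) \<le> r2" unfolding wb by (rule kappa_bound)
      then have 2: "cmod (s - pt i) \<le> r2" using kap(1) by simp
      have "cmod (z - (pt i + (z - s))) \<le> r2" using 2 by (simp add: algebra_simps)
      then show ?thesis using that[OF s b _ 1] by blast
    qed
  qed
qed

text \<open>A handle point closer than \<open>r0\<close> to a lattice point is read in the sector
  instead; since \<kappa> equals \<open>r0 * r0\<close>, the inverted coordinate has modulus at
  least \<open>r0\<close>.\<close>

lemma pieces_cover:
  assumes x: "x \<in> topspace X"
  shows "(\<exists>z\<in>center_dom r0. x = Qc z) \<or> (\<exists>i<k. \<exists>w\<in>handle_dom r0. x = Yh i w)"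
proof -
  have r0: "r0 \<le> \<iota>" using rad by simp
  obtain u where u: "u \<in> rect k" "x = q u" using x q_onto by blast
  show ?thesis
  proof (cases "1 / 2 \<le> Im u")
    case True
    have "Cc u \<in> center_dom r0"
      unfolding center_dom_def using upper_far[OF u(1) True _ iota(2)] r0 by (auto intro: order_trans)
    moreover have "Qc (Cc u) = q u" by (rule Qc_upper) (use u True lat_0 in \<open>auto simp: upper_def\<close>)
    ultimately show ?thesis using u by metis
  next
    case False
    then obtain i where i: "i < k" "u \<in> cell i" using cell_exists[OF u(1)] by (metis linear)
    obtain w where w: "w \<in> Eh i" "Yh i w = q u" using YE(4)[OF i] by blast
    show ?thesis
    proof (cases "w \<in> handle_dom r0")
      case True then show ?thesis using w i u by metis
    next
      case far: False
      then obtain a where a: "a \<in> lat" "cmod (w - a) < r0" by (auto simp: handle_dom_def not_le)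
      define v where "v = w - a"
      have "w + (- a) \<in> Eh i" using YE(9)[OF i(1) w(1) lat_minus[OF a(1)]] .
      then have vE: "v \<in> Eh i" by (simp add: v_def)
      have v: "cmod v < r0" using a by (simp add: v_def)
      define z where "z = pt i + nc \<kappa> i / v"
      have vz: "v \<noteq> 0" "z \<in> sec i" using YE(8)[OF i(1) vE] v rad by (auto simp: z_def)
      have cz: "cmod (z - pt i) = \<kappa> / cmod v" by (simp add: z_def nc_cmod)
      have "cmod v * r0 \<le> r0 * r0" using v rad by (intro mult_right_mono) auto
      then have big: "r0 \<le> cmod (z - pt i)" unfolding cz using vz(1) rad(4) by (simp add: \<kappa>_def le_divide_eq mult.commute)
      then have za: "z \<in> ann i" using vz rad ann_iff by simp
      have "z \<in> center_dom r0"
        unfolding center_dom_def mem_Collect_eq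
      proof (intro allI impI ballI)
        fix j b assume j: "j < k" and b: "b \<in> lat"
        show "r0 \<le> cmod (z - (pt j + b))"
        proof (rule ccontr)
          assume n: "\<not> ?thesis"
          then have "i = j \<and> b = 0" using sec_far[OF i(1) j iota(2)[OF j] vz(2) b] r0 by simp
          then show False using n big by simp
        qed
      qed
      moreover have "Qc z = nk i z" by (rule Qc_ann[OF i(1) za]) (simp add: lat_0)
      then have "Qc z = Yh i v" using nc_nz[of i] vz(1) by (simp add: nk_def z_def)
      moreover have "Yh i v = Yh i w" using YE(2)[OF i(1) vE w(1)] lat_minus[OF a(1)] by (simp add: v_def)
      ultimately show ?thesis using w u by metis
    qed
  qed
qed

end

section \<open>The linear model\<close>

context center
begin

text \<open>The matrix \<open>cat\<close> is congruent to the identity modulo \<open>4 k\<close>, so it fixes the points \<open>pt i\<close>, whose coordinates are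
  multiples of \<open>1 / (4 k)\<close>, modulo \<open>lat\<close>. It is symmetric, and multiplication by \<open>rot\<close> diagonalizes it.\<close>
definition "\<tau> = (4 * real k + sqrt ((4 * real k)\<^sup>2 + 4)) / 2"
definition "rot = Complex \<tau> (- 1)"
definition "cat z = Complex ((1 + (4 * real k)\<^sup>2) * Re z + 4 * real k * Im z) (4 * real k * Re z + Im z)"

lemma tau: "\<tau>\<^sup>2 = 4 * real k * \<tau> + 1" "1 < \<tau>" "1 < \<tau>\<^sup>2"
proof -
  have s: "(sqrt ((4 * real k)\<^sup>2 + 4))\<^sup>2 = (4 * real k)\<^sup>2 + 4" by simp
  have t2: "2 * \<tau> = 4 * real k + sqrt ((4 * real k)\<^sup>2 + 4)" by (simp add: \<tau>_def)
  have "(2 * \<tau>)\<^sup>2 = (4 * real k)\<^sup>2 + ((4 * real k)\<^sup>2 + 4) + 2 * (4 * real k) * sqrt ((4 * real k)\<^sup>2 + 4)"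
    unfolding t2 power2_sum s ..
  also have "\<dots> = 8 * real k * (2 * \<tau>) + 4"
    unfolding t2 by (simp add: algebra_simps power2_eq_square[of "real k"])
  also have "\<dots> = 4 * (4 * real k * \<tau> + 1)" by simp
  finally show "\<tau>\<^sup>2 = 4 * real k * \<tau> + 1" by (simp add: power_mult_distrib)
  have "4 * real k \<le> 2 * \<tau>" unfolding t2 by simp
  then show t: "1 < \<tau>" using k' by linarith
  show "1 < \<tau>\<^sup>2" using t by (simp add: one_less_power)
qed

text \<open>\<open>\<tau>\<^sup>2\<close> is the larger eigenvalue of \<open>cat\<close>, and
  multiplication by \<open>rot\<close> passes to coordinates along its orthogonal
  eigenvectors.\<close>

lemma hyp_rot: "hyp (\<tau>\<^sup>2) (rot * z) = rot * cat z"
proof -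
  define n where "n = 4 * real k"
  have t: "\<tau> * \<tau> = n * \<tau> + 1" "\<tau> \<noteq> 0" using tau by (auto simp: n_def power2_eq_square)
  \<comment> \<open>This is the other eigenvalue: \<open>cat\<close> has determinant 1 and trace
    \<open>n\<^sup>2 + 2\<close>.\<close>
  have inv: "1 / (\<tau> * \<tau>) = 1 + n\<^sup>2 - n * \<tau>"
  proof -
    have "(\<tau> * \<tau>) * (1 + n\<^sup>2 - n * \<tau>) = (n * \<tau> + 1) * (1 + n\<^sup>2 - n * \<tau>)" by (simp add: t(1))
    also have "\<dots> = 1 + n\<^sup>2 + n ^ 3 * \<tau> - n\<^sup>2 * (\<tau> * \<tau>)" by (simp add: algebra_simps power2_eq_square power3_eq_cube)
    also have "\<dots> = 1" unfolding t(1) by (simp add: algebra_simps power2_eq_square power3_eq_cube)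
    finally show ?thesis using t(2) by (simp add: divide_eq_eq mult.commute)
  qed
  have m: "cat z = Complex ((1 + n\<^sup>2) * Re z + n * Im z) (n * Re z + Im z)" by (simp add: cat_def n_def)
  have r: "rot * z = Complex (\<tau> * Re z + Im z) (\<tau> * Im z - Re z)" by (simp add: rot_def complex_eq_iff)
  have "\<tau> * \<tau> * (\<tau> * Re z + Im z) = \<tau> * ((1 + n\<^sup>2) * Re z + n * Im z) + (n * Re z + Im z)"
  proof -
    have "\<tau> * \<tau> * (\<tau> * Re z + Im z) = (n * \<tau> + 1) * (\<tau> * Re z + Im z)" by (simp only: t(1))
    also have "\<dots> = n * (\<tau> * \<tau>) * Re z + (\<tau> * Re z + n * \<tau> * Im z + Im z)" by (simp add: algebra_simps)
    also have "\<dots> = \<tau> * ((1 + n\<^sup>2) * Re z + n * Im z) + (n * Re z + Im z)"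
      unfolding t(1) by (simp add: algebra_simps power2_eq_square)
    finally show ?thesis .
  qed
  moreover have "(\<tau> * Im z - Re z) / (\<tau> * \<tau>) = \<tau> * (n * Re z + Im z) - ((1 + n\<^sup>2) * Re z + n * Im z)"
  proof -
    have "(\<tau> * Im z - Re z) / (\<tau> * \<tau>) = (\<tau> * Im z - Re z) * (1 / (\<tau> * \<tau>))" by simp
    also have "\<dots> = (1 + n\<^sup>2) * \<tau> * Im z - n * (\<tau> * \<tau>) * Im z - (1 + n\<^sup>2 - n * \<tau>) * Re z"
      unfolding inv by (simp add: algebra_simps)
    also have "\<dots> = \<tau> * (n * Re z + Im z) - ((1 + n\<^sup>2) * Re z + n * Im z)"
      unfolding t(1) by (simp add: algebra_simps power2_eq_square)
    finally show ?thesis .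
  qed
  ultimately show ?thesis
    unfolding r m by (simp add: hyp_def rot_def complex_eq_iff power2_eq_square[of \<tau>])
qed

lemma Ints_mult_k: "x \<in> \<int> \<Longrightarrow> 4 * real k * x \<in> \<int>"
  by (intro Ints_mult) auto

lemma cat_lat: "cat z \<in> lat \<longleftrightarrow> z \<in> lat"
proof
  show "z \<in> lat \<Longrightarrow> cat z \<in> lat"
    unfolding cat_def lat_Complex unfolding lat_def by (auto intro!: Ints_add Ints_mult_k Ints_mult Ints_power)
  assume "cat z \<in> lat"
  then have m: "Re (cat z) \<in> \<int>" "Im (cat z) \<in> \<int>" by (auto simp: lat_def)
  have x: "Re z = Re (cat z) - 4 * real k * Im (cat z)" by (simp add: cat_def algebra_simps power2_eq_square)
  have y: "Im z = Im (cat z) - 4 * real k * Re z" by (simp add: cat_def)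
  have "Re z \<in> \<int>" unfolding x by (intro Ints_diff m Ints_mult_k)
  moreover have "Im z \<in> \<int>" unfolding y by (intro Ints_diff m Ints_mult_k \<open>Re z \<in> \<int>\<close>)
  ultimately show "z \<in> lat" by (simp add: lat_def)
qed

lemma cat_pt: assumes "a \<in> lat" shows "cat (pt i + a) - (pt i + a) \<in> lat"
proof -
  let ?z = "pt i + a"
  have G: "real k * Re (Gm (real i + 1 / 2)) \<in> \<int> \<and> real k * Im (Gm (real i + 1 / 2)) \<in> \<int>"
  proof (cases "real i + 1 / 2 \<le> real k / 2")
    case True
    then have "real k * Re (Gm (real i + 1 / 2)) = of_int (2 * int i + 1)" "real k * Im (Gm (real i + 1 / 2)) = of_int (int k)"
      using k' by (simp_all add: Gm_def)
    then show ?thesis by (metis Ints_of_int)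
  next
    case False
    then have "real k * Re (Gm (real i + 1 / 2)) = of_int (int k)" "real k * Im (Gm (real i + 1 / 2)) = of_int (2 * int k - (2 * int i + 1))"
      using k' by (simp_all add: Gm_def right_diff_distrib)
    then show ?thesis by (metis Ints_of_int)
  qed
  have p: "4 * real k * Re (pt i) = real k * Re (Gm (real i + 1 / 2))" "4 * real k * Im (pt i) = real k * Im (Gm (real i + 1 / 2))"
    by (simp_all add: pt_Gm)
  have n: "4 * real k * Re ?z \<in> \<int>" "4 * real k * Im ?z \<in> \<int>"
    using G assms by (auto simp: distrib_left p lat_def intro!: Ints_add Ints_mult_k)
  have "cat ?z - ?z = Complex (4 * real k * (4 * real k * Re ?z) + 4 * real k * Im ?z) (4 * real k * Re ?z)"
    by (simp add: cat_def complex_eq_iff algebra_simps power2_eq_square)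
  then show ?thesis unfolding lat_Complex[symmetric] using Ints_add[OF Ints_mult_k[OF n(1)] n(2)] n(1) by (simp only: lat_Complex simp_thms)
qed

lemma rot_nz: "rot \<noteq> 0" by (simp add: rot_def complex_eq_iff)

lemma rot_dist: "cmod (\<zeta> - rot * x) = cmod rot * cmod (\<zeta> / rot - x)"
proof -
  have "\<zeta> - rot * x = rot * (\<zeta> / rot - x)" using rot_nz by (simp add: right_diff_distrib)
  then show ?thesis by (simp add: norm_mult)
qed

text \<open>\<open>Im (rot\<^sup>2 z)\<close> vanishes on the line \<open>2 Re z = 4 k Im z\<close> only, and the points \<open>pt i\<close> lie above it.\<close>
lemma Im_rot_pt: assumes "i < k" shows "Im (rot\<^sup>2 * pt i) \<noteq> 0"
proof -
  let ?G = "Gm (real i + 1 / 2)"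
  have lt: "2 * Re ?G < 4 * real k * Im ?G"
  proof (cases "real i + 1 / 2 \<le> real k / 2")
    case True
    then have "Re ?G \<le> 1" "Im ?G = 1" using k' by (auto simp: Gm_def divide_le_eq)
    then show ?thesis using k' by simp
  next
    case False
    have "real k * Im ?G = 2 * real k - (2 * real i + 1)" using False k' by (simp add: Gm_def right_diff_distrib)
    moreover have "real i + 1 \<le> real k" using assms by simp
    ultimately have "1 \<le> real k * Im ?G" by linarith
    moreover have "Re ?G = 1" using False by (simp add: Gm_def)
    ultimately show ?thesis by linarith
  qed
  have "Im (rot\<^sup>2 * pt i) = ((\<tau>\<^sup>2 - 1) * Im ?G - 2 * \<tau> * Re ?G) / 4"
    unfolding pt_Gm by (simp add: rot_def power2_eq_square algebra_simps)
  also have "\<dots> = \<tau> * (4 * real k * Im ?G - 2 * Re ?G) / 4" unfolding tau(1) by (simp add: algebra_simps)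
  also have "0 < \<tau> * (4 * real k * Im ?G - 2 * Re ?G) / 4" using lt tau(2) by simp
  finally show ?thesis by simp
qed

definition "\<Gamma> = (*) rot ` lat"
text \<open>Index 0 is the central torus with \<open>k\<close> holes per period. Index
  \<open>Suc i\<close> is the outer torus of handle \<open>i\<close>, with a single hole at the
  lattice point.\<close>

definition "holes j = (if j = (0::nat) then {rot * (pt i + a) |i a. i < k \<and> a \<in> lat} else \<Gamma>)"

lemma rot_Gamma: "rot * z \<in> \<Gamma> \<longleftrightarrow> z \<in> lat"
  using rot_nz by (auto simp: \<Gamma>_def)

lemma Gamma_iff: "\<zeta> \<in> \<Gamma> \<longleftrightarrow> \<zeta> / rot \<in> lat"
  using rot_Gamma[of "\<zeta> / rot"] rot_nz by simp

lemma lat_cmod: "a \<in> lat \<Longrightarrow> a \<noteq> 0 \<Longrightarrow> 1 / 2 \<le> cmod a"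
  using n1_lat[of a] n1_cmod(2)[of a] by linarith

end

section \<open>The pieces satisfy the requirements of the gluing\<close>

context surf_radii
begin

text \<open>The left side of the bound is \<open>2 * rad\<close>. Before scaling by
  \<open>rot\<close> distinct holes are at least \<open>min \<iota> (1 / 2)\<close> apart, by
  \<open>pt_sep\<close> in the central torus and by the lattice in the outer ones.\<close>

lemma da_holes:
  assumes \<rho>: "0 < \<rho>" "2 * (2 * \<rho> + 8 * (\<tau>\<^sup>2)\<^sup>2 * \<rho>) \<le> cmod rot * min \<iota> (1 / 2)"
  shows "da (\<tau>\<^sup>2) \<rho> \<Gamma> (holes j)"
proof -
  interpret bump "\<tau>\<^sup>2" \<rho> using tau(3) \<rho> by unfold_locales
  have rad_le: "2 * rad \<le> cmod rot * \<iota>" "2 * rad \<le> cmod rot * (1 / 2)"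
  proof -
    have "cmod rot * min \<iota> (1 / 2) \<le> cmod rot * \<iota>" "cmod rot * min \<iota> (1 / 2) \<le> cmod rot * (1 / 2)"
      by (intro mult_left_mono; simp)+
    then show "2 * rad \<le> cmod rot * \<iota>" "2 * rad \<le> cmod rot * (1 / 2)"
      using \<rho>(2) unfolding rad_def ext_def by auto
  qed
  have addG: "rot * a + rot * b = rot * (a + b)" for a b by (simp add: algebra_simps)
  show ?thesis
  proof
    show "a + b \<in> \<Gamma>" if "a \<in> \<Gamma>" "b \<in> \<Gamma>" for a b
      using that lat_add by (simp add: Gamma_iff add_divide_distrib)
    show "- a \<in> \<Gamma>" if "a \<in> \<Gamma>" for a using that lat_minus[of "a / rot"] by (simp add: Gamma_iff)
    show "hyp (\<tau>\<^sup>2) a \<in> \<Gamma> \<longleftrightarrow> a \<in> \<Gamma>" for a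
      using hyp_rot[of "a / rot"] rot_nz cat_lat rot_Gamma by (simp add: Gamma_iff[of a])
    show "p + a \<in> holes j" if pa: "p \<in> holes j" "a \<in> \<Gamma>" for p a
    proof (cases "j = 0")
      case True
      then obtain i b where ib: "p = rot * (pt i + b)" "i < k" "b \<in> lat" using pa by (auto simp: holes_def)
      obtain c where c: "a = rot * c" "c \<in> lat" using pa(2) by (auto simp: \<Gamma>_def)
      have "p + a = rot * (pt i + (b + c))" using ib c by (simp add: algebra_simps)
      then show ?thesis using ib c lat_add True by (auto simp: holes_def)
    next
      case False
      then show ?thesis using pa lat_add by (simp add: holes_def Gamma_iff add_divide_distrib)
    qed
    show "hyp (\<tau>\<^sup>2) p - p \<in> \<Gamma>" if p: "p \<in> holes j" for p
    proof (cases "j = 0")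
      case True
      then obtain i b where ib: "p = rot * (pt i + b)" "i < k" "b \<in> lat" using p by (auto simp: holes_def)
      have "hyp (\<tau>\<^sup>2) p - p = rot * (cat (pt i + b) - (pt i + b))" unfolding ib(1) hyp_rot by (simp add: algebra_simps)
      then show ?thesis using cat_pt[OF ib(3)] rot_Gamma by simp
    next
      case False
      then obtain c where c: "p = rot * c" "c \<in> lat" using p by (auto simp: holes_def \<Gamma>_def)
      have "hyp (\<tau>\<^sup>2) p - p = rot * (cat c - c)" unfolding c(1) hyp_rot by (simp add: algebra_simps)
      then show ?thesis using c cat_lat lat_diff rot_Gamma by simp
    qed
    show "2 * rad \<le> cmod (p - p')" if pp: "p \<in> holes j" "p' \<in> holes j" "p \<noteq> p'" for p p'
    proof (cases "j = 0")
      case True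
      obtain i b where ib: "p = rot * (pt i + b)" "i < k" "b \<in> lat" using pp(1) True by (auto simp: holes_def)
      obtain i' b' where ib': "p' = rot * (pt i' + b')" "i' < k" "b' \<in> lat" using pp(2) True by (auto simp: holes_def)
      have "pt i \<noteq> pt i' + (b' - b)" using pp(3) ib ib' by auto
      from pt_sep[OF ib(2) ib'(2) iota(2)[OF ib'(2)] lat_diff[OF ib'(3) ib(3)] this]
      have s: "\<iota> \<le> cmod ((pt i + b) - (pt i' + b'))" by (simp add: algebra_simps)
      have "p - p' = rot * ((pt i + b) - (pt i' + b'))" using ib ib' by (simp add: algebra_simps)
      then have "cmod (p - p') = cmod rot * cmod ((pt i + b) - (pt i' + b'))" by (simp only: norm_mult)
      then show ?thesis using rad_le(1) mult_left_mono[OF s, of "cmod rot"] by simp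
    next
      case False
      then obtain b b' where b: "p = rot * b" "b \<in> lat" "p' = rot * b'" "b' \<in> lat" using pp by (auto simp: holes_def \<Gamma>_def)
      then have s: "1 / 2 \<le> cmod (b - b')" using lat_cmod[of "b - b'"] lat_diff pp(3) by auto
      have "p - p' = rot * (b - b')" using b by (simp add: algebra_simps)
      then have "cmod (p - p') = cmod rot * cmod (b - b')" by (simp only: norm_mult)
      then show ?thesis using rad_le(2) mult_left_mono[OF s, of "cmod rot"] by simp
    qed
  qed
qed

definition "piece j \<zeta> = (if j = 0 then Qc (\<zeta> / rot) else Yh (j - 1) (\<zeta> / rot))"

definition "pdom j r = (if j = (0::nat) then center_dom r else handle_dom r)"

lemma E_holes:
  assumes "da (\<tau>\<^sup>2) \<rho> \<Gamma> (holes j)"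
  shows "\<zeta> \<in> da.E (holes j) (cmod rot * r) \<longleftrightarrow> \<zeta> / rot \<in> pdom j r"
proof -
  interpret da "\<tau>\<^sup>2" \<rho> \<Gamma> "holes j" by fact
  have c: "cmod rot * r \<le> cmod (\<zeta> - rot * x) \<longleftrightarrow> r \<le> cmod (\<zeta> / rot - x)" for x
    unfolding rot_dist using rot_nz by simp
  show ?thesis
  proof (cases "j = 0")
    case True
    have "\<zeta> \<in> E (cmod rot * r) \<longleftrightarrow> (\<forall>i<k. \<forall>a\<in>lat. cmod rot * r \<le> cmod (\<zeta> - rot * (pt i + a)))"
      unfolding E_def mem_Collect_eq using True by (auto simp: holes_def)
    then show ?thesis using True by (simp add: c pdom_def center_dom_def)
  next
    case False
    have "\<zeta> \<in> E (cmod rot * r) \<longleftrightarrow> (\<forall>a\<in>lat. cmod rot * r \<le> cmod (\<zeta> - rot * a))"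
      unfolding E_def mem_Collect_eq using False by (auto simp: holes_def \<Gamma>_def)
    then show ?thesis using False by (simp add: c pdom_def handle_dom_def)
  qed
qed

text \<open>Both neck coordinates are scaled by \<open>rot\<close>, so the constant of the inversion
  becomes \<open>rot\<^sup>2 * nc \<kappa> i\<close>; the same constant serves in both
  directions.\<close>

lemma piece_neck:
  assumes i: "i < k" and ab: "a \<in> lat" "b \<in> lat" and v: "cmod rot * r1 \<le> cmod v" "cmod v \<le> cmod rot * r2"
  shows "piece 0 (rot * (pt i + a) + v) = piece (Suc i) (rot * b + rot\<^sup>2 * nc \<kappa> i / v)"
    "piece (Suc i) (rot * b + v) = piece 0 (rot * (pt i + a) + rot\<^sup>2 * nc \<kappa> i / v)"
proof -
  have sp: "0 < cmod rot" using rot_nz by simp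
  have vp: "0 < cmod v" using v rad(1) sp by (smt (verit) mult_pos_pos)
  have v0: "v \<noteq> 0" using vp by auto
  have vr: "r1 \<le> cmod (v / rot)" "cmod (v / rot) \<le> r2"
    using v sp by (auto simp: norm_divide le_divide_eq divide_le_eq mult.commute)
  have "piece 0 (rot * (pt i + a) + v) = Qc (pt i + a + v / rot)" using rot_nz by (simp add: piece_def add_divide_distrib)
  also have "\<dots> = Yh i (b + nc \<kappa> i / (v / rot))" by (rule neck_map[OF i ab vr])
  also have "\<dots> = piece (Suc i) (rot * b + rot\<^sup>2 * nc \<kappa> i / v)"
    using rot_nz v0 by (simp add: piece_def add_divide_distrib power2_eq_square mult.commute)
  finally show "piece 0 (rot * (pt i + a) + v) = piece (Suc i) (rot * b + rot\<^sup>2 * nc \<kappa> i / v)" .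
  let ?u = "rot * nc \<kappa> i / v"
  have cu: "cmod ?u = \<kappa> / cmod (v / rot)" using cmod_nc[OF kap(1)] by (simp add: norm_mult norm_divide)
  have u: "r1 \<le> cmod ?u" "cmod ?u \<le> r2"
  proof -
    show "cmod ?u \<le> r2" unfolding cu by (rule kappa_bound[OF vr(1)])
    have p: "0 < cmod (v / rot)" using vr(1) rad(1) by linarith
    have "r1 * cmod (v / rot) \<le> r1 * r2" using vr(2) rad(1) by (intro mult_left_mono) auto
    then show "r1 \<le> cmod ?u" unfolding cu using p by (simp only: le_divide_eq \<kappa>_def) simp
  qed
  have "piece 0 (rot * (pt i + a) + rot\<^sup>2 * nc \<kappa> i / v) = Qc (pt i + a + ?u)"
    using rot_nz v0 by (simp add: piece_def add_divide_distrib power2_eq_square)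
  also have "\<dots> = Yh i (b + nc \<kappa> i / ?u)" by (rule neck_map[OF i ab u])
  also have "nc \<kappa> i / ?u = v / rot" using nc_nz[of i] v0 rot_nz by simp
  also have "Yh i (b + v / rot) = piece (Suc i) (rot * b + v)" using rot_nz by (simp add: piece_def add_divide_distrib)
  finally show "piece (Suc i) (rot * b + v) = piece 0 (rot * (pt i + a) + rot\<^sup>2 * nc \<kappa> i / v)" by simp
qed

text \<open>\<open>nc \<kappa> i\<close> is a nonzero real multiple of \<open>pt i\<close>, so
  \<open>Im_rot_pt\<close> gives the nonvanishing imaginary part that the count of solutions in a
  neck depends on.\<close>

lemma neck_constant: assumes "i < k" shows "Im (rot\<^sup>2 * nc \<kappa> i) \<noteq> 0" "cmod (rot\<^sup>2 * nc \<kappa> i) = cmod rot * r1 * (cmod rot * r2)"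
proof -
  have "rot\<^sup>2 * nc \<kappa> i = of_real (- \<kappa> / cmod (pt i)) * (rot\<^sup>2 * pt i)" by (simp add: nc_def mult.left_commute)
  moreover have "Im (of_real c * z) = c * Im z" for c z by simp
  ultimately have "Im (rot\<^sup>2 * nc \<kappa> i) = - \<kappa> / cmod (pt i) * Im (rot\<^sup>2 * pt i)" by (simp only:)
  then show "Im (rot\<^sup>2 * nc \<kappa> i) \<noteq> 0" using Im_rot_pt[OF assms] kap(1) pt_nz[of i] by simp
  show "cmod (rot\<^sup>2 * nc \<kappa> i) = cmod rot * r1 * (cmod rot * r2)"
    using cmod_nc[OF kap(1), of i] by (simp add: norm_mult norm_power \<kappa>_def power2_eq_square)
qed

lemma necks_pieces:
  assumes X: "X = Metric_space.mtopology M d" and M: "Metric_space M d"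
    and r: "r2 = (\<tau>\<^sup>2) ^ 3 * r0" "r0 = (\<tau>\<^sup>2) ^ 3 * r1"
    and sep: "40 * (\<tau>\<^sup>2) ^ 3 * r2 \<le> min \<iota> (1 / 2)"
  shows "necks M d (\<tau>\<^sup>2) (\<tau>\<^sup>2 * (cmod rot * r2)) \<Gamma> {..k} (\<lambda>j. j = 0) holes piece (cmod rot * r0) (cmod rot * r1) (cmod rot * r2)"
proof -
  interpret Metric_space M d by (rule M)
  let ?\<rho> = "\<tau>\<^sup>2 * (cmod rot * r2)"
  have sp: "0 < cmod rot" using rot_nz by simp
  have r2p: "0 < r2" using rad by simp
  have rho: "0 < ?\<rho>" using sp r2p tau(3) by (intro mult_pos_pos) linarith+
  have D: "da (\<tau>\<^sup>2) ?\<rho> \<Gamma> (holes j)" for j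
  proof (rule da_holes[OF rho])
    have "1 \<le> (\<tau>\<^sup>2)\<^sup>2" by (rule one_le_power[OF less_imp_le[OF tau(3)]])
    then have "1 * ?\<rho> \<le> (\<tau>\<^sup>2)\<^sup>2 * ?\<rho>" using rho by (intro mult_right_mono) linarith+
    \<comment> \<open>With \<open>c = (\<tau>\<^sup>2)\<^sup>2 \<ge> 1\<close> the separation bound
      simplifies to \<open>20 * c * a\<close>, which explains the numerical factor in the choice of
      \<open>r2\<close>.\<close>
    moreover have "1 * a \<le> c * a \<Longrightarrow> 2 * (2 * a + 8 * c * a) \<le> 20 * c * a" for a c :: real by (simp add: mult.commute)
    ultimately have "2 * (2 * ?\<rho> + 8 * (\<tau>\<^sup>2)\<^sup>2 * ?\<rho>) \<le> 20 * (\<tau>\<^sup>2)\<^sup>2 * ?\<rho>" by blast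
    also have "\<dots> = cmod rot * (20 * (\<tau>\<^sup>2) ^ 3 * r2)" by (simp add: power2_eq_square power3_eq_cube)
    also have "\<dots> \<le> cmod rot * (40 * (\<tau>\<^sup>2) ^ 3 * r2)" using sp r2p tau(3) by (intro mult_left_mono) auto
    also have "\<dots> \<le> cmod rot * min \<iota> (1 / 2)" using sep sp by (intro mult_left_mono) auto
    finally show "2 * (2 * ?\<rho> + 8 * (\<tau>\<^sup>2)\<^sup>2 * ?\<rho>) \<le> cmod rot * min \<iota> (1 / 2)" .
  qed
  note E = E_holes[OF D]
  have dvd: "z / rot - w / rot = (z - w) / rot" for z w by (simp add: diff_divide_distrib)
  have in_I: "j \<le> k \<Longrightarrow> j \<noteq> 0 \<Longrightarrow> j - 1 < k" for j by simp
  have topX: "topspace X = M" using X by simp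
  have cont: "continuous_map (top_of_set (pdom j r1)) X (\<lambda>z. piece j (rot * z))" if "j \<in> {..k}" for j
    using Qc_cont Yh_cont[of "j - 1"] that rot_nz by (cases "j = 0") (simp_all add: pdom_def piece_def)
  have contE: "continuous_map (top_of_set (da.E (holes j) (cmod rot * r1))) mtopology (piece j)" if j: "j \<in> {..k}" for j
  proof -
    have "continuous_on (da.E (holes j) (cmod rot * r1)) (\<lambda>z. z / rot)" using rot_nz by (intro continuous_intros) auto
    then have "continuous_map (top_of_set (da.E (holes j) (cmod rot * r1))) (top_of_set (pdom j r1)) (\<lambda>z. z / rot)"
      using E by (auto simp: continuous_map_in_subtopology)
    from continuous_map_compose[OF this cont[OF j]] show ?thesis using rot_nz X by (simp add: o_def)
  qed
  have E0: "z \<in> da.E (holes 0) (cmod rot * r) \<Longrightarrow> z / rot \<in> center_dom r" for z r using E[of z 0 r] by (simp add: pdom_def)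
  have Ei: "z \<in> da.E (holes j) (cmod rot * r) \<Longrightarrow> j \<noteq> 0 \<Longrightarrow> z / rot \<in> handle_dom r" for z j r using E[of z j r] by (simp add: pdom_def)
  have h0: "rot * (pt i + a) \<in> holes 0" if "i < k" "a \<in> lat" for i a using that by (auto simp: holes_def)
  have hi: "rot * b \<in> holes (Suc i)" if "b \<in> lat" for b i using that by (auto simp: holes_def \<Gamma>_def)
  have meet: "\<exists>a\<in>lat. \<exists>b\<in>lat. cmod (z - rot * (pt i + a)) \<le> cmod rot * r2 \<and> cmod (w - rot * b) \<le> cmod rot * r2"
    if i: "i < k" and z: "z \<in> da.E (holes 0) (cmod rot * r1)" and w: "w \<in> da.E (holes (Suc i)) (cmod rot * r1)"
      and e: "piece 0 z = piece (Suc i) w" for i z w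
  proof -
    have e': "Qc (z / rot) = Yh i (w / rot)" using e by (simp add: piece_def)
    have w': "w / rot \<in> handle_dom r1" using Ei[OF w] by simp
    obtain a b where "a \<in> lat" "b \<in> lat" "cmod (z / rot - (pt i + a)) \<le> r2" "cmod (w / rot - b) \<le> r2"
      using center_meets_handle[OF E0[OF z] i w' e'] by blast
    then show ?thesis unfolding rot_dist using sp by (intro bexI[of _ a] bexI[of _ b]) auto
  qed
  show ?thesis
  proof (rule necks.intro[OF M necks_axioms.intro])
    show "da (\<tau>\<^sup>2) ?\<rho> \<Gamma> (holes j)" for j by (rule D)
    show "cmod rot * r2 = ?\<rho> / \<tau>\<^sup>2" using tau(3) by auto
    show "cmod rot * r2 = (\<tau>\<^sup>2) ^ 3 * (cmod rot * r0)" using r(1) by simp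
    show "cmod rot * r0 = (\<tau>\<^sup>2) ^ 3 * (cmod rot * r1)" using r(2) by simp
    show "finite {..k}" by simp
    show "\<exists>\<mu>>0. \<forall>a\<in>\<Gamma>. a \<noteq> 0 \<longrightarrow> \<mu> \<le> cmod a"
    proof (intro exI conjI ballI impI)
      show "0 < cmod rot * (1 / 2)" using sp by simp
      fix a assume "a \<in> \<Gamma>" "a \<noteq> 0"
      then obtain b where "a = rot * b" "b \<in> lat" "b \<noteq> 0" by (auto simp: \<Gamma>_def)
      then show "cmod rot * (1 / 2) \<le> cmod a" using lat_cmod[of b] sp by (simp only: norm_mult) simp
    qed
    show "piece j z \<in> M" if j: "j \<in> {..k}" and z: "z \<in> da.E (holes j) (cmod rot * r1)" for j z
      using contE[OF j] z by (auto simp: continuous_map_def)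
    show "piece j z = piece j w \<longleftrightarrow> z - w \<in> \<Gamma>"
      if j: "j \<in> {..k}" and z: "z \<in> da.E (holes j) (cmod rot * r1)" and w: "w \<in> da.E (holes j) (cmod rot * r1)" for j z w
    proof (cases "j = 0")
      case True
      then show ?thesis using Qc_eq[OF E0 E0] z w by (simp add: piece_def Gamma_iff dvd)
    next
      case False
      then show ?thesis using Yh_eq[OF in_I Ei Ei] j z w by (simp add: piece_def Gamma_iff dvd)
    qed
    show "\<exists>p\<in>holes j. \<exists>q\<in>holes i. \<exists>C. (j = 0) \<noteq> (i = 0) \<and> Im C \<noteq> 0 \<and> cmod C = cmod rot * r1 * (cmod rot * r2) \<and>
        cmod (z - p) \<le> cmod rot * r2 \<and> (\<forall>v. cmod rot * r1 \<le> cmod v \<and> cmod v \<le> cmod rot * r2 \<longrightarrow> piece j (p + v) = piece i (q + C / v))"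
      if j: "j \<in> {..k}" and i: "i \<in> {..k}" and ji: "j \<noteq> i" and z: "z \<in> da.E (holes j) (cmod rot * r1)"
        and w: "w \<in> da.E (holes i) (cmod rot * r1)" and e: "piece j z = piece i w" for j i z w
    proof -
      consider m where "j = 0" "i = Suc m" "m < k" | m where "i = 0" "j = Suc m" "m < k" | m n where "j = Suc m" "i = Suc n" "m < k" "n < k" "m \<noteq> n"
        using i j ji by (cases j; cases i) auto
      then show ?thesis
      proof cases
        case (1 m)
        obtain a b where ab: "a \<in> lat" "b \<in> lat" "cmod (z - rot * (pt m + a)) \<le> cmod rot * r2"
          using meet[of m z w] 1 z w e by auto
        show ?thesis
          unfolding 1(1,2)
          by (rule bexI[OF _ h0[OF 1(3) ab(1)]], rule bexI[OF _ hi[OF ab(2)]], rule exI[of _ "rot\<^sup>2 * nc \<kappa> m"])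
            (use neck_constant[OF 1(3)] ab(3) piece_neck(1)[OF 1(3) ab(1,2)] in auto)
      next
        case (2 m)
        obtain a b where ab: "a \<in> lat" "b \<in> lat" "cmod (z - rot * b) \<le> cmod rot * r2"
          using meet[of m w z] 2 z w e by auto
        show ?thesis
          unfolding 2(1,2)
          by (rule bexI[OF _ hi[OF ab(2)]], rule bexI[OF _ h0[OF 2(3) ab(1)]], rule exI[of _ "rot\<^sup>2 * nc \<kappa> m"])
            (use neck_constant[OF 2(3)] ab(3) piece_neck(2)[OF 2(3) ab(1,2)] in auto)
      next
        case (3 m n)
        have "z / rot \<in> handle_dom r1" "w / rot \<in> handle_dom r1" using Ei[OF z] Ei[OF w] 3 by auto
        then have "Yh m (z / rot) \<noteq> Yh n (w / rot)" using Yh_disjoint[OF 3(3-5)] by blast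
        then show ?thesis using e 3 by (simp add: piece_def)
      qed
    qed
    show "\<exists>i\<in>{..k}. \<exists>q\<in>holes i. \<exists>C. (j = 0) \<noteq> (i = 0) \<and> Im C \<noteq> 0 \<and> cmod C = cmod rot * r1 * (cmod rot * r2) \<and>
        (\<forall>v. cmod rot * r1 \<le> cmod v \<and> cmod v \<le> cmod rot * r2 \<longrightarrow> piece j (p + v) = piece i (q + C / v))"
      if j: "j \<in> {..k}" and p: "p \<in> holes j" for j p
    proof (cases j)
      case 0
      then obtain i a where ia: "p = rot * (pt i + a)" "i < k" "a \<in> lat" using p by (auto simp: holes_def)
      have "Suc i \<in> {..k}" using ia by simp
      then show ?thesis
        unfolding 0 ia(1)
        by (rule bexI[rotated], intro bexI[OF _ hi[OF lat_0]] exI[of _ "rot\<^sup>2 * nc \<kappa> i"])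
          (use neck_constant[OF ia(2)] piece_neck(1)[OF ia(2,3) lat_0] in auto)
    next
      case (Suc i)
      then obtain b where b: "p = rot * b" "b \<in> lat" using p by (auto simp: holes_def \<Gamma>_def)
      have i: "i < k" using Suc j by simp
      have "0 \<in> {..k}" by simp
      then show ?thesis
        unfolding Suc b(1)
        by (rule bexI[rotated], intro bexI[OF _ h0[OF i lat_0]] exI[of _ "rot\<^sup>2 * nc \<kappa> i"])
          (use neck_constant[OF i] piece_neck(2)[OF i lat_0 b(2)] in auto)
    qed
    show "\<exists>j\<in>{..k}. \<exists>z\<in>da.E (holes j) (cmod rot * r0). x = piece j z" if x: "x \<in> M" for x
    proof -
      have "(\<exists>z\<in>center_dom r0. x = Qc z) \<or> (\<exists>i<k. \<exists>w\<in>handle_dom r0. x = Yh i w)" using pieces_cover x topX by blast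
      then show ?thesis
      proof (elim disjE bexE exE conjE)
        fix z assume "z \<in> center_dom r0" "x = Qc z"
        then show ?thesis using E[of "rot * z" 0 r0] rot_nz
          by (intro bexI[of _ 0] bexI[of _ "rot * z"]) (auto simp: pdom_def piece_def)
      next
        fix i w assume "i < k" "w \<in> handle_dom r0" "x = Yh i w"
        then show ?thesis using E[of "rot * w" "Suc i" r0] rot_nz
          by (intro bexI[of _ "Suc i"] bexI[of _ "rot * w"]) (auto simp: pdom_def piece_def)
      qed
    qed
    show "continuous_map (top_of_set (da.E (holes j) (cmod rot * r1))) mtopology (piece j)" if "j \<in> {..k}" for j
      using contE[OF that] .
    show "\<exists>K. compact K \<and> (\<forall>z. \<exists>a\<in>\<Gamma>. z - a \<in> K)"
    proof (intro exI conjI allI)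
      show "compact ((*) rot ` cbox 0 (Complex 1 1))" by (intro compact_continuous_image continuous_intros compact_cbox)
      fix z
      let ?b = "Complex (of_int \<lfloor>Re (z / rot)\<rfloor>) (of_int \<lfloor>Im (z / rot)\<rfloor>)"
      have "?b \<in> lat" by (simp add: lat_def)
      moreover have "z / rot - ?b \<in> cbox 0 (Complex 1 1)" unfolding in_cbox_complex_iff by (simp_all; linarith)
      moreover have "z - rot * ?b = rot * (z / rot - ?b)" using rot_nz by (simp add: right_diff_distrib)
      ultimately show "\<exists>a\<in>\<Gamma>. z - a \<in> (*) rot ` cbox 0 (Complex 1 1)"
        by (intro bexI[of _ "rot * ?b"]) (auto simp: \<Gamma>_def)
    qed
    show "\<exists>j\<in>{..k}. j = 0 \<and> holes j \<noteq> {}" using h0[of 0 0] k lat_0 by auto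
  qed
qed

end

theorem theorem1p1:
  fixes g :: nat and M :: "'a set" and d :: "'a \<Rightarrow> 'a \<Rightarrow> real"
  assumes "g \<ge> 2"
    and "Metric_space M d"
    and "surface_of_genus g (Metric_space.mtopology M d)"
  shows "\<exists>f. homeomorphic_map (Metric_space.mtopology M d) (Metric_space.mtopology M d) f \<and>
             Metric_space.N_expansive M d 2 f \<and> \<not> Metric_space.expansive M d f"
proof -
  define k where "k = g - 1"
  interpret poly g using assms(1) by unfold_locales
  interpret center k using assms(1) by unfold_locales (simp add: k_def)
  let ?X = "Metric_space.mtopology M d"
  obtain q where q: "continuous_map (top_of_set (rect k)) ?X q" "q ` rect k = topspace ?X"
    "\<And>x y. x \<in> rect k \<Longrightarrow> y \<in> rect k \<Longrightarrow> q x = q y \<longleftrightarrow> equivclp (rect_glued k) x y"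
    using surface_rect[OF assms(3) k_def] by blast
  obtain \<iota> where io: "0 < \<iota>" "\<And>i. i < k \<Longrightarrow> ball (pt i) \<iota> \<subseteq> sec i" using inradius by blast
  \<comment> \<open>The factor \<open>40 * (\<tau>\<^sup>2) ^ 3\<close> leaves room for disjoint
    bumps around the holes; the further divisions give the ratios
    \<open>(\<tau>\<^sup>2) ^ 3\<close> between consecutive radii.\<close>
  define r2 where "r2 = min \<iota> (1 / 2) / (40 * (\<tau>\<^sup>2) ^ 3)"
  define r0 where "r0 = r2 / (\<tau>\<^sup>2) ^ 3"
  define r1 where "r1 = r0 / (\<tau>\<^sup>2) ^ 3"
  have t3: "1 < (\<tau>\<^sup>2) ^ 3" by (rule one_less_power[OF tau(3)]) simp
  have "0 < min \<iota> (1 / 2)" using io(1) by simp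
  then have p: "0 < r2" unfolding r2_def using t3 by (intro divide_pos_pos) linarith+
  have p0: "0 < r0" unfolding r0_def using p t3 by (intro divide_pos_pos) linarith+
  have p1: "0 < r1" unfolding r1_def using p0 t3 by (intro divide_pos_pos) linarith+
  have "\<tau> \<noteq> 0" using tau(2) by simp
  then have e: "r2 = (\<tau>\<^sup>2) ^ 3 * r0" "r0 = (\<tau>\<^sup>2) ^ 3 * r1" and m: "40 * (\<tau>\<^sup>2) ^ 3 * r2 = min \<iota> (1 / 2)"
    by (simp_all add: r0_def r1_def r2_def)
  have le: "40 * r2 < min \<iota> (1 / 2)" unfolding m[symmetric] using t3 p by simp
  interpret surf_radii k ?X q \<iota> r0 r1 r2
  proof
    show "r1 < r0" "r0 < r2"
      using mult_strict_right_mono[OF t3 p1] mult_strict_right_mono[OF t3 p0] by (simp_all only: e[symmetric] mult_1)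
    show "r1 * r2 = r0 * r0" by (subst e(1), subst (2) e(2)) simp
    show "2 * r2 \<le> \<iota>" "r2 < 1 / 16" using le p by auto
  qed (use q io p1 in auto)
  have "necks M d (\<tau>\<^sup>2) (\<tau>\<^sup>2 * (cmod rot * r2)) \<Gamma> {..k} (\<lambda>j. j = 0) holes piece (cmod rot * r0) (cmod rot * r1) (cmod rot * r2)"
    using necks_pieces[OF refl assms(2) e] m by simp
  then show ?thesis by (rule necks.dynamics)
qed

end
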